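(* Let $Comp_k$ be given by: (a) objects: pairs $(\mathscr O,\mathscr L)$ where $\mathscr O$ is a non-$\Sigma$ operad with multiplication over $k$ and $\mathscr L$ is a cyclic unital comp module over $\mathscr O$; (b) hom-objects: for pairs $(\mathscr O,\mathscr L)$, $(\mathscr O',\mathscr L')$, $$Comp_k((\mathscr O,\mathscr L),(\mathscr O',\mathscr L')):=\big(\mathcal M_c(\mathscr O,\mathscr O'),\mathcal Q_{\mathcal M_c(\mathscr O,\mathscr O')}(\mathscr L,\mathscr L')\big)\in Comod_k.$$ Then $Comp_k$ is enriched over the symmetric monoidal category $Comod_k$.
   Context: $k$ is a field; $Vect_k(V,W)$ denotes $k$-linear maps; Sweedler notation with summation suppressed. Left and right comodules over a cocommutative coalgebra are identified. A non-$\Sigma$ operad $(\mathscr O,m,e)$ over $k$ with multiplication consists of vector spaces $\{\mathscr O(n)\}_{n\ge0}$, bilinear operations $\circ_i:\mathscr O(p)\otimes\mathscr O(q)\to\mathscr O(p+q-1)$ and an identity $\mathbf 1\in\mathscr O(1)$ such that for $u\in\mathscr O(p)$, $v\in\mathscr O(q)$, $w\in\mathscr O(r)$: $u\circ_iv=0$ if $p<i$ or $p=0$; $(u\circ_iv)\circ_jw$ equals $(u\circ_jw)\circ_{i+r-1}v$ if $j<i$, $u\circ_i(v\circ_{j-i+1}w)$ if $i\le j<q+i$, and $(u\circ_{j-q+1}w)\circ_iv$ if $j\ge q+i$; $u\circ_i\mathbf 1=\mathbf 1\circ_1u=u$ for $i\le p$; together with $m\in\mathscr O(2)$, $e\in\mathscr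 O(0)$ satisfying $m\circ_1m=m\circ_2m$ and $m\circ_1e=m\circ_2e=\mathbf 1$. A $C$-measuring from $(\mathscr O,m,e)$ to $(\mathscr O',m',e')$, with $C$ a cocommutative $k$-coalgebra with counit $\epsilon_C$, is a family of linear maps $\{\Psi_n:C\to Vect_k(\mathscr O(n),\mathscr O'(n))\}_{n\ge0}$ such that $\Psi_{p+q-1}(x)(u\circ_iv)=\Psi_p(x_{(1)})(u)\circ'_i\Psi_q(x_{(2)})(v)$, $\Psi_2(x)(m)=\epsilon_C(x)m'$, $\Psi_0(x)(e)=\epsilon_C(x)e'$ for all $x\in C$, $u\in\mathscr O(p)$, $v\in\mathscr O(q)$. $\mathcal M_c(\mathscr O,\mathscr O')$, with measuring $\{\Phi_n\}$, is the universal cocommutative measuring: every measuring by a cocommutative $C$ factors through it by a unique coalgebra morphism. A cyclic unital (left) comp module $\mathscr L$ over $(\mathscr O,m,e)$ consists of vector spaces $\{\mathscr L(n)\}_{n\ge0}$; bilinear operations $\bullet_i:\mathscr O(p)\otimes\mathscr L(n)\to\mathscr L(n-p+1)$, $0\le i\le n+1-p$, set to be zero for $p>n+1$, such that for $u\in\mathscr O(p)$, $v\in\mathscr O(q)$, $l\in\mathscr L(n)$: if $p>0$, $u\bullet_i(v\bullet_jl)$ equals $v\bullet_j(u\bullet_{i+q-1}l)$ if $j<i$, $(u\circ_{j-i+1}v)\bullet_il$ if $j-p<i\le j$, and $v\bullet_{j-p+1}(u\bullet_il)$ if $0\le i\le j-p$; if $p=0$, $u\bullet_i(v\bullet_jl)$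 equals $v\bullet_j(u\bullet_{i+q-1}l)$ if $j<i$ and $v\bullet_{j+1}(u\bullet_il)$ if $0\le i\le j$; $\mathbf 1\bullet_il=l$ for $i=0,\dots,n$; and cyclic operators $t:\mathscr L(n)\to\mathscr L(n)$ ($n\ge1$; $t=\mathrm{id}$ on $\mathscr L(0)$) with $t(u\bullet_il)=u\bullet_{i+1}t(l)$ for $0\le i\le n-p$ and $t^{n+1}=\mathrm{id}$ on $\mathscr L(n)$. A $(C,\{\Psi_n\})$-comodule measuring from $\mathscr L$ to $\mathscr L'$ is a left $C$-comodule $D$ (coaction $y\mapsto y_{(0)}\otimes y_{(1)}\in C\otimes D$) and linear maps $\{\Omega_n:D\to Vect_k(\mathscr L(n),\mathscr L'(n))\}_{n\ge0}$ such that $\Omega_{n-p+1}(y)(u\bullet_il)=\Psi_p(y_{(0)})(u)\bullet_i\Omega_n(y_{(1)})(l)$ for $u\in\mathscr O(p)$, $l\in\mathscr L(n)$, $0\le i\le n+1-p$, and $\Omega_n(y)(t(l))=t'(\Omega_n(y)(l))$. Universal measuring comodule $\mathcal Q_C(\mathscr L,\mathscr L')$: let $\mathfrak R_C$ be the right adjoint of the forgetful functor from $C$-comodules to vector spaces, $V=\prod_{n\ge0}Vect_k(\mathscr L(n),\mathscr L'(n))$ and $\rho(V):\mathfrak R_C(V)\to V$ the counit; $\mathcal Q_C(\mathscr L,\mathscr L')$ is the sum of all subcomodules $Q\subseteq\mathfrak R_C(V)$ such that $\rho(V)|_Q$ gives a $(C,\{\Psi_n\})$-comodule measuring. Every $(C,\{\Psi_n\})$-comodule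 measuring factors through it by a comodule morphism. $\mathcal Q_{\mathcal M_c(\mathscr O,\mathscr O')}(\mathscr L,\mathscr L')$ is taken with respect to $\{\Phi_n\}$. $Comod_k$: objects are pairs $(C,D)$ with $C$ a cocommutative $k$-coalgebra and $D$ a $C$-comodule; a morphism $(f,g):(C,D)\to(C',D')$ is a coalgebra morphism $f:C\to C'$ and a morphism $g:D\to D'$ of $C'$-comodules, $D$ being a $C'$-comodule by corestriction along $f$; $(C,D)\otimes(C',D')=(C\otimes C',D\otimes D')$. Composition and units in $Comp_k$ are those induced, via the universal properties, by composition of measurings and comodule measurings ($x\otimes x'\mapsto\Phi'_n(x')\circ\Phi_n(x)$, $y\otimes y'\mapsto\Omega'_n(y')\circ\Omega_n(y)$) and by scalar multiples of identity maps. *)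

theory Defs
  imports "HOL-Algebra.Module"
begin

section \<open>Linear algebra over a field given as a ring record\<close>

text \<open>Throughout, \<open>K\<close> is the ground field, and a \<open>K\<close>-vector space is a module over \<open>K\<close> in the
  sense of \<open>HOL-Algebra\<close>; the ring multiplication and unit of a module record are not used.\<close>

definition linear_map ::
  "'k ring \<Rightarrow> ('k, 'v) module \<Rightarrow> ('k, 'w) module \<Rightarrow> ('v \<Rightarrow> 'w) \<Rightarrow> bool" where
  "linear_map K V W f \<longleftrightarrow>
     f \<in> carrier V \<rightarrow> carrier W \<and>
     (\<forall>x\<in>carrier V. \<forall>y\<in>carrier V. f (x \<oplus>\<^bsub>V\<^esub> y) = f x \<oplus>\<^bsub>W\<^esub> f y) \<and>
     (\<forall>a\<in>carrier K. \<forall>x\<in>carrier V. f (a \<odot>\<^bsub>V\<^esub> x) = a \<odot>\<^bsub>W\<^esub> f x)"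

definition bilinear_map ::
  "'k ring \<Rightarrow> ('k, 'u) module \<Rightarrow> ('k, 'v) module \<Rightarrow> ('k, 'w) module \<Rightarrow> ('u \<Rightarrow> 'v \<Rightarrow> 'w) \<Rightarrow> bool" where
  "bilinear_map K U V W \<beta> \<longleftrightarrow>
     (\<forall>u\<in>carrier U. linear_map K V W (\<beta> u)) \<and>
     (\<forall>v\<in>carrier V. linear_map K U W (\<lambda>u. \<beta> u v))"

text \<open>The space of linear maps. Its elements are extensional functions, so that two elements are
  equal as soon as they agree on \<open>V\<close>.\<close>

definition Vect :: "'k ring \<Rightarrow> ('k, 'v) module \<Rightarrow> ('k, 'w) module \<Rightarrow> ('k, 'v \<Rightarrow> 'w) module" where
  "Vect K V W =
     \<lparr>carrier = {f \<in> extensional (carrier V). linear_map K V W f},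
      mult = undefined, one = undefined,
      zero = (\<lambda>x\<in>carrier V. \<zero>\<^bsub>W\<^esub>),
      add = (\<lambda>f g. \<lambda>x\<in>carrier V. f x \<oplus>\<^bsub>W\<^esub> g x),
      smult = (\<lambda>a f. \<lambda>x\<in>carrier V. a \<odot>\<^bsub>W\<^esub> f x)\<rparr>"

definition product_space :: "(nat \<Rightarrow> ('k, 'v) module) \<Rightarrow> ('k, nat \<Rightarrow> 'v) module" where
  "product_space V =
     \<lparr>carrier = {F. \<forall>n. F n \<in> carrier (V n)},
      mult = undefined, one = undefined,
      zero = (\<lambda>n. \<zero>\<^bsub>V n\<^esub>),
      add = (\<lambda>F G n. F n \<oplus>\<^bsub>V n\<^esub> G n),
      smult = (\<lambda>a F n. a \<odot>\<^bsub>V n\<^esub> F n)\<rparr>"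

definition ring_module :: "'k ring \<Rightarrow> ('k, 'k) module" where
  "ring_module K =
     \<lparr>carrier = carrier K, mult = mult K, one = one K, zero = zero K, add = add K, smult = mult K\<rparr>"


section \<open>Tensor products\<close>

text \<open>To have a category of coalgebras and comodules with tensor products as a single HOL object,
  all their underlying spaces have carriers in one type closed under tensor products.
  \<open>Atom\<close> makes room for arbitrary vector spaces (the type \<open>'a\<close> is arbitrary),
  \<open>Scalar\<close> holds the ground field, and \<open>Tens [(v\<^sub>1, w\<^sub>1), \<dots>, (v\<^sub>n, w\<^sub>n)]\<close> represents
  the tensor \<open>v\<^sub>1 \<otimes> w\<^sub>1 + \<dots> + v\<^sub>n \<otimes> w\<^sub>n\<close>.\<close>

datatype ('k, 'a) elt = Atom 'a | Scalar 'k | Tens "(('k, 'a) elt \<times> ('k, 'a) elt) list"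

type_synonym ('k, 'a) vspace = "('k, ('k, 'a) elt) module"

fun summands :: "('k, 'a) elt \<Rightarrow> (('k, 'a) elt \<times> ('k, 'a) elt) list" where
  "summands (Tens ps) = ps"
| "summands _ = []"

fun scalar :: "('k, 'a) elt \<Rightarrow> 'k" where
  "scalar (Scalar a) = a"
| "scalar _ = undefined"

inductive tensor_eq ::
  "'k ring \<Rightarrow> ('k, 'a) vspace \<Rightarrow> ('k, 'a) vspace \<Rightarrow>
   (('k, 'a) elt \<times> ('k, 'a) elt) list \<Rightarrow> (('k, 'a) elt \<times> ('k, 'a) elt) list \<Rightarrow> bool"
  for K V W where
  refl: "set ps \<subseteq> carrier V \<times> carrier W \<Longrightarrow> tensor_eq K V W ps ps"
| sym: "tensor_eq K V W ps qs \<Longrightarrow> tensor_eq K V W qs ps"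
| trans: "tensor_eq K V W ps qs \<Longrightarrow> tensor_eq K V W qs rs \<Longrightarrow> tensor_eq K V W ps rs"
| append: "tensor_eq K V W ps qs \<Longrightarrow> tensor_eq K V W ps' qs' \<Longrightarrow> tensor_eq K V W (ps @ ps') (qs @ qs')"
| commute: "set (ps @ qs) \<subseteq> carrier V \<times> carrier W \<Longrightarrow> tensor_eq K V W (ps @ qs) (qs @ ps)"
| add_left: "v \<in> carrier V \<Longrightarrow> v' \<in> carrier V \<Longrightarrow> w \<in> carrier W \<Longrightarrow>
    tensor_eq K V W [(v \<oplus>\<^bsub>V\<^esub> v', w)] [(v, w), (v', w)]"
| add_right: "v \<in> carrier V \<Longrightarrow> w \<in> carrier W \<Longrightarrow> w' \<in> carrier W \<Longrightarrow>
    tensor_eq K V W [(v, w \<oplus>\<^bsub>W\<^esub> w')] [(v, w), (v, w')]"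
| smult: "a \<in> carrier K \<Longrightarrow> v \<in> carrier V \<Longrightarrow> w \<in> carrier W \<Longrightarrow>
    tensor_eq K V W [(a \<odot>\<^bsub>V\<^esub> v, w)] [(v, a \<odot>\<^bsub>W\<^esub> w)]"
| zero: "w \<in> carrier W \<Longrightarrow> tensor_eq K V W [(\<zero>\<^bsub>V\<^esub>, w)] []"

definition tensor_class ::
  "'k ring \<Rightarrow> ('k, 'a) vspace \<Rightarrow> ('k, 'a) vspace \<Rightarrow> (('k, 'a) elt \<times> ('k, 'a) elt) list \<Rightarrow> ('k, 'a) elt" where
  "tensor_class K V W ps = Tens (SOME qs. tensor_eq K V W ps qs)"

definition tensor :: "'k ring \<Rightarrow> ('k, 'a) vspace \<Rightarrow> ('k, 'a) vspace \<Rightarrow> ('k, 'a) vspace" where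
  "tensor K V W =
     \<lparr>carrier = tensor_class K V W ` lists (carrier V \<times> carrier W),
      mult = undefined, one = undefined,
      zero = tensor_class K V W [],
      add = (\<lambda>s t. tensor_class K V W (summands s @ summands t)),
      smult = (\<lambda>a t. tensor_class K V W (map (\<lambda>(v, w). (a \<odot>\<^bsub>V\<^esub> v, w)) (summands t)))\<rparr>"

definition pure ::
  "'k ring \<Rightarrow> ('k, 'a) vspace \<Rightarrow> ('k, 'a) vspace \<Rightarrow> ('k, 'a) elt \<Rightarrow> ('k, 'a) elt \<Rightarrow> ('k, 'a) elt" where
  "pure K V W v w = tensor_class K V W [(v, w)]"

text \<open>If \<open>\<beta>\<close> is bilinear, \<open>tensor_sum Z \<beta>\<close> is the linear map on the tensor product induced by \<open>\<beta>\<close>.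
  Applied to \<open>\<Delta>(x) = x\<^sub>1 \<otimes> x\<^sub>2\<close> it is the Sweedler sum of the \<open>\<beta> x\<^sub>1 x\<^sub>2\<close>, taken in \<open>Z\<close>.\<close>

definition tensor_sum ::
  "('k, 'z) module \<Rightarrow> (('k, 'a) elt \<Rightarrow> ('k, 'a) elt \<Rightarrow> 'z) \<Rightarrow> ('k, 'a) elt \<Rightarrow> 'z" where
  "tensor_sum Z \<beta> t = foldr (\<lambda>(v, w) z. \<beta> v w \<oplus>\<^bsub>Z\<^esub> z) (summands t) \<zero>\<^bsub>Z\<^esub>"

definition tensor_map ::
  "'k ring \<Rightarrow> ('k, 'a) vspace \<Rightarrow> ('k, 'a) vspace \<Rightarrow> ('k, 'a) vspace \<Rightarrow> ('k, 'a) vspace \<Rightarrow>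
   (('k, 'a) elt \<Rightarrow> ('k, 'a) elt) \<Rightarrow> (('k, 'a) elt \<Rightarrow> ('k, 'a) elt) \<Rightarrow> ('k, 'a) elt \<Rightarrow> ('k, 'a) elt" where
  "tensor_map K V W V' W' f g =
     (\<lambda>t\<in>carrier (tensor K V W). tensor_sum (tensor K V' W') (\<lambda>v w. pure K V' W' (f v) (g w)) t)"

definition associator ::
  "'k ring \<Rightarrow> ('k, 'a) vspace \<Rightarrow> ('k, 'a) vspace \<Rightarrow> ('k, 'a) vspace \<Rightarrow> ('k, 'a) elt \<Rightarrow> ('k, 'a) elt" where
  "associator K U V W =
     (let Z = tensor K U (tensor K V W) in
      (\<lambda>t\<in>carrier (tensor K (tensor K U V) W).
        tensor_sum Z (\<lambda>s w. tensor_sum Z (\<lambda>u v. pure K U (tensor K V W) u (pure K V W v w)) s) t))"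

definition swap :: "'k ring \<Rightarrow> ('k, 'a) vspace \<Rightarrow> ('k, 'a) vspace \<Rightarrow> ('k, 'a) elt \<Rightarrow> ('k, 'a) elt" where
  "swap K V W =
     (\<lambda>t\<in>carrier (tensor K V W). tensor_sum (tensor K W V) (\<lambda>v w. pure K W V w v) t)"

text \<open>\<open>(v \<otimes> w) \<otimes> (v' \<otimes> w') \<mapsto> (v \<otimes> v') \<otimes> (w \<otimes> w')\<close>\<close>

definition interchange ::
  "'k ring \<Rightarrow> ('k, 'a) vspace \<Rightarrow> ('k, 'a) vspace \<Rightarrow> ('k, 'a) vspace \<Rightarrow> ('k, 'a) vspace \<Rightarrow>
   ('k, 'a) elt \<Rightarrow> ('k, 'a) elt" where
  "interchange K V W V' W' =
     (let Z = tensor K (tensor K V V') (tensor K W W') in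
      (\<lambda>t\<in>carrier (tensor K (tensor K V W) (tensor K V' W')).
        tensor_sum Z (\<lambda>s s'.
          tensor_sum Z (\<lambda>v w.
            tensor_sum Z (\<lambda>v' w'.
              pure K (tensor K V V') (tensor K W W') (pure K V V' v v') (pure K W W' w w')) s') s) t))"

definition unit_space :: "'k ring \<Rightarrow> ('k, 'a) vspace" where
  "unit_space K =
     \<lparr>carrier = Scalar ` carrier K,
      mult = undefined, one = undefined,
      zero = Scalar \<zero>\<^bsub>K\<^esub>,
      add = (\<lambda>x y. Scalar (scalar x \<oplus>\<^bsub>K\<^esub> scalar y)),
      smult = (\<lambda>a x. Scalar (a \<otimes>\<^bsub>K\<^esub> scalar x))\<rparr>"

definition left_unitor :: "'k ring \<Rightarrow> ('k, 'a) vspace \<Rightarrow> ('k, 'a) elt \<Rightarrow> ('k, 'a) elt" where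
  "left_unitor K V =
     (\<lambda>t\<in>carrier (tensor K (unit_space K) V). tensor_sum V (\<lambda>a v. scalar a \<odot>\<^bsub>V\<^esub> v) t)"

definition right_unitor :: "'k ring \<Rightarrow> ('k, 'a) vspace \<Rightarrow> ('k, 'a) elt \<Rightarrow> ('k, 'a) elt" where
  "right_unitor K V =
     (\<lambda>t\<in>carrier (tensor K V (unit_space K)). tensor_sum V (\<lambda>v a. scalar a \<odot>\<^bsub>V\<^esub> v) t)"


section \<open>Coalgebras and comodules\<close>

record ('k, 'a) coalg =
  cspace :: "('k, 'a) vspace"
  comult :: "('k, 'a) elt \<Rightarrow> ('k, 'a) elt"
  counit :: "('k, 'a) elt \<Rightarrow> 'k"

locale coalgebra =
  fixes K :: "'k ring" and C :: "('k, 'a) coalg"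
  assumes space: "module K (cspace C)"
    and comult_linear: "linear_map K (cspace C) (tensor K (cspace C) (cspace C)) (comult C)"
    and counit_linear: "linear_map K (cspace C) (ring_module K) (counit C)"
    and coassoc: "x \<in> carrier (cspace C) \<Longrightarrow>
      associator K (cspace C) (cspace C) (cspace C)
        (tensor_map K (cspace C) (cspace C) (tensor K (cspace C) (cspace C)) (cspace C)
          (comult C) id (comult C x)) =
      tensor_map K (cspace C) (cspace C) (cspace C) (tensor K (cspace C) (cspace C))
          id (comult C) (comult C x)"
    and counit_left: "x \<in> carrier (cspace C) \<Longrightarrow>
      tensor_sum (cspace C) (\<lambda>x\<^sub>1 x\<^sub>2. counit C x\<^sub>1 \<odot>\<^bsub>cspace C\<^esub> x\<^sub>2) (comult C x) = x"
    and counit_right: "x \<in> carrier (cspace C) \<Longrightarrow>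
      tensor_sum (cspace C) (\<lambda>x\<^sub>1 x\<^sub>2. counit C x\<^sub>2 \<odot>\<^bsub>cspace C\<^esub> x\<^sub>1) (comult C x) = x"

locale cocommutative_coalgebra = coalgebra +
  assumes cocommutative: "x \<in> carrier (cspace C) \<Longrightarrow>
    swap K (cspace C) (cspace C) (comult C x) = comult C x"

definition coalgebra_hom ::
  "'k ring \<Rightarrow> ('k, 'a) coalg \<Rightarrow> ('k, 'a) coalg \<Rightarrow> (('k, 'a) elt \<Rightarrow> ('k, 'a) elt) \<Rightarrow> bool" where
  "coalgebra_hom K C C' f \<longleftrightarrow>
     f \<in> carrier (Vect K (cspace C) (cspace C')) \<and>
     (\<forall>x\<in>carrier (cspace C).
        comult C' (f x) = tensor_map K (cspace C) (cspace C) (cspace C') (cspace C') f f (comult C x) \<and>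
        counit C' (f x) = counit C x)"

record ('k, 'a) comod =
  dspace :: "('k, 'a) vspace"
  coact :: "('k, 'a) elt \<Rightarrow> ('k, 'a) elt"

text \<open>Left comodules: the coaction is a map \<open>D \<rightarrow> C \<otimes> D\<close>.\<close>

locale comodule =
  fixes K :: "'k ring" and C :: "('k, 'a) coalg" and D :: "('k, 'a) comod"
  assumes space: "module K (dspace D)"
    and coact_linear: "linear_map K (dspace D) (tensor K (cspace C) (dspace D)) (coact D)"
    and coact_coassoc: "y \<in> carrier (dspace D) \<Longrightarrow>
      associator K (cspace C) (cspace C) (dspace D)
        (tensor_map K (cspace C) (dspace D) (tensor K (cspace C) (cspace C)) (dspace D)
          (comult C) id (coact D y)) =
      tensor_map K (cspace C) (dspace D) (cspace C) (tensor K (cspace C) (dspace D))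
          id (coact D) (coact D y)"
    and coact_counit: "y \<in> carrier (dspace D) \<Longrightarrow>
      tensor_sum (dspace D) (\<lambda>y\<^sub>0 y\<^sub>1. counit C y\<^sub>0 \<odot>\<^bsub>dspace D\<^esub> y\<^sub>1) (coact D y) = y"

definition comodule_hom ::
  "'k ring \<Rightarrow> ('k, 'a) coalg \<Rightarrow> ('k, 'a) comod \<Rightarrow> ('k, 'a) comod \<Rightarrow>
   (('k, 'a) elt \<Rightarrow> ('k, 'a) elt) \<Rightarrow> bool" where
  "comodule_hom K C D D' g \<longleftrightarrow>
     g \<in> carrier (Vect K (dspace D) (dspace D')) \<and>
     (\<forall>y\<in>carrier (dspace D).
        coact D' (g y) = tensor_map K (cspace C) (dspace D) (cspace C) (dspace D') id g (coact D y))"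

definition corestriction ::
  "'k ring \<Rightarrow> ('k, 'a) coalg \<Rightarrow> ('k, 'a) coalg \<Rightarrow> (('k, 'a) elt \<Rightarrow> ('k, 'a) elt) \<Rightarrow>
   ('k, 'a) comod \<Rightarrow> ('k, 'a) comod" where
  "corestriction K C C' f D =
     \<lparr>dspace = dspace D,
      coact = (\<lambda>y. tensor_map K (cspace C) (dspace D) (cspace C') (dspace D) f id (coact D y))\<rparr>"

definition tensor_coalg :: "'k ring \<Rightarrow> ('k, 'a) coalg \<Rightarrow> ('k, 'a) coalg \<Rightarrow> ('k, 'a) coalg" where
  "tensor_coalg K C C' =
     \<lparr>cspace = tensor K (cspace C) (cspace C'),
      comult = (\<lambda>t. interchange K (cspace C) (cspace C) (cspace C') (cspace C')
        (tensor_map K (cspace C) (cspace C')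
          (tensor K (cspace C) (cspace C)) (tensor K (cspace C') (cspace C'))
          (comult C) (comult C') t)),
      counit = tensor_sum (ring_module K) (\<lambda>x x'. counit C x \<otimes>\<^bsub>K\<^esub> counit C' x')\<rparr>"

definition tensor_comod ::
  "'k ring \<Rightarrow> ('k, 'a) coalg \<Rightarrow> ('k, 'a) comod \<Rightarrow> ('k, 'a) coalg \<Rightarrow> ('k, 'a) comod \<Rightarrow> ('k, 'a) comod" where
  "tensor_comod K C D C' D' =
     \<lparr>dspace = tensor K (dspace D) (dspace D'),
      coact = (\<lambda>t. interchange K (cspace C) (dspace D) (cspace C') (dspace D')
        (tensor_map K (dspace D) (dspace D')
          (tensor K (cspace C) (dspace D)) (tensor K (cspace C') (dspace D'))
          (coact D) (coact D') t))\<rparr>"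

definition unit_coalg :: "'k ring \<Rightarrow> ('k, 'a) coalg" where
  "unit_coalg K =
     \<lparr>cspace = unit_space K,
      comult = (\<lambda>x. pure K (unit_space K) (unit_space K) x (Scalar \<one>\<^bsub>K\<^esub>)),
      counit = scalar\<rparr>"

definition unit_comod :: "'k ring \<Rightarrow> ('k, 'a) comod" where
  "unit_comod K =
     \<lparr>dspace = unit_space K,
      coact = (\<lambda>y. pure K (unit_space K) (unit_space K) (Scalar \<one>\<^bsub>K\<^esub>) y)\<rparr>"

text \<open>A subspace \<open>W\<close> of a comodule \<open>D\<close> is a subcomodule if the coaction maps \<open>W\<close> into \<open>C \<otimes> W\<close>,
  regarded as a subspace of \<open>C \<otimes> D\<close>. As \<open>C \<otimes> W\<close> has its own carrier, that inclusion is an explicit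
  map (injective over a field), and the coaction of \<open>W\<close> is the unique lift along it.\<close>

definition tensor_incl ::
  "'k ring \<Rightarrow> ('k, 'a) coalg \<Rightarrow> ('k, 'a) comod \<Rightarrow> ('k, 'a) elt set \<Rightarrow> ('k, 'a) elt \<Rightarrow> ('k, 'a) elt" where
  "tensor_incl K C D W = tensor_map K (cspace C) (dspace D\<lparr>carrier := W\<rparr>) (cspace C) (dspace D) id id"

definition subcomodule ::
  "'k ring \<Rightarrow> ('k, 'a) coalg \<Rightarrow> ('k, 'a) comod \<Rightarrow> ('k, 'a) elt set \<Rightarrow> bool" where
  "subcomodule K C D W \<longleftrightarrow>
     submodule W K (dspace D) \<and>
     coact D ` W \<subseteq> tensor_incl K C D W ` carrier (tensor K (cspace C) (dspace D\<lparr>carrier := W\<rparr>))"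

definition subcomod ::
  "'k ring \<Rightarrow> ('k, 'a) coalg \<Rightarrow> ('k, 'a) comod \<Rightarrow> ('k, 'a) elt set \<Rightarrow> ('k, 'a) comod" where
  "subcomod K C D W =
     \<lparr>dspace = dspace D\<lparr>carrier := W\<rparr>,
      coact = (\<lambda>y. THE t. t \<in> carrier (tensor K (cspace C) (dspace D\<lparr>carrier := W\<rparr>)) \<and>
        tensor_incl K C D W t = coact D y)\<rparr>"

definition sum_of_subspaces :: "('k, 'v) module \<Rightarrow> 'v set set \<Rightarrow> 'v set" where
  "sum_of_subspaces V \<W> = {foldr (add V) ys \<zero>\<^bsub>V\<^esub> |ys. set ys \<subseteq> \<Union>\<W>}"

text \<open>\<open>R\<close> with \<open>\<rho>\<close> is the value at \<open>V\<close>, with the counit at \<open>V\<close>, of the right adjoint of the forgetful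
  functor from \<open>C\<close>-comodules to vector spaces.\<close>

definition cofree_comodule ::
  "'k ring \<Rightarrow> ('k, 'a) coalg \<Rightarrow> ('k, 'v) module \<Rightarrow> ('k, 'a) comod \<Rightarrow> (('k, 'a) elt \<Rightarrow> 'v) \<Rightarrow> bool" where
  "cofree_comodule K C V R \<rho> \<longleftrightarrow>
     comodule K C R \<and> linear_map K (dspace R) V \<rho> \<and>
     (\<forall>D g. comodule K C D \<and> linear_map K (dspace D) V g \<longrightarrow>
        (\<exists>!h. comodule_hom K C D R h \<and> (\<forall>y\<in>carrier (dspace D). \<rho> (h y) = g y)))"


section \<open>Operads with multiplication and cyclic unital comp modules\<close>

text \<open>\<open>ocomp P p q i u v\<close> is \<open>u \<circ>\<^sub>i v\<close> for \<open>u \<in> P(p)\<close>, \<open>v \<in> P(q)\<close>. The degrees are arguments because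
  the carriers of the components need not be disjoint.\<close>

record ('k, 'o) operad_data =
  ospace :: "nat \<Rightarrow> ('k, 'o) module"
  ocomp :: "nat \<Rightarrow> nat \<Rightarrow> nat \<Rightarrow> 'o \<Rightarrow> 'o \<Rightarrow> 'o"
  oid :: 'o
  omult :: 'o
  ounit :: 'o

text \<open>The partial compositions are indexed by \<open>i \<ge> 1\<close>. For \<open>p = 0\<close> they vanish, and the three
  associativity relations are void (all terms are 0, possibly in the nonexistent degree \<open>-1\<close>);
  for \<open>p \<ge> 1\<close> the truncated subtraction in the degrees is harmless, a negative degree arising only
  together with terms that are 0 by the vanishing rule.\<close>

locale operad_with_multiplication =
  fixes K :: "'k ring" and P :: "('k, 'o) operad_data"
  assumes space: "module K (ospace P n)"
    and ocomp_bilinear: "1 \<le> i \<Longrightarrow>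
      bilinear_map K (ospace P p) (ospace P q) (ospace P (p + q - 1)) (ocomp P p q i)"
    and ocomp_zero: "\<lbrakk>1 \<le> i; p < i \<or> p = 0; u \<in> carrier (ospace P p); v \<in> carrier (ospace P q)\<rbrakk> \<Longrightarrow>
      ocomp P p q i u v = \<zero>\<^bsub>ospace P (p + q - 1)\<^esub>"
    and ocomp_assoc1:
      "\<lbrakk>1 \<le> p; 1 \<le> j; j < i;
        u \<in> carrier (ospace P p); v \<in> carrier (ospace P q); w \<in> carrier (ospace P r)\<rbrakk> \<Longrightarrow>
      ocomp P (p + q - 1) r j (ocomp P p q i u v) w =
      ocomp P (p + r - 1) q (i + r - 1) (ocomp P p r j u w) v"
    and ocomp_assoc2:
      "\<lbrakk>1 \<le> p; 1 \<le> i; i \<le> j; j < q + i;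
        u \<in> carrier (ospace P p); v \<in> carrier (ospace P q); w \<in> carrier (ospace P r)\<rbrakk> \<Longrightarrow>
      ocomp P (p + q - 1) r j (ocomp P p q i u v) w =
      ocomp P p (q + r - 1) i u (ocomp P q r (j - i + 1) v w)"
    and ocomp_assoc3:
      "\<lbrakk>1 \<le> p; 1 \<le> i; q + i \<le> j;
        u \<in> carrier (ospace P p); v \<in> carrier (ospace P q); w \<in> carrier (ospace P r)\<rbrakk> \<Longrightarrow>
      ocomp P (p + q - 1) r j (ocomp P p q i u v) w =
      ocomp P (p + r - 1) q i (ocomp P p r (j - q + 1) u w) v"
    and oid_closed: "oid P \<in> carrier (ospace P 1)"
    and oid_right: "\<lbrakk>1 \<le> i; i \<le> p; u \<in> carrier (ospace P p)\<rbrakk> \<Longrightarrow> ocomp P p 1 i u (oid P) = u"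
    and oid_left: "u \<in> carrier (ospace P p) \<Longrightarrow> ocomp P 1 p 1 (oid P) u = u"
    and omult_closed: "omult P \<in> carrier (ospace P 2)"
    and ounit_closed: "ounit P \<in> carrier (ospace P 0)"
    and omult_assoc: "ocomp P 2 2 1 (omult P) (omult P) = ocomp P 2 2 2 (omult P) (omult P)"
    and omult_unit_left: "ocomp P 2 0 1 (omult P) (ounit P) = oid P"
    and omult_unit_right: "ocomp P 2 0 2 (omult P) (ounit P) = oid P"

text \<open>\<open>lact L p n i u l\<close> is \<open>u \<bullet>\<^sub>i l\<close> for \<open>u \<in> P(p)\<close>, \<open>l \<in> L(n)\<close>; it is only used for
  \<open>i + p \<le> n + 1\<close>, i.e. for \<open>0 \<le> i \<le> n + 1 - p\<close>. For \<open>p > n + 1\<close> there is no such \<open>i\<close> and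
  the zero convention concerns a negative degree, so no condition is needed.\<close>

record ('k, 'o, 'l) comp_module_data =
  lspace :: "nat \<Rightarrow> ('k, 'l) module"
  lact :: "nat \<Rightarrow> nat \<Rightarrow> nat \<Rightarrow> 'o \<Rightarrow> 'l \<Rightarrow> 'l"
  lcyc :: "nat \<Rightarrow> 'l \<Rightarrow> 'l"


text \<open>In the relations below all operations are applied within their index range, and \<open>p\<close>, \<open>q\<close>, \<open>i\<close>, \<open>j\<close>
  run over all values for which the left-hand side \<open>u \<bullet>\<^sub>i (v \<bullet>\<^sub>j l)\<close> is defined.\<close>

locale cyclic_comp_module =
  fixes K :: "'k ring" and P :: "('k, 'o) operad_data" and L :: "('k, 'o, 'l) comp_module_data"
  assumes space: "module K (lspace L n)"
    and lact_bilinear: "i + p \<le> n + 1 \<Longrightarrow>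
      bilinear_map K (ospace P p) (lspace L n) (lspace L (n + 1 - p)) (lact L p n i)"
    and lact_assoc1:
      "\<lbrakk>j + q \<le> n + 1; i + p + q \<le> n + 2; j < i;
        u \<in> carrier (ospace P p); v \<in> carrier (ospace P q); l \<in> carrier (lspace L n)\<rbrakk> \<Longrightarrow>
      lact L p (n + 1 - q) i u (lact L q n j v l) =
      lact L q (n + 1 - p) j v (lact L p n (i + q - 1) u l)"
    and lact_assoc2:
      "\<lbrakk>0 < p; j + q \<le> n + 1; i + p + q \<le> n + 2; j < i + p; i \<le> j;
        u \<in> carrier (ospace P p); v \<in> carrier (ospace P q); l \<in> carrier (lspace L n)\<rbrakk> \<Longrightarrow>
      lact L p (n + 1 - q) i u (lact L q n j v l) =
      lact L (p + q - 1) n i (ocomp P p q (j - i + 1) u v) l"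
    and lact_assoc3:
      "\<lbrakk>0 < p; j + q \<le> n + 1; i + p + q \<le> n + 2; i + p \<le> j;
        u \<in> carrier (ospace P p); v \<in> carrier (ospace P q); l \<in> carrier (lspace L n)\<rbrakk> \<Longrightarrow>
      lact L p (n + 1 - q) i u (lact L q n j v l) =
      lact L q (n + 1 - p) (j - p + 1) v (lact L p n i u l)"
    and lact_assoc3_zero:
      "\<lbrakk>j + q \<le> n + 1; i + q \<le> n + 2; i \<le> j;
        u \<in> carrier (ospace P 0); v \<in> carrier (ospace P q); l \<in> carrier (lspace L n)\<rbrakk> \<Longrightarrow>
      lact L 0 (n + 1 - q) i u (lact L q n j v l) =
      lact L q (n + 1) (j + 1) v (lact L 0 n i u l)"
    and lact_unit: "\<lbrakk>i \<le> n; l \<in> carrier (lspace L n)\<rbrakk> \<Longrightarrow> lact L 1 n i (oid P) l = l"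
    and lcyc_linear: "linear_map K (lspace L n) (lspace L n) (lcyc L n)"
    and lcyc_zero: "l \<in> carrier (lspace L 0) \<Longrightarrow> lcyc L 0 l = l"
    and lcyc_lact:
      "\<lbrakk>i + p \<le> n; u \<in> carrier (ospace P p); l \<in> carrier (lspace L n)\<rbrakk> \<Longrightarrow>
      lcyc L (n + 1 - p) (lact L p n i u l) = lact L p n (i + 1) u (lcyc L n l)"
    and lcyc_order: "l \<in> carrier (lspace L n) \<Longrightarrow> (lcyc L n ^^ (n + 1)) l = l"


section \<open>Measurings\<close>

locale operad_measuring = cocommutative_coalgebra K C
  for K :: "'k ring" and P P' :: "('k, 'o) operad_data" and C :: "('k, 'a) coalg" +
  fixes \<Psi> :: "nat \<Rightarrow> ('k, 'a) elt \<Rightarrow> 'o \<Rightarrow> 'o"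
  assumes linear: "linear_map K (cspace C) (Vect K (ospace P n) (ospace P' n)) (\<Psi> n)"
    and ocomp: "\<lbrakk>1 \<le> i; x \<in> carrier (cspace C); u \<in> carrier (ospace P p); v \<in> carrier (ospace P q)\<rbrakk> \<Longrightarrow>
      \<Psi> (p + q - 1) x (ocomp P p q i u v) =
      tensor_sum (ospace P' (p + q - 1)) (\<lambda>x\<^sub>1 x\<^sub>2. ocomp P' p q i (\<Psi> p x\<^sub>1 u) (\<Psi> q x\<^sub>2 v)) (comult C x)"
    and omult: "x \<in> carrier (cspace C) \<Longrightarrow> \<Psi> 2 x (omult P) = counit C x \<odot>\<^bsub>ospace P' 2\<^esub> omult P'"
    and ounit: "x \<in> carrier (cspace C) \<Longrightarrow> \<Psi> 0 x (ounit P) = counit C x \<odot>\<^bsub>ospace P' 0\<^esub> ounit P'"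

text \<open>Here and in \<open>cofree_comodule\<close> the test objects are all coalgebras (comodules) whose carriers lie
  in \<open>('k, 'a) elt\<close>. For given types of operad and module elements this is the usual universal
  property as soon as \<open>'a\<close> is large enough for the universal objects to have a copy in that type.\<close>

definition universal_measuring ::
  "'k ring \<Rightarrow> ('k, 'o) operad_data \<Rightarrow> ('k, 'o) operad_data \<Rightarrow> ('k, 'a) coalg \<Rightarrow>
   (nat \<Rightarrow> ('k, 'a) elt \<Rightarrow> 'o \<Rightarrow> 'o) \<Rightarrow> bool" where
  "universal_measuring K P P' M \<Phi> \<longleftrightarrow>
     operad_measuring K P P' M \<Phi> \<and>
     (\<forall>C \<Psi>. operad_measuring K P P' C \<Psi> \<longrightarrow>
        (\<exists>!f. coalgebra_hom K C M f \<and> (\<forall>n. \<forall>x\<in>carrier (cspace C). \<Psi> n x = \<Phi> n (f x))))"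

locale comodule_measuring = comodule K C D
  for K :: "'k ring" and P :: "('k, 'o) operad_data" and C :: "('k, 'a) coalg"
    and \<Psi> :: "nat \<Rightarrow> ('k, 'a) elt \<Rightarrow> 'o \<Rightarrow> 'o"
    and L L' :: "('k, 'o, 'l) comp_module_data" and D :: "('k, 'a) comod" +
  fixes \<Omega> :: "nat \<Rightarrow> ('k, 'a) elt \<Rightarrow> 'l \<Rightarrow> 'l"
  assumes linear: "linear_map K (dspace D) (Vect K (lspace L n) (lspace L' n)) (\<Omega> n)"
    and lact: "\<lbrakk>i + p \<le> n + 1; y \<in> carrier (dspace D); u \<in> carrier (ospace P p); l \<in> carrier (lspace L n)\<rbrakk> \<Longrightarrow>
      \<Omega> (n + 1 - p) y (lact L p n i u l) =
      tensor_sum (lspace L' (n + 1 - p)) (\<lambda>y\<^sub>0 y\<^sub>1. lact L' p n i (\<Psi> p y\<^sub>0 u) (\<Omega> n y\<^sub>1 l)) (coact D y)"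
    and lcyc: "\<lbrakk>y \<in> carrier (dspace D); l \<in> carrier (lspace L n)\<rbrakk> \<Longrightarrow>
      \<Omega> n y (lcyc L n l) = lcyc L' n (\<Omega> n y l)"

text \<open>The universal measuring comodule, formed inside the cofree comodule \<open>R\<close> on
  \<open>\<Prod>\<^sub>n Vect(L(n), L'(n))\<close> with counit \<open>\<rho>\<close>.\<close>

definition measuring_comod ::
  "'k ring \<Rightarrow> ('k, 'o) operad_data \<Rightarrow> ('k, 'a) coalg \<Rightarrow>
   (nat \<Rightarrow> ('k, 'a) elt \<Rightarrow> 'o \<Rightarrow> 'o) \<Rightarrow>
   ('k, 'o, 'l) comp_module_data \<Rightarrow> ('k, 'o, 'l) comp_module_data \<Rightarrow>
   ('k, 'a) comod \<Rightarrow> (('k, 'a) elt \<Rightarrow> nat \<Rightarrow> 'l \<Rightarrow> 'l) \<Rightarrow> ('k, 'a) comod" where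
  "measuring_comod K P C \<Psi> L L' R \<rho> =
     subcomod K C R (sum_of_subspaces (dspace R)
       {W. subcomodule K C R W \<and>
           comodule_measuring K P C \<Psi> L L' (subcomod K C R W) (\<lambda>n y. \<rho> y n)})"


section \<open>Enriched categories\<close>

record ('o, 'm) monoidal_data =
  Obj :: "'o set"
  Hom :: "'o \<Rightarrow> 'o \<Rightarrow> 'm set"
  Id :: "'o \<Rightarrow> 'm"
  Comp :: "'m \<Rightarrow> 'm \<Rightarrow> 'm" (infixr \<open>\<cdot>\<index>\<close> 55)
  Ten :: "'o \<Rightarrow> 'o \<Rightarrow> 'o" (infixr \<open>\<boxtimes>\<index>\<close> 65)
  TenArr :: "'m \<Rightarrow> 'm \<Rightarrow> 'm" (infixr \<open>\<star>\<index>\<close> 65)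
  Unit :: 'o (\<open>\<I>\<index>\<close>)
  Assoc :: "'o \<Rightarrow> 'o \<Rightarrow> 'o \<Rightarrow> 'm"
  LUnit :: "'o \<Rightarrow> 'm"
  RUnit :: "'o \<Rightarrow> 'm"
  Braid :: "'o \<Rightarrow> 'o \<Rightarrow> 'm"

definition iso_arr :: "('o, 'm) monoidal_data \<Rightarrow> 'o \<Rightarrow> 'o \<Rightarrow> 'm \<Rightarrow> bool" where
  "iso_arr V A B f \<longleftrightarrow> f \<in> Hom V A B \<and> (\<exists>g\<in>Hom V B A. g \<cdot>\<^bsub>V\<^esub> f = Id V A \<and> f \<cdot>\<^bsub>V\<^esub> g = Id V B)"

locale symmetric_monoidal_category =
  fixes V :: "('o, 'm) monoidal_data" (structure)
  assumes Id_hom: "A \<in> Obj V \<Longrightarrow> Id V A \<in> Hom V A A"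
    and Comp_hom: "\<lbrakk>A \<in> Obj V; B \<in> Obj V; C \<in> Obj V; f \<in> Hom V A B; g \<in> Hom V B C\<rbrakk> \<Longrightarrow> g \<cdot> f \<in> Hom V A C"
    and Comp_Id: "\<lbrakk>A \<in> Obj V; B \<in> Obj V; f \<in> Hom V A B\<rbrakk> \<Longrightarrow> f \<cdot> Id V A = f"
    and Id_Comp: "\<lbrakk>A \<in> Obj V; B \<in> Obj V; f \<in> Hom V A B\<rbrakk> \<Longrightarrow> Id V B \<cdot> f = f"
    and Comp_assoc:
      "\<lbrakk>A \<in> Obj V; B \<in> Obj V; C \<in> Obj V; D \<in> Obj V; f \<in> Hom V A B; g \<in> Hom V B C; h \<in> Hom V C D\<rbrakk> \<Longrightarrow>
      (h \<cdot> g) \<cdot> f = h \<cdot> (g \<cdot> f)"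
    and Ten_Obj: "\<lbrakk>A \<in> Obj V; B \<in> Obj V\<rbrakk> \<Longrightarrow> A \<boxtimes> B \<in> Obj V"
    and TenArr_hom:
      "\<lbrakk>A \<in> Obj V; A' \<in> Obj V; B \<in> Obj V; B' \<in> Obj V; f \<in> Hom V A A'; g \<in> Hom V B B'\<rbrakk> \<Longrightarrow>
      f \<star> g \<in> Hom V (A \<boxtimes> B) (A' \<boxtimes> B')"
    and TenArr_Id: "\<lbrakk>A \<in> Obj V; B \<in> Obj V\<rbrakk> \<Longrightarrow> Id V A \<star> Id V B = Id V (A \<boxtimes> B)"
    and TenArr_Comp:
      "\<lbrakk>A \<in> Obj V; A' \<in> Obj V; A'' \<in> Obj V; B \<in> Obj V; B' \<in> Obj V; B'' \<in> Obj V;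
        f \<in> Hom V A A'; f' \<in> Hom V A' A''; g \<in> Hom V B B'; g' \<in> Hom V B' B''\<rbrakk> \<Longrightarrow>
      (f' \<cdot> f) \<star> (g' \<cdot> g) = (f' \<star> g') \<cdot> (f \<star> g)"
    and Unit_Obj: "\<I> \<in> Obj V"
    and Assoc_iso: "\<lbrakk>A \<in> Obj V; B \<in> Obj V; C \<in> Obj V\<rbrakk> \<Longrightarrow>
      iso_arr V ((A \<boxtimes> B) \<boxtimes> C) (A \<boxtimes> (B \<boxtimes> C)) (Assoc V A B C)"
    and Assoc_natural:
      "\<lbrakk>A \<in> Obj V; A' \<in> Obj V; B \<in> Obj V; B' \<in> Obj V; C \<in> Obj V; C' \<in> Obj V;
        f \<in> Hom V A A'; g \<in> Hom V B B'; h \<in> Hom V C C'\<rbrakk> \<Longrightarrow>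
      Assoc V A' B' C' \<cdot> ((f \<star> g) \<star> h) = (f \<star> (g \<star> h)) \<cdot> Assoc V A B C"
    and LUnit_iso: "A \<in> Obj V \<Longrightarrow> iso_arr V (\<I> \<boxtimes> A) A (LUnit V A)"
    and LUnit_natural: "\<lbrakk>A \<in> Obj V; A' \<in> Obj V; f \<in> Hom V A A'\<rbrakk> \<Longrightarrow>
      LUnit V A' \<cdot> (Id V \<I> \<star> f) = f \<cdot> LUnit V A"
    and RUnit_iso: "A \<in> Obj V \<Longrightarrow> iso_arr V (A \<boxtimes> \<I>) A (RUnit V A)"
    and RUnit_natural: "\<lbrakk>A \<in> Obj V; A' \<in> Obj V; f \<in> Hom V A A'\<rbrakk> \<Longrightarrow>
      RUnit V A' \<cdot> (f \<star> Id V \<I>) = f \<cdot> RUnit V A"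
    and Braid_hom: "\<lbrakk>A \<in> Obj V; B \<in> Obj V\<rbrakk> \<Longrightarrow> Braid V A B \<in> Hom V (A \<boxtimes> B) (B \<boxtimes> A)"
    and Braid_natural:
      "\<lbrakk>A \<in> Obj V; A' \<in> Obj V; B \<in> Obj V; B' \<in> Obj V; f \<in> Hom V A A'; g \<in> Hom V B B'\<rbrakk> \<Longrightarrow>
      Braid V A' B' \<cdot> (f \<star> g) = (g \<star> f) \<cdot> Braid V A B"
    and Braid_symmetric: "\<lbrakk>A \<in> Obj V; B \<in> Obj V\<rbrakk> \<Longrightarrow> Braid V B A \<cdot> Braid V A B = Id V (A \<boxtimes> B)"
    and pentagon: "\<lbrakk>A \<in> Obj V; B \<in> Obj V; C \<in> Obj V; D \<in> Obj V\<rbrakk> \<Longrightarrow>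
      (Id V A \<star> Assoc V B C D) \<cdot> Assoc V A (B \<boxtimes> C) D \<cdot> (Assoc V A B C \<star> Id V D) =
      Assoc V A B (C \<boxtimes> D) \<cdot> Assoc V (A \<boxtimes> B) C D"
    and triangle: "\<lbrakk>A \<in> Obj V; B \<in> Obj V\<rbrakk> \<Longrightarrow>
      (Id V A \<star> LUnit V B) \<cdot> Assoc V A \<I> B = RUnit V A \<star> Id V B"
    and hexagon: "\<lbrakk>A \<in> Obj V; B \<in> Obj V; C \<in> Obj V\<rbrakk> \<Longrightarrow>
      Assoc V B C A \<cdot> Braid V A (B \<boxtimes> C) \<cdot> Assoc V A B C =
      (Id V B \<star> Braid V A C) \<cdot> Assoc V B A C \<cdot> (Braid V A B \<star> Id V C)"

record ('x, 'o, 'm) enriched_data =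
  EObj :: "'x set"
  EHom :: "'x \<Rightarrow> 'x \<Rightarrow> 'o"
  EComp :: "'x \<Rightarrow> 'x \<Rightarrow> 'x \<Rightarrow> 'm"
  EId :: "'x \<Rightarrow> 'm"

text \<open>Composition is written in diagrammatic order, \<open>Hom(X, Y) \<otimes> Hom(Y, Z) \<rightarrow> Hom(X, Z)\<close>.\<close>

locale enriched_category = symmetric_monoidal_category V
  for V :: "('o, 'm) monoidal_data" (structure) +
  fixes E :: "('x, 'o, 'm) enriched_data"
  assumes EHom_Obj: "\<lbrakk>X \<in> EObj E; Y \<in> EObj E\<rbrakk> \<Longrightarrow> EHom E X Y \<in> Obj V"
    and EComp_hom: "\<lbrakk>X \<in> EObj E; Y \<in> EObj E; Z \<in> EObj E\<rbrakk> \<Longrightarrow>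
      EComp E X Y Z \<in> Hom V (EHom E X Y \<boxtimes> EHom E Y Z) (EHom E X Z)"
    and EId_hom: "X \<in> EObj E \<Longrightarrow> EId E X \<in> Hom V \<I> (EHom E X X)"
    and EComp_assoc: "\<lbrakk>W \<in> EObj E; X \<in> EObj E; Y \<in> EObj E; Z \<in> EObj E\<rbrakk> \<Longrightarrow>
      EComp E W Y Z \<cdot> (EComp E W X Y \<star> Id V (EHom E Y Z)) =
      EComp E W X Z \<cdot> (Id V (EHom E W X) \<star> EComp E X Y Z) \<cdot>
        Assoc V (EHom E W X) (EHom E X Y) (EHom E Y Z)"
    and EId_left: "\<lbrakk>X \<in> EObj E; Y \<in> EObj E\<rbrakk> \<Longrightarrow>
      EComp E X X Y \<cdot> (EId E X \<star> Id V (EHom E X Y)) = LUnit V (EHom E X Y)"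
    and EId_right: "\<lbrakk>X \<in> EObj E; Y \<in> EObj E\<rbrakk> \<Longrightarrow>
      EComp E X Y Y \<cdot> (Id V (EHom E X Y) \<star> EId E Y) = RUnit V (EHom E X Y)"


section \<open>The category of comodules over cocommutative coalgebras\<close>

type_synonym ('k, 'a) comod_obj = "('k, 'a) coalg \<times> ('k, 'a) comod"

record ('k, 'a) comod_arr =
  Dom :: "('k, 'a) comod_obj"
  Cod :: "('k, 'a) comod_obj"
  cmap :: "('k, 'a) elt \<Rightarrow> ('k, 'a) elt"
  dmap :: "('k, 'a) elt \<Rightarrow> ('k, 'a) elt"

abbreviation fst_space :: "('k, 'a) comod_obj \<Rightarrow> ('k, 'a) vspace" where
  "fst_space A \<equiv> cspace (fst A)"

abbreviation snd_space :: "('k, 'a) comod_obj \<Rightarrow> ('k, 'a) vspace" where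
  "snd_space A \<equiv> dspace (snd A)"

definition tensor_obj :: "'k ring \<Rightarrow> ('k, 'a) comod_obj \<Rightarrow> ('k, 'a) comod_obj \<Rightarrow> ('k, 'a) comod_obj" where
  "tensor_obj K A B =
     (tensor_coalg K (fst A) (fst B), tensor_comod K (fst A) (snd A) (fst B) (snd B))"

definition unit_obj :: "'k ring \<Rightarrow> ('k, 'a) comod_obj" where
  "unit_obj K = (unit_coalg K, unit_comod K)"

definition Comod :: "'k ring \<Rightarrow> (('k, 'a) comod_obj, ('k, 'a) comod_arr) monoidal_data" where
  "Comod K =
     \<lparr>Obj = {(C, D). cocommutative_coalgebra K C \<and> comodule K C D},
      Hom = (\<lambda>A B. {h. Dom h = A \<and> Cod h = B \<and>
        coalgebra_hom K (fst A) (fst B) (cmap h) \<and>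
        comodule_hom K (fst B) (corestriction K (fst A) (fst B) (cmap h) (snd A)) (snd B) (dmap h)}),
      Id = (\<lambda>A. \<lparr>Dom = A, Cod = A,
        cmap = (\<lambda>x\<in>carrier (fst_space A). x), dmap = (\<lambda>y\<in>carrier (snd_space A). y)\<rparr>),
      Comp = (\<lambda>h' h. \<lparr>Dom = Dom h, Cod = Cod h',
        cmap = compose (carrier (fst_space (Dom h))) (cmap h') (cmap h),
        dmap = compose (carrier (snd_space (Dom h))) (dmap h') (dmap h)\<rparr>),
      Ten = tensor_obj K,
      TenArr = (\<lambda>h h'. \<lparr>Dom = tensor_obj K (Dom h) (Dom h'), Cod = tensor_obj K (Cod h) (Cod h'),
        cmap = tensor_map K (fst_space (Dom h)) (fst_space (Dom h'))
                 (fst_space (Cod h)) (fst_space (Cod h')) (cmap h) (cmap h'),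
        dmap = tensor_map K (snd_space (Dom h)) (snd_space (Dom h'))
                 (snd_space (Cod h)) (snd_space (Cod h')) (dmap h) (dmap h')\<rparr>),
      Unit = unit_obj K,
      Assoc = (\<lambda>A B C. \<lparr>Dom = tensor_obj K (tensor_obj K A B) C, Cod = tensor_obj K A (tensor_obj K B C),
        cmap = associator K (fst_space A) (fst_space B) (fst_space C),
        dmap = associator K (snd_space A) (snd_space B) (snd_space C)\<rparr>),
      LUnit = (\<lambda>A. \<lparr>Dom = tensor_obj K (unit_obj K) A, Cod = A,
        cmap = left_unitor K (fst_space A), dmap = left_unitor K (snd_space A)\<rparr>),
      RUnit = (\<lambda>A. \<lparr>Dom = tensor_obj K A (unit_obj K), Cod = A,
        cmap = right_unitor K (fst_space A), dmap = right_unitor K (snd_space A)\<rparr>),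
      Braid = (\<lambda>A B. \<lparr>Dom = tensor_obj K A B, Cod = tensor_obj K B A,
        cmap = swap K (fst_space A) (fst_space B), dmap = swap K (snd_space A) (snd_space B)\<rparr>)\<rparr>"


section \<open>The enriched category of operads with comp modules\<close>

type_synonym ('k, 'o, 'l) comp_obj = "('k, 'o) operad_data \<times> ('k, 'o, 'l) comp_module_data"

definition comp_objects :: "'k ring \<Rightarrow> ('k, 'o, 'l) comp_obj set" where
  "comp_objects K = {(P, L). operad_with_multiplication K P \<and> cyclic_comp_module K P L}"

definition hom_product ::
  "'k ring \<Rightarrow> ('k, 'o, 'l) comp_obj \<Rightarrow> ('k, 'o, 'l) comp_obj \<Rightarrow> ('k, nat \<Rightarrow> 'l \<Rightarrow> 'l) module" where
  "hom_product K X Y = product_space (\<lambda>n. Vect K (lspace (snd X) n) (lspace (snd Y) n))"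

text \<open>The parameters are a choice of universal measuring coalgebras \<open>M P P'\<close> with measurings \<open>\<Phi> P P'\<close>,
  and of cofree \<open>M P P'\<close>-comodules \<open>R X Y\<close> with counits \<open>\<rho> X Y\<close> on the space \<open>hom_product K X Y\<close>.\<close>

locale comp_setup =
  fixes K :: "'k ring"
    and M :: "('k, 'o) operad_data \<Rightarrow> ('k, 'o) operad_data \<Rightarrow> ('k, 'a) coalg"
    and \<Phi> :: "('k, 'o) operad_data \<Rightarrow> ('k, 'o) operad_data \<Rightarrow> nat \<Rightarrow> ('k, 'a) elt \<Rightarrow> 'o \<Rightarrow> 'o"
    and R :: "('k, 'o, 'l) comp_obj \<Rightarrow> ('k, 'o, 'l) comp_obj \<Rightarrow> ('k, 'a) comod"
    and \<rho> :: "('k, 'o, 'l) comp_obj \<Rightarrow> ('k, 'o, 'l) comp_obj \<Rightarrow> ('k, 'a) elt \<Rightarrow> nat \<Rightarrow> 'l \<Rightarrow> 'l"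
begin

definition comp_hom :: "('k, 'o, 'l) comp_obj \<Rightarrow> ('k, 'o, 'l) comp_obj \<Rightarrow> ('k, 'a) comod_obj" where
  "comp_hom X Y =
     (M (fst X) (fst Y),
      measuring_comod K (fst X) (M (fst X) (fst Y)) (\<Phi> (fst X) (fst Y)) (snd X) (snd Y) (R X Y) (\<rho> X Y))"

definition induced_composition ::
  "('k, 'o, 'l) comp_obj \<Rightarrow> ('k, 'o, 'l) comp_obj \<Rightarrow> ('k, 'o, 'l) comp_obj \<Rightarrow> ('k, 'a) comod_arr \<Rightarrow> bool" where
  "induced_composition X Y Z h \<longleftrightarrow>
     h \<in> Hom (Comod K) (comp_hom X Y \<boxtimes>\<^bsub>Comod K\<^esub> comp_hom Y Z) (comp_hom X Z) \<and>
     (\<forall>x\<in>carrier (fst_space (comp_hom X Y)). \<forall>x'\<in>carrier (fst_space (comp_hom Y Z)). \<forall>n.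
        \<Phi> (fst X) (fst Z) n (cmap h (pure K (fst_space (comp_hom X Y)) (fst_space (comp_hom Y Z)) x x')) =
        compose (carrier (ospace (fst X) n)) (\<Phi> (fst Y) (fst Z) n x') (\<Phi> (fst X) (fst Y) n x)) \<and>
     (\<forall>y\<in>carrier (snd_space (comp_hom X Y)). \<forall>y'\<in>carrier (snd_space (comp_hom Y Z)). \<forall>n.
        \<rho> X Z (dmap h (pure K (snd_space (comp_hom X Y)) (snd_space (comp_hom Y Z)) y y')) n =
        compose (carrier (lspace (snd X) n)) (\<rho> Y Z y' n) (\<rho> X Y y n))"

definition induced_identity :: "('k, 'o, 'l) comp_obj \<Rightarrow> ('k, 'a) comod_arr \<Rightarrow> bool" where
  "induced_identity X h \<longleftrightarrow>
     h \<in> Hom (Comod K) \<I>\<^bsub>Comod K\<^esub> (comp_hom X X) \<and>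
     (\<forall>a\<in>carrier K. \<forall>n.
        \<Phi> (fst X) (fst X) n (cmap h (Scalar a)) =
          (\<lambda>u\<in>carrier (ospace (fst X) n). a \<odot>\<^bsub>ospace (fst X) n\<^esub> u) \<and>
        \<rho> X X (dmap h (Scalar a)) n =
          (\<lambda>l\<in>carrier (lspace (snd X) n). a \<odot>\<^bsub>lspace (snd X) n\<^esub> l))"

definition comp_category ::
  "(('k, 'o, 'l) comp_obj, ('k, 'a) comod_obj, ('k, 'a) comod_arr) enriched_data" where
  "comp_category =
     \<lparr>EObj = comp_objects K,
      EHom = comp_hom,
      EComp = (\<lambda>X Y Z. THE h. induced_composition X Y Z h),
      EId = (\<lambda>X. THE h. induced_identity X h)\<rparr>"

end

end

theory Submission
  imports Defs
begin

text \<open>Every construction is checked on pure tensors: a linear map out of a tensor product is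
  determined by its values there, which gives the coherence of \<open>Comod K\<close> as well as the
  comultiplication of a tensor product of coalgebras. A coalgebra is a comodule over itself, and its
  comultiplication is the coaction, so most facts about coalgebras are instances of facts about comodules.

  Composing measurings by \<open>C\<close> and \<open>C'\<close> gives a measuring by \<open>C \<otimes> C'\<close>, and scalar
  multiples of identities give one by \<open>K\<close>; both factor through the universal measuring coalgebra.
  The corresponding comodule measurings become measurings over the universal coalgebra after corestriction,
  and then factor through the universal measuring comodule, since the image of a comodule in the
  cofree comodule is one of the subcomodules that are summed up. Over a field a subspace is a retract,
  so tensoring preserves inclusions; this makes subcomodules, their sums and these images well behaved.
  The axioms of an enriched category then follow from uniqueness: both sides induce the same maps
  on pure tensors.\<close>

section \<open>Linear maps\<close>

text \<open>An obstacle shapes the second half. An element of a tensor product is a list picked by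
  \<open>SOME\<close>, so \<open>C \<otimes> W\<close> is not a subset of
  \<open>C \<otimes> D\<close> when \<open>W\<close> is a subspace of \<open>D\<close>: inclusions
  are explicit maps, and a subcomodule obtains its coaction by lifting along one. Inverses of
  nonzero scalars are used once, to construct complements of subspaces. Being measuring is treated
  as a condition on single elements of the cofree comodule. That condition is closed under addition,
  which is why the sum of all measuring subcomodules is itself measuring. The coalgebra part of an
  arrow always precedes its comodule part, because a comodule map between objects over different
  coalgebras makes sense only after corestriction along a known coalgebra morphism. The unit and all
  tensor products have carriers in the same type \<open>elt\<close> as the test objects of the
  universal properties, so these properties apply to them directly. Maps are extensional, so arrows
  are equal once they agree on carriers.\<close>

named_theorems lin

lemma linear_mapI:
  assumes "\<And>x. x \<in> carrier V \<Longrightarrow> f x \<in> carrier W"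
    and "\<And>x y. \<lbrakk>x \<in> carrier V; y \<in> carrier V\<rbrakk> \<Longrightarrow> f (x \<oplus>\<^bsub>V\<^esub> y) = f x \<oplus>\<^bsub>W\<^esub> f y"
    and "\<And>a x. \<lbrakk>a \<in> carrier K; x \<in> carrier V\<rbrakk> \<Longrightarrow> f (a \<odot>\<^bsub>V\<^esub> x) = a \<odot>\<^bsub>W\<^esub> f x"
  shows "linear_map K V W f"
  using assms by (simp add: linear_map_def)

lemma linear_map_cong:
  assumes "module K V" "\<And>x. x \<in> carrier V \<Longrightarrow> f x = g x"
  shows "linear_map K V W f \<longleftrightarrow> linear_map K V W g"
proof -
  interpret V: module K V by fact
  show ?thesis using assms(2) by (auto simp: linear_map_def Pi_iff)
qed

lemma linear_map_Vect: "f \<in> carrier (Vect K V W) \<Longrightarrow> linear_map K V W f"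
  by (simp add: Vect_def)

lemma Vect_eqI:
  assumes "f \<in> carrier (Vect K V W)" "g \<in> carrier (Vect K V W)" "\<And>x. x \<in> carrier V \<Longrightarrow> f x = g x"
  shows "f = g"
  using assms by (auto simp: Vect_def intro: extensionalityI)

locale ground_ring = cring K for K :: "'k ring"
begin

abbreviation tensor_notation (infixr \<open>\<otimes>\<^sub>K\<close> 70) where "V \<otimes>\<^sub>K W \<equiv> tensor K V W"

abbreviation lin_map where "lin_map V W f \<equiv> linear_map K V W f"

abbreviation vec where "vec V \<equiv> module K V"

lemma lin_closed: "\<lbrakk>lin_map V W f; x \<in> carrier V\<rbrakk> \<Longrightarrow> f x \<in> carrier W"
  by (auto simp: linear_map_def)

lemma lin_add: "\<lbrakk>lin_map V W f; x \<in> carrier V; y \<in> carrier V\<rbrakk> \<Longrightarrow> f (x \<oplus>\<^bsub>V\<^esub> y) = f x \<oplus>\<^bsub>W\<^esub> f y"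
  by (auto simp: linear_map_def)

lemma lin_smult: "\<lbrakk>lin_map V W f; a \<in> carrier K; x \<in> carrier V\<rbrakk> \<Longrightarrow> f (a \<odot>\<^bsub>V\<^esub> x) = a \<odot>\<^bsub>W\<^esub> f x"
  by (auto simp: linear_map_def)

lemma lin_zero:
  assumes "vec V" "vec W" "lin_map V W f"
  shows "f \<zero>\<^bsub>V\<^esub> = \<zero>\<^bsub>W\<^esub>"
proof -
  interpret V: module K V by fact
  interpret W: module K W by fact
  \<comment> \<open>\<open>linear_map\<close> has no clause for zero, so zero is presented as the
    zero multiple of a vector and homogeneity is used.\<close>
  have "f (\<zero>\<^bsub>K\<^esub> \<odot>\<^bsub>V\<^esub> \<zero>\<^bsub>V\<^esub>) = \<zero>\<^bsub>K\<^esub> \<odot>\<^bsub>W\<^esub> f \<zero>\<^bsub>V\<^esub>"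
    by (rule lin_smult[OF assms(3)]) simp_all
  then show ?thesis
    using lin_closed[OF assms(3)] by simp
qed

lemma vec_add_closed [simp]: "\<lbrakk>vec V; x \<in> carrier V; y \<in> carrier V\<rbrakk> \<Longrightarrow> x \<oplus>\<^bsub>V\<^esub> y \<in> carrier V"
  by (simp add: abelian_groupE(1) module.axioms(2))

lemma vec_zero_closed [simp]: "vec V \<Longrightarrow> \<zero>\<^bsub>V\<^esub> \<in> carrier V"
  by (simp add: abelian_groupE(2) module.axioms(2))

lemma vec_smult_closed [simp]: "\<lbrakk>vec V; a \<in> carrier K; x \<in> carrier V\<rbrakk> \<Longrightarrow> a \<odot>\<^bsub>V\<^esub> x \<in> carrier V"
  by (simp add: module.smult_closed)

lemma lin_id [lin]: "lin_map V V (\<lambda>x. x)"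
  by (rule linear_mapI) auto

lemma lin_id' [lin]: "lin_map V V id"
  by (rule linear_mapI) auto

lemma lin_compose:
  assumes "lin_map V W g" "lin_map U V f"
  shows "lin_map U W (\<lambda>x. g (f x))"
  using assms by (intro linear_mapI) (simp_all add: lin_closed[OF assms(1)] lin_closed[OF assms(2)]
      lin_add[OF assms(1)] lin_add[OF assms(2)] lin_smult[OF assms(1)] lin_smult[OF assms(2)])

text \<open>Commutativity of \<open>K\<close> enters here: the new scalar has to pass the one pulled
  out of the argument.\<close>

lemma lin_smult_const [lin]:
  assumes "vec W" "lin_map V W f" "a \<in> carrier K"
  shows "lin_map V W (\<lambda>x. a \<odot>\<^bsub>W\<^esub> f x)"
proof -
  interpret W: module K W by fact
  show ?thesis
    using assms(3) by (intro linear_mapI)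
      (simp_all add: lin_closed[OF assms(2)] lin_add[OF assms(2)] lin_smult[OF assms(2)]
        W.smult_r_distr m_comm flip: W.smult_assoc1)
qed

lemma lin_smult_scalar [lin]:
  assumes "vec W" "lin_map V (ring_module K) f" "w \<in> carrier W"
  shows "lin_map V W (\<lambda>x. f x \<odot>\<^bsub>W\<^esub> w)"
proof -
  interpret W: module K W by fact
  show ?thesis
    using assms(3) lin_closed[OF assms(2)] lin_add[OF assms(2)] lin_smult[OF assms(2)]
    by (intro linear_mapI) (simp_all add: ring_module_def W.smult_l_distr W.smult_assoc1)
qed

lemma lin_add_fun:
  assumes "vec W" "lin_map V W f" "lin_map V W g"
  shows "lin_map V W (\<lambda>x. f x \<oplus>\<^bsub>W\<^esub> g x)"
proof -
  interpret W: module K W by fact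
  show ?thesis
    by (intro linear_mapI)
      (simp_all add: lin_closed[OF assms(2)] lin_closed[OF assms(3)] lin_add[OF assms(2)]
        lin_add[OF assms(3)] lin_smult[OF assms(2)] lin_smult[OF assms(3)] W.smult_r_distr W.M.a_ac)
qed

lemma lin_zero_fun: "vec W \<Longrightarrow> lin_map V W (\<lambda>x. \<zero>\<^bsub>W\<^esub>)"
  by (intro linear_mapI) (simp_all add: module.smult_closed abelian_groupE(5) module.axioms(2)
      module.smult_r_null)

lemma lin_restrict: "vec V \<Longrightarrow> lin_map V W f \<Longrightarrow> lin_map V W (restrict f (carrier V))"
  by (subst linear_map_cong[where g = f]) auto

lemma restrict_Vect: "vec V \<Longrightarrow> lin_map V W f \<Longrightarrow> restrict f (carrier V) \<in> carrier (Vect K V W)"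
  by (simp add: Vect_def lin_restrict)

lemma compose_Vect:
  assumes "vec U" "f \<in> carrier (Vect K U V)" "g \<in> carrier (Vect K V W)"
  shows "compose (carrier U) g f \<in> carrier (Vect K U W)"
  unfolding compose_def using assms
  by (intro restrict_Vect lin_compose[of V W g U f] linear_map_Vect)

lemma bilinear_mapI:
  assumes "\<And>u. u \<in> carrier U \<Longrightarrow> lin_map V W (\<beta> u)"
    and "\<And>v. v \<in> carrier V \<Longrightarrow> lin_map U W (\<lambda>u. \<beta> u v)"
  shows "bilinear_map K U V W \<beta>"
  using assms by (simp add: bilinear_map_def)

lemma bilinear_right: "\<lbrakk>bilinear_map K U V W \<beta>; u \<in> carrier U\<rbrakk> \<Longrightarrow> lin_map V W (\<beta> u)"
  by (simp add: bilinear_map_def)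

lemma bilinear_left: "\<lbrakk>bilinear_map K U V W \<beta>; v \<in> carrier V\<rbrakk> \<Longrightarrow> lin_map U W (\<lambda>u. \<beta> u v)"
  by (simp add: bilinear_map_def)

lemma bilinear_closed: "\<lbrakk>bilinear_map K U V W \<beta>; u \<in> carrier U; v \<in> carrier V\<rbrakk> \<Longrightarrow> \<beta> u v \<in> carrier W"
  by (rule lin_closed[OF bilinear_right])

lemma bilinear_compose:
  assumes "bilinear_map K U V W \<beta>" "lin_map U' U f" "lin_map V' V g"
  shows "bilinear_map K U' V' W (\<lambda>u v. \<beta> (f u) (g v))"
proof (rule bilinear_mapI)
  fix u assume "u \<in> carrier U'"
  then show "lin_map V' W (\<lambda>v. \<beta> (f u) (g v))"
    using lin_compose[OF bilinear_right[OF assms(1)] assms(3)] lin_closed[OF assms(2)] by blast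
next
  fix v assume "v \<in> carrier V'"
  then show "lin_map U' W (\<lambda>u. \<beta> (f u) (g v))"
    using lin_compose[OF bilinear_left[OF assms(1)] assms(2)] lin_closed[OF assms(3)] by blast
qed

lemma vec_Vect:
  assumes "vec V" "vec W"
  shows "vec (Vect K V W)"
proof -
  interpret V: module K V by fact
  interpret W: module K W by fact
  have "abelian_group (Vect K V W)"
  proof (rule abelian_groupI)
    fix f assume f: "f \<in> carrier (Vect K V W)"
    have fl: "lin_map V W f" using f by (rule linear_map_Vect)
    \<comment> \<open>Negation is taken as multiplication by minus one, so its linearity is an
      instance of \<open>lin_smult_const\<close>.\<close>
    let ?g = "\<lambda>x\<in>carrier V. (\<ominus>\<^bsub>K\<^esub> \<one>\<^bsub>K\<^esub>) \<odot>\<^bsub>W\<^esub> f x"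
    have "?g \<in> carrier (Vect K V W)"
      by (intro restrict_Vect lin_smult_const assms fl) simp
    moreover have "?g \<oplus>\<^bsub>Vect K V W\<^esub> f = \<zero>\<^bsub>Vect K V W\<^esub>"
      using lin_closed[OF fl] by (auto simp: Vect_def W.smult_l_minus W.M.l_neg)
    ultimately show "\<exists>g\<in>carrier (Vect K V W). g \<oplus>\<^bsub>Vect K V W\<^esub> f = \<zero>\<^bsub>Vect K V W\<^esub>"
      by blast
  next
    fix f g assume "f \<in> carrier (Vect K V W)" "g \<in> carrier (Vect K V W)"
    then show "f \<oplus>\<^bsub>Vect K V W\<^esub> g \<in> carrier (Vect K V W)"
      using restrict_Vect[OF assms(1) lin_add_fun[OF assms(2) linear_map_Vect linear_map_Vect]]
      by (simp add: Vect_def)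
  next
    show "\<zero>\<^bsub>Vect K V W\<^esub> \<in> carrier (Vect K V W)"
      using restrict_Vect[OF assms(1) lin_zero_fun[OF assms(2)]] by (simp add: Vect_def)
  qed (auto simp: Vect_def fun_eq_iff linear_map_def Pi_iff W.M.a_ac
        dest: extensional_arb)
  then show ?thesis
  proof (rule moduleI[OF is_cring])
    fix a f assume "a \<in> carrier K" "f \<in> carrier (Vect K V W)"
    then show "a \<odot>\<^bsub>Vect K V W\<^esub> f \<in> carrier (Vect K V W)"
      using restrict_Vect[OF assms(1) lin_smult_const[OF assms(2) linear_map_Vect]]
      by (simp add: Vect_def)
  qed (auto simp: Vect_def fun_eq_iff linear_map_def Pi_iff W.smult_l_distr W.smult_r_distr
        W.smult_assoc1 dest: extensional_arb)
qed

lemma lin_eval: "v \<in> carrier V \<Longrightarrow> lin_map (Vect K V W) W (\<lambda>f. f v)"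
  by (rule linear_mapI) (auto simp: Vect_def linear_map_def)

lemma lin_Vect_apply:
  assumes "lin_map U (Vect K V W) f" "v \<in> carrier V"
  shows "lin_map U W (\<lambda>u. f u v)"
  by (rule lin_compose[OF lin_eval[OF assms(2)] assms(1)])

text \<open>Elements of \<open>Vect\<close> are extensional, so equations between values of \<beta>
  reduce to equations at each \<open>v\<close>. Linearity into a space of maps is thereby tested one
  argument at a time.\<close>

lemma lin_into_Vect:
  assumes "vec U" "vec V" "vec W"
    and "\<And>u. u \<in> carrier U \<Longrightarrow> \<beta> u \<in> carrier (Vect K V W)"
    and "\<And>v. v \<in> carrier V \<Longrightarrow> lin_map U W (\<lambda>u. \<beta> u v)"
  shows "lin_map U (Vect K V W) \<beta>"
proof -
  interpret U: module K U by fact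
  interpret VW: module K "Vect K V W" by (rule vec_Vect; fact)
  show ?thesis
  proof (rule linear_mapI)
    fix x y assume xy: "x \<in> carrier U" "y \<in> carrier U"
    show "\<beta> (x \<oplus>\<^bsub>U\<^esub> y) = \<beta> x \<oplus>\<^bsub>Vect K V W\<^esub> \<beta> y"
    proof (rule Vect_eqI)
      fix v assume "v \<in> carrier V"
      then show "\<beta> (x \<oplus>\<^bsub>U\<^esub> y) v = (\<beta> x \<oplus>\<^bsub>Vect K V W\<^esub> \<beta> y) v"
        using lin_add[OF assms(5) xy] by (simp add: Vect_def)
    qed (use xy assms(4) in auto)
  next
    fix a x assume ax: "a \<in> carrier K" "x \<in> carrier U"
    show "\<beta> (a \<odot>\<^bsub>U\<^esub> x) = a \<odot>\<^bsub>Vect K V W\<^esub> \<beta> x"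
    proof (rule Vect_eqI)
      fix v assume "v \<in> carrier V"
      then show "\<beta> (a \<odot>\<^bsub>U\<^esub> x) v = (a \<odot>\<^bsub>Vect K V W\<^esub> \<beta> x) v"
        using lin_smult[OF assms(5) ax] by (simp add: Vect_def)
    qed (use ax assms(4) in auto)
  qed (use assms(4) in auto)
qed

lemma vec_ring_module: "vec (ring_module K)"
proof -
  have "abelian_group (ring_module K)"
    by (rule abelian_groupI) (auto simp: ring_module_def a_ac intro: l_neg)
  then show ?thesis
    by (rule moduleI[OF is_cring]) (auto simp: ring_module_def l_distr r_distr m_assoc)
qed

lemma vec_unit_space: "vec (unit_space K)"
proof -
  have "abelian_group (unit_space K)"
    by (rule abelian_groupI) (auto simp: unit_space_def a_ac intro: l_neg)
  then show ?thesis
    by (rule moduleI[OF is_cring]) (auto simp: unit_space_def l_distr r_distr m_assoc)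
qed

lemma lin_scalar [lin]: "lin_map (unit_space K) (ring_module K) scalar"
  by (rule linear_mapI) (auto simp: unit_space_def ring_module_def)

section \<open>Tensor products of modules\<close>

text \<open>The rules \<open>sym\<close>, \<open>trans\<close> and \<open>append\<close> carry no
  membership premises; they are recovered from the generating rules by closure of the
  carriers.\<close>

lemma tensor_eq_carrier:
  assumes "vec V" "vec W" "tensor_eq K V W ps qs"
  shows "set ps \<subseteq> carrier V \<times> carrier W \<and> set qs \<subseteq> carrier V \<times> carrier W"
  using assms(3)
proof induction
  case (add_left v v' w)
  then show ?case using assms(1) by simp
next
  case (add_right v w w')
  then show ?case using assms(2) by simp
next
  case (smult a v w)
  then show ?case using assms(1,2) by simp
next
  case (zero w)
  then show ?case using assms(1) by simp
qed auto

text \<open>Related lists have exactly the same relatives, so \<open>SOME\<close> is applied to one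
  and the same predicate.\<close>

lemma tensor_class_eq:
  assumes "tensor_eq K V W ps qs"
  shows "tensor_class K V W ps = tensor_class K V W qs"
proof -
  have "tensor_eq K V W ps = tensor_eq K V W qs"
    using assms by (auto simp: fun_eq_iff intro: tensor_eq.sym tensor_eq.trans)
  then show ?thesis by (simp add: tensor_class_def)
qed

text \<open>Reflexivity, available for lists over the carriers, is the witness that
  \<open>SOME\<close> requires.\<close>

lemma summands_tensor_class:
  assumes "set ps \<subseteq> carrier V \<times> carrier W"
  shows "tensor_eq K V W ps (summands (tensor_class K V W ps))"
  using someI[of "tensor_eq K V W ps", OF tensor_eq.refl[OF assms]] by (simp add: tensor_class_def)

abbreviation scale_pairs ::
  "('k, 'v) module \<Rightarrow> 'k \<Rightarrow> ('v \<times> 'w) list \<Rightarrow> ('v \<times> 'w) list"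
  where "scale_pairs V a \<equiv> map (\<lambda>(v, w). (a \<odot>\<^bsub>V\<^esub> v, w))"

text \<open>Makes the scalar action of \<open>tensor\<close>, which acts on left entries,
  independent of the representative.\<close>

lemma tensor_eq_scale:
  assumes "vec V" "vec W" "a \<in> carrier K" "tensor_eq K V W ps qs"
  shows "tensor_eq K V W (scale_pairs V a ps) (scale_pairs V a qs)"
proof -
  interpret V: module K V by fact
  interpret W: module K W by fact
  show ?thesis
    using assms(4)
  proof induction
    case (refl ps)
    then show ?case using assms(3) by (intro tensor_eq.refl) auto
  next
    case (commute ps qs)
    then have "set (scale_pairs V a ps @ scale_pairs V a qs) \<subseteq> carrier V \<times> carrier W"
      using assms(3) by auto
    from tensor_eq.commute[OF this] show ?case by simp
  next
    case (add_left v v' w)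
    then show ?case using assms(3) by (simp add: V.smult_r_distr tensor_eq.add_left)
  next
    case (add_right v w w')
    then show ?case using assms(3) by (simp add: tensor_eq.add_right)
  next
    case (smult b v w)
    \<comment> \<open>The balancing rule survives scaling because the two scalars commute.\<close>
    then have "a \<odot>\<^bsub>V\<^esub> (b \<odot>\<^bsub>V\<^esub> v) = b \<odot>\<^bsub>V\<^esub> (a \<odot>\<^bsub>V\<^esub> v)"
      using assms(3) by (simp add: m_comm flip: V.smult_assoc1)
    then show ?case using smult assms(3) by (simp add: tensor_eq.smult)
  next
    case (zero w)
    then show ?case using assms(3) by (simp add: tensor_eq.zero)
  qed (auto intro: tensor_eq.sym tensor_eq.trans tensor_eq.append)
qed

lemma tensor_carrier: "carrier (V \<otimes>\<^sub>K W) = tensor_class K V W ` {ps. set ps \<subseteq> carrier V \<times> carrier W}"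
  by (simp add: tensor_def lists_eq_set)

lemma tensor_class_closed: "set ps \<subseteq> carrier V \<times> carrier W \<Longrightarrow> tensor_class K V W ps \<in> carrier (V \<otimes>\<^sub>K W)"
  by (auto simp: tensor_carrier)

lemma tensor_class_Nil: "tensor_class K V W [] = \<zero>\<^bsub>V \<otimes>\<^sub>K W\<^esub>"
  by (simp add: tensor_def)

text \<open>Addition first replaces both lists by their chosen representatives; the congruence rule
  \<open>append\<close> makes this harmless.\<close>

lemma tensor_class_append:
  assumes "set ps \<subseteq> carrier V \<times> carrier W" "set qs \<subseteq> carrier V \<times> carrier W"
  shows "tensor_class K V W (ps @ qs) = tensor_class K V W ps \<oplus>\<^bsub>V \<otimes>\<^sub>K W\<^esub> tensor_class K V W qs"
  by (simp add: tensor_def) (intro tensor_class_eq tensor_eq.append summands_tensor_class assms)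

lemma tensor_class_scale:
  assumes "vec V" "vec W" "a \<in> carrier K" "set ps \<subseteq> carrier V \<times> carrier W"
  shows "tensor_class K V W (scale_pairs V a ps) = a \<odot>\<^bsub>V \<otimes>\<^sub>K W\<^esub> tensor_class K V W ps"
  by (simp add: tensor_def) (intro tensor_class_eq tensor_eq_scale summands_tensor_class assms)

text \<open>The source of additive inverses in the tensor product.\<close>

lemma tensor_eq_zero_sum:
  assumes "vec V" "vec W" "set ps \<subseteq> carrier V \<times> carrier W"
  shows "tensor_eq K V W (scale_pairs V (\<ominus>\<^bsub>K\<^esub> \<one>\<^bsub>K\<^esub>) ps @ ps) []"
  using assms(3)
proof (induction ps)
  case Nil
  then show ?case by (auto intro: tensor_eq.refl)
next
  case (Cons p ps)
  interpret V: module K V by fact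
  interpret W: module K W by fact
  obtain v w where p: "p = (v, w)" by (cases p)
  let ?n = "\<lambda>ps. scale_pairs V (\<ominus>\<^bsub>K\<^esub> \<one>\<^bsub>K\<^esub>) ps"
  have vw: "v \<in> carrier V" "w \<in> carrier W" and ps: "set ps \<subseteq> carrier V \<times> carrier W"
    using Cons.prems p by auto
  then have n: "set (?n ps) \<subseteq> carrier V \<times> carrier W" by auto
  have cancel: "(\<ominus>\<^bsub>K\<^esub> \<one>\<^bsub>K\<^esub>) \<odot>\<^bsub>V\<^esub> v \<oplus>\<^bsub>V\<^esub> v = \<zero>\<^bsub>V\<^esub>"
    using vw by (simp add: V.smult_l_minus V.M.l_neg)
  \<comment> \<open>\<open>add_left\<close>, read backwards, merges the head with its negative into
    a pair whose left entry is zero.\<close>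
  have "tensor_eq K V W (?n [p] @ [p]) [(\<zero>\<^bsub>V\<^esub>, w)]"
    using tensor_eq.sym[OF tensor_eq.add_left[of "(\<ominus>\<^bsub>K\<^esub> \<one>\<^bsub>K\<^esub>) \<odot>\<^bsub>V\<^esub> v" V v w W K]] vw cancel p by simp
  then have 1: "tensor_eq K V W (?n [p] @ [p]) []"
    using tensor_eq.zero[OF vw(2)] tensor_eq.trans by blast
  \<comment> \<open>The head has to pass the scaled tail in order to stand next to its
    negative.\<close>
  have "tensor_eq K V W (?n ps @ [p]) ([p] @ ?n ps)"
    using vw n p by (intro tensor_eq.commute) auto
  then have "tensor_eq K V W (?n [p] @ ((?n ps @ [p]) @ ps)) (?n [p] @ (([p] @ ?n ps) @ ps))"
    using vw ps p n by (intro tensor_eq.append[OF tensor_eq.refl tensor_eq.append[OF _ tensor_eq.refl]]) auto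
  moreover have "tensor_eq K V W ((?n [p] @ [p]) @ (?n ps @ ps)) ([] @ [])"
    using 1 Cons.IH[OF ps] by (rule tensor_eq.append)
  ultimately show ?case
    using tensor_eq.trans by fastforce
qed

text \<open>The group laws are those of concatenation up to \<open>commute\<close>. Of the module
  laws only additivity in the scalar needs work, since it splits every entry of a list.\<close>

lemma vec_tensor [simp]:
  assumes "vec V" "vec W"
  shows "vec (V \<otimes>\<^sub>K W)"
proof -
  interpret V: module K V by fact
  interpret W: module K W by fact
  let ?ok = "\<lambda>ps. set ps \<subseteq> carrier V \<times> carrier W"
  have sc: "?ok (scale_pairs V a ps)" if "a \<in> carrier K" "?ok ps" for a ps
    using that by auto
  note ap = tensor_class_append[symmetric]
  note ts = tensor_class_scale[OF assms, symmetric]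
  have comm: "tensor_class K V W (ps @ qs) = tensor_class K V W (qs @ ps)" if "?ok ps" "?ok qs" for ps qs
    using that by (intro tensor_class_eq tensor_eq.commute) auto
  have inv: "tensor_class K V W (scale_pairs V (\<ominus>\<^bsub>K\<^esub> \<one>\<^bsub>K\<^esub>) ps @ ps) = \<zero>\<^bsub>V \<otimes>\<^sub>K W\<^esub>" if "?ok ps" for ps
    using tensor_class_eq[OF tensor_eq_zero_sum[OF assms that]] by (simp add: tensor_class_Nil)
  have "abelian_group (V \<otimes>\<^sub>K W)"
  proof (rule abelian_groupI, goal_cases)
    case (1 x y)
    then show ?case by (auto simp: tensor_carrier ap)
  next
    case 2
    then show ?case by (force simp: tensor_carrier simp flip: tensor_class_Nil)
  next
    case (3 x y z)
    then show ?case by (auto simp: tensor_carrier ap)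
  next
    case (4 x y)
    then show ?case by (auto simp: tensor_carrier ap comm)
  next
    case (5 x)
    then show ?case by (auto simp: tensor_carrier ap simp flip: tensor_class_Nil)
  next
    case (6 x)
    then obtain ps where ps: "?ok ps" "x = tensor_class K V W ps" by (auto simp: tensor_carrier)
    then have "tensor_class K V W (scale_pairs V (\<ominus>\<^bsub>K\<^esub> \<one>\<^bsub>K\<^esub>) ps) \<oplus>\<^bsub>V \<otimes>\<^sub>K W\<^esub> x = \<zero>\<^bsub>V \<otimes>\<^sub>K W\<^esub>"
      using inv sc by (simp add: ap)
    moreover have "tensor_class K V W (scale_pairs V (\<ominus>\<^bsub>K\<^esub> \<one>\<^bsub>K\<^esub>) ps) \<in> carrier (V \<otimes>\<^sub>K W)"
      using sc[OF _ ps(1), of "\<ominus>\<^bsub>K\<^esub> \<one>\<^bsub>K\<^esub>"] by (intro tensor_class_closed) simp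
    ultimately show ?case by blast
  qed
  then show ?thesis
  proof (rule moduleI[OF is_cring], goal_cases)
    case (1 a x)
    then obtain ps where ps: "?ok ps" "x = tensor_class K V W ps" by (auto simp: tensor_carrier)
    show ?case using ps 1 sc[OF 1(1) ps(1)] by (simp add: ts tensor_class_closed)
  next
    case (2 a b x)
    then obtain ps where ps: "?ok ps" "x = tensor_class K V W ps" by (auto simp: tensor_carrier)
    \<comment> \<open>\<open>add_left\<close> splits a single pair, so the list is treated by
      induction. The second half of each split head is then moved past \<open>?A\<close>, to gather
      the \<open>a\<close>-multiples before the \<open>b\<close>-multiples.\<close>
    have "tensor_class K V W (scale_pairs V (a \<oplus>\<^bsub>K\<^esub> b) ps) =
        tensor_class K V W (scale_pairs V a ps) \<oplus>\<^bsub>V \<otimes>\<^sub>K W\<^esub> tensor_class K V W (scale_pairs V b ps)"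
      using ps(1)
    proof (induction ps)
      case Nil
      then show ?case using ap[of "[]" V W "[]"] by simp
    next
      case (Cons p ps)
      obtain v w where p: "p = (v, w)" by (cases p)
      have vw: "v \<in> carrier V" "w \<in> carrier W" and ps: "?ok ps"
        using Cons.prems p by auto
      let ?c = "tensor_class K V W" and ?A = "scale_pairs V a ps" and ?B = "scale_pairs V b ps"
      have A: "?ok ?A" and B: "?ok ?B" using ps 2 sc by blast+
      have avw: "?ok [(a \<odot>\<^bsub>V\<^esub> v, w)]" "?ok [(b \<odot>\<^bsub>V\<^esub> v, w)]" "?ok [((a \<oplus>\<^bsub>K\<^esub> b) \<odot>\<^bsub>V\<^esub> v, w)]"
        "?ok [(a \<odot>\<^bsub>V\<^esub> v, w), (b \<odot>\<^bsub>V\<^esub> v, w)]"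
        using vw 2 by auto
      have "?c (scale_pairs V (a \<oplus>\<^bsub>K\<^esub> b) (p # ps)) = ?c ([((a \<oplus>\<^bsub>K\<^esub> b) \<odot>\<^bsub>V\<^esub> v, w)] @ scale_pairs V (a \<oplus>\<^bsub>K\<^esub> b) ps)"
        using p by simp
      also have "\<dots> = ?c [((a \<oplus>\<^bsub>K\<^esub> b) \<odot>\<^bsub>V\<^esub> v, w)] \<oplus>\<^bsub>V \<otimes>\<^sub>K W\<^esub> ?c (scale_pairs V (a \<oplus>\<^bsub>K\<^esub> b) ps)"
        using avw(3) sc[OF _ ps, of "a \<oplus>\<^bsub>K\<^esub> b"] 2 by (intro tensor_class_append) auto
      also have "?c [((a \<oplus>\<^bsub>K\<^esub> b) \<odot>\<^bsub>V\<^esub> v, w)] = ?c ([(a \<odot>\<^bsub>V\<^esub> v, w)] @ [(b \<odot>\<^bsub>V\<^esub> v, w)])"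
        using vw 2 by (auto simp: V.smult_l_distr intro!: tensor_class_eq tensor_eq.add_left)
      also have "?c (scale_pairs V (a \<oplus>\<^bsub>K\<^esub> b) ps) = ?c (?A @ ?B)"
        using Cons.IH[OF ps] A B by (simp add: ap)
      also have "?c ([(a \<odot>\<^bsub>V\<^esub> v, w)] @ [(b \<odot>\<^bsub>V\<^esub> v, w)]) \<oplus>\<^bsub>V \<otimes>\<^sub>K W\<^esub> ?c (?A @ ?B) =
          ?c ([(a \<odot>\<^bsub>V\<^esub> v, w)] @ (([(b \<odot>\<^bsub>V\<^esub> v, w)] @ ?A) @ ?B))"
        using avw A B by (subst ap) auto
      also have "\<dots> = ?c ([(a \<odot>\<^bsub>V\<^esub> v, w)] @ ((?A @ [(b \<odot>\<^bsub>V\<^esub> v, w)]) @ ?B))"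
        using avw A B by (intro tensor_class_eq tensor_eq.append tensor_eq.refl tensor_eq.commute) auto
      also have "\<dots> = ?c (scale_pairs V a (p # ps) @ scale_pairs V b (p # ps))"
        using p by simp
      also have "\<dots> = ?c (scale_pairs V a (p # ps)) \<oplus>\<^bsub>V \<otimes>\<^sub>K W\<^esub> ?c (scale_pairs V b (p # ps))"
        using avw A B p by (intro tensor_class_append) auto
      finally show ?case .
    qed
    then show ?case using ps 2 by (simp add: ts)
  next
    case (3 a x y)
    then obtain ps qs where ps: "?ok ps" "x = tensor_class K V W ps" "?ok qs" "y = tensor_class K V W qs"
      by (auto simp: tensor_carrier)
    then show ?case using 3 sc[OF 3(1) ps(1)] sc[OF 3(1) ps(3)] by (simp add: ap ts)
  next
    case (4 a b x)
    then obtain ps where ps: "?ok ps" "x = tensor_class K V W ps" by (auto simp: tensor_carrier)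
    have "scale_pairs V (a \<otimes>\<^bsub>K\<^esub> b) ps = scale_pairs V a (scale_pairs V b ps)"
      using ps(1) 4 by (auto simp: V.smult_assoc1)
    then show ?case using 4 ps sc[OF 4(2) ps(1)] by (simp add: ts del: map_map map_eq_conv)
  next
    case (5 x)
    then obtain ps where ps: "?ok ps" "x = tensor_class K V W ps" by (auto simp: tensor_carrier)
    have "scale_pairs V \<one>\<^bsub>K\<^esub> ps = ps"
      using ps(1) by (auto intro!: map_idI)
    then show ?case using ps ts[of "\<one>\<^bsub>K\<^esub>" ps] by simp
  qed
qed

section \<open>Pure tensors and the universal property of the tensor product\<close>

lemma pure_closed [simp]: "\<lbrakk>v \<in> carrier V; w \<in> carrier W\<rbrakk> \<Longrightarrow> pure K V W v w \<in> carrier (V \<otimes>\<^sub>K W)"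
  by (simp add: pure_def tensor_class_closed)

lemma pure_bilinear:
  assumes "vec V" "vec W"
  shows "bilinear_map K V W (V \<otimes>\<^sub>K W) (pure K V W)"
proof -
  interpret V: module K V by fact
  interpret W: module K W by fact
  have ap: "tensor_class K V W [p, q] = tensor_class K V W [p] \<oplus>\<^bsub>V \<otimes>\<^sub>K W\<^esub> tensor_class K V W [q]"
    if "set [p, q] \<subseteq> carrier V \<times> carrier W" for p q
    using tensor_class_append[of "[p]" V W "[q]"] that by simp
  have sm: "pure K V W (a \<odot>\<^bsub>V\<^esub> v) w = a \<odot>\<^bsub>V \<otimes>\<^sub>K W\<^esub> pure K V W v w"
    if "a \<in> carrier K" "v \<in> carrier V" "w \<in> carrier W" for a v w
    using tensor_class_scale[OF assms that(1), of "[(v, w)]"] that by (simp add: pure_def)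
  \<comment> \<open>The scalar action of the tensor product touches left entries, so a scalar on the
    right is first carried across by balancing.\<close>
  have mv: "pure K V W v (a \<odot>\<^bsub>W\<^esub> w) = pure K V W (a \<odot>\<^bsub>V\<^esub> v) w"
    if "a \<in> carrier K" "v \<in> carrier V" "w \<in> carrier W" for a v w
    unfolding pure_def using that by (intro tensor_class_eq tensor_eq.sym[OF tensor_eq.smult])
  show ?thesis
  proof (intro bilinear_mapI linear_mapI)
    fix v v' w assume "v \<in> carrier V" "v' \<in> carrier V" "w \<in> carrier W"
    then show "pure K V W (v \<oplus>\<^bsub>V\<^esub> v') w = pure K V W v w \<oplus>\<^bsub>V \<otimes>\<^sub>K W\<^esub> pure K V W v' w"
      by (simp add: pure_def flip: ap) (intro tensor_class_eq tensor_eq.add_left)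
  next
    fix v w w' assume "v \<in> carrier V" "w \<in> carrier W" "w' \<in> carrier W"
    then show "pure K V W v (w \<oplus>\<^bsub>W\<^esub> w') = pure K V W v w \<oplus>\<^bsub>V \<otimes>\<^sub>K W\<^esub> pure K V W v w'"
      by (simp add: pure_def flip: ap) (intro tensor_class_eq tensor_eq.add_right)
  qed (simp_all add: mv sm)
qed

text \<open>A representing list is built by putting one pair in front at a time, which adds a pure
  tensor, and the empty list represents zero.\<close>

lemma tensor_induct [consumes 3, case_names zero pure add]:
  assumes "vec V" "vec W" "t \<in> carrier (V \<otimes>\<^sub>K W)"
    and "Q \<zero>\<^bsub>V \<otimes>\<^sub>K W\<^esub>"
    and "\<And>v w. \<lbrakk>v \<in> carrier V; w \<in> carrier W\<rbrakk> \<Longrightarrow> Q (pure K V W v w)"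
    and "\<And>s t. \<lbrakk>s \<in> carrier (V \<otimes>\<^sub>K W); t \<in> carrier (V \<otimes>\<^sub>K W); Q s; Q t\<rbrakk> \<Longrightarrow> Q (s \<oplus>\<^bsub>V \<otimes>\<^sub>K W\<^esub> t)"
  shows "Q t"
proof -
  obtain ps where ps: "set ps \<subseteq> carrier V \<times> carrier W" "t = tensor_class K V W ps"
    using assms(3) by (auto simp: tensor_carrier)
  from ps(1) have "Q (tensor_class K V W ps)"
  proof (induction ps)
    case Nil
    then show ?case using assms(4) by (simp add: tensor_class_Nil)
  next
    case (Cons p ps)
    obtain v w where p: "p = (v, w)" by (cases p)
    have "tensor_class K V W (p # ps) = pure K V W v w \<oplus>\<^bsub>V \<otimes>\<^sub>K W\<^esub> tensor_class K V W ps"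
      using tensor_class_append[of "[p]" V W ps] Cons.prems p by (simp add: pure_def)
    then show ?case using Cons p assms(5,6) by (simp add: tensor_class_closed)
  qed
  then show ?thesis using ps by simp
qed

text \<open>The conclusion is a bounded quantification so that instances can serve as conditional
  rewrite rules, as the coherence laws do later.\<close>

lemma tensor_ext:
  assumes "vec V" "vec W" "vec Z"
    and "lin_map (V \<otimes>\<^sub>K W) Z f" "lin_map (V \<otimes>\<^sub>K W) Z g"
    and "\<And>v w. \<lbrakk>v \<in> carrier V; w \<in> carrier W\<rbrakk> \<Longrightarrow> f (pure K V W v w) = g (pure K V W v w)"
  shows "\<forall>t\<in>carrier (V \<otimes>\<^sub>K W). f t = g t"
proof
  fix t assume "t \<in> carrier (V \<otimes>\<^sub>K W)"
  with assms(1,2) show "f t = g t"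
  proof (induction rule: tensor_induct)
    case zero
    show ?case by (simp add: assms(1-3) lin_zero[OF _ _ assms(4)] lin_zero[OF _ _ assms(5)])
  next
    case (add s t)
    then show ?case using lin_add[OF assms(4)] lin_add[OF assms(5)] by simp
  qed (fact assms(6))
qed

abbreviation pairs_sum where
  "pairs_sum Z \<beta> ps \<equiv> foldr (\<lambda>(v, w) z. \<beta> v w \<oplus>\<^bsub>Z\<^esub> z) ps \<zero>\<^bsub>Z\<^esub>"

lemma pairs_sum_closed:
  assumes "vec Z" "bilinear_map K V W Z \<beta>" "set ps \<subseteq> carrier V \<times> carrier W"
  shows "pairs_sum Z \<beta> ps \<in> carrier Z"
  using assms(3) by (induction ps) (auto simp: assms(1) bilinear_closed[OF assms(2)])

lemma pairs_sum_append:
  assumes "vec Z" "bilinear_map K V W Z \<beta>" "set ps \<subseteq> carrier V \<times> carrier W" "set qs \<subseteq> carrier V \<times> carrier W"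
  shows "pairs_sum Z \<beta> (ps @ qs) = pairs_sum Z \<beta> ps \<oplus>\<^bsub>Z\<^esub> pairs_sum Z \<beta> qs"
proof -
  interpret Z: module K Z by fact
  note cl = pairs_sum_closed[OF assms(1,2)]
  show ?thesis using assms(3)
    by (induction ps) (auto simp: cl assms bilinear_closed[OF assms(2)] Z.M.a_assoc)
qed

lemma pairs_sum_scale:
  assumes "vec Z" "bilinear_map K V W Z \<beta>" "a \<in> carrier K" "set ps \<subseteq> carrier V \<times> carrier W"
  shows "pairs_sum Z \<beta> (scale_pairs V a ps) = a \<odot>\<^bsub>Z\<^esub> pairs_sum Z \<beta> ps"
proof -
  interpret Z: module K Z by fact
  note cl = pairs_sum_closed[OF assms(1,2)]
  show ?thesis using assms(4)
    by (induction ps) (auto simp: cl assms(3) bilinear_closed[OF assms(2)] Z.smult_r_distr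
        lin_smult[OF bilinear_left[OF assms(2)]])
qed

text \<open>The heart of the universal property: bilinearity of \<beta> validates each generating
  relation, and commutativity of \<open>Z\<close> validates the reordering of lists.\<close>

lemma pairs_sum_tensor_eq:
  assumes "vec V" "vec W" "vec Z" "bilinear_map K V W Z \<beta>" "tensor_eq K V W ps qs"
  shows "pairs_sum Z \<beta> ps = pairs_sum Z \<beta> qs"
proof -
  interpret Z: module K Z by fact
  note cl = bilinear_closed[OF assms(4)]
  note lin_l = bilinear_left[OF assms(4)]
  note lin_r = bilinear_right[OF assms(4)]
  show ?thesis using assms(5)
  proof induction
    case (append ps qs ps' qs')
    then show ?case
      using tensor_eq_carrier[OF assms(1,2)] by (simp add: pairs_sum_append[OF assms(3,4)] del: foldr_append)
  next
    case (commute ps qs)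
    then show ?case
      using pairs_sum_closed[OF assms(3,4)]
      by (simp add: pairs_sum_append[OF assms(3,4)] Z.M.a_comm del: foldr_append)
  next
    case (zero w)
    then show ?case using lin_zero[OF assms(1,3) lin_l] by simp
  qed (auto simp: cl lin_add[OF lin_l] lin_add[OF lin_r] lin_smult[OF lin_l] lin_smult[OF lin_r] Z.M.a_ac)
qed

text \<open>Frees \<open>tensor_sum\<close> from the representative chosen by \<open>SOME\<close>,
  so that sums can be computed on any list at hand.\<close>

lemma tensor_sum_tensor_class:
  assumes "vec V" "vec W" "vec Z" "bilinear_map K V W Z \<beta>" "set ps \<subseteq> carrier V \<times> carrier W"
  shows "tensor_sum Z \<beta> (tensor_class K V W ps) = pairs_sum Z \<beta> ps"
  unfolding tensor_sum_def
  using pairs_sum_tensor_eq[OF assms(1-4) summands_tensor_class[OF assms(5)]] by simp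

lemma lin_tensor_sum:
  assumes "vec V" "vec W" "vec Z" "bilinear_map K V W Z \<beta>"
  shows "lin_map (V \<otimes>\<^sub>K W) Z (tensor_sum Z \<beta>)"
proof -
  interpret V: module K V by fact
  note ts = tensor_sum_tensor_class[OF assms]
  show ?thesis
  proof (rule linear_mapI)
    fix s assume "s \<in> carrier (V \<otimes>\<^sub>K W)"
    then show "tensor_sum Z \<beta> s \<in> carrier Z"
      by (auto simp: tensor_carrier ts pairs_sum_closed[OF assms(3,4)])
  next
    fix s t assume "s \<in> carrier (V \<otimes>\<^sub>K W)" "t \<in> carrier (V \<otimes>\<^sub>K W)"
    then show "tensor_sum Z \<beta> (s \<oplus>\<^bsub>V \<otimes>\<^sub>K W\<^esub> t) = tensor_sum Z \<beta> s \<oplus>\<^bsub>Z\<^esub> tensor_sum Z \<beta> t"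
      by (auto simp: tensor_carrier ts pairs_sum_append[OF assms(3,4)]
          simp del: foldr_append simp flip: tensor_class_append)
  next
    fix a t assume a: "a \<in> carrier K" and "t \<in> carrier (V \<otimes>\<^sub>K W)"
    then obtain ps where ps: "set ps \<subseteq> carrier V \<times> carrier W" "t = tensor_class K V W ps"
      by (auto simp: tensor_carrier)
    moreover have "set (scale_pairs V a ps) \<subseteq> carrier V \<times> carrier W"
      using a ps(1) by auto
    ultimately show "tensor_sum Z \<beta> (a \<odot>\<^bsub>V \<otimes>\<^sub>K W\<^esub> t) = a \<odot>\<^bsub>Z\<^esub> tensor_sum Z \<beta> t"
      using a by (simp add: ts pairs_sum_scale[OF assms(3,4)] flip: tensor_class_scale[OF assms(1,2)])
  qed
qed

lemma tensor_sum_pure: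
  assumes "vec V" "vec W" "vec Z" "bilinear_map K V W Z \<beta>" "v \<in> carrier V" "w \<in> carrier W"
  shows "tensor_sum Z \<beta> (pure K V W v w) = \<beta> v w"
proof -
  interpret Z: module K Z by fact
  show ?thesis
    using tensor_sum_tensor_class[OF assms(1-4), of "[(v, w)]"] assms(5,6)
    by (simp add: pure_def bilinear_closed[OF assms(4)])
qed

lemma lin_tensor_sum_compose [lin]:
  assumes "vec V" "vec W" "vec Z" "bilinear_map K V W Z \<beta>" "lin_map X (V \<otimes>\<^sub>K W) h"
  shows "lin_map X Z (\<lambda>x. tensor_sum Z \<beta> (h x))"
  by (rule lin_compose[OF lin_tensor_sum[OF assms(1-4)] assms(5)])

text \<open>Nested Sweedler sums, as in \<open>associator\<close> and \<open>interchange\<close>,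
  also have to be linear in a variable on which the summed form depends. With the tensor fixed, one
  fixed finite list is summed, hence a finite sum of linear maps.\<close>

lemma lin_tensor_sum_param [lin]:
  assumes "vec V" "vec W" "vec Z" "t \<in> carrier (V \<otimes>\<^sub>K W)"
    and "\<And>x. x \<in> carrier X \<Longrightarrow> bilinear_map K V W Z (\<beta> x)"
    and "\<And>v w. \<lbrakk>v \<in> carrier V; w \<in> carrier W\<rbrakk> \<Longrightarrow> lin_map X Z (\<lambda>x. \<beta> x v w)"
  shows "lin_map X Z (\<lambda>x. tensor_sum Z (\<beta> x) t)"
proof -
  obtain ps where ps: "set ps \<subseteq> carrier V \<times> carrier W" "tensor_class K V W ps = t"
    using assms(4) by (auto simp: tensor_carrier)
  \<comment> \<open>The list being summed is the chosen representative; its entries lie in the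
    carriers because it is related to \<open>ps\<close>.\<close>
  have "set (summands t) \<subseteq> carrier V \<times> carrier W"
    using tensor_eq_carrier[OF assms(1,2) summands_tensor_class[OF ps(1)]] ps(2) by simp
  moreover have "lin_map X Z (\<lambda>x. pairs_sum Z (\<beta> x) qs)" if "set qs \<subseteq> carrier V \<times> carrier W" for qs
    using that by (induction qs) (auto intro!: lin_zero_fun lin_add_fun assms)
  ultimately show ?thesis
    by (simp add: tensor_sum_def)
qed

end

section \<open>Extensionality in several factors, and the structure maps on pure tensors\<close>

context ground_ring
begin

declare vec_ring_module [simp] vec_unit_space [simp] vec_Vect [simp]
declare bilinear_mapI [lin]

lemma lin_pure_left [lin]:
  "\<lbrakk>vec V; vec W; lin_map X V f; w \<in> carrier W\<rbrakk> \<Longrightarrow> lin_map X (V \<otimes>\<^sub>K W) (\<lambda>x. pure K V W (f x) w)"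
  by (rule lin_compose[OF bilinear_left[OF pure_bilinear]])

lemma lin_pure_right [lin]:
  "\<lbrakk>vec V; vec W; v \<in> carrier V; lin_map X W g\<rbrakk> \<Longrightarrow> lin_map X (V \<otimes>\<^sub>K W) (\<lambda>x. pure K V W v (g x))"
  by (rule lin_compose[OF bilinear_right[OF pure_bilinear]])

lemma pure_smult_left:
  "\<lbrakk>vec V; vec W; a \<in> carrier K; v \<in> carrier V; w \<in> carrier W\<rbrakk> \<Longrightarrow>
    pure K V W (a \<odot>\<^bsub>V\<^esub> v) w = a \<odot>\<^bsub>V \<otimes>\<^sub>K W\<^esub> pure K V W v w"
  by (rule lin_smult[OF bilinear_left[OF pure_bilinear]])

lemma pure_smult_right:
  "\<lbrakk>vec V; vec W; a \<in> carrier K; v \<in> carrier V; w \<in> carrier W\<rbrakk> \<Longrightarrow>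
    pure K V W v (a \<odot>\<^bsub>W\<^esub> w) = a \<odot>\<^bsub>V \<otimes>\<^sub>K W\<^esub> pure K V W v w"
  by (rule lin_smult[OF bilinear_right[OF pure_bilinear]])

text \<open>Two nested uses of \<open>tensor_ext\<close>: with \<open>w\<close> fixed, both sides
  are linear in the left factor \<open>U \<otimes> V\<close>.\<close>

lemma tensor_ext3:
  assumes "vec U" "vec V" "vec W" "vec Z"
    and "lin_map ((U \<otimes>\<^sub>K V) \<otimes>\<^sub>K W) Z f" "lin_map ((U \<otimes>\<^sub>K V) \<otimes>\<^sub>K W) Z g"
    and eq: "\<And>u v w. \<lbrakk>u \<in> carrier U; v \<in> carrier V; w \<in> carrier W\<rbrakk> \<Longrightarrow>
      f (pure K (U \<otimes>\<^sub>K V) W (pure K U V u v) w) = g (pure K (U \<otimes>\<^sub>K V) W (pure K U V u v) w)"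
  shows "\<forall>t\<in>carrier ((U \<otimes>\<^sub>K V) \<otimes>\<^sub>K W). f t = g t"
proof (rule tensor_ext)
  fix s w assume s: "s \<in> carrier (U \<otimes>\<^sub>K V)" and w: "w \<in> carrier W"
  have "\<forall>s\<in>carrier (U \<otimes>\<^sub>K V). f (pure K (U \<otimes>\<^sub>K V) W s w) = g (pure K (U \<otimes>\<^sub>K V) W s w)"
    by (rule tensor_ext[where Z = Z])
      (simp_all add: assms(1-4) eq w lin_compose[OF assms(5)] lin_compose[OF assms(6)] lin_pure_left lin_id)
  then show "f (pure K (U \<otimes>\<^sub>K V) W s w) = g (pure K (U \<otimes>\<^sub>K V) W s w)"
    using s by blast
qed (use assms in simp_all)

lemma tensor_ext4:
  assumes "vec U" "vec V" "vec W" "vec X" "vec Z"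
    and "lin_map (((U \<otimes>\<^sub>K V) \<otimes>\<^sub>K W) \<otimes>\<^sub>K X) Z f" "lin_map (((U \<otimes>\<^sub>K V) \<otimes>\<^sub>K W) \<otimes>\<^sub>K X) Z g"
    and eq: "\<And>u v w x. \<lbrakk>u \<in> carrier U; v \<in> carrier V; w \<in> carrier W; x \<in> carrier X\<rbrakk> \<Longrightarrow>
      f (pure K ((U \<otimes>\<^sub>K V) \<otimes>\<^sub>K W) X (pure K (U \<otimes>\<^sub>K V) W (pure K U V u v) w) x) =
      g (pure K ((U \<otimes>\<^sub>K V) \<otimes>\<^sub>K W) X (pure K (U \<otimes>\<^sub>K V) W (pure K U V u v) w) x)"
  shows "\<forall>t\<in>carrier (((U \<otimes>\<^sub>K V) \<otimes>\<^sub>K W) \<otimes>\<^sub>K X). f t = g t"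
proof (rule tensor_ext)
  fix s x assume s: "s \<in> carrier ((U \<otimes>\<^sub>K V) \<otimes>\<^sub>K W)" and x: "x \<in> carrier X"
  let ?p = "\<lambda>s. pure K ((U \<otimes>\<^sub>K V) \<otimes>\<^sub>K W) X s x"
  have "\<forall>s\<in>carrier ((U \<otimes>\<^sub>K V) \<otimes>\<^sub>K W). f (?p s) = g (?p s)"
    by (rule tensor_ext3[where Z = Z])
      (simp_all add: assms(1-5) eq x lin_compose[OF assms(6)] lin_compose[OF assms(7)] lin_pure_left lin_id)
  then show "f (?p s) = g (?p s)"
    using s by blast
qed (use assms in simp_all)

text \<open>The right tensor is varied while the left one is pure, then the left one with the right
  one arbitrary. The laws of \<open>interchange\<close> are stated for two arbitrary tensors because
  they are applied to coactions, which are not pure.\<close>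

lemma bilinear_ext:
  assumes "vec U" "vec V" "vec W" "vec X" "vec Z"
    and "bilinear_map K (U \<otimes>\<^sub>K V) (W \<otimes>\<^sub>K X) Z f" "bilinear_map K (U \<otimes>\<^sub>K V) (W \<otimes>\<^sub>K X) Z g"
    and eq: "\<And>u v w x. \<lbrakk>u \<in> carrier U; v \<in> carrier V; w \<in> carrier W; x \<in> carrier X\<rbrakk> \<Longrightarrow>
      f (pure K U V u v) (pure K W X w x) = g (pure K U V u v) (pure K W X w x)"
  shows "\<forall>s\<in>carrier (U \<otimes>\<^sub>K V). \<forall>t\<in>carrier (W \<otimes>\<^sub>K X). f s t = g s t"
proof (intro ballI)
  fix s t assume s: "s \<in> carrier (U \<otimes>\<^sub>K V)" and t: "t \<in> carrier (W \<otimes>\<^sub>K X)"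
  have 1: "\<forall>t\<in>carrier (W \<otimes>\<^sub>K X). f (pure K U V u v) t = g (pure K U V u v) t"
    if "u \<in> carrier U" "v \<in> carrier V" for u v
    by (rule tensor_ext[where Z = Z])
      (simp_all add: assms(1-5) eq that bilinear_right[OF assms(6)] bilinear_right[OF assms(7)])
  have "\<forall>s\<in>carrier (U \<otimes>\<^sub>K V). f s t = g s t"
    by (rule tensor_ext[where Z = Z])
      (simp_all add: assms(1-5) 1 t bilinear_left[OF assms(6)] bilinear_left[OF assms(7)])
  then show "f s t = g s t" using s by blast
qed

lemma tensor_map_bilinear:
  assumes "vec V'" "vec W'" "lin_map V V' f" "lin_map W W' g"
  shows "bilinear_map K V W (V' \<otimes>\<^sub>K W') (\<lambda>v w. pure K V' W' (f v) (g w))"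
  by (intro lin assms lin_closed[OF assms(3)] lin_closed[OF assms(4)])

lemma tensor_map_Vect:
  assumes "vec V" "vec W" "vec V'" "vec W'" "lin_map V V' f" "lin_map W W' g"
  shows "tensor_map K V W V' W' f g \<in> carrier (Vect K (V \<otimes>\<^sub>K W) (V' \<otimes>\<^sub>K W'))"
  unfolding tensor_map_def
  by (intro restrict_Vect lin_tensor_sum[OF assms(1,2)] tensor_map_bilinear assms vec_tensor)

lemma tensor_map_pure [simp]:
  assumes "vec V" "vec W" "vec V'" "vec W'" "lin_map V V' f" "lin_map W W' g" "v \<in> carrier V" "w \<in> carrier W"
  shows "tensor_map K V W V' W' f g (pure K V W v w) = pure K V' W' (f v) (g w)"
  by (simp add: tensor_map_def assms tensor_sum_pure[OF _ _ _ tensor_map_bilinear])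

lemmas lin_tensor_map' [simp] = tensor_map_Vect[THEN linear_map_Vect]
lemmas lin_tensor_map [lin] = lin_compose[OF lin_tensor_map']
lemmas tensor_map_closed [simp] = lin_closed[OF lin_tensor_map']

context
  fixes U V W :: "('k, 'a) vspace"
  assumes UVW: "vec U" "vec V" "vec W"
begin

private lemma associator_bilinear1:
  "w \<in> carrier W \<Longrightarrow> bilinear_map K U V (U \<otimes>\<^sub>K (V \<otimes>\<^sub>K W)) (\<lambda>u v. pure K U (V \<otimes>\<^sub>K W) u (pure K V W v w))"
  by (intro lin UVW vec_tensor pure_closed)

private lemma associator_bilinear2:
  "bilinear_map K (U \<otimes>\<^sub>K V) W (U \<otimes>\<^sub>K (V \<otimes>\<^sub>K W))
    (\<lambda>s w. tensor_sum (U \<otimes>\<^sub>K (V \<otimes>\<^sub>K W)) (\<lambda>u v. pure K U (V \<otimes>\<^sub>K W) u (pure K V W v w)) s)"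
  by (intro bilinear_mapI lin_tensor_sum_param[of U V] lin_tensor_sum UVW vec_tensor associator_bilinear1
      lin_pure_left lin_pure_right lin_id pure_closed)

lemma associator_Vect: "associator K U V W \<in> carrier (Vect K ((U \<otimes>\<^sub>K V) \<otimes>\<^sub>K W) (U \<otimes>\<^sub>K (V \<otimes>\<^sub>K W)))"
  unfolding associator_def Let_def
  by (intro restrict_Vect lin_tensor_sum associator_bilinear2 UVW vec_tensor)

lemma associator_pure [simp]:
  assumes "u \<in> carrier U" "v \<in> carrier V" "w \<in> carrier W"
  shows "associator K U V W (pure K (U \<otimes>\<^sub>K V) W (pure K U V u v) w) =
    pure K U (V \<otimes>\<^sub>K W) u (pure K V W v w)"
  by (simp add: associator_def Let_def assms UVW tensor_sum_pure associator_bilinear1 tensor_sum_pure[OF _ _ _ associator_bilinear2])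

end

lemmas lin_associator' [simp] = associator_Vect[THEN linear_map_Vect]
lemmas lin_associator [lin] = lin_compose[OF lin_associator']
lemmas associator_closed [simp] = lin_closed[OF lin_associator']

context
  fixes V W :: "('k, 'a) vspace"
  assumes VW: "vec V" "vec W"
begin

private lemma swap_bilinear: "bilinear_map K V W (W \<otimes>\<^sub>K V) (\<lambda>v w. pure K W V w v)"
  by (intro lin VW)

lemma swap_Vect: "swap K V W \<in> carrier (Vect K (V \<otimes>\<^sub>K W) (W \<otimes>\<^sub>K V))"
  unfolding swap_def by (intro restrict_Vect lin_tensor_sum swap_bilinear VW vec_tensor)

lemma swap_pure [simp]:
  assumes "v \<in> carrier V" "w \<in> carrier W"
  shows "swap K V W (pure K V W v w) = pure K W V w v"
  by (simp add: swap_def assms VW tensor_sum_pure[OF _ _ _ swap_bilinear])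

end

lemmas lin_swap' [simp] = swap_Vect[THEN linear_map_Vect]
lemmas lin_swap [lin] = lin_compose[OF lin_swap']
lemmas swap_closed [simp] = lin_closed[OF lin_swap']

context
  fixes V :: "('k, 'a) vspace"
  assumes V: "vec V"
begin

private lemma left_unitor_bilinear: "bilinear_map K (unit_space K) V V (\<lambda>a v. scalar a \<odot>\<^bsub>V\<^esub> v)"
  by (intro lin V) (auto simp: unit_space_def)

private lemma right_unitor_bilinear: "bilinear_map K V (unit_space K) V (\<lambda>v a. scalar a \<odot>\<^bsub>V\<^esub> v)"
  by (intro lin V) (auto simp: unit_space_def)

lemma left_unitor_Vect: "left_unitor K V \<in> carrier (Vect K (unit_space K \<otimes>\<^sub>K V) V)"
  unfolding left_unitor_def by (intro restrict_Vect lin_tensor_sum left_unitor_bilinear V vec_tensor vec_unit_space)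

lemma right_unitor_Vect: "right_unitor K V \<in> carrier (Vect K (V \<otimes>\<^sub>K unit_space K) V)"
  unfolding right_unitor_def by (intro restrict_Vect lin_tensor_sum right_unitor_bilinear V vec_tensor vec_unit_space)

lemma left_unitor_pure [simp]:
  assumes "a \<in> carrier (unit_space K)" "v \<in> carrier V"
  shows "left_unitor K V (pure K (unit_space K) V a v) = scalar a \<odot>\<^bsub>V\<^esub> v"
  by (simp add: left_unitor_def assms V tensor_sum_pure[OF _ _ _ left_unitor_bilinear])

lemma right_unitor_pure [simp]:
  assumes "a \<in> carrier (unit_space K)" "v \<in> carrier V"
  shows "right_unitor K V (pure K V (unit_space K) v a) = scalar a \<odot>\<^bsub>V\<^esub> v"
  by (simp add: right_unitor_def assms V tensor_sum_pure[OF _ _ _ right_unitor_bilinear])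

end

lemmas lin_left_unitor' [simp] = left_unitor_Vect[THEN linear_map_Vect]
lemmas lin_left_unitor [lin] = lin_compose[OF lin_left_unitor']
lemmas left_unitor_closed [simp] = lin_closed[OF lin_left_unitor']
lemmas lin_right_unitor' [simp] = right_unitor_Vect[THEN linear_map_Vect]
lemmas lin_right_unitor [lin] = lin_compose[OF lin_right_unitor']
lemmas right_unitor_closed [simp] = lin_closed[OF lin_right_unitor']

context
  fixes V W V' W' :: "('k, 'a) vspace"
  assumes VW: "vec V" "vec W" "vec V'" "vec W'"
begin

private abbreviation (input) "Z \<equiv> (V \<otimes>\<^sub>K V') \<otimes>\<^sub>K (W \<otimes>\<^sub>K W')"
private abbreviation (input) "Q v w v' w' \<equiv>
  pure K (V \<otimes>\<^sub>K V') (W \<otimes>\<^sub>K W') (pure K V V' v v') (pure K W W' w w')"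

private lemma interchange_bilinear1:
  "\<lbrakk>v \<in> carrier V; w \<in> carrier W\<rbrakk> \<Longrightarrow> bilinear_map K V' W' Z (\<lambda>v' w'. Q v w v' w')"
  by (intro lin VW vec_tensor pure_closed)

private lemma interchange_bilinear2:
  "s' \<in> carrier (V' \<otimes>\<^sub>K W') \<Longrightarrow> bilinear_map K V W Z (\<lambda>v w. tensor_sum Z (\<lambda>v' w'. Q v w v' w') s')"
  by (intro bilinear_mapI lin_tensor_sum_param[of V' W'] VW vec_tensor interchange_bilinear1
      lin_pure_left lin_pure_right lin_id pure_closed)

private lemma interchange_bilinear3:
  "bilinear_map K (V \<otimes>\<^sub>K W) (V' \<otimes>\<^sub>K W') Z
    (\<lambda>s s'. tensor_sum Z (\<lambda>v w. tensor_sum Z (\<lambda>v' w'. Q v w v' w') s') s)"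
proof (rule bilinear_mapI)
  fix s assume "s \<in> carrier (V \<otimes>\<^sub>K W)"
  then show "lin_map (V' \<otimes>\<^sub>K W') Z (\<lambda>s'. tensor_sum Z (\<lambda>v w. tensor_sum Z (\<lambda>v' w'. Q v w v' w') s') s)"
    by (intro lin_tensor_sum_param[of V W] lin_tensor_sum interchange_bilinear2 interchange_bilinear1 VW vec_tensor)
next
  fix s' assume "s' \<in> carrier (V' \<otimes>\<^sub>K W')"
  then show "lin_map (V \<otimes>\<^sub>K W) Z (\<lambda>s. tensor_sum Z (\<lambda>v w. tensor_sum Z (\<lambda>v' w'. Q v w v' w') s') s)"
    by (intro lin_tensor_sum interchange_bilinear2 VW vec_tensor)
qed

lemma interchange_Vect: "interchange K V W V' W' \<in> carrier (Vect K ((V \<otimes>\<^sub>K W) \<otimes>\<^sub>K (V' \<otimes>\<^sub>K W')) Z)"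
  unfolding interchange_def Let_def
  by (intro restrict_Vect lin_tensor_sum interchange_bilinear3 VW vec_tensor)

lemma interchange_pure [simp]:
  assumes "v \<in> carrier V" "w \<in> carrier W" "v' \<in> carrier V'" "w' \<in> carrier W'"
  shows "interchange K V W V' W' (pure K (V \<otimes>\<^sub>K W) (V' \<otimes>\<^sub>K W') (pure K V W v w) (pure K V' W' v' w')) =
    Q v w v' w'"
  by (simp add: interchange_def Let_def assms VW tensor_sum_pure[OF _ _ _ interchange_bilinear1]
      tensor_sum_pure[OF _ _ _ interchange_bilinear2] tensor_sum_pure[OF _ _ _ interchange_bilinear3])

end

lemmas lin_interchange' [simp] = interchange_Vect[THEN linear_map_Vect]
lemmas lin_interchange [lin] = lin_compose[OF lin_interchange']
lemmas interchange_closed [simp] = lin_closed[OF lin_interchange']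

end

section \<open>Coherence of the tensor product\<close>

context ground_ring
begin

lemmas lin_simps [simp] = lin_pure_left lin_pure_right lin_tensor_map lin_associator lin_swap
  lin_interchange lin_left_unitor lin_right_unitor lin_id lin_id' bilinear_mapI

abbreviation id_on :: "('k, 'v) module \<Rightarrow> 'v \<Rightarrow> 'v" where "id_on V \<equiv> \<lambda>x\<in>carrier V. x"

lemma lin_id_on [simp]: "vec V \<Longrightarrow> lin_map V V (id_on V)"
  by (simp add: lin_restrict)

lemma tensor_map_id:
  "\<lbrakk>vec V; vec W\<rbrakk> \<Longrightarrow> tensor_map K V W V W (id_on V) (id_on W) = id_on (V \<otimes>\<^sub>K W)"
proof (rule Vect_eqI[where K = K and V = "V \<otimes>\<^sub>K W" and W = "V \<otimes>\<^sub>K W"])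
  assume VW: "vec V" "vec W"
  fix t assume "t \<in> carrier (V \<otimes>\<^sub>K W)"
  moreover have "\<forall>t\<in>carrier (V \<otimes>\<^sub>K W). tensor_map K V W V W (id_on V) (id_on W) t = t"
    by (rule tensor_ext[where Z = "V \<otimes>\<^sub>K W"]) (simp_all add: VW)
  ultimately show "tensor_map K V W V W (id_on V) (id_on W) t = id_on (V \<otimes>\<^sub>K W) t"
    by simp
qed (simp_all add: tensor_map_Vect restrict_Vect)

text \<open>The composites appear as functions \<open>f''\<close> and \<open>g''\<close> known on
  the carriers only. This covers \<open>compose\<close> and \<open>id_on\<close> as well as plain
  composition.\<close>

lemma tensor_map_compose:
  assumes "vec V" "vec W" "vec V'" "vec W'" "vec V''" "vec W''"
    and f: "lin_map V V' f" "lin_map V' V'' f'" and g: "lin_map W W' g" "lin_map W' W'' g'"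
    and "\<And>v. v \<in> carrier V \<Longrightarrow> f'' v = f' (f v)" "\<And>w. w \<in> carrier W \<Longrightarrow> g'' w = g' (g w)"
  shows "\<forall>t\<in>carrier (V \<otimes>\<^sub>K W). tensor_map K V W V'' W'' f'' g'' t =
    tensor_map K V' W' V'' W'' f' g' (tensor_map K V W V' W' f g t)"
proof -
  have "lin_map V V'' f''" "lin_map W W'' g''"
    using lin_compose[OF f(2,1)] lin_compose[OF g(2,1)] assms(11,12)
      linear_map_cong[OF assms(1)] linear_map_cong[OF assms(2)] by metis+
  then show ?thesis
    by (intro tensor_ext[where Z = "V'' \<otimes>\<^sub>K W''"])
      (simp_all add: assms lin_closed[OF f(1)] lin_closed[OF g(1)])
qed

lemma associator_natural:
  assumes "vec U" "vec V" "vec W" "vec U'" "vec V'" "vec W'"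
    and "lin_map U U' f" "lin_map V V' g" "lin_map W W' h"
  shows "\<forall>t\<in>carrier ((U \<otimes>\<^sub>K V) \<otimes>\<^sub>K W).
    associator K U' V' W' (tensor_map K (U \<otimes>\<^sub>K V) W (U' \<otimes>\<^sub>K V') W' (tensor_map K U V U' V' f g) h t) =
    tensor_map K U (V \<otimes>\<^sub>K W) U' (V' \<otimes>\<^sub>K W') f (tensor_map K V W V' W' g h) (associator K U V W t)"
  by (rule tensor_ext3[where Z = "U' \<otimes>\<^sub>K (V' \<otimes>\<^sub>K W')"])
    (simp_all add: assms lin_closed[OF assms(7)] lin_closed[OF assms(8)] lin_closed[OF assms(9)])

lemma swap_natural:
  assumes "vec V" "vec W" "vec V'" "vec W'" "lin_map V V' f" "lin_map W W' g"
  shows "\<forall>t\<in>carrier (V \<otimes>\<^sub>K W). swap K V' W' (tensor_map K V W V' W' f g t) =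
    tensor_map K W V W' V' g f (swap K V W t)"
  by (rule tensor_ext[where Z = "W' \<otimes>\<^sub>K V'"])
    (simp_all add: assms lin_closed[OF assms(5)] lin_closed[OF assms(6)])

lemma swap_swap: "\<lbrakk>vec V; vec W\<rbrakk> \<Longrightarrow> \<forall>t\<in>carrier (V \<otimes>\<^sub>K W). swap K W V (swap K V W t) = t"
  by (rule tensor_ext[where Z = "V \<otimes>\<^sub>K W"]) simp_all

lemma unit_space_scalar: "a \<in> carrier (unit_space K) \<Longrightarrow> scalar a \<in> carrier K \<and> Scalar (scalar a) = a"
  by (auto simp: unit_space_def)

lemma scalar_closed [simp]: "a \<in> carrier (unit_space K) \<Longrightarrow> scalar a \<in> carrier K"
  by (simp add: unit_space_scalar)

lemma Scalar_closed [simp]: "a \<in> carrier K \<Longrightarrow> Scalar a \<in> carrier (unit_space K)"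
  by (simp add: unit_space_def)

lemma unit_space_smult: "a \<in> carrier (unit_space K) \<Longrightarrow> a = scalar a \<odot>\<^bsub>unit_space K\<^esub> Scalar \<one>\<^bsub>K\<^esub>"
  by (auto simp: unit_space_def)

lemma vec_smult_one [simp]: "\<lbrakk>vec V; v \<in> carrier V\<rbrakk> \<Longrightarrow> \<one>\<^bsub>K\<^esub> \<odot>\<^bsub>V\<^esub> v = v"
  by (simp add: module.smult_one)

lemma left_unitor_natural:
  assumes "vec V" "vec V'" "lin_map V V' f"
  shows "\<forall>t\<in>carrier (unit_space K \<otimes>\<^sub>K V).
    left_unitor K V' (tensor_map K (unit_space K) V (unit_space K) V' (id_on (unit_space K)) f t) =
    f (left_unitor K V t)"
  by (rule tensor_ext[where Z = V'])
    (simp_all add: assms lin_closed[OF assms(3)] lin_smult[OF assms(3)] lin_compose[OF assms(3)])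

lemma right_unitor_natural:
  assumes "vec V" "vec V'" "lin_map V V' f"
  shows "\<forall>t\<in>carrier (V \<otimes>\<^sub>K unit_space K).
    right_unitor K V' (tensor_map K V (unit_space K) V' (unit_space K) f (id_on (unit_space K)) t) =
    f (right_unitor K V t)"
  by (rule tensor_ext[where Z = V'])
    (simp_all add: assms lin_closed[OF assms(3)] lin_smult[OF assms(3)] lin_compose[OF assms(3)])

text \<open>A scalar can cross the tensor sign, and \<open>a\<close> itself is a multiple of the
  unit.\<close>

lemma left_unitor_inverse:
  fixes V :: "('k, 'a) vspace"
  assumes "vec V"
  shows "\<forall>t\<in>carrier (unit_space K \<otimes>\<^sub>K V). pure K (unit_space K) V (Scalar \<one>\<^bsub>K\<^esub>) (left_unitor K V t) = t"
proof (rule tensor_ext[where Z = "unit_space K \<otimes>\<^sub>K V"])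
  fix a v :: "('k, 'a) elt" assume a: "a \<in> carrier (unit_space K)" and v: "v \<in> carrier V"
  have "pure K (unit_space K) V (Scalar \<one>\<^bsub>K\<^esub>) (scalar a \<odot>\<^bsub>V\<^esub> v) =
      pure K (unit_space K) V (scalar a \<odot>\<^bsub>unit_space K\<^esub> Scalar \<one>\<^bsub>K\<^esub>) v"
    using a v assms by (simp add: pure_smult_left pure_smult_right)
  then show "pure K (unit_space K) V (Scalar \<one>\<^bsub>K\<^esub>) (left_unitor K V (pure K (unit_space K) V a v)) =
      pure K (unit_space K) V a v"
    using a v assms by (simp flip: unit_space_smult)
qed (simp_all add: assms)

lemma right_unitor_inverse:
  fixes V :: "('k, 'a) vspace"
  assumes "vec V"
  shows "\<forall>t\<in>carrier (V \<otimes>\<^sub>K unit_space K). pure K V (unit_space K) (right_unitor K V t) (Scalar \<one>\<^bsub>K\<^esub>) = t"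
proof (rule tensor_ext[where Z = "V \<otimes>\<^sub>K unit_space K"])
  fix v a :: "('k, 'a) elt" assume a: "a \<in> carrier (unit_space K)" and v: "v \<in> carrier V"
  have "pure K V (unit_space K) (scalar a \<odot>\<^bsub>V\<^esub> v) (Scalar \<one>\<^bsub>K\<^esub>) =
      pure K V (unit_space K) v (scalar a \<odot>\<^bsub>unit_space K\<^esub> Scalar \<one>\<^bsub>K\<^esub>)"
    using a v assms by (simp add: pure_smult_left pure_smult_right)
  then show "pure K V (unit_space K) (right_unitor K V (pure K V (unit_space K) v a)) (Scalar \<one>\<^bsub>K\<^esub>) =
      pure K V (unit_space K) v a"
    using a v assms by (simp flip: unit_space_smult)
qed (simp_all add: assms)

lemma pentagon:
  assumes "vec U" "vec V" "vec W" "vec X"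
  shows "\<forall>t\<in>carrier (((U \<otimes>\<^sub>K V) \<otimes>\<^sub>K W) \<otimes>\<^sub>K X).
    tensor_map K U ((V \<otimes>\<^sub>K W) \<otimes>\<^sub>K X) U (V \<otimes>\<^sub>K (W \<otimes>\<^sub>K X)) (id_on U) (associator K V W X)
      (associator K U (V \<otimes>\<^sub>K W) X
        (tensor_map K ((U \<otimes>\<^sub>K V) \<otimes>\<^sub>K W) X (U \<otimes>\<^sub>K (V \<otimes>\<^sub>K W)) X (associator K U V W) (id_on X) t)) =
    associator K U V (W \<otimes>\<^sub>K X) (associator K (U \<otimes>\<^sub>K V) W X t)"
  by (rule tensor_ext4[where Z = "U \<otimes>\<^sub>K (V \<otimes>\<^sub>K (W \<otimes>\<^sub>K X))"]) (simp_all add: assms)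

lemma triangle:
  assumes "vec U" "vec V"
  shows "\<forall>t\<in>carrier ((U \<otimes>\<^sub>K unit_space K) \<otimes>\<^sub>K V).
    tensor_map K U (unit_space K \<otimes>\<^sub>K V) U V (id_on U) (left_unitor K V) (associator K U (unit_space K) V t) =
    tensor_map K (U \<otimes>\<^sub>K unit_space K) V U V (right_unitor K U) (id_on V) t"
  by (rule tensor_ext3[where Z = "U \<otimes>\<^sub>K V"]) (simp_all add: assms pure_smult_left pure_smult_right)

lemma hexagon:
  assumes "vec U" "vec V" "vec W"
  shows "\<forall>t\<in>carrier ((U \<otimes>\<^sub>K V) \<otimes>\<^sub>K W).
    associator K V W U (swap K U (V \<otimes>\<^sub>K W) (associator K U V W t)) =
    tensor_map K V (U \<otimes>\<^sub>K W) V (W \<otimes>\<^sub>K U) (id_on V) (swap K U W)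
      (associator K V U W (tensor_map K (U \<otimes>\<^sub>K V) W (V \<otimes>\<^sub>K U) W (swap K U V) (id_on W) t))"
  by (rule tensor_ext3[where Z = "V \<otimes>\<^sub>K (W \<otimes>\<^sub>K U)"]) (simp_all add: assms)

text \<open>The associator of \<open>W\<close>, \<open>V\<close>, \<open>U\<close> conjugated by
  swaps: \<open>u(vw)\<close>, \<open>(vw)u\<close>, \<open>(wv)u\<close>, \<open>w(vu)\<close>,
  \<open>(vu)w\<close>, \<open>(uv)w\<close>. Building the inverse from known maps makes its
  linearity automatic.\<close>

abbreviation associator_inv ::
  "('k, 'a) vspace \<Rightarrow> ('k, 'a) vspace \<Rightarrow> ('k, 'a) vspace \<Rightarrow> ('k, 'a) elt \<Rightarrow> ('k, 'a) elt" where
  "associator_inv U V W t \<equiv>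
    tensor_map K (V \<otimes>\<^sub>K U) W (U \<otimes>\<^sub>K V) W (swap K V U) (id_on W)
      (swap K W (V \<otimes>\<^sub>K U)
        (associator K W V U
          (tensor_map K (V \<otimes>\<^sub>K W) U (W \<otimes>\<^sub>K V) U (swap K V W) (id_on U)
            (swap K U (V \<otimes>\<^sub>K W) t))))"

lemma associator_inv_left:
  assumes "vec U" "vec V" "vec W"
  shows "\<forall>t\<in>carrier ((U \<otimes>\<^sub>K V) \<otimes>\<^sub>K W). associator_inv U V W (associator K U V W t) = t"
  by (rule tensor_ext3[where Z = "(U \<otimes>\<^sub>K V) \<otimes>\<^sub>K W"]) (simp_all add: assms)

text \<open>These tensors are bracketed to the right, a shape that \<open>tensor_ext3\<close> does
  not cover; hence the two nested uses of \<open>tensor_ext\<close>.\<close>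

lemma associator_inv_right:
  assumes "vec U" "vec V" "vec W"
  shows "\<forall>t\<in>carrier (U \<otimes>\<^sub>K (V \<otimes>\<^sub>K W)). associator K U V W (associator_inv U V W t) = t"
proof (rule tensor_ext[where Z = "U \<otimes>\<^sub>K (V \<otimes>\<^sub>K W)"])
  fix u s assume u: "u \<in> carrier U" and s: "s \<in> carrier (V \<otimes>\<^sub>K W)"
  have "\<forall>s\<in>carrier (V \<otimes>\<^sub>K W). associator K U V W (associator_inv U V W (pure K U (V \<otimes>\<^sub>K W) u s)) =
      pure K U (V \<otimes>\<^sub>K W) u s"
    by (rule tensor_ext[where Z = "U \<otimes>\<^sub>K (V \<otimes>\<^sub>K W)"]) (simp_all add: assms u)
  then show "associator K U V W (associator_inv U V W (pure K U (V \<otimes>\<^sub>K W) u s)) =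
      pure K U (V \<otimes>\<^sub>K W) u s"
    using s by blast
qed (simp_all add: assms)

text \<open>Coactions on tensor products are formed with \<open>interchange\<close>, so its
  naturality is what makes the tensor product of two compatible maps compatible.\<close>

lemma interchange_natural:
  assumes "vec V" "vec W" "vec V'" "vec W'" "vec X" "vec Y" "vec X'" "vec Y'"
    and "lin_map V X f" "lin_map W Y g" "lin_map V' X' f'" "lin_map W' Y' g'"
  shows "\<forall>s\<in>carrier (V \<otimes>\<^sub>K W). \<forall>t\<in>carrier (V' \<otimes>\<^sub>K W').
    interchange K X Y X' Y' (pure K (X \<otimes>\<^sub>K Y) (X' \<otimes>\<^sub>K Y')
      (tensor_map K V W X Y f g s) (tensor_map K V' W' X' Y' f' g' t)) =
    tensor_map K (V \<otimes>\<^sub>K V') (W \<otimes>\<^sub>K W') (X \<otimes>\<^sub>K X') (Y \<otimes>\<^sub>K Y')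
      (tensor_map K V V' X X' f f') (tensor_map K W W' Y Y' g g')
      (interchange K V W V' W' (pure K (V \<otimes>\<^sub>K W) (V' \<otimes>\<^sub>K W') s t))"
  by (rule bilinear_ext[where Z = "(X \<otimes>\<^sub>K X') \<otimes>\<^sub>K (Y \<otimes>\<^sub>K Y')"])
    (simp_all add: assms lin_closed[OF assms(9)] lin_closed[OF assms(10)]
      lin_closed[OF assms(11)] lin_closed[OF assms(12)])

lemma interchange_swap:
  assumes "vec V" "vec W" "vec V'" "vec W'"
  shows "\<forall>s\<in>carrier (V \<otimes>\<^sub>K W). \<forall>t\<in>carrier (V' \<otimes>\<^sub>K W').
    interchange K V' W' V W (pure K (V' \<otimes>\<^sub>K W') (V \<otimes>\<^sub>K W) t s) =
    tensor_map K (V \<otimes>\<^sub>K V') (W \<otimes>\<^sub>K W') (V' \<otimes>\<^sub>K V) (W' \<otimes>\<^sub>K W) (swap K V V') (swap K W W')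
      (interchange K V W V' W' (pure K (V \<otimes>\<^sub>K W) (V' \<otimes>\<^sub>K W') s t))"
  by (rule bilinear_ext[where Z = "(V' \<otimes>\<^sub>K V) \<otimes>\<^sub>K (W' \<otimes>\<^sub>K W)"]) (simp_all add: assms)

lemma interchange_associator:
  assumes "vec V" "vec W" "vec V'" "vec W'" "vec V''" "vec W''"
    and "u \<in> carrier (V'' \<otimes>\<^sub>K W'')"
  shows "\<forall>s\<in>carrier (V \<otimes>\<^sub>K W). \<forall>t\<in>carrier (V' \<otimes>\<^sub>K W').
    interchange K V W (V' \<otimes>\<^sub>K V'') (W' \<otimes>\<^sub>K W'')
      (pure K (V \<otimes>\<^sub>K W) ((V' \<otimes>\<^sub>K V'') \<otimes>\<^sub>K (W' \<otimes>\<^sub>K W'')) s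
        (interchange K V' W' V'' W'' (pure K (V' \<otimes>\<^sub>K W') (V'' \<otimes>\<^sub>K W'') t u))) =
    tensor_map K ((V \<otimes>\<^sub>K V') \<otimes>\<^sub>K V'') ((W \<otimes>\<^sub>K W') \<otimes>\<^sub>K W'') (V \<otimes>\<^sub>K (V' \<otimes>\<^sub>K V'')) (W \<otimes>\<^sub>K (W' \<otimes>\<^sub>K W''))
      (associator K V V' V'') (associator K W W' W'')
      (interchange K (V \<otimes>\<^sub>K V') (W \<otimes>\<^sub>K W') V'' W''
        (pure K ((V \<otimes>\<^sub>K V') \<otimes>\<^sub>K (W \<otimes>\<^sub>K W')) (V'' \<otimes>\<^sub>K W'')
          (interchange K V W V' W' (pure K (V \<otimes>\<^sub>K W) (V' \<otimes>\<^sub>K W') s t)) u))"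
    (is "\<forall>s\<in>_. \<forall>t\<in>_. ?L s t u = ?R s t u")
proof (rule bilinear_ext[where Z = "(V \<otimes>\<^sub>K (V' \<otimes>\<^sub>K V'')) \<otimes>\<^sub>K (W \<otimes>\<^sub>K (W' \<otimes>\<^sub>K W''))"])
  fix v w v' w' assume vw: "v \<in> carrier V" "w \<in> carrier W" "v' \<in> carrier V'" "w' \<in> carrier W'"
  \<comment> \<open>\<open>bilinear_ext\<close> varies two of the three tensors; the third one is
    varied here, while the first two are pure.\<close>
  have "\<forall>u\<in>carrier (V'' \<otimes>\<^sub>K W''). ?L (pure K V W v w) (pure K V' W' v' w') u =
      ?R (pure K V W v w) (pure K V' W' v' w') u"
    by (rule tensor_ext[where Z = "(V \<otimes>\<^sub>K (V' \<otimes>\<^sub>K V'')) \<otimes>\<^sub>K (W \<otimes>\<^sub>K (W' \<otimes>\<^sub>K W''))"])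
      (simp_all add: assms vw)
  then show "?L (pure K V W v w) (pure K V' W' v' w') u = ?R (pure K V W v w) (pure K V' W' v' w') u"
    using assms by blast
qed (simp_all add: assms)

text \<open>The tensor \<open>1 \<otimes> a\<close> stands for the coaction of the unit comodule at
  \<open>a\<close>. This is compatibility of the left unitor with coactions, before the coaction on
  \<open>V \<otimes> W\<close> is filled in for \<open>s\<close>.\<close>

lemma interchange_left_unitor:
  fixes V W :: "('k, 'a) vspace" and a :: "('k, 'a) elt"
  assumes "vec V" "vec W" "a \<in> carrier (unit_space K)"
  shows "\<forall>s\<in>carrier (V \<otimes>\<^sub>K W).
    tensor_map K (unit_space K \<otimes>\<^sub>K V) (unit_space K \<otimes>\<^sub>K W) V W (left_unitor K V) (left_unitor K W)
      (interchange K (unit_space K) (unit_space K) V W (pure K (unit_space K \<otimes>\<^sub>K unit_space K) (V \<otimes>\<^sub>K W)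
        (pure K (unit_space K) (unit_space K) (Scalar \<one>\<^bsub>K\<^esub>) a) s)) =
    scalar a \<odot>\<^bsub>V \<otimes>\<^sub>K W\<^esub> s"
  by (rule tensor_ext[where Z = "V \<otimes>\<^sub>K W"])
    (simp_all add: assms pure_smult_left pure_smult_right lin_smult_const)

lemma interchange_right_unitor:
  fixes V W :: "('k, 'a) vspace" and a :: "('k, 'a) elt"
  assumes "vec V" "vec W" "a \<in> carrier (unit_space K)"
  shows "\<forall>s\<in>carrier (V \<otimes>\<^sub>K W).
    tensor_map K (V \<otimes>\<^sub>K unit_space K) (W \<otimes>\<^sub>K unit_space K) V W (right_unitor K V) (right_unitor K W)
      (interchange K V W (unit_space K) (unit_space K) (pure K (V \<otimes>\<^sub>K W) (unit_space K \<otimes>\<^sub>K unit_space K)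
        s (pure K (unit_space K) (unit_space K) (Scalar \<one>\<^bsub>K\<^esub>) a))) =
    scalar a \<odot>\<^bsub>V \<otimes>\<^sub>K W\<^esub> s"
  by (rule tensor_ext[where Z = "V \<otimes>\<^sub>K W"])
    (simp_all add: assms pure_smult_left pure_smult_right lin_smult_const)

end

section \<open>Coalgebras, comodules and their tensor products\<close>

definition regular :: "('k, 'a) coalg \<Rightarrow> ('k, 'a) comod_obj" where
  "regular C = (C, \<lparr>dspace = cspace C, coact = comult C\<rparr>)"

text \<open>A linear coaction without the comodule axioms: one hypothesis under which the
  compatibility lemmas treat comodules and coalgebras together.\<close>

definition precomodule :: "'k ring \<Rightarrow> ('k, 'a) comod_obj \<Rightarrow> bool" where
  "precomodule K A \<longleftrightarrow> module K (fst_space A) \<and> module K (snd_space A) \<and>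
     linear_map K (snd_space A) (tensor K (fst_space A) (snd_space A)) (coact (snd A))"

text \<open>The condition on a comodule map over a change of coalgebra, with the corestriction
  already absorbed. Between two \<open>regular\<close> objects and with \<open>f = g\<close> it is
  compatibility with the comultiplications.\<close>

definition coact_compat ::
  "'k ring \<Rightarrow> ('k, 'a) comod_obj \<Rightarrow> ('k, 'a) comod_obj \<Rightarrow>
   (('k, 'a) elt \<Rightarrow> ('k, 'a) elt) \<Rightarrow> (('k, 'a) elt \<Rightarrow> ('k, 'a) elt) \<Rightarrow> bool" where
  "coact_compat K A B f g \<longleftrightarrow>
     (\<forall>y\<in>carrier (snd_space A). coact (snd B) (g y) =
        tensor_map K (fst_space A) (snd_space A) (fst_space B) (snd_space B) f g (coact (snd A) y))"

lemma regular_simps [simp]: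
  "fst (regular C) = C" "dspace (snd (regular C)) = cspace C" "coact (snd (regular C)) = comult C"
  by (simp_all add: regular_def)

lemma tensor_obj_simps [simp]:
  "fst (tensor_obj K A B) = tensor_coalg K (fst A) (fst B)"
  "snd (tensor_obj K A B) = tensor_comod K (fst A) (snd A) (fst B) (snd B)"
  "cspace (tensor_coalg K C C') = tensor K (cspace C) (cspace C')"
  "dspace (tensor_comod K C D C' D') = tensor K (dspace D) (dspace D')"
  by (simp_all add: tensor_obj_def tensor_coalg_def tensor_comod_def)

text \<open>Comultiplication and coaction of a tensor product use the same
  \<open>interchange\<close> formula. Through this identity, results on coactions of tensor products
  are read as results on comultiplications.\<close>

lemma regular_tensor: "regular (tensor_coalg K C C') = tensor_obj K (regular C) (regular C')"
  by (simp add: regular_def tensor_obj_def tensor_coalg_def tensor_comod_def)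

lemma unit_obj_simps [simp]:
  "fst (unit_obj K) = unit_coalg K" "snd (unit_obj K) = unit_comod K"
  "cspace (unit_coalg K) = unit_space K" "dspace (unit_comod K) = unit_space K"
  "comult (unit_coalg K) = (\<lambda>x. pure K (unit_space K) (unit_space K) x (Scalar \<one>\<^bsub>K\<^esub>))"
  "coact (unit_comod K) = (\<lambda>x. pure K (unit_space K) (unit_space K) (Scalar \<one>\<^bsub>K\<^esub>) x)"
  "counit (unit_coalg K) = scalar"
  by (simp_all add: unit_obj_def unit_coalg_def unit_comod_def)

lemma coact_tensor_obj [simp]:
  "coact (tensor_comod K C D C' D') = (\<lambda>t. interchange K (cspace C) (dspace D) (cspace C') (dspace D')
      (tensor_map K (dspace D) (dspace D') (tensor K (cspace C) (dspace D)) (tensor K (cspace C') (dspace D'))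
        (coact D) (coact D') t))"
  by (simp add: tensor_comod_def)

lemma counit_tensor_coalg:
  "counit (tensor_coalg K C C') = tensor_sum (ring_module K) (\<lambda>x x'. counit C x \<otimes>\<^bsub>K\<^esub> counit C' x')"
  by (simp add: tensor_coalg_def)

lemma coalgebra_comodule: "coalgebra K C \<Longrightarrow> comodule K C (snd (regular C))"
  by (simp add: coalgebra_def comodule_def)

lemma comodule_precomodule:
  assumes "module K (cspace C)" "comodule K C D"
  shows "precomodule K (C, D)"
  using assms by (simp add: precomodule_def comodule_def)

lemma Obj_Comod: "A \<in> Obj (Comod K) \<longleftrightarrow> cocommutative_coalgebra K (fst A) \<and> comodule K (fst A) (snd A)"
  by (auto simp: Comod_def)

lemma cocommutative_coalgebra_coalgebra: "cocommutative_coalgebra K C \<Longrightarrow> coalgebra K C"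
  by (simp add: cocommutative_coalgebra_def)

lemma Obj_precomodule:
  assumes "A \<in> Obj (Comod K)"
  shows "precomodule K A" "precomodule K (regular (fst A))"
proof -
  have c: "coalgebra K (fst A)"
    using assms by (simp add: Obj_Comod cocommutative_coalgebra_coalgebra)
  then show "precomodule K A"
    using assms comodule_precomodule[of K "fst A" "snd A"] by (simp add: Obj_Comod coalgebra.space)
  show "precomodule K (regular (fst A))"
    using c by (simp add: precomodule_def coalgebra_def)
qed

section \<open>Compatibility of the structure maps with coactions\<close>

context ground_ring
begin

lemma precomoduleD [simp]:
  assumes "precomodule K A"
  shows "vec (fst_space A)" "vec (snd_space A)"
    "lin_map (snd_space A) (fst_space A \<otimes>\<^sub>K snd_space A) (coact (snd A))"
    "y \<in> carrier (snd_space A) \<Longrightarrow> coact (snd A) y \<in> carrier (fst_space A \<otimes>\<^sub>K snd_space A)"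
proof -
  show "vec (fst_space A)" "vec (snd_space A)" and
    lin: "lin_map (snd_space A) (fst_space A \<otimes>\<^sub>K snd_space A) (coact (snd A))"
    using assms by (simp_all add: precomodule_def)
  show "coact (snd A) y \<in> carrier (fst_space A \<otimes>\<^sub>K snd_space A)" if "y \<in> carrier (snd_space A)"
    by (rule lin_closed[OF lin that])
qed

lemma coact_compat_compose:
  assumes "precomodule K A" "precomodule K B" "precomodule K C"
    and f: "lin_map (fst_space A) (fst_space B) f" "lin_map (fst_space B) (fst_space C) f'"
    and g: "lin_map (snd_space A) (snd_space B) g" "lin_map (snd_space B) (snd_space C) g'"
    and "coact_compat K A B f g" "coact_compat K B C f' g'"
    and "\<And>x. x \<in> carrier (fst_space A) \<Longrightarrow> f'' x = f' (f x)" "\<And>y. y \<in> carrier (snd_space A) \<Longrightarrow> g'' y = g' (g y)"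
  shows "coact_compat K A C f'' g''"
  unfolding coact_compat_def
proof
  fix y assume y: "y \<in> carrier (snd_space A)"
  show "coact (snd C) (g'' y) =
      tensor_map K (fst_space A) (snd_space A) (fst_space C) (snd_space C) f'' g'' (coact (snd A) y)"
    using y assms(8,9) lin_closed[OF g(1) y]
      tensor_map_compose[OF _ _ _ _ _ _ f g assms(10,11)] assms(1-3,11)
    by (simp add: coact_compat_def)
qed

lemma coact_compat_tensor:
  assumes "precomodule K A" "precomodule K A'" "precomodule K B" "precomodule K B'"
    and "lin_map (fst_space A) (fst_space B) f" "lin_map (fst_space A') (fst_space B') f'"
    and "lin_map (snd_space A) (snd_space B) g" "lin_map (snd_space A') (snd_space B') g'"
    and "coact_compat K A B f g" "coact_compat K A' B' f' g'"
  shows "coact_compat K (tensor_obj K A A') (tensor_obj K B B')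
    (tensor_map K (fst_space A) (fst_space A') (fst_space B) (fst_space B') f f')
    (tensor_map K (snd_space A) (snd_space A') (snd_space B) (snd_space B') g g')"
  unfolding coact_compat_def tensor_obj_simps
  by (rule tensor_ext[where Z = "(fst_space B \<otimes>\<^sub>K fst_space B') \<otimes>\<^sub>K (snd_space B \<otimes>\<^sub>K snd_space B')"])
    (use assms in \<open>simp_all add: coact_compat_def interchange_natural lin_closed[OF assms(7)] lin_closed[OF assms(8)]\<close>)

lemma coact_compat_associator:
  assumes "precomodule K A" "precomodule K B" "precomodule K C"
  shows "coact_compat K (tensor_obj K (tensor_obj K A B) C) (tensor_obj K A (tensor_obj K B C))
    (associator K (fst_space A) (fst_space B) (fst_space C))
    (associator K (snd_space A) (snd_space B) (snd_space C))"
  unfolding coact_compat_def tensor_obj_simps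
  by (rule tensor_ext3[where Z = "(fst_space A \<otimes>\<^sub>K (fst_space B \<otimes>\<^sub>K fst_space C)) \<otimes>\<^sub>K (snd_space A \<otimes>\<^sub>K (snd_space B \<otimes>\<^sub>K snd_space C))"])
    (use assms in \<open>simp_all add: interchange_associator\<close>)

lemma coact_compat_swap:
  assumes "precomodule K A" "precomodule K B"
  shows "coact_compat K (tensor_obj K A B) (tensor_obj K B A)
    (swap K (fst_space A) (fst_space B)) (swap K (snd_space A) (snd_space B))"
  unfolding coact_compat_def tensor_obj_simps
  by (rule tensor_ext[where Z = "(fst_space B \<otimes>\<^sub>K fst_space A) \<otimes>\<^sub>K (snd_space B \<otimes>\<^sub>K snd_space A)"])
    (use assms in \<open>simp_all add: interchange_swap[of "fst_space A" "snd_space A" "fst_space B" "snd_space B"]\<close>)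

text \<open>The comultiplication of \<open>unit_coalg\<close> puts the unit scalar on the right, the
  coaction of \<open>unit_comod\<close> on the left. The two agree because \<open>a\<close> is a
  multiple of the unit.\<close>

lemma unit_coact_commute:
  fixes a :: "('k, 'a) elt"
  assumes a: "a \<in> carrier (unit_space K)"
  shows "pure K (unit_space K) (unit_space K) a (Scalar \<one>\<^bsub>K\<^esub>) =
    pure K (unit_space K) (unit_space K) (Scalar \<one>\<^bsub>K\<^esub>) a"
proof -
  have "pure K (unit_space K) (unit_space K) (scalar a \<odot>\<^bsub>unit_space K\<^esub> (Scalar \<one>\<^bsub>K\<^esub> :: ('k, 'a) elt)) (Scalar \<one>\<^bsub>K\<^esub>) =
      pure K (unit_space K) (unit_space K) (Scalar \<one>\<^bsub>K\<^esub>) (scalar a \<odot>\<^bsub>unit_space K\<^esub> Scalar \<one>\<^bsub>K\<^esub>)"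
    using a by (simp add: pure_smult_left pure_smult_right)
  then show ?thesis
    unfolding unit_space_smult[OF a, symmetric] .
qed

lemma unit_precomodule: "precomodule K (unit_obj K)" "precomodule K (regular (unit_coalg K))"
  by (simp_all add: precomodule_def del: precomoduleD)

text \<open>The unit \<open>E\<close> is left open so that the lemma covers both \<open>unit_obj\<close> and \<open>regular unit_coalg\<close>.\<close>

lemma coact_compat_unitors:
  assumes "precomodule K A" "precomodule K E" "fst_space E = unit_space K" "snd_space E = unit_space K"
    and "\<And>a. a \<in> carrier (unit_space K) \<Longrightarrow> coact (snd E) a = pure K (unit_space K) (unit_space K) (Scalar \<one>\<^bsub>K\<^esub>) a"
  shows "coact_compat K (tensor_obj K E A) A (left_unitor K (fst_space A)) (left_unitor K (snd_space A))"
    and "coact_compat K (tensor_obj K A E) A (right_unitor K (fst_space A)) (right_unitor K (snd_space A))"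
proof -
  have E: "lin_map (unit_space K) (unit_space K \<otimes>\<^sub>K unit_space K) (coact (snd E))"
    using precomoduleD(3)[OF assms(2)] assms(3,4) by simp
  show "coact_compat K (tensor_obj K E A) A (left_unitor K (fst_space A)) (left_unitor K (snd_space A))"
    unfolding coact_compat_def tensor_obj_simps assms(3,4)
    by (rule tensor_ext[where Z = "fst_space A \<otimes>\<^sub>K snd_space A"])
      (use assms E in \<open>simp_all add: interchange_left_unitor lin_smult[OF precomoduleD(3)]
        lin_compose[OF precomoduleD(3)]\<close>)
  show "coact_compat K (tensor_obj K A E) A (right_unitor K (fst_space A)) (right_unitor K (snd_space A))"
    unfolding coact_compat_def tensor_obj_simps assms(3,4)
    by (rule tensor_ext[where Z = "fst_space A \<otimes>\<^sub>K snd_space A"])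
      (use assms E in \<open>simp_all add: interchange_right_unitor lin_smult[OF precomoduleD(3)]
        lin_compose[OF precomoduleD(3)]\<close>)
qed

section \<open>Tensor products of comodules and of cocommutative coalgebras\<close>

lemma ring_module_carrier [simp]: "carrier (ring_module K) = carrier K"
  by (simp add: ring_module_def)

lemma bilinear_counit:
  assumes "vec V" "lin_map U (ring_module K) e"
  shows "bilinear_map K U V V (\<lambda>u v. e u \<odot>\<^bsub>V\<^esub> v)"
  using lin_closed[OF assms(2)] assms by (intro lin) auto

lemma lin_counit_tensor:
  assumes "vec (cspace C)" "vec (cspace C')"
    and "lin_map (cspace C) (ring_module K) (counit C)" "lin_map (cspace C') (ring_module K) (counit C')"
  shows "lin_map (cspace C \<otimes>\<^sub>K cspace C') (ring_module K) (counit (tensor_coalg K C C'))"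
    and "\<lbrakk>x \<in> carrier (cspace C); x' \<in> carrier (cspace C')\<rbrakk> \<Longrightarrow>
      counit (tensor_coalg K C C') (pure K (cspace C) (cspace C') x x') = counit C x \<otimes>\<^bsub>K\<^esub> counit C' x'"
proof -
  \<comment> \<open>Multiplication of scalars is the action of \<open>K\<close> on itself, so the
    form multiplying two counits is a case of \<open>bilinear_counit\<close>.\<close>
  have "bilinear_map K (cspace C) (ring_module K) (ring_module K) (\<lambda>x b. counit C x \<odot>\<^bsub>ring_module K\<^esub> b)"
    by (intro bilinear_counit assms vec_ring_module)
  from bilinear_compose[OF this lin_id assms(4)]
  have "bilinear_map K (cspace C) (cspace C') (ring_module K) (\<lambda>x x'. counit C x \<otimes>\<^bsub>K\<^esub> counit C' x')"
    by (simp add: ring_module_def)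
  note bil = this
  show "lin_map (cspace C \<otimes>\<^sub>K cspace C') (ring_module K) (counit (tensor_coalg K C C'))"
    unfolding counit_tensor_coalg by (intro lin_tensor_sum assms bil vec_ring_module)
  show "counit (tensor_coalg K C C') (pure K (cspace C) (cspace C') x x') = counit C x \<otimes>\<^bsub>K\<^esub> counit C' x'"
    if "x \<in> carrier (cspace C)" "x' \<in> carrier (cspace C')"
    by (simp add: that counit_tensor_coalg tensor_sum_pure[OF assms(1,2) vec_ring_module bil])
qed

text \<open>The counit of a tensor product contracts the two factors separately. With
  \<open>s\<close> and \<open>t\<close> the two coactions, the right side collapses and the counit
  law of the tensor product results.\<close>

lemma counit_interchange:
  assumes "vec C" "vec C'" "vec D" "vec D'" "lin_map C (ring_module K) e" "lin_map C' (ring_module K) e'"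
    and E: "lin_map (C \<otimes>\<^sub>K C') (ring_module K) e''"
    and "\<And>x x'. \<lbrakk>x \<in> carrier C; x' \<in> carrier C'\<rbrakk> \<Longrightarrow> e'' (pure K C C' x x') = e x \<otimes>\<^bsub>K\<^esub> e' x'"
  shows "\<forall>s\<in>carrier (C \<otimes>\<^sub>K D). \<forall>t\<in>carrier (C' \<otimes>\<^sub>K D').
    tensor_sum (D \<otimes>\<^sub>K D') (\<lambda>z w. e'' z \<odot>\<^bsub>D \<otimes>\<^sub>K D'\<^esub> w)
      (interchange K C D C' D' (pure K (C \<otimes>\<^sub>K D) (C' \<otimes>\<^sub>K D') s t)) =
    pure K D D' (tensor_sum D (\<lambda>x y. e x \<odot>\<^bsub>D\<^esub> y) s) (tensor_sum D' (\<lambda>x y. e' x \<odot>\<^bsub>D'\<^esub> y) t)"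
proof (rule bilinear_ext[where Z = "D \<otimes>\<^sub>K D'"])
  note b = bilinear_counit[OF assms(3,5)] bilinear_counit[OF assms(4,6)]
    bilinear_counit[OF vec_tensor[OF assms(3,4)] E]
  note l = lin_tensor_sum_compose[OF _ _ _ b(1)] lin_tensor_sum_compose[OF _ _ _ b(2)]
    lin_tensor_sum_compose[OF _ _ _ b(3)]
  note ts = tensor_sum_pure[OF _ _ _ b(1)] tensor_sum_pure[OF _ _ _ b(2)] tensor_sum_pure[OF _ _ _ b(3)]
  have cl: "e x \<in> carrier K" "e' x' \<in> carrier K" if "x \<in> carrier C" "x' \<in> carrier C'" for x x'
    using lin_closed[OF assms(5)] lin_closed[OF assms(6)] that by auto
  show "bilinear_map K (C \<otimes>\<^sub>K D) (C' \<otimes>\<^sub>K D') (D \<otimes>\<^sub>K D')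
      (\<lambda>s t. tensor_sum (D \<otimes>\<^sub>K D') (\<lambda>z w. e'' z \<odot>\<^bsub>D \<otimes>\<^sub>K D'\<^esub> w)
      (interchange K C D C' D' (pure K (C \<otimes>\<^sub>K D) (C' \<otimes>\<^sub>K D') s t)))"
    by (intro bilinear_mapI l) (simp_all add: assms)
  show "bilinear_map K (C \<otimes>\<^sub>K D) (C' \<otimes>\<^sub>K D') (D \<otimes>\<^sub>K D') (\<lambda>s t.
      pure K D D' (tensor_sum D (\<lambda>x y. e x \<odot>\<^bsub>D\<^esub> y) s) (tensor_sum D' (\<lambda>x y. e' x \<odot>\<^bsub>D'\<^esub> y) t))"
    by (intro bilinear_compose[OF pure_bilinear] l lin_id assms)
  fix x y x' y'
  assume xy: "x \<in> carrier C" "y \<in> carrier D" "x' \<in> carrier C'" "y' \<in> carrier D'"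
  interpret T: module K "D \<otimes>\<^sub>K D'" by (intro vec_tensor assms)
  show "tensor_sum (D \<otimes>\<^sub>K D') (\<lambda>z w. e'' z \<odot>\<^bsub>D \<otimes>\<^sub>K D'\<^esub> w)
      (interchange K C D C' D' (pure K (C \<otimes>\<^sub>K D) (C' \<otimes>\<^sub>K D') (pure K C D x y) (pure K C' D' x' y'))) =
    pure K D D' (tensor_sum D (\<lambda>x y. e x \<odot>\<^bsub>D\<^esub> y) (pure K C D x y))
      (tensor_sum D' (\<lambda>x y. e' x \<odot>\<^bsub>D'\<^esub> y) (pure K C' D' x' y'))"
    using xy cl by (simp add: ts assms pure_smult_left pure_smult_right m_comm flip: T.smult_assoc1)
qed (use assms in simp_all)

text \<open>One half of coassociativity for a tensor product: the iterated comultiplication is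
  pushed through \<open>interchange\<close> until it acts on each factor by itself.
  \<open>coassoc_interchange_right\<close> arrives at the same shape from the iterated coaction, and
  coassociativity of the factors then identifies the two.\<close>

lemma coassoc_interchange_left:
  assumes "vec C" "vec C'" "vec D" "vec D'"
    and d: "lin_map C (C \<otimes>\<^sub>K C) d" "lin_map C' (C' \<otimes>\<^sub>K C') d'"
    and d'': "lin_map (C \<otimes>\<^sub>K C') ((C \<otimes>\<^sub>K C') \<otimes>\<^sub>K (C \<otimes>\<^sub>K C')) d''"
      "\<And>x x'. \<lbrakk>x \<in> carrier C; x' \<in> carrier C'\<rbrakk> \<Longrightarrow> d'' (pure K C C' x x') =
        interchange K C C C' C' (pure K (C \<otimes>\<^sub>K C) (C' \<otimes>\<^sub>K C') (d x) (d' x'))"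
  shows "\<forall>s\<in>carrier (C \<otimes>\<^sub>K D). \<forall>t\<in>carrier (C' \<otimes>\<^sub>K D').
    associator K (C \<otimes>\<^sub>K C') (C \<otimes>\<^sub>K C') (D \<otimes>\<^sub>K D')
      (tensor_map K (C \<otimes>\<^sub>K C') (D \<otimes>\<^sub>K D') ((C \<otimes>\<^sub>K C') \<otimes>\<^sub>K (C \<otimes>\<^sub>K C')) (D \<otimes>\<^sub>K D') d'' id
        (interchange K C D C' D' (pure K (C \<otimes>\<^sub>K D) (C' \<otimes>\<^sub>K D') s t))) =
    tensor_map K (C \<otimes>\<^sub>K C') ((C \<otimes>\<^sub>K D) \<otimes>\<^sub>K (C' \<otimes>\<^sub>K D')) (C \<otimes>\<^sub>K C') ((C \<otimes>\<^sub>K C') \<otimes>\<^sub>K (D \<otimes>\<^sub>K D')) id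
      (interchange K C D C' D')
      (interchange K C (C \<otimes>\<^sub>K D) C' (C' \<otimes>\<^sub>K D')
        (pure K (C \<otimes>\<^sub>K (C \<otimes>\<^sub>K D)) (C' \<otimes>\<^sub>K (C' \<otimes>\<^sub>K D'))
          (associator K C C D (tensor_map K C D (C \<otimes>\<^sub>K C) D d id s))
          (associator K C' C' D' (tensor_map K C' D' (C' \<otimes>\<^sub>K C') D' d' id t))))"
proof (rule bilinear_ext[where Z = "(C \<otimes>\<^sub>K C') \<otimes>\<^sub>K ((C \<otimes>\<^sub>K C') \<otimes>\<^sub>K (D \<otimes>\<^sub>K D'))"])
  fix x y x' y'
  assume xy: "x \<in> carrier C" "y \<in> carrier D" "x' \<in> carrier C'" "y' \<in> carrier D'"
  \<comment> \<open>\<open>d x\<close> and \<open>d' x'\<close> are no longer pure, so they are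
    generalized to arbitrary \<open>r\<close> and \<open>r'\<close> and a second extensionality
    argument is run.\<close>
  have "\<forall>r\<in>carrier (C \<otimes>\<^sub>K C). \<forall>r'\<in>carrier (C' \<otimes>\<^sub>K C').
    associator K (C \<otimes>\<^sub>K C') (C \<otimes>\<^sub>K C') (D \<otimes>\<^sub>K D')
      (pure K ((C \<otimes>\<^sub>K C') \<otimes>\<^sub>K (C \<otimes>\<^sub>K C')) (D \<otimes>\<^sub>K D')
        (interchange K C C C' C' (pure K (C \<otimes>\<^sub>K C) (C' \<otimes>\<^sub>K C') r r')) (pure K D D' y y')) =
    tensor_map K (C \<otimes>\<^sub>K C') ((C \<otimes>\<^sub>K D) \<otimes>\<^sub>K (C' \<otimes>\<^sub>K D')) (C \<otimes>\<^sub>K C') ((C \<otimes>\<^sub>K C') \<otimes>\<^sub>K (D \<otimes>\<^sub>K D')) id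
      (interchange K C D C' D')
      (interchange K C (C \<otimes>\<^sub>K D) C' (C' \<otimes>\<^sub>K D')
        (pure K (C \<otimes>\<^sub>K (C \<otimes>\<^sub>K D)) (C' \<otimes>\<^sub>K (C' \<otimes>\<^sub>K D'))
          (associator K C C D (pure K (C \<otimes>\<^sub>K C) D r y))
          (associator K C' C' D' (pure K (C' \<otimes>\<^sub>K C') D' r' y'))))"
    by (rule bilinear_ext[where Z = "(C \<otimes>\<^sub>K C') \<otimes>\<^sub>K ((C \<otimes>\<^sub>K C') \<otimes>\<^sub>K (D \<otimes>\<^sub>K D'))"])
      (simp_all add: assms xy)
  then show "associator K (C \<otimes>\<^sub>K C') (C \<otimes>\<^sub>K C') (D \<otimes>\<^sub>K D')
      (tensor_map K (C \<otimes>\<^sub>K C') (D \<otimes>\<^sub>K D') ((C \<otimes>\<^sub>K C') \<otimes>\<^sub>K (C \<otimes>\<^sub>K C')) (D \<otimes>\<^sub>K D') d'' id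
        (interchange K C D C' D' (pure K (C \<otimes>\<^sub>K D) (C' \<otimes>\<^sub>K D') (pure K C D x y) (pure K C' D' x' y')))) =
    tensor_map K (C \<otimes>\<^sub>K C') ((C \<otimes>\<^sub>K D) \<otimes>\<^sub>K (C' \<otimes>\<^sub>K D')) (C \<otimes>\<^sub>K C') ((C \<otimes>\<^sub>K C') \<otimes>\<^sub>K (D \<otimes>\<^sub>K D')) id
      (interchange K C D C' D')
      (interchange K C (C \<otimes>\<^sub>K D) C' (C' \<otimes>\<^sub>K D')
        (pure K (C \<otimes>\<^sub>K (C \<otimes>\<^sub>K D)) (C' \<otimes>\<^sub>K (C' \<otimes>\<^sub>K D'))
          (associator K C C D (tensor_map K C D (C \<otimes>\<^sub>K C) D d id (pure K C D x y)))
          (associator K C' C' D' (tensor_map K C' D' (C' \<otimes>\<^sub>K C') D' d' id (pure K C' D' x' y')))))"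
    using xy lin_closed[OF d(1)] lin_closed[OF d(2)] by (simp add: assms)
qed (use assms in simp_all)

lemma coassoc_interchange_right:
  assumes "vec C" "vec C'" "vec D" "vec D'"
    and d: "lin_map D (C \<otimes>\<^sub>K D) d" "lin_map D' (C' \<otimes>\<^sub>K D') d'"
    and d'': "lin_map (D \<otimes>\<^sub>K D') ((C \<otimes>\<^sub>K C') \<otimes>\<^sub>K (D \<otimes>\<^sub>K D')) d''"
      "\<And>y y'. \<lbrakk>y \<in> carrier D; y' \<in> carrier D'\<rbrakk> \<Longrightarrow> d'' (pure K D D' y y') =
        interchange K C D C' D' (pure K (C \<otimes>\<^sub>K D) (C' \<otimes>\<^sub>K D') (d y) (d' y'))"
  shows "\<forall>s\<in>carrier (C \<otimes>\<^sub>K D). \<forall>t\<in>carrier (C' \<otimes>\<^sub>K D').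
    tensor_map K (C \<otimes>\<^sub>K C') (D \<otimes>\<^sub>K D') (C \<otimes>\<^sub>K C') ((C \<otimes>\<^sub>K C') \<otimes>\<^sub>K (D \<otimes>\<^sub>K D')) id d''
        (interchange K C D C' D' (pure K (C \<otimes>\<^sub>K D) (C' \<otimes>\<^sub>K D') s t)) =
    tensor_map K (C \<otimes>\<^sub>K C') ((C \<otimes>\<^sub>K D) \<otimes>\<^sub>K (C' \<otimes>\<^sub>K D')) (C \<otimes>\<^sub>K C') ((C \<otimes>\<^sub>K C') \<otimes>\<^sub>K (D \<otimes>\<^sub>K D')) id
      (interchange K C D C' D')
      (interchange K C (C \<otimes>\<^sub>K D) C' (C' \<otimes>\<^sub>K D')
        (pure K (C \<otimes>\<^sub>K (C \<otimes>\<^sub>K D)) (C' \<otimes>\<^sub>K (C' \<otimes>\<^sub>K D'))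
          (tensor_map K C D C (C \<otimes>\<^sub>K D) id d s)
          (tensor_map K C' D' C' (C' \<otimes>\<^sub>K D') id d' t)))"
  by (rule bilinear_ext[where Z = "(C \<otimes>\<^sub>K C') \<otimes>\<^sub>K ((C \<otimes>\<^sub>K C') \<otimes>\<^sub>K (D \<otimes>\<^sub>K D'))"])
    (simp_all add: assms lin_closed[OF d(1)] lin_closed[OF d(2)])

text \<open>Each axiom is an equation of linear maps on the tensor product of \<open>D\<close> and
  \<open>D'\<close>; on a pure tensor it is an interchange lemma applied to the two
  coactions.\<close>

lemma comodule_tensor:
  assumes "coalgebra K C" "coalgebra K C'" "comodule K C D" "comodule K C' D'"
  shows "comodule K (tensor_coalg K C C') (tensor_comod K C D C' D')"
proof -
  interpret C: coalgebra K C by fact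
  interpret C': coalgebra K C' by fact
  interpret D: comodule K C D by fact
  interpret D': comodule K C' D' by fact
  note [simp] = C.space C'.space D.space D'.space C.comult_linear C'.comult_linear
    C.counit_linear C'.counit_linear D.coact_linear D'.coact_linear
    lin_closed[OF D.coact_linear] lin_closed[OF D'.coact_linear]
  let ?T = "tensor_coalg K C C'" and ?E = "tensor_comod K C D C' D'"
  let ?X = "cspace C \<otimes>\<^sub>K cspace C'" and ?Y = "dspace D \<otimes>\<^sub>K dspace D'"
  have linE: "lin_map ?Y (?X \<otimes>\<^sub>K ?Y) (coact ?E)"
    unfolding coact_tensor_obj by simp
  \<comment> \<open>The comultiplication is presented as a coaction so that it unfolds by the same
    rule as the coaction of \<open>?E\<close>.\<close>
  have comult_eq: "comult ?T = coact (snd (tensor_obj K (regular C) (regular C')))"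
    using regular_tensor[of K C C'] regular_simps(3)[of ?T] by simp
  have linT: "lin_map ?X (?X \<otimes>\<^sub>K ?X) (comult ?T)"
    unfolding comult_eq coact_tensor_obj tensor_obj_simps regular_simps by simp
  show ?thesis
  proof (rule comodule.intro)
    show "lin_map (dspace ?E) (cspace ?T \<otimes>\<^sub>K dspace ?E) (coact ?E)"
      using linE by simp
    have "\<forall>y\<in>carrier ?Y. associator K ?X ?X ?Y
        (tensor_map K ?X ?Y (?X \<otimes>\<^sub>K ?X) ?Y (comult ?T) id (coact ?E y)) =
        tensor_map K ?X ?Y ?X (?X \<otimes>\<^sub>K ?Y) id (coact ?E) (coact ?E y)"
    proof (rule tensor_ext[where Z = "?X \<otimes>\<^sub>K (?X \<otimes>\<^sub>K ?Y)"])
      fix y y' assume y: "y \<in> carrier (dspace D)" "y' \<in> carrier (dspace D')"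
      show "associator K ?X ?X ?Y (tensor_map K ?X ?Y (?X \<otimes>\<^sub>K ?X) ?Y (comult ?T) id
            (coact ?E (pure K (dspace D) (dspace D') y y'))) =
          tensor_map K ?X ?Y ?X (?X \<otimes>\<^sub>K ?Y) id (coact ?E) (coact ?E (pure K (dspace D) (dspace D') y y'))"
        using coassoc_interchange_left[OF _ _ _ _ C.comult_linear C'.comult_linear linT]
          coassoc_interchange_right[OF _ _ _ _ D.coact_linear D'.coact_linear linE]
          y D.coact_coassoc D'.coact_coassoc
        by (simp add: comult_eq)
    qed (use linE linT lin_compose[OF linE] in simp_all)
    then show "associator K (cspace ?T) (cspace ?T) (dspace ?E)
        (tensor_map K (cspace ?T) (dspace ?E) (cspace ?T \<otimes>\<^sub>K cspace ?T) (dspace ?E) (comult ?T) id (coact ?E y)) =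
        tensor_map K (cspace ?T) (dspace ?E) (cspace ?T) (cspace ?T \<otimes>\<^sub>K dspace ?E) id (coact ?E) (coact ?E y)"
      if "y \<in> carrier (dspace ?E)" for y
      using that by simp
    have ce: "lin_map ?X (ring_module K) (counit ?T)"
      by (intro lin_counit_tensor) simp_all
    have "\<forall>y\<in>carrier ?Y. tensor_sum ?Y (\<lambda>y\<^sub>0 y\<^sub>1. counit ?T y\<^sub>0 \<odot>\<^bsub>?Y\<^esub> y\<^sub>1) (coact ?E y) = y"
    proof (rule tensor_ext[where Z = ?Y])
      show "lin_map ?Y ?Y (\<lambda>y. tensor_sum ?Y (\<lambda>y\<^sub>0 y\<^sub>1. counit ?T y\<^sub>0 \<odot>\<^bsub>?Y\<^esub> y\<^sub>1) (coact ?E y))"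
        by (intro lin_tensor_sum_compose[OF _ _ _ bilinear_counit[OF _ ce]] linE vec_tensor) simp_all
      fix y y' assume y: "y \<in> carrier (dspace D)" "y' \<in> carrier (dspace D')"
      then show "tensor_sum ?Y (\<lambda>y\<^sub>0 y\<^sub>1. counit ?T y\<^sub>0 \<odot>\<^bsub>?Y\<^esub> y\<^sub>1) (coact ?E (pure K (dspace D) (dspace D') y y')) =
          pure K (dspace D) (dspace D') y y'"
        using counit_interchange[OF _ _ _ _ C.counit_linear C'.counit_linear ce, of "dspace D" "dspace D'"]
        by (simp add: lin_counit_tensor(2) D.coact_counit D'.coact_counit)
    qed simp_all
    then show "tensor_sum (dspace ?E) (\<lambda>y\<^sub>0 y\<^sub>1. counit ?T y\<^sub>0 \<odot>\<^bsub>dspace ?E\<^esub> y\<^sub>1) (coact ?E y) = y"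
      if "y \<in> carrier (dspace ?E)" for y
      using that by simp
  qed simp
qed

lemma tensor_sum_swap:
  assumes "vec U" "vec V" "vec Z" "bilinear_map K U V Z \<beta>"
  shows "\<forall>t\<in>carrier (V \<otimes>\<^sub>K U). tensor_sum Z \<beta> (swap K V U t) = tensor_sum Z (\<lambda>v u. \<beta> u v) t"
proof (rule tensor_ext[where Z = Z])
  have b: "bilinear_map K V U Z (\<lambda>v u. \<beta> u v)"
    using assms(4) by (simp add: bilinear_map_def)
  show "lin_map (V \<otimes>\<^sub>K U) Z (tensor_sum Z (\<lambda>v u. \<beta> u v))"
    by (intro lin_tensor_sum b assms)
  show "lin_map (V \<otimes>\<^sub>K U) Z (\<lambda>t. tensor_sum Z \<beta> (swap K V U t))"
    by (intro lin_tensor_sum_compose[OF assms(1,2,3,4)]) (simp add: assms)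
  show "tensor_sum Z \<beta> (swap K V U (pure K V U v u)) = tensor_sum Z (\<lambda>v u. \<beta> u v) (pure K V U v u)"
    if "v \<in> carrier V" "u \<in> carrier U" for v u
    by (simp add: that assms tensor_sum_pure[OF _ _ _ b] tensor_sum_pure[OF _ _ _ assms(4)])
qed (use assms in simp_all)

text \<open>The comodule axioms of the regular comodule contain only the left counit law; the right
  one is its image under \<open>swap\<close>, by cocommutativity.\<close>

lemma cocommutative_coalgebraI:
  assumes "comodule K C (snd (regular C))" "lin_map (cspace C) (ring_module K) (counit C)"
    and "\<And>x. x \<in> carrier (cspace C) \<Longrightarrow> swap K (cspace C) (cspace C) (comult C x) = comult C x"
  shows "cocommutative_coalgebra K C"
proof -
  interpret D: comodule K C "snd (regular C)" by fact
  note [simp] = D.space[simplified]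
  show ?thesis
  proof (intro cocommutative_coalgebra.intro coalgebra.intro cocommutative_coalgebra_axioms.intro)
    fix x assume x: "x \<in> carrier (cspace C)"
    then have cx: "comult C x \<in> carrier (cspace C \<otimes>\<^sub>K cspace C)"
      using lin_closed[OF D.coact_linear] by simp
    have "tensor_sum (cspace C) (\<lambda>x\<^sub>1 x\<^sub>2. counit C x\<^sub>2 \<odot>\<^bsub>cspace C\<^esub> x\<^sub>1) (comult C x) =
        tensor_sum (cspace C) (\<lambda>x\<^sub>1 x\<^sub>2. counit C x\<^sub>1 \<odot>\<^bsub>cspace C\<^esub> x\<^sub>2) (swap K (cspace C) (cspace C) (comult C x))"
      using tensor_sum_swap[OF _ _ _ bilinear_counit[OF _ assms(2)]] cx D.space[simplified]
      by simp
    then show "tensor_sum (cspace C) (\<lambda>x\<^sub>1 x\<^sub>2. counit C x\<^sub>2 \<odot>\<^bsub>cspace C\<^esub> x\<^sub>1) (comult C x) = x"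
      using D.coact_counit x by (simp add: assms(3))
  qed (use D.coact_linear D.coact_coassoc D.coact_counit assms in simp_all)
qed

lemma cocommutative_coalgebra_tensor:
  assumes "cocommutative_coalgebra K C" "cocommutative_coalgebra K C'"
  shows "cocommutative_coalgebra K (tensor_coalg K C C')"
proof -
  interpret C: cocommutative_coalgebra K C by fact
  interpret C': cocommutative_coalgebra K C' by fact
  note [simp] = C.space C'.space C.comult_linear C'.comult_linear
    lin_closed[OF C.comult_linear] lin_closed[OF C'.comult_linear]
  let ?T = "tensor_coalg K C C'" and ?X = "cspace C \<otimes>\<^sub>K cspace C'"
  have eq: "regular ?T = (?T, tensor_comod K C (snd (regular C)) C' (snd (regular C')))"
    unfolding regular_tensor by (simp add: tensor_obj_def)
  have comult_eq: "comult ?T = coact (tensor_comod K C (snd (regular C)) C' (snd (regular C')))"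
    using regular_simps(3)[of ?T] unfolding eq by simp
  have linT: "lin_map ?X (?X \<otimes>\<^sub>K ?X) (comult ?T)"
    unfolding comult_eq coact_tensor_obj regular_simps by simp
  have "comodule K ?T (tensor_comod K C (snd (regular C)) C' (snd (regular C')))"
    by (intro comodule_tensor coalgebra_comodule C.coalgebra_axioms C'.coalgebra_axioms)
  then have "comodule K ?T (snd (regular ?T))"
    by (simp add: eq)
  moreover have "lin_map (cspace ?T) (ring_module K) (counit ?T)"
    using lin_counit_tensor(1)[OF C.space C'.space C.counit_linear C'.counit_linear] by simp
  moreover have "swap K (cspace ?T) (cspace ?T) (comult ?T x) = comult ?T x" if "x \<in> carrier (cspace ?T)" for x
  proof -
    \<comment> \<open>A swap after \<open>interchange\<close> is a swap in each factor before it,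
      and there cocommutativity of \<open>C\<close> and \<open>C'\<close> applies.\<close>
    have sw: "\<forall>s\<in>carrier (cspace C \<otimes>\<^sub>K cspace C). \<forall>t\<in>carrier (cspace C' \<otimes>\<^sub>K cspace C').
        swap K ?X ?X (interchange K (cspace C) (cspace C) (cspace C') (cspace C')
          (pure K (cspace C \<otimes>\<^sub>K cspace C) (cspace C' \<otimes>\<^sub>K cspace C') s t)) =
        interchange K (cspace C) (cspace C) (cspace C') (cspace C')
          (pure K (cspace C \<otimes>\<^sub>K cspace C) (cspace C' \<otimes>\<^sub>K cspace C')
            (swap K (cspace C) (cspace C) s) (swap K (cspace C') (cspace C') t))"
      by (rule bilinear_ext[where Z = "?X \<otimes>\<^sub>K ?X"]) simp_all
    have "\<forall>x\<in>carrier ?X. swap K ?X ?X (comult ?T x) = comult ?T x"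
      by (rule tensor_ext[where Z = "?X \<otimes>\<^sub>K ?X"])
        (use linT in \<open>simp_all add: comult_eq sw C.cocommutative C'.cocommutative\<close>)
    then show ?thesis using that by simp
  qed
  ultimately show ?thesis by (rule cocommutative_coalgebraI)
qed

lemma unit_space_smult_eq: "\<lbrakk>a \<in> carrier K; b \<in> carrier (unit_space K)\<rbrakk> \<Longrightarrow> a \<odot>\<^bsub>unit_space K\<^esub> b = Scalar (a \<otimes>\<^bsub>K\<^esub> scalar b)"
  by (simp add: unit_space_def)

lemma unit_counit_sum:
  "\<lbrakk>a \<in> carrier (unit_space K); b \<in> carrier (unit_space K)\<rbrakk> \<Longrightarrow>
    tensor_sum (unit_space K) (\<lambda>a b. scalar a \<odot>\<^bsub>unit_space K\<^esub> b) (pure K (unit_space K) (unit_space K) a b) =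
    scalar a \<odot>\<^bsub>unit_space K\<^esub> b"
  by (intro tensor_sum_pure bilinear_counit vec_unit_space lin_scalar)

lemma comodule_unit:
  "comodule K (unit_coalg K) (unit_comod K)"
  "comodule K (unit_coalg K) (snd (regular (unit_coalg K)))"
  by (rule comodule.intro, simp_all add: unit_counit_sum unit_space_smult_eq unit_space_scalar)+

lemma cocommutative_coalgebra_unit: "cocommutative_coalgebra K (unit_coalg K)"
  by (rule cocommutative_coalgebraI) (simp_all add: comodule_unit lin_scalar unit_coact_commute)

end

section \<open>The symmetric monoidal category of comodules\<close>

text \<open>A morphism stripped of its record and of the corestriction in its source;
  \<open>Hom_Comod\<close> shows the equivalence with arrows of \<open>Comod\<close>.\<close>

definition comod_hom ::
  "'k ring \<Rightarrow> ('k, 'a) comod_obj \<Rightarrow> ('k, 'a) comod_obj \<Rightarrow>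
   (('k, 'a) elt \<Rightarrow> ('k, 'a) elt) \<Rightarrow> (('k, 'a) elt \<Rightarrow> ('k, 'a) elt) \<Rightarrow> bool" where
  "comod_hom K A B f g \<longleftrightarrow>
     f \<in> carrier (Vect K (fst_space A) (fst_space B)) \<and>
     g \<in> carrier (Vect K (snd_space A) (snd_space B)) \<and>
     coact_compat K (regular (fst A)) (regular (fst B)) f f \<and>
     coact_compat K A B f g \<and>
     (\<forall>x\<in>carrier (fst_space A). counit (fst B) (f x) = counit (fst A) x)"

lemma comod_homI:
  assumes "f \<in> carrier (Vect K (fst_space A) (fst_space B))" "g \<in> carrier (Vect K (snd_space A) (snd_space B))"
    and "coact_compat K (regular (fst A)) (regular (fst B)) f f" "coact_compat K A B f g"
    and "\<And>x. x \<in> carrier (fst_space A) \<Longrightarrow> counit (fst B) (f x) = counit (fst A) x"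
  shows "comod_hom K A B f g"
  using assms by (simp add: comod_hom_def)

lemma comod_homD:
  assumes "comod_hom K A B f g"
  shows "f \<in> carrier (Vect K (fst_space A) (fst_space B))" "g \<in> carrier (Vect K (snd_space A) (snd_space B))"
    "linear_map K (fst_space A) (fst_space B) f" "linear_map K (snd_space A) (snd_space B) g"
    "coact_compat K (regular (fst A)) (regular (fst B)) f f" "coact_compat K A B f g"
    "x \<in> carrier (fst_space A) \<Longrightarrow> counit (fst B) (f x) = counit (fst A) x"
  using assms by (simp_all add: comod_hom_def linear_map_Vect)

lemma coalgebra_hom_iff:
  "coalgebra_hom K C C' f \<longleftrightarrow> f \<in> carrier (Vect K (cspace C) (cspace C')) \<and>
     coact_compat K (regular C) (regular C') f f \<and> (\<forall>x\<in>carrier (cspace C). counit C' (f x) = counit C x)"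
  by (auto simp: coalgebra_hom_def coact_compat_def)

lemma Vect_extensional: "f \<in> carrier (Vect K V W) \<Longrightarrow> f \<in> extensional (carrier V)"
  by (simp add: Vect_def)

lemma compose_cong_all: "\<forall>x\<in>S. f (g x) = f' (g' x) \<Longrightarrow> compose S f g = compose S f' g'"
  by (auto simp: compose_def)

lemma compose_eqI: "\<lbrakk>h \<in> extensional S; \<forall>x\<in>S. f (g x) = h x\<rbrakk> \<Longrightarrow> compose S f g = h"
  by (auto simp: compose_def extensional_def fun_eq_iff)

lemma Comod_simps:
  "Id (Comod K) A = \<lparr>Dom = A, Cod = A,
     cmap = (\<lambda>x\<in>carrier (fst_space A). x), dmap = (\<lambda>y\<in>carrier (snd_space A). y)\<rparr>"
  "h' \<cdot>\<^bsub>Comod K\<^esub> h = \<lparr>Dom = Dom h, Cod = Cod h',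
     cmap = compose (carrier (fst_space (Dom h))) (cmap h') (cmap h),
     dmap = compose (carrier (snd_space (Dom h))) (dmap h') (dmap h)\<rparr>"
  "A \<boxtimes>\<^bsub>Comod K\<^esub> B = tensor_obj K A B"
  "h \<star>\<^bsub>Comod K\<^esub> h' = \<lparr>Dom = tensor_obj K (Dom h) (Dom h'), Cod = tensor_obj K (Cod h) (Cod h'),
     cmap = tensor_map K (fst_space (Dom h)) (fst_space (Dom h'))
              (fst_space (Cod h)) (fst_space (Cod h')) (cmap h) (cmap h'),
     dmap = tensor_map K (snd_space (Dom h)) (snd_space (Dom h'))
              (snd_space (Cod h)) (snd_space (Cod h')) (dmap h) (dmap h')\<rparr>"
  "\<I>\<^bsub>Comod K\<^esub> = unit_obj K"
  "Assoc (Comod K) A B C =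
     \<lparr>Dom = tensor_obj K (tensor_obj K A B) C, Cod = tensor_obj K A (tensor_obj K B C),
      cmap = associator K (fst_space A) (fst_space B) (fst_space C),
      dmap = associator K (snd_space A) (snd_space B) (snd_space C)\<rparr>"
  "LUnit (Comod K) A = \<lparr>Dom = tensor_obj K (unit_obj K) A, Cod = A,
     cmap = left_unitor K (fst_space A), dmap = left_unitor K (snd_space A)\<rparr>"
  "RUnit (Comod K) A = \<lparr>Dom = tensor_obj K A (unit_obj K), Cod = A,
     cmap = right_unitor K (fst_space A), dmap = right_unitor K (snd_space A)\<rparr>"
  "Braid (Comod K) A B = \<lparr>Dom = tensor_obj K A B, Cod = tensor_obj K B A,
     cmap = swap K (fst_space A) (fst_space B), dmap = swap K (snd_space A) (snd_space B)\<rparr>"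
  by (simp_all add: Comod_def)

context ground_ring
begin

lemma Obj_vec:
  assumes "A \<in> Obj (Comod K)"
  shows "vec (fst_space A)" "vec (snd_space A)"
  using Obj_precomodule[OF assms] precomoduleD by auto

lemma Obj_counit_linear: "A \<in> Obj (Comod K) \<Longrightarrow> lin_map (fst_space A) (ring_module K) (counit (fst A))"
  by (auto simp: Obj_Comod cocommutative_coalgebra_def coalgebra.counit_linear)

lemma Obj_counit_closed:
  assumes "A \<in> Obj (Comod K)" "x \<in> carrier (fst_space A)"
  shows "counit (fst A) x \<in> carrier K"
  using lin_closed[OF Obj_counit_linear[OF assms(1)] assms(2)] by simp

text \<open>The corestricted coaction contributes \<open>f \<otimes> id\<close> and the definition
  of \<open>comodule_hom\<close> contributes \<open>id \<otimes> g\<close>; this merges the two into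
  the single map of \<open>coact_compat\<close>.\<close>

lemma tensor_map_id_right:
  assumes "vec V" "vec W" "vec V'" "vec W'" "lin_map V V' f" "lin_map W W' g"
  shows "\<forall>t\<in>carrier (V \<otimes>\<^sub>K W). tensor_map K V' W V' W' id g (tensor_map K V W V' W f id t) =
    tensor_map K V W V' W' f g t"
  by (rule tensor_ext[where Z = "V' \<otimes>\<^sub>K W'"]) (simp_all add: assms lin_closed[OF assms(5)])

lemma Hom_Comod:
  assumes "A \<in> Obj (Comod K)" "B \<in> Obj (Comod K)"
  shows "h \<in> Hom (Comod K) A B \<longleftrightarrow> Dom h = A \<and> Cod h = B \<and> comod_hom K A B (cmap h) (dmap h)"
proof -
  have "comodule_hom K (fst B) (corestriction K (fst A) (fst B) f (snd A)) (snd B) g \<longleftrightarrow>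
      g \<in> carrier (Vect K (snd_space A) (snd_space B)) \<and> coact_compat K A B f g"
    if f: "lin_map (fst_space A) (fst_space B) f" for f g
  proof -
    have "coact (snd B) (g y) = tensor_map K (fst_space B) (snd_space A) (fst_space B) (snd_space B) id g
          (tensor_map K (fst_space A) (snd_space A) (fst_space B) (snd_space A) f id (coact (snd A) y)) \<longleftrightarrow>
        coact (snd B) (g y) = tensor_map K (fst_space A) (snd_space A) (fst_space B) (snd_space B) f g (coact (snd A) y)"
      if y: "y \<in> carrier (snd_space A)" and g: "g \<in> carrier (Vect K (snd_space A) (snd_space B))" for y
      using tensor_map_id_right[OF _ _ _ _ f linear_map_Vect[OF g]] Obj_vec[OF assms(1)] Obj_vec[OF assms(2)]
        precomoduleD(4)[OF Obj_precomodule(1)[OF assms(1)] y] by simp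
    then show ?thesis
      by (auto simp: comodule_hom_def corestriction_def coact_compat_def)
  qed
  then show ?thesis
    by (auto simp: Comod_def comod_hom_def coalgebra_hom_iff linear_map_Vect)
qed

lemma HomD:
  assumes "A \<in> Obj (Comod K)" "B \<in> Obj (Comod K)" "h \<in> Hom (Comod K) A B"
  shows "Dom h = A" "Cod h = B" "comod_hom K A B (cmap h) (dmap h)"
  using assms by (simp_all add: Hom_Comod)

lemma comod_hom_id:
  assumes "A \<in> Obj (Comod K)"
  shows "comod_hom K A A (id_on (fst_space A)) (id_on (snd_space A))"
  using Obj_precomodule[OF assms] precomoduleD(4)[OF Obj_precomodule(2)[OF assms]]
  by (intro comod_homI) (simp_all add: coact_compat_def tensor_map_id restrict_Vect Obj_vec[OF assms])

lemma comod_hom_compose: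
  assumes "A \<in> Obj (Comod K)" "B \<in> Obj (Comod K)" "C \<in> Obj (Comod K)"
    and "comod_hom K A B f g" "comod_hom K B C f' g'"
  shows "comod_hom K A C (compose (carrier (fst_space A)) f' f) (compose (carrier (snd_space A)) g' g)"
proof (rule comod_homI)
  note f = comod_homD[OF assms(4)] and f' = comod_homD[OF assms(5)]
  note pA = Obj_precomodule[OF assms(1)] and pB = Obj_precomodule[OF assms(2)]
    and pC = Obj_precomodule[OF assms(3)]
  show "compose (carrier (fst_space A)) f' f \<in> carrier (Vect K (fst_space A) (fst_space C))"
    "compose (carrier (snd_space A)) g' g \<in> carrier (Vect K (snd_space A) (snd_space C))"
    using compose_Vect f f' Obj_vec assms(1) by blast+
  show "coact_compat K A C (compose (carrier (fst_space A)) f' f) (compose (carrier (snd_space A)) g' g)"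
    by (rule coact_compat_compose[OF pA(1) pB(1) pC(1) f(3) f'(3) f(4) f'(4) f(6) f'(6)])
      (simp_all add: compose_def)
  show "coact_compat K (regular (fst A)) (regular (fst C)) (compose (carrier (fst_space A)) f' f)
      (compose (carrier (fst_space A)) f' f)"
    by (rule coact_compat_compose[OF pA(2) pB(2) pC(2) _ _ _ _ f(5) f'(5)])
      (simp_all add: compose_def f f')
  show "counit (fst C) (compose (carrier (fst_space A)) f' f x) = counit (fst A) x"
    if "x \<in> carrier (fst_space A)" for x
    using that f f' lin_closed[OF f(3)] by (simp add: compose_def)
qed

lemma Obj_tensor:
  assumes "A \<in> Obj (Comod K)" "B \<in> Obj (Comod K)"
  shows "tensor_obj K A B \<in> Obj (Comod K)"
  using assms comodule_tensor[of "fst A" "fst B" "snd A" "snd B"]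
  by (simp add: Obj_Comod cocommutative_coalgebra_coalgebra cocommutative_coalgebra_tensor)

lemma Obj_unit: "unit_obj K \<in> Obj (Comod K)"
  by (simp add: Obj_Comod cocommutative_coalgebra_unit comodule_unit)

lemma comod_hom_tensor:
  assumes "A \<in> Obj (Comod K)" "A' \<in> Obj (Comod K)" "B \<in> Obj (Comod K)" "B' \<in> Obj (Comod K)"
    and "comod_hom K A A' f g" "comod_hom K B B' f' g'"
  shows "comod_hom K (tensor_obj K A B) (tensor_obj K A' B')
    (tensor_map K (fst_space A) (fst_space B) (fst_space A') (fst_space B') f f')
    (tensor_map K (snd_space A) (snd_space B) (snd_space A') (snd_space B') g g')"
    (is "comod_hom _ _ _ ?f ?g")
proof (rule comod_homI)
  note f = comod_homD[OF assms(5)] and f' = comod_homD[OF assms(6)]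
  note p = Obj_precomodule[OF assms(1)] Obj_precomodule[OF assms(2)]
    Obj_precomodule[OF assms(3)] Obj_precomodule[OF assms(4)]
  note [simp] = Obj_vec[OF assms(1)] Obj_vec[OF assms(2)] Obj_vec[OF assms(3)] Obj_vec[OF assms(4)]
    Obj_counit_linear[OF assms(1)] Obj_counit_linear[OF assms(2)]
    Obj_counit_linear[OF assms(3)] Obj_counit_linear[OF assms(4)]
  show "?f \<in> carrier (Vect K (fst_space (tensor_obj K A B)) (fst_space (tensor_obj K A' B')))"
    "?g \<in> carrier (Vect K (snd_space (tensor_obj K A B)) (snd_space (tensor_obj K A' B')))"
    using f f' by (simp_all add: tensor_map_Vect)
  show "coact_compat K (tensor_obj K A B) (tensor_obj K A' B') ?f ?g"
    using f f' p by (intro coact_compat_tensor)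
  \<comment> \<open>Compatibility with comultiplications is the same lemma for the regular
    comodules, read through \<open>regular_tensor\<close>.\<close>
  have "coact_compat K (tensor_obj K (regular (fst A)) (regular (fst B)))
      (tensor_obj K (regular (fst A')) (regular (fst B'))) ?f ?f"
    using coact_compat_tensor[OF p(2,6,4,8), of f f' f f'] f f' by simp
  then show "coact_compat K (regular (fst (tensor_obj K A B))) (regular (fst (tensor_obj K A' B'))) ?f ?f"
    by (simp add: regular_tensor)
  have "\<forall>x\<in>carrier (fst_space A \<otimes>\<^sub>K fst_space B).
      counit (tensor_coalg K (fst A') (fst B')) (?f x) = counit (tensor_coalg K (fst A) (fst B)) x"
    by (rule tensor_ext[where Z = "ring_module K"])
      (simp_all add: lin_counit_tensor lin_compose[OF lin_counit_tensor(1)] f f' lin_closed[OF f(3)] lin_closed[OF f'(3)])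
  then show "counit (fst (tensor_obj K A' B')) (?f x) = counit (fst (tensor_obj K A B)) x"
    if "x \<in> carrier (fst_space (tensor_obj K A B))" for x
    using that by simp
qed

lemma comod_hom_associator:
  assumes "A \<in> Obj (Comod K)" "B \<in> Obj (Comod K)" "C \<in> Obj (Comod K)"
  shows "comod_hom K (tensor_obj K (tensor_obj K A B) C) (tensor_obj K A (tensor_obj K B C))
    (associator K (fst_space A) (fst_space B) (fst_space C))
    (associator K (snd_space A) (snd_space B) (snd_space C))" (is "comod_hom _ ?X ?Y ?f ?g")
proof (rule comod_homI)
  note p = Obj_precomodule[OF assms(1)] Obj_precomodule[OF assms(2)] Obj_precomodule[OF assms(3)]
  note [simp] = Obj_vec[OF assms(1)] Obj_vec[OF assms(2)] Obj_vec[OF assms(3)]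
    Obj_counit_linear[OF assms(1)] Obj_counit_linear[OF assms(2)] Obj_counit_linear[OF assms(3)]
  show "?f \<in> carrier (Vect K (fst_space ?X) (fst_space ?Y))" "?g \<in> carrier (Vect K (snd_space ?X) (snd_space ?Y))"
    by (simp_all add: associator_Vect)
  show "coact_compat K ?X ?Y ?f ?g"
    by (intro coact_compat_associator p)
  show "coact_compat K (regular (fst ?X)) (regular (fst ?Y)) ?f ?f"
    using coact_compat_associator[OF p(2,4,6)] by (simp add: regular_tensor)
  have cl: "counit (fst A) x \<in> carrier K" "counit (fst B) y \<in> carrier K" "counit (fst C) z \<in> carrier K"
    if "x \<in> carrier (fst_space A)" "y \<in> carrier (fst_space B)" "z \<in> carrier (fst_space C)" for x y z
    by (simp_all add: Obj_counit_closed assms that)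
  have "\<forall>x\<in>carrier ((fst_space A \<otimes>\<^sub>K fst_space B) \<otimes>\<^sub>K fst_space C).
      counit (tensor_coalg K (fst A) (tensor_coalg K (fst B) (fst C))) (?f x) =
      counit (tensor_coalg K (tensor_coalg K (fst A) (fst B)) (fst C)) x"
    by (rule tensor_ext3[where Z = "ring_module K"])
      (simp_all add: lin_counit_tensor[where C = "tensor_coalg K (fst A) (fst B)", simplified]
        lin_counit_tensor[where C' = "tensor_coalg K (fst B) (fst C)", simplified]
        lin_counit_tensor lin_compose[OF lin_counit_tensor(1)[where C' = "tensor_coalg K (fst B) (fst C)", simplified]]
        m_assoc cl)
  then show "counit (fst ?Y) (?f x) = counit (fst ?X) x" if "x \<in> carrier (fst_space ?X)" for x
    using that by simp
qed

lemma comod_hom_swap: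
  assumes "A \<in> Obj (Comod K)" "B \<in> Obj (Comod K)"
  shows "comod_hom K (tensor_obj K A B) (tensor_obj K B A)
    (swap K (fst_space A) (fst_space B)) (swap K (snd_space A) (snd_space B))" (is "comod_hom _ ?X ?Y ?f ?g")
proof (rule comod_homI)
  note p = Obj_precomodule[OF assms(1)] Obj_precomodule[OF assms(2)]
  note [simp] = Obj_vec[OF assms(1)] Obj_vec[OF assms(2)] Obj_counit_linear[OF assms(1)] Obj_counit_linear[OF assms(2)]
  show "?f \<in> carrier (Vect K (fst_space ?X) (fst_space ?Y))" "?g \<in> carrier (Vect K (snd_space ?X) (snd_space ?Y))"
    by (simp_all add: swap_Vect)
  show "coact_compat K ?X ?Y ?f ?g"
    by (intro coact_compat_swap p)
  show "coact_compat K (regular (fst ?X)) (regular (fst ?Y)) ?f ?f"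
    using coact_compat_swap[OF p(2,4)] by (simp add: regular_tensor)
  have cl: "counit (fst A) x \<in> carrier K" "counit (fst B) y \<in> carrier K"
    if "x \<in> carrier (fst_space A)" "y \<in> carrier (fst_space B)" for x y
    by (simp_all add: Obj_counit_closed assms that)
  have "\<forall>x\<in>carrier (fst_space A \<otimes>\<^sub>K fst_space B).
      counit (tensor_coalg K (fst B) (fst A)) (?f x) = counit (tensor_coalg K (fst A) (fst B)) x"
    by (rule tensor_ext[where Z = "ring_module K"])
      (simp_all add: lin_counit_tensor lin_compose[OF lin_counit_tensor(1)] m_comm cl)
  then show "counit (fst ?Y) (?f x) = counit (fst ?X) x" if "x \<in> carrier (fst_space ?X)" for x
    using that by simp
qed

lemma regular_unit_coact:
  "a \<in> carrier (unit_space K) \<Longrightarrow> coact (snd (regular (unit_coalg K))) a =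
    pure K (unit_space K) (unit_space K) (Scalar \<one>\<^bsub>K\<^esub>) a"
  by (simp add: unit_coact_commute)

lemma comod_hom_unitors:
  assumes "A \<in> Obj (Comod K)"
  shows "comod_hom K (tensor_obj K (unit_obj K) A) A (left_unitor K (fst_space A)) (left_unitor K (snd_space A))"
    and "comod_hom K (tensor_obj K A (unit_obj K)) A (right_unitor K (fst_space A)) (right_unitor K (snd_space A))"
proof -
  note p = Obj_precomodule[OF assms]
  note [simp] = Obj_vec[OF assms] Obj_counit_linear[OF assms]
  have cl: "counit (fst A) x \<in> carrier K" if "x \<in> carrier (fst_space A)" for x
    by (simp_all add: Obj_counit_closed assms that)
  note unit_counit = lin_counit_tensor[where C = "unit_coalg K", simplified, OF _ lin_scalar]
    lin_counit_tensor[where C' = "unit_coalg K", simplified, OF _ _ lin_scalar]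
  have smult: "a \<odot>\<^bsub>ring_module K\<^esub> b = a \<otimes>\<^bsub>K\<^esub> b" for a b
    by (simp add: ring_module_def)
  note cs = lin_smult[OF Obj_counit_linear[OF assms], unfolded smult]
  show "comod_hom K (tensor_obj K (unit_obj K) A) A (left_unitor K (fst_space A)) (left_unitor K (snd_space A))"
  proof (rule comod_homI)
    show "coact_compat K (tensor_obj K (unit_obj K) A) A (left_unitor K (fst_space A)) (left_unitor K (snd_space A))"
      by (rule coact_compat_unitors(1)[OF p(1) unit_precomodule(1)]) simp_all
    show "coact_compat K (regular (fst (tensor_obj K (unit_obj K) A))) (regular (fst A))
        (left_unitor K (fst_space A)) (left_unitor K (fst_space A))"
      using coact_compat_unitors(1)[OF p(2) unit_precomodule(2) _ _ regular_unit_coact]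
      by (simp add: regular_tensor)
    have "\<forall>x\<in>carrier (unit_space K \<otimes>\<^sub>K fst_space A). counit (fst A) (left_unitor K (fst_space A) x) =
        counit (tensor_coalg K (unit_coalg K) (fst A)) x"
      by (rule tensor_ext[where Z = "ring_module K"])
        (simp_all add: unit_counit lin_compose[OF Obj_counit_linear[OF assms]] cs)
    then show "counit (fst A) (left_unitor K (fst_space A) x) = counit (fst (tensor_obj K (unit_obj K) A)) x"
      if "x \<in> carrier (fst_space (tensor_obj K (unit_obj K) A))" for x
      using that by simp
  qed (simp_all add: left_unitor_Vect)
  show "comod_hom K (tensor_obj K A (unit_obj K)) A (right_unitor K (fst_space A)) (right_unitor K (snd_space A))"
  proof (rule comod_homI)
    show "coact_compat K (tensor_obj K A (unit_obj K)) A (right_unitor K (fst_space A)) (right_unitor K (snd_space A))"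
      by (rule coact_compat_unitors(2)[OF p(1) unit_precomodule(1)]) simp_all
    show "coact_compat K (regular (fst (tensor_obj K A (unit_obj K)))) (regular (fst A))
        (right_unitor K (fst_space A)) (right_unitor K (fst_space A))"
      using coact_compat_unitors(2)[OF p(2) unit_precomodule(2) _ _ regular_unit_coact]
      by (simp add: regular_tensor)
    have "\<forall>x\<in>carrier (fst_space A \<otimes>\<^sub>K unit_space K). counit (fst A) (right_unitor K (fst_space A) x) =
        counit (tensor_coalg K (fst A) (unit_coalg K)) x"
      by (rule tensor_ext[where Z = "ring_module K"])
        (simp_all add: unit_counit lin_compose[OF Obj_counit_linear[OF assms]] cs m_comm cl)
    then show "counit (fst A) (right_unitor K (fst_space A) x) = counit (fst (tensor_obj K A (unit_obj K))) x"
      if "x \<in> carrier (fst_space (tensor_obj K A (unit_obj K)))" for x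
      using that by simp
  qed (simp_all add: right_unitor_Vect)
qed

text \<open>Write \<open>y\<close> as \<open>g (g' y)\<close>, apply compatibility of
  \<open>f\<close> and \<open>g\<close>, and cancel \<open>f' \<otimes> g'\<close> against
  \<open>f \<otimes> g\<close> on the coaction of \<open>g' y\<close>.\<close>

lemma coact_compat_inverse:
  assumes A: "precomodule K A" and B: "precomodule K B"
    and f: "lin_map (fst_space A) (fst_space B) f" "lin_map (fst_space B) (fst_space A) f'"
    and g: "lin_map (snd_space A) (snd_space B) g" "lin_map (snd_space B) (snd_space A) g'"
    and "coact_compat K A B f g"
    and "\<And>x. x \<in> carrier (fst_space A) \<Longrightarrow> f' (f x) = x" "\<And>y. y \<in> carrier (snd_space A) \<Longrightarrow> g' (g y) = y"
      "\<And>y. y \<in> carrier (snd_space B) \<Longrightarrow> g (g' y) = y"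
  shows "coact_compat K B A f' g'"
  unfolding coact_compat_def
proof
  fix y assume y: "y \<in> carrier (snd_space B)"
  let ?s = "coact (snd A) (g' y)"
  have g'y: "g' y \<in> carrier (snd_space A)" using lin_closed[OF g(2) y] .
  then have s: "?s \<in> carrier (fst_space A \<otimes>\<^sub>K snd_space A)"
    using precomoduleD(4)[OF A] by simp
  have "tensor_map K (fst_space B) (snd_space B) (fst_space A) (snd_space A) f' g'
      (tensor_map K (fst_space A) (snd_space A) (fst_space B) (snd_space B) f g ?s) =
      tensor_map K (fst_space A) (snd_space A) (fst_space A) (snd_space A)
        (id_on (fst_space A)) (id_on (snd_space A)) ?s"
    using tensor_map_compose[OF _ _ _ _ _ _ f g, of "id_on (fst_space A)" "id_on (snd_space A)"] A B s assms(8,9)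
    by simp
  also have "\<dots> = ?s"
    using s A by (simp add: tensor_map_id)
  moreover have "coact (snd B) y = tensor_map K (fst_space A) (snd_space A) (fst_space B) (snd_space B) f g ?s"
    using assms(7) g'y assms(10)[OF y] unfolding coact_compat_def by metis
  ultimately show "coact (snd A) (g' y) =
      tensor_map K (fst_space B) (snd_space B) (fst_space A) (snd_space A) f' g' (coact (snd B) y)"
    by simp
qed

text \<open>For an isomorphism only inverse linear maps have to be given; that they form a morphism
  follows from \<open>coact_compat_inverse\<close>. They are restricted to the carriers because
  arrows are extensional.\<close>

lemma comod_hom_iso_arr:
  assumes A: "A \<in> Obj (Comod K)" and B: "B \<in> Obj (Comod K)" and h: "comod_hom K A B f g"
    and f': "lin_map (fst_space B) (fst_space A) f'"
      "\<forall>x\<in>carrier (fst_space A). f' (f x) = x" "\<forall>x\<in>carrier (fst_space B). f (f' x) = x"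
    and g': "lin_map (snd_space B) (snd_space A) g'"
      "\<forall>y\<in>carrier (snd_space A). g' (g y) = y" "\<forall>y\<in>carrier (snd_space B). g (g' y) = y"
  shows "iso_arr (Comod K) A B \<lparr>Dom = A, Cod = B, cmap = f, dmap = g\<rparr>"
proof -
  note hD = comod_homD[OF h]
  let ?f = "restrict f' (carrier (fst_space B))" and ?g = "restrict g' (carrier (snd_space B))"
  have V: "?f \<in> carrier (Vect K (fst_space B) (fst_space A))" "?g \<in> carrier (Vect K (snd_space B) (snd_space A))"
    using restrict_Vect Obj_vec[OF B] f'(1) g'(1) by auto
  note cl = lin_closed[OF hD(3)] lin_closed[OF hD(4)] lin_closed[OF f'(1)] lin_closed[OF g'(1)]
  have "comod_hom K B A ?f ?g"
  proof (rule comod_homI)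
    show "coact_compat K B A ?f ?g"
      using f' g' cl by (intro coact_compat_inverse[OF Obj_precomodule(1)[OF A] Obj_precomodule(1)[OF B]
            hD(3) linear_map_Vect[OF V(1)] hD(4) linear_map_Vect[OF V(2)] hD(6)]) auto
    show "coact_compat K (regular (fst B)) (regular (fst A)) ?f ?f"
      using f' cl hD linear_map_Vect[OF V(1)]
      by (intro coact_compat_inverse[OF Obj_precomodule(2)[OF A] Obj_precomodule(2)[OF B] _ _ _ _ hD(5)]) auto
    show "counit (fst A) (?f x) = counit (fst B) x" if "x \<in> carrier (fst_space B)" for x
      using that f'(3) hD(7)[of "f' x"] cl by simp
  qed (use V in auto)
  then have "\<lparr>Dom = B, Cod = A, cmap = ?f, dmap = ?g\<rparr> \<in> Hom (Comod K) B A"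
    using A B by (simp add: Hom_Comod)
  moreover have "\<lparr>Dom = A, Cod = B, cmap = f, dmap = g\<rparr> \<in> Hom (Comod K) A B"
    using A B h by (simp add: Hom_Comod)
  moreover have "compose (carrier (fst_space A)) ?f f = id_on (fst_space A)"
    "compose (carrier (snd_space A)) ?g g = id_on (snd_space A)"
    "compose (carrier (fst_space B)) f ?f = id_on (fst_space B)"
    "compose (carrier (snd_space B)) g ?g = id_on (snd_space B)"
    using f' g' cl by (auto intro!: compose_eqI)
  ultimately show ?thesis
    unfolding iso_arr_def by (intro conjI bexI) (auto simp: Comod_simps)
qed

text \<open>An equation of arrows splits into the coalgebra maps and the comodule maps. Both are the
  same vector space identity, taken on \<open>fst_space\<close> and on
  \<open>snd_space\<close>.\<close>

lemma symmetric_monoidal_Comod: "symmetric_monoidal_category (Comod K :: (('k, 'a) comod_obj, ('k, 'a) comod_arr) monoidal_data)"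
proof
  fix A :: "('k, 'a) comod_obj" assume A: "A \<in> Obj (Comod K)"
  show "Id (Comod K) A \<in> Hom (Comod K) A A"
    using A by (simp add: Hom_Comod Comod_simps comod_hom_id)
  have I: "unit_obj K \<in> Obj (Comod K)" by (rule Obj_unit)
  note [simp] = Obj_vec[OF A]
  show "iso_arr (Comod K) (\<I>\<^bsub>Comod K\<^esub> \<boxtimes>\<^bsub>Comod K\<^esub> A) A (LUnit (Comod K) A)"
    unfolding Comod_simps
    by (rule comod_hom_iso_arr[OF Obj_tensor[OF I A] A comod_hom_unitors(1)[OF A],
          of "pure K (unit_space K) (fst_space A) (Scalar \<one>\<^bsub>K\<^esub>)" "pure K (unit_space K) (snd_space A) (Scalar \<one>\<^bsub>K\<^esub>)"])
      (simp_all add: left_unitor_inverse)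
  show "iso_arr (Comod K) (A \<boxtimes>\<^bsub>Comod K\<^esub> \<I>\<^bsub>Comod K\<^esub>) A (RUnit (Comod K) A)"
    unfolding Comod_simps
    by (rule comod_hom_iso_arr[OF Obj_tensor[OF A I] A comod_hom_unitors(2)[OF A],
          of "\<lambda>x. pure K (fst_space A) (unit_space K) x (Scalar \<one>\<^bsub>K\<^esub>)" "\<lambda>y. pure K (snd_space A) (unit_space K) y (Scalar \<one>\<^bsub>K\<^esub>)"])
      (simp_all add: right_unitor_inverse)
next
  fix A B C :: "('k, 'a) comod_obj" and f g :: "('k, 'a) comod_arr"
  assume "A \<in> Obj (Comod K)" "B \<in> Obj (Comod K)" "C \<in> Obj (Comod K)" "f \<in> Hom (Comod K) A B" "g \<in> Hom (Comod K) B C"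
  then show "g \<cdot>\<^bsub>Comod K\<^esub> f \<in> Hom (Comod K) A C"
    by (simp add: Hom_Comod Comod_simps comod_hom_compose)
next
  fix A B :: "('k, 'a) comod_obj" and f :: "('k, 'a) comod_arr"
  assume A: "A \<in> Obj (Comod K)" and B: "B \<in> Obj (Comod K)" and f: "f \<in> Hom (Comod K) A B"
  note D = HomD[OF A B f]
  note E = comod_homD[OF D(3)]
  note [simp] = Obj_vec[OF A] Obj_vec[OF B]
  show "f \<cdot>\<^bsub>Comod K\<^esub> Id (Comod K) A = f"
    using D E Vect_extensional[OF E(1)] Vect_extensional[OF E(2)]
    by (intro comod_arr.equality) (auto simp: Comod_simps intro!: compose_eqI)
  show "Id (Comod K) B \<cdot>\<^bsub>Comod K\<^esub> f = f"
    using D E Vect_extensional[OF E(1)] Vect_extensional[OF E(2)] lin_closed[OF E(3)] lin_closed[OF E(4)]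
    by (intro comod_arr.equality) (auto simp: Comod_simps intro!: compose_eqI)
  show "LUnit (Comod K) B \<cdot>\<^bsub>Comod K\<^esub> (Id (Comod K) \<I>\<^bsub>Comod K\<^esub> \<star>\<^bsub>Comod K\<^esub> f) = f \<cdot>\<^bsub>Comod K\<^esub> LUnit (Comod K) A"
    using left_unitor_natural[OF _ _ E(3)] left_unitor_natural[OF _ _ E(4)] D
    by (auto simp: Comod_simps intro!: compose_cong_all)
  show "RUnit (Comod K) B \<cdot>\<^bsub>Comod K\<^esub> (f \<star>\<^bsub>Comod K\<^esub> Id (Comod K) \<I>\<^bsub>Comod K\<^esub>) = f \<cdot>\<^bsub>Comod K\<^esub> RUnit (Comod K) A"
    using right_unitor_natural[OF _ _ E(3)] right_unitor_natural[OF _ _ E(4)] D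
    by (auto simp: Comod_simps intro!: compose_cong_all)
next
  fix A B C D :: "('k, 'a) comod_obj" and f g h :: "('k, 'a) comod_arr"
  assume O: "A \<in> Obj (Comod K)" "B \<in> Obj (Comod K)" "C \<in> Obj (Comod K)" "D \<in> Obj (Comod K)"
    and f: "f \<in> Hom (Comod K) A B" and g: "g \<in> Hom (Comod K) B C" and h: "h \<in> Hom (Comod K) C D"
  note f = HomD[OF O(1,2) f] and g = HomD[OF O(2,3) g] and h = HomD[OF O(3,4) h]
  show "(h \<cdot>\<^bsub>Comod K\<^esub> g) \<cdot>\<^bsub>Comod K\<^esub> f = h \<cdot>\<^bsub>Comod K\<^esub> g \<cdot>\<^bsub>Comod K\<^esub> f"
    using f g h lin_closed[OF comod_homD(3)[OF f(3)]] lin_closed[OF comod_homD(4)[OF f(3)]]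
    by (auto simp: Comod_simps compose_eq intro!: compose_cong_all)
next
  fix A B :: "('k, 'a) comod_obj" assume "A \<in> Obj (Comod K)" "B \<in> Obj (Comod K)"
  then show "A \<boxtimes>\<^bsub>Comod K\<^esub> B \<in> Obj (Comod K)"
    by (simp add: Comod_simps Obj_tensor)
next
  fix A A' B B' :: "('k, 'a) comod_obj" and f g :: "('k, 'a) comod_arr"
  assume O: "A \<in> Obj (Comod K)" "A' \<in> Obj (Comod K)" "B \<in> Obj (Comod K)" "B' \<in> Obj (Comod K)"
    and f: "f \<in> Hom (Comod K) A A'" and g: "g \<in> Hom (Comod K) B B'"
  note f = HomD[OF O(1,2) f] and g = HomD[OF O(3,4) g]
  show "f \<star>\<^bsub>Comod K\<^esub> g \<in> Hom (Comod K) (A \<boxtimes>\<^bsub>Comod K\<^esub> B) (A' \<boxtimes>\<^bsub>Comod K\<^esub> B')"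
    using comod_hom_tensor[OF O f(3) g(3)] f g O by (simp add: Hom_Comod Comod_simps Obj_tensor)
  note E = comod_homD[OF f(3)] comod_homD[OF g(3)]
  note [simp] = Obj_vec[OF O(1)] Obj_vec[OF O(2)] Obj_vec[OF O(3)] Obj_vec[OF O(4)]
  show "Braid (Comod K) A' B' \<cdot>\<^bsub>Comod K\<^esub> (f \<star>\<^bsub>Comod K\<^esub> g) = (g \<star>\<^bsub>Comod K\<^esub> f) \<cdot>\<^bsub>Comod K\<^esub> Braid (Comod K) A B"
    using swap_natural[OF _ _ _ _ E(3,10)] swap_natural[OF _ _ _ _ E(4,11)] f g
    by (auto simp: Comod_simps intro!: compose_cong_all)
next
  fix A B :: "('k, 'a) comod_obj" assume A: "A \<in> Obj (Comod K)" and B: "B \<in> Obj (Comod K)"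
  note [simp] = Obj_vec[OF A] Obj_vec[OF B]
  show "Id (Comod K) A \<star>\<^bsub>Comod K\<^esub> Id (Comod K) B = Id (Comod K) (A \<boxtimes>\<^bsub>Comod K\<^esub> B)"
    by (simp add: Comod_simps tensor_map_id)
  show "Braid (Comod K) A B \<in> Hom (Comod K) (A \<boxtimes>\<^bsub>Comod K\<^esub> B) (B \<boxtimes>\<^bsub>Comod K\<^esub> A)"
    using A B by (simp add: Hom_Comod Comod_simps Obj_tensor comod_hom_swap)
  show "Braid (Comod K) B A \<cdot>\<^bsub>Comod K\<^esub> Braid (Comod K) A B = Id (Comod K) (A \<boxtimes>\<^bsub>Comod K\<^esub> B)"
    by (auto simp: Comod_simps swap_swap intro!: compose_eqI)
  show "(Id (Comod K) A \<star>\<^bsub>Comod K\<^esub> LUnit (Comod K) B) \<cdot>\<^bsub>Comod K\<^esub> Assoc (Comod K) A \<I>\<^bsub>Comod K\<^esub> B =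
      RUnit (Comod K) A \<star>\<^bsub>Comod K\<^esub> Id (Comod K) B"
    by (auto simp: Comod_simps triangle intro!: compose_eqI Vect_extensional[OF tensor_map_Vect])
next
  fix A A' A'' B B' B'' :: "('k, 'a) comod_obj" and f f' g g' :: "('k, 'a) comod_arr"
  assume O: "A \<in> Obj (Comod K)" "A' \<in> Obj (Comod K)" "A'' \<in> Obj (Comod K)"
      "B \<in> Obj (Comod K)" "B' \<in> Obj (Comod K)" "B'' \<in> Obj (Comod K)"
    and f: "f \<in> Hom (Comod K) A A'" "f' \<in> Hom (Comod K) A' A''"
    and g: "g \<in> Hom (Comod K) B B'" "g' \<in> Hom (Comod K) B' B''"
  note [simp] = Obj_vec[OF O(1)] Obj_vec[OF O(2)] Obj_vec[OF O(3)] Obj_vec[OF O(4)] Obj_vec[OF O(5)] Obj_vec[OF O(6)]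
  note f1 = HomD[OF O(1,2) f(1)] and f2 = HomD[OF O(2,3) f(2)]
    and g1 = HomD[OF O(4,5) g(1)] and g2 = HomD[OF O(5,6) g(2)]
  note E = comod_homD[OF f1(3)] comod_homD[OF f2(3)] comod_homD[OF g1(3)] comod_homD[OF g2(3)]
  \<comment> \<open>Stated for arbitrary spaces, since it is applied to the coalgebra layer and to
    the comodule layer.\<close>
  have V: "tensor_map K V W V'' W'' (compose (carrier V) a' a) (compose (carrier W) b' b) =
      compose (carrier (V \<otimes>\<^sub>K W)) (tensor_map K V' W' V'' W'' a' b') (tensor_map K V W V' W' a b)"
    if m: "vec V" "vec V'" "vec V''" "vec W" "vec W'" "vec W''" and a: "lin_map V V' a" "lin_map V' V'' a'"
      and b: "lin_map W W' b" "lin_map W' W'' b'"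
    for V V' V'' W W' W'' :: "('k, 'a) vspace" and a a' b b'
  proof (rule compose_eqI[symmetric])
    have l: "lin_map V V'' (compose (carrier V) a' a)" "lin_map W W'' (compose (carrier W) b' b)"
      using lin_restrict[OF m(1) lin_compose[OF a(2,1)]] lin_restrict[OF m(4) lin_compose[OF b(2,1)]]
      by (simp_all add: compose_def)
    show "tensor_map K V W V'' W'' (compose (carrier V) a' a) (compose (carrier W) b' b) \<in> extensional (carrier (V \<otimes>\<^sub>K W))"
      by (intro Vect_extensional[OF tensor_map_Vect] m l)
    show "\<forall>t\<in>carrier (V \<otimes>\<^sub>K W). tensor_map K V' W' V'' W'' a' b' (tensor_map K V W V' W' a b t) =
        tensor_map K V W V'' W'' (compose (carrier V) a' a) (compose (carrier W) b' b) t"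
      using tensor_map_compose[OF m(1,4,2,5,3,6) a b, of "compose (carrier V) a' a" "compose (carrier W) b' b"]
      by (simp add: compose_def)
  qed
  show "(f' \<cdot>\<^bsub>Comod K\<^esub> f) \<star>\<^bsub>Comod K\<^esub> (g' \<cdot>\<^bsub>Comod K\<^esub> g) = (f' \<star>\<^bsub>Comod K\<^esub> g') \<cdot>\<^bsub>Comod K\<^esub> (f \<star>\<^bsub>Comod K\<^esub> g)"
    using f1 f2 g1 g2 E by (simp add: Comod_simps V[symmetric])
next
  show "\<I>\<^bsub>Comod K\<^esub> \<in> Obj (Comod K)"
    by (simp add: Comod_simps Obj_unit)
next
  fix A B C :: "('k, 'a) comod_obj" assume A: "A \<in> Obj (Comod K)" and B: "B \<in> Obj (Comod K)" and C: "C \<in> Obj (Comod K)"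
  note [simp] = Obj_vec[OF A] Obj_vec[OF B] Obj_vec[OF C]
  show "iso_arr (Comod K) ((A \<boxtimes>\<^bsub>Comod K\<^esub> B) \<boxtimes>\<^bsub>Comod K\<^esub> C) (A \<boxtimes>\<^bsub>Comod K\<^esub> B \<boxtimes>\<^bsub>Comod K\<^esub> C) (Assoc (Comod K) A B C)"
    unfolding Comod_simps
    by (rule comod_hom_iso_arr[OF Obj_tensor[OF Obj_tensor[OF A B] C] Obj_tensor[OF A Obj_tensor[OF B C]]
          comod_hom_associator[OF A B C], of "\<lambda>t. associator_inv (fst_space A) (fst_space B) (fst_space C) t"
          "\<lambda>t. associator_inv (snd_space A) (snd_space B) (snd_space C) t"])
      (simp_all add: associator_inv_left associator_inv_right)
  show "Assoc (Comod K) B C A \<cdot>\<^bsub>Comod K\<^esub> Braid (Comod K) A (B \<boxtimes>\<^bsub>Comod K\<^esub> C) \<cdot>\<^bsub>Comod K\<^esub> Assoc (Comod K) A B C =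
      (Id (Comod K) B \<star>\<^bsub>Comod K\<^esub> Braid (Comod K) A C) \<cdot>\<^bsub>Comod K\<^esub> Assoc (Comod K) B A C \<cdot>\<^bsub>Comod K\<^esub>
        (Braid (Comod K) A B \<star>\<^bsub>Comod K\<^esub> Id (Comod K) C)"
    by (auto simp: Comod_simps compose_eq hexagon intro!: compose_cong_all)
next
  fix A A' B B' C C' :: "('k, 'a) comod_obj" and f g h :: "('k, 'a) comod_arr"
  assume O: "A \<in> Obj (Comod K)" "A' \<in> Obj (Comod K)" "B \<in> Obj (Comod K)" "B' \<in> Obj (Comod K)"
      "C \<in> Obj (Comod K)" "C' \<in> Obj (Comod K)"
    and f: "f \<in> Hom (Comod K) A A'" and g: "g \<in> Hom (Comod K) B B'" and h: "h \<in> Hom (Comod K) C C'"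
  note [simp] = Obj_vec[OF O(1)] Obj_vec[OF O(2)] Obj_vec[OF O(3)] Obj_vec[OF O(4)] Obj_vec[OF O(5)] Obj_vec[OF O(6)]
  note f = HomD[OF O(1,2) f] and g = HomD[OF O(3,4) g] and h = HomD[OF O(5,6) h]
  note E = comod_homD[OF f(3)] comod_homD[OF g(3)] comod_homD[OF h(3)]
  show "Assoc (Comod K) A' B' C' \<cdot>\<^bsub>Comod K\<^esub> ((f \<star>\<^bsub>Comod K\<^esub> g) \<star>\<^bsub>Comod K\<^esub> h) =
      (f \<star>\<^bsub>Comod K\<^esub> g \<star>\<^bsub>Comod K\<^esub> h) \<cdot>\<^bsub>Comod K\<^esub> Assoc (Comod K) A B C"
    using associator_natural[OF _ _ _ _ _ _ E(3,10,17)] associator_natural[OF _ _ _ _ _ _ E(4,11,18)] f g h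
    by (auto simp: Comod_simps intro!: compose_cong_all)
next
  fix A B C D :: "('k, 'a) comod_obj"
  assume O: "A \<in> Obj (Comod K)" "B \<in> Obj (Comod K)" "C \<in> Obj (Comod K)" "D \<in> Obj (Comod K)"
  note [simp] = Obj_vec[OF O(1)] Obj_vec[OF O(2)] Obj_vec[OF O(3)] Obj_vec[OF O(4)]
  show "(Id (Comod K) A \<star>\<^bsub>Comod K\<^esub> Assoc (Comod K) B C D) \<cdot>\<^bsub>Comod K\<^esub> Assoc (Comod K) A (B \<boxtimes>\<^bsub>Comod K\<^esub> C) D
        \<cdot>\<^bsub>Comod K\<^esub> (Assoc (Comod K) A B C \<star>\<^bsub>Comod K\<^esub> Id (Comod K) D) =
      Assoc (Comod K) A B (C \<boxtimes>\<^bsub>Comod K\<^esub> D) \<cdot>\<^bsub>Comod K\<^esub> Assoc (Comod K) (A \<boxtimes>\<^bsub>Comod K\<^esub> B) C D"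
    by (auto simp: Comod_simps compose_eq pentagon intro!: compose_cong_all)
qed

end

section \<open>Subspaces and subcomodules over a field\<close>

context ground_ring
begin

abbreviation sub :: "('k, 'v) module \<Rightarrow> 'v set \<Rightarrow> ('k, 'v) module" where
  "sub V W \<equiv> V\<lparr>carrier := W\<rparr>"

text \<open>\<open>submodule\<close> is built on additive subgroups; closure under negatives comes
  from multiplication by minus one.\<close>

lemma submodule_iff:
  assumes "vec V"
  shows "submodule W K V \<longleftrightarrow> W \<subseteq> carrier V \<and> \<zero>\<^bsub>V\<^esub> \<in> W \<and>
    (\<forall>x\<in>W. \<forall>y\<in>W. x \<oplus>\<^bsub>V\<^esub> y \<in> W) \<and> (\<forall>a\<in>carrier K. \<forall>x\<in>W. a \<odot>\<^bsub>V\<^esub> x \<in> W)" (is "_ \<longleftrightarrow> ?R")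
proof -
  interpret V: module K V by fact
  show ?thesis
  proof
    assume W: "submodule W K V"
    then have "\<zero>\<^bsub>V\<^esub> \<in> W"
      using subgroup.one_closed[OF submodule.axioms(1)[OF W]] by simp
    then show ?R using V.submoduleE[OF W] by auto
  next
    assume R: ?R
    show "submodule W K V"
    proof (rule V.submoduleI)
      fix x assume x: "x \<in> W"
      have "(\<ominus>\<^bsub>K\<^esub> \<one>\<^bsub>K\<^esub>) \<odot>\<^bsub>V\<^esub> x = \<ominus>\<^bsub>V\<^esub> x"
        using R x by (subst V.smult_l_minus) auto
      moreover have "\<ominus>\<^bsub>K\<^esub> \<one>\<^bsub>K\<^esub> \<in> carrier K" by simp
      ultimately show "\<ominus>\<^bsub>V\<^esub> x \<in> W" using R x by metis
    qed (use R in auto)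
  qed
qed

lemma submoduleD:
  assumes "vec V" "submodule W K V"
  shows "W \<subseteq> carrier V" "\<zero>\<^bsub>V\<^esub> \<in> W" "\<lbrakk>x \<in> W; y \<in> W\<rbrakk> \<Longrightarrow> x \<oplus>\<^bsub>V\<^esub> y \<in> W"
    "\<lbrakk>a \<in> carrier K; x \<in> W\<rbrakk> \<Longrightarrow> a \<odot>\<^bsub>V\<^esub> x \<in> W"
  using assms by (auto simp: submodule_iff)

lemma vec_sub: "\<lbrakk>vec V; submodule W K V\<rbrakk> \<Longrightarrow> vec (sub V W)"
  by (rule submodule.submodule_is_module)

lemma lin_sub_incl: "\<lbrakk>vec V; submodule W K V\<rbrakk> \<Longrightarrow> lin_map (sub V W) V id"
  using submoduleD(1)[of V W] by (intro linear_mapI) auto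

lemma lin_into_sub:
  assumes "lin_map U V f" "\<And>u. u \<in> carrier U \<Longrightarrow> f u \<in> W"
  shows "lin_map U (sub V W) f"
  using assms by (intro linear_mapI) (auto simp: lin_add[OF assms(1)] lin_smult[OF assms(1)])

lemma submodule_image:
  assumes "vec U" "vec V" "lin_map U V f"
  shows "submodule (f ` carrier U) K V"
  unfolding submodule_iff[OF assms(2)]
proof (intro conjI ballI)
  show "f ` carrier U \<subseteq> carrier V" using lin_closed[OF assms(3)] by auto
  show "\<zero>\<^bsub>V\<^esub> \<in> f ` carrier U"
    using lin_zero[OF assms] vec_zero_closed[OF assms(1)] by (metis imageI)
next
  fix x y assume "x \<in> f ` carrier U" "y \<in> f ` carrier U"
  then show "x \<oplus>\<^bsub>V\<^esub> y \<in> f ` carrier U"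
    using assms(1) by (auto simp flip: lin_add[OF assms(3)])
next
  fix a x assume "a \<in> carrier K" "x \<in> f ` carrier U"
  then show "a \<odot>\<^bsub>V\<^esub> x \<in> f ` carrier U"
    using assms(1) by (auto simp flip: lin_smult[OF assms(3)])
qed

text \<open>Change of variables in a Sweedler sum. It transports measuring identities along
  inclusions, comodule maps and corestrictions.\<close>

lemma tensor_sum_tensor_map:
  assumes "vec U" "vec V" "vec U'" "vec V'" "vec Z" "bilinear_map K U' V' Z \<beta>"
    and f: "lin_map U U' f" and g: "lin_map V V' g"
  shows "\<forall>t\<in>carrier (U \<otimes>\<^sub>K V). tensor_sum Z \<beta> (tensor_map K U V U' V' f g t) =
    tensor_sum Z (\<lambda>u v. \<beta> (f u) (g v)) t"
proof (rule tensor_ext[where Z = Z])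
  note b = bilinear_compose[OF assms(6) f g]
  show "lin_map (U \<otimes>\<^sub>K V) Z (tensor_sum Z (\<lambda>u v. \<beta> (f u) (g v)))"
    by (intro lin_tensor_sum b assms)
  show "lin_map (U \<otimes>\<^sub>K V) Z (\<lambda>t. tensor_sum Z \<beta> (tensor_map K U V U' V' f g t))"
    by (intro lin_tensor_sum_compose[OF _ _ _ assms(6)]) (simp_all add: assms)
  show "tensor_sum Z \<beta> (tensor_map K U V U' V' f g (pure K U V u v)) =
      tensor_sum Z (\<lambda>u v. \<beta> (f u) (g v)) (pure K U V u v)"
    if "u \<in> carrier U" "v \<in> carrier V" for u v
    using that lin_closed[OF f] lin_closed[OF g]
    by (simp add: assms tensor_sum_pure[OF _ _ _ b] tensor_sum_pure[OF _ _ _ assms(6)])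
qed (use assms in simp_all)

lemma tensor_sum_linear:
  assumes "vec U" "vec V" "vec Z" "vec Z'" "bilinear_map K U V Z \<beta>" "lin_map Z Z' h"
  shows "\<forall>t\<in>carrier (U \<otimes>\<^sub>K V). h (tensor_sum Z \<beta> t) = tensor_sum Z' (\<lambda>u v. h (\<beta> u v)) t"
proof (rule tensor_ext[where Z = Z'])
  have b: "bilinear_map K U V Z' (\<lambda>u v. h (\<beta> u v))"
    by (intro bilinear_mapI lin_compose[OF assms(6)] bilinear_left[OF assms(5)] bilinear_right[OF assms(5)])
  show "lin_map (U \<otimes>\<^sub>K V) Z' (tensor_sum Z' (\<lambda>u v. h (\<beta> u v)))"
    by (intro lin_tensor_sum b assms)
  show "lin_map (U \<otimes>\<^sub>K V) Z' (\<lambda>t. h (tensor_sum Z \<beta> t))"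
    by (intro lin_compose[OF assms(6)] lin_tensor_sum assms)
  show "h (tensor_sum Z \<beta> (pure K U V u v)) = tensor_sum Z' (\<lambda>u v. h (\<beta> u v)) (pure K U V u v)"
    if "u \<in> carrier U" "v \<in> carrier V" for u v
    using that by (simp add: assms tensor_sum_pure[OF _ _ _ b] tensor_sum_pure[OF _ _ _ assms(5)])
qed (use assms in simp_all)

lemma sum_of_subspaces_induct [consumes 1, case_names zero add]:
  assumes "y \<in> sum_of_subspaces V \<W>"
    and "Q \<zero>\<^bsub>V\<^esub>"
    and "\<And>W x y. \<lbrakk>W \<in> \<W>; x \<in> W; y \<in> sum_of_subspaces V \<W>; Q y\<rbrakk> \<Longrightarrow> Q (x \<oplus>\<^bsub>V\<^esub> y)"
  shows "Q y"
proof -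
  obtain ys where ys: "set ys \<subseteq> \<Union>\<W>" "y = foldr (add V) ys \<zero>\<^bsub>V\<^esub>"
    using assms(1) by (auto simp: sum_of_subspaces_def)
  have "Q (foldr (add V) ys \<zero>\<^bsub>V\<^esub>)"
    using ys(1)
  proof (induction ys)
    case (Cons x ys)
    then have "foldr (add V) ys \<zero>\<^bsub>V\<^esub> \<in> sum_of_subspaces V \<W>"
      by (auto simp: sum_of_subspaces_def)
    then show ?case using Cons assms(3) by auto
  qed (simp add: assms(2))
  then show ?thesis using ys(2) by simp
qed

lemma sum_of_subspaces_zero: "\<zero>\<^bsub>V\<^esub> \<in> sum_of_subspaces V \<W>"
  by (auto simp: sum_of_subspaces_def intro!: exI[of _ "[]"])

lemma sum_of_subspaces_add:
  "\<lbrakk>W \<in> \<W>; x \<in> W; y \<in> sum_of_subspaces V \<W>\<rbrakk> \<Longrightarrow> x \<oplus>\<^bsub>V\<^esub> y \<in> sum_of_subspaces V \<W>"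
proof -
  assume *: "W \<in> \<W>" "x \<in> W" "y \<in> sum_of_subspaces V \<W>"
  then obtain ys where "set ys \<subseteq> \<Union>\<W>" "y = foldr (add V) ys \<zero>\<^bsub>V\<^esub>"
    by (auto simp: sum_of_subspaces_def)
  with * show ?thesis
    unfolding sum_of_subspaces_def by (intro CollectI exI[of _ "x # ys"]) auto
qed

lemma submodule_sum:
  assumes "vec V" "\<And>W. W \<in> \<W> \<Longrightarrow> submodule W K V"
  shows "submodule (sum_of_subspaces V \<W>) K V" "W \<in> \<W> \<Longrightarrow> W \<subseteq> sum_of_subspaces V \<W>"
proof -
  interpret V: module K V by fact
  note S = submoduleD[OF assms]
  have sub: "y \<in> carrier V" if "y \<in> sum_of_subspaces V \<W>" for y
    using that by (induction rule: sum_of_subspaces_induct) (use S(1) in auto)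
  show "submodule (sum_of_subspaces V \<W>) K V"
    unfolding submodule_iff[OF assms(1)]
  proof (intro conjI ballI)
    fix x y assume x: "x \<in> sum_of_subspaces V \<W>" and y: "y \<in> sum_of_subspaces V \<W>"
    show "x \<oplus>\<^bsub>V\<^esub> y \<in> sum_of_subspaces V \<W>"
      using x
    proof (induction rule: sum_of_subspaces_induct)
      case zero
      show ?case using y sub by simp
    next
      case (add W x x')
      have "x \<oplus>\<^bsub>V\<^esub> (x' \<oplus>\<^bsub>V\<^esub> y) \<in> sum_of_subspaces V \<W>"
        by (rule sum_of_subspaces_add[OF add(1,2,4)])
      moreover have "x \<in> carrier V" using add S(1) by blast
      ultimately show ?case using sub[OF add(3)] sub[OF y] by (simp add: V.M.a_assoc)
    qed
  next
    fix a y assume a: "a \<in> carrier K" and y: "y \<in> sum_of_subspaces V \<W>"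
    from y show "a \<odot>\<^bsub>V\<^esub> y \<in> sum_of_subspaces V \<W>"
    proof (induction rule: sum_of_subspaces_induct)
      case zero
      show ?case using a sum_of_subspaces_zero by simp
    next
      case (add W x y)
      then have "x \<in> carrier V" using S(1) by blast
      then show ?case
        using add a sub[OF add(3)] S(4)[OF add(1)] by (auto simp: V.smult_r_distr intro!: sum_of_subspaces_add)
    qed
  qed (use sub sum_of_subspaces_zero in auto)
  show "W \<subseteq> sum_of_subspaces V \<W>" if "W \<in> \<W>"
  proof
    fix x assume "x \<in> W"
    then show "x \<in> sum_of_subspaces V \<W>"
      using sum_of_subspaces_add[OF that _ sum_of_subspaces_zero, of x V] S(1)[OF that]
      by (auto simp: subsetD)
  qed
qed

end

section \<open>Complements and retractions over a field\<close>

locale ground_field = ground_ring K + field K for K :: "'k ring"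
begin

text \<open>Zorn's lemma gives a maximal subspace \<open>U\<close> meeting \<open>W\<close>
  trivially. If some \<open>v\<close> were outside \<open>U + W\<close>, then \<open>U + K v\<close>
  would still meet \<open>W\<close> trivially, against maximality.\<close>

lemma complement_exists:
  assumes "vec V" "submodule W K V"
  obtains U where "submodule U K V" "U \<inter> W = {\<zero>\<^bsub>V\<^esub>}"
    "\<And>v. v \<in> carrier V \<Longrightarrow> \<exists>u\<in>U. \<exists>w\<in>W. v = u \<oplus>\<^bsub>V\<^esub> w"
proof -
  interpret V: module K V by fact
  note S = submoduleD[OF assms(1)]
  let ?A = "{U. submodule U K V \<and> U \<inter> W = {\<zero>\<^bsub>V\<^esub>}}"
  have "submodule {\<zero>\<^bsub>V\<^esub>} K V" by (subst submodule_iff) (auto simp: assms)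
  then have ne: "?A \<noteq> {}" using S(2)[OF assms(2)] by blast
  have chain: "\<Union>C \<in> ?A" if C: "C \<noteq> {}" "subset.chain ?A C" for C
  proof -
    have mem: "submodule U K V" "U \<inter> W = {\<zero>\<^bsub>V\<^esub>}" if "U \<in> C" for U
      using C(2) that by (auto simp: subset.chain_def)
    have tot: "U \<subseteq> U' \<or> U' \<subseteq> U" if "U \<in> C" "U' \<in> C" for U U'
      using C(2) that by (auto simp: subset.chain_def)
    have "submodule (\<Union>C) K V"
      unfolding submodule_iff[OF assms(1)]
    proof (intro conjI ballI)
      show "\<Union>C \<subseteq> carrier V" "\<zero>\<^bsub>V\<^esub> \<in> \<Union>C" using C(1) S(1,2) mem(1) by blast+
      show "x \<oplus>\<^bsub>V\<^esub> y \<in> \<Union>C" if xy: "x \<in> \<Union>C" "y \<in> \<Union>C" for x y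
      proof -
        obtain U U' where "U \<in> C" "x \<in> U" "U' \<in> C" "y \<in> U'" using xy by blast
        then obtain U'' where "U'' \<in> C" "x \<in> U''" "y \<in> U''" using tot by blast
        then show ?thesis using S(3)[OF mem(1)] by blast
      qed
      show "a \<odot>\<^bsub>V\<^esub> x \<in> \<Union>C" if "a \<in> carrier K" "x \<in> \<Union>C" for a x
        using that S(4) mem(1) by blast
    qed
    then show ?thesis using mem(2) C(1) by blast
  qed
  obtain U where U: "submodule U K V" "U \<inter> W = {\<zero>\<^bsub>V\<^esub>}"
    and max: "\<And>X. \<lbrakk>submodule X K V; X \<inter> W = {\<zero>\<^bsub>V\<^esub>}; U \<subseteq> X\<rbrakk> \<Longrightarrow> X = U"
    using subset_Zorn_nonempty[OF ne chain] by auto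
  note SU = S[OF U(1)] and SW = S[OF assms(2)]
  have "\<exists>u\<in>U. \<exists>w\<in>W. v = u \<oplus>\<^bsub>V\<^esub> w" if v: "v \<in> carrier V" for v
  proof (rule ccontr)
    assume no: "\<not> (\<exists>u\<in>U. \<exists>w\<in>W. v = u \<oplus>\<^bsub>V\<^esub> w)"
    let ?X = "{u \<oplus>\<^bsub>V\<^esub> a \<odot>\<^bsub>V\<^esub> v | u a. u \<in> U \<and> a \<in> carrier K}"
    have uV: "u \<in> carrier V" if "u \<in> U" for u using SU(1) that by blast
    have wV: "w \<in> carrier V" if "w \<in> W" for w using SW(1) that by blast
    have "submodule ?X K V"
      unfolding submodule_iff[OF assms(1)]
    proof (intro conjI ballI)
      show "?X \<subseteq> carrier V" using uV v by auto
      have "\<zero>\<^bsub>V\<^esub> = \<zero>\<^bsub>V\<^esub> \<oplus>\<^bsub>V\<^esub> \<zero>\<^bsub>K\<^esub> \<odot>\<^bsub>V\<^esub> v" using v by simp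
      then show "\<zero>\<^bsub>V\<^esub> \<in> ?X" using SU(2) by blast
    next
      fix x y assume "x \<in> ?X" "y \<in> ?X"
      then obtain u a u' a' where *: "x = u \<oplus>\<^bsub>V\<^esub> a \<odot>\<^bsub>V\<^esub> v" "u \<in> U" "a \<in> carrier K"
        "y = u' \<oplus>\<^bsub>V\<^esub> a' \<odot>\<^bsub>V\<^esub> v" "u' \<in> U" "a' \<in> carrier K" by blast
      then have "x \<oplus>\<^bsub>V\<^esub> y = (u \<oplus>\<^bsub>V\<^esub> u') \<oplus>\<^bsub>V\<^esub> (a \<oplus>\<^bsub>K\<^esub> a') \<odot>\<^bsub>V\<^esub> v"
        using uV v by (simp add: V.smult_l_distr V.M.a_ac)
      then show "x \<oplus>\<^bsub>V\<^esub> y \<in> ?X" using SU(3) * by blast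
    next
      fix b x assume b: "b \<in> carrier K" and "x \<in> ?X"
      then obtain u a where *: "x = u \<oplus>\<^bsub>V\<^esub> a \<odot>\<^bsub>V\<^esub> v" "u \<in> U" "a \<in> carrier K" by blast
      then have "b \<odot>\<^bsub>V\<^esub> x = b \<odot>\<^bsub>V\<^esub> u \<oplus>\<^bsub>V\<^esub> (b \<otimes>\<^bsub>K\<^esub> a) \<odot>\<^bsub>V\<^esub> v"
        using uV v b by (simp add: V.smult_r_distr V.smult_assoc1)
      then show "b \<odot>\<^bsub>V\<^esub> x \<in> ?X" using SU(4) * b by blast
    qed
    moreover have "?X \<inter> W = {\<zero>\<^bsub>V\<^esub>}"
    proof (intro equalityI subsetI)
      fix x assume "x \<in> ?X \<inter> W"
      then obtain u a where x: "x \<in> W" "x = u \<oplus>\<^bsub>V\<^esub> a \<odot>\<^bsub>V\<^esub> v" "u \<in> U" "a \<in> carrier K" by blast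
      \<comment> \<open>Dividing by a nonzero \<open>a\<close> would solve
        \<open>x = u + a v\<close> for \<open>v\<close> and exhibit it as a sum of an element of
        \<open>U\<close> and one of \<open>W\<close>.\<close>
      have "a = \<zero>\<^bsub>K\<^esub>"
      proof (rule ccontr)
        assume "a \<noteq> \<zero>\<^bsub>K\<^esub>"
        then have inv: "inv\<^bsub>K\<^esub> a \<in> carrier K" "inv\<^bsub>K\<^esub> a \<otimes>\<^bsub>K\<^esub> a = \<one>\<^bsub>K\<^esub>"
          using x(4) field_Units by (auto intro: Units_l_inv Units_inv_closed)
        have xV: "x \<in> carrier V" using wV[OF x(1)] .
        let ?u = "(\<ominus>\<^bsub>K\<^esub> (inv\<^bsub>K\<^esub> a)) \<odot>\<^bsub>V\<^esub> u" and ?w = "inv\<^bsub>K\<^esub> a \<odot>\<^bsub>V\<^esub> x"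
        have "?w = inv\<^bsub>K\<^esub> a \<odot>\<^bsub>V\<^esub> u \<oplus>\<^bsub>V\<^esub> v"
          using x uV inv v by (simp add: V.smult_r_distr flip: V.smult_assoc1)
        moreover have "?u \<oplus>\<^bsub>V\<^esub> inv\<^bsub>K\<^esub> a \<odot>\<^bsub>V\<^esub> u = \<zero>\<^bsub>V\<^esub>"
          using x(3) uV inv by (simp add: V.smult_l_minus V.M.l_neg)
        ultimately have "?u \<oplus>\<^bsub>V\<^esub> ?w = v"
          using x(3) uV inv v by (simp flip: V.M.a_assoc)
        then have "v = ?u \<oplus>\<^bsub>V\<^esub> ?w" by simp
        moreover have "?u \<in> U" "?w \<in> W" using SU(4) SW(4) inv x by auto
        ultimately show False using no by blast
      qed
      then have "x = u" using x uV v by simp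
      then show "x \<in> {\<zero>\<^bsub>V\<^esub>}" using x U(2) by blast
    next
      fix x assume "x \<in> {\<zero>\<^bsub>V\<^esub>}"
      moreover have "\<zero>\<^bsub>V\<^esub> \<in> ?X" using calculation \<open>submodule ?X K V\<close> S(2) by blast
      ultimately show "x \<in> ?X \<inter> W" using SW(2) by blast
    qed
    moreover have "U \<subseteq> ?X"
    proof
      fix u assume u: "u \<in> U"
      then have "u = u \<oplus>\<^bsub>V\<^esub> \<zero>\<^bsub>K\<^esub> \<odot>\<^bsub>V\<^esub> v" using uV v by simp
      then show "u \<in> ?X" using u by blast
    qed
    ultimately have eq: "?X = U" by (rule max)
    have "v = \<zero>\<^bsub>V\<^esub> \<oplus>\<^bsub>V\<^esub> \<one>\<^bsub>K\<^esub> \<odot>\<^bsub>V\<^esub> v" using v by simp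
    then have "v \<in> ?X" using SU(2) by blast
    then have "v \<in> U" using eq by simp
    moreover have "v = v \<oplus>\<^bsub>V\<^esub> \<zero>\<^bsub>V\<^esub>" using v by simp
    ultimately show False using no SW(2) by blast
  qed
  with U show ?thesis using that by blast
qed

text \<open>The retraction is the projection onto \<open>W\<close> along a complement.\<close>

lemma retraction_exists:
  assumes "vec V" "submodule W K V"
  obtains r where "lin_map V (sub V W) r" "\<And>w. w \<in> W \<Longrightarrow> r w = w"
proof -
  interpret V: module K V by fact
  obtain U where U: "submodule U K V" "U \<inter> W = {\<zero>\<^bsub>V\<^esub>}"
    and dec: "\<And>v. v \<in> carrier V \<Longrightarrow> \<exists>u\<in>U. \<exists>w\<in>W. v = u \<oplus>\<^bsub>V\<^esub> w"
    using complement_exists[OF assms] by blast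
  note SU = submoduleD[OF assms(1) U(1)] and SW = submoduleD[OF assms]
  have uV: "u \<in> carrier V" if "u \<in> U" for u using SU(1) that by blast
  have wV: "w \<in> carrier V" if "w \<in> W" for w using SW(1) that by blast
  \<comment> \<open>The difference of two decompositions lies in \<open>U\<close> and in
    \<open>W\<close>, hence vanishes; this gives \<open>THE\<close> a unique value below.\<close>
  have uniq: "w = w'" if "u \<in> U" "u' \<in> U" "w \<in> W" "w' \<in> W" "u \<oplus>\<^bsub>V\<^esub> w = u' \<oplus>\<^bsub>V\<^esub> w'" for u u' w w'
  proof -
    have c: "u \<in> carrier V" "u' \<in> carrier V" "w \<in> carrier V" "w' \<in> carrier V" using that uV wV by auto
    have "\<ominus>\<^bsub>V\<^esub> u' \<oplus>\<^bsub>V\<^esub> u = \<ominus>\<^bsub>V\<^esub> u' \<oplus>\<^bsub>V\<^esub> ((u \<oplus>\<^bsub>V\<^esub> w) \<oplus>\<^bsub>V\<^esub> \<ominus>\<^bsub>V\<^esub> w)"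
      using c by (simp add: V.M.a_assoc V.M.r_neg)
    also have "\<dots> = (\<ominus>\<^bsub>V\<^esub> u' \<oplus>\<^bsub>V\<^esub> u') \<oplus>\<^bsub>V\<^esub> (w' \<oplus>\<^bsub>V\<^esub> \<ominus>\<^bsub>V\<^esub> w)"
      using c by (simp add: that(5) V.M.a_assoc)
    also have "\<dots> = w' \<oplus>\<^bsub>V\<^esub> \<ominus>\<^bsub>V\<^esub> w" using c by (simp add: V.M.l_neg)
    finally have eq: "\<ominus>\<^bsub>V\<^esub> u' \<oplus>\<^bsub>V\<^esub> u = w' \<oplus>\<^bsub>V\<^esub> \<ominus>\<^bsub>V\<^esub> w" .
    have "\<ominus>\<^bsub>V\<^esub> u' \<oplus>\<^bsub>V\<^esub> u \<in> U" "w' \<oplus>\<^bsub>V\<^esub> \<ominus>\<^bsub>V\<^esub> w \<in> W"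
      using that SU(3) SW(3) V.submoduleE(3)[OF U(1)] V.submoduleE(3)[OF assms(2)] by auto
    then have "w' \<oplus>\<^bsub>V\<^esub> \<ominus>\<^bsub>V\<^esub> w = \<zero>\<^bsub>V\<^esub>" using eq U(2) by auto
    then have "w' \<oplus>\<^bsub>V\<^esub> \<ominus>\<^bsub>V\<^esub> w \<oplus>\<^bsub>V\<^esub> w = w" using c by simp
    then show ?thesis using c by (simp add: V.M.a_assoc V.M.l_neg)
  qed
  define r where "r v = (THE w. w \<in> W \<and> (\<exists>u\<in>U. v = u \<oplus>\<^bsub>V\<^esub> w))" for v
  have r: "r (u \<oplus>\<^bsub>V\<^esub> w) = w" if "u \<in> U" "w \<in> W" for u w
    unfolding r_def using that uniq by (intro the_equality) blast+
  have "lin_map V (sub V W) r"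
  proof (rule linear_mapI)
    fix x assume "x \<in> carrier V"
    then show "r x \<in> carrier (sub V W)" using dec[of x] r by auto
  next
    fix x y assume "x \<in> carrier V" "y \<in> carrier V"
    then obtain u w u' w' where *: "u \<in> U" "w \<in> W" "x = u \<oplus>\<^bsub>V\<^esub> w" "u' \<in> U" "w' \<in> W" "y = u' \<oplus>\<^bsub>V\<^esub> w'"
      using dec[of x] dec[of y] by metis
    then have "x \<oplus>\<^bsub>V\<^esub> y = (u \<oplus>\<^bsub>V\<^esub> u') \<oplus>\<^bsub>V\<^esub> (w \<oplus>\<^bsub>V\<^esub> w')" using uV wV by (simp add: V.M.a_ac)
    then show "r (x \<oplus>\<^bsub>V\<^esub> y) = r x \<oplus>\<^bsub>sub V W\<^esub> r y" using * r SU(3) SW(3) by simp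
  next
    fix a x assume a: "a \<in> carrier K" and "x \<in> carrier V"
    then obtain u w where *: "u \<in> U" "w \<in> W" "x = u \<oplus>\<^bsub>V\<^esub> w" using dec by blast
    then have "a \<odot>\<^bsub>V\<^esub> x = a \<odot>\<^bsub>V\<^esub> u \<oplus>\<^bsub>V\<^esub> a \<odot>\<^bsub>V\<^esub> w" using uV wV a by (simp add: V.smult_r_distr)
    then show "r (a \<odot>\<^bsub>V\<^esub> x) = a \<odot>\<^bsub>sub V W\<^esub> r x" using * a r SU(4) SW(4) by simp
  qed
  moreover have "r w = w" if "w \<in> W" for w
    using r[OF SU(2) that] wV[OF that] by simp
  ultimately show ?thesis using that by blast
qed

end

section \<open>Subcomodules: their coactions, sums, and images of morphisms\<close>

context ground_field
begin

text \<open>The retraction \<open>r\<close> is handed out together with the left inverse, since it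
  also yields an explicit formula for the coaction of a subcomodule.\<close>

lemma tensor_incl_retraction:
  assumes "vec V" "vec D" "submodule W K D"
  obtains r where "lin_map D (sub D W) r" "\<And>w. w \<in> W \<Longrightarrow> r w = w"
    "\<forall>t\<in>carrier (V \<otimes>\<^sub>K sub D W). tensor_map K V D V (sub D W) id r (tensor_map K V (sub D W) V D id id t) = t"
proof -
  obtain r where r: "lin_map D (sub D W) r" "\<And>w. w \<in> W \<Longrightarrow> r w = w"
    using retraction_exists[OF assms(2,3)] by blast
  note [simp] = vec_sub[OF assms(2,3)] lin_sub_incl[OF assms(2,3)] assms(1,2)
  have "\<forall>t\<in>carrier (V \<otimes>\<^sub>K sub D W). tensor_map K V D V (sub D W) id r (tensor_map K V (sub D W) V D id id t) = t"
    by (rule tensor_ext[where Z = "V \<otimes>\<^sub>K sub D W"])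
      (use submoduleD(1)[OF assms(2,3)] in \<open>simp_all add: r subsetD\<close>)
  with r show ?thesis using that by blast
qed

lemma tensor_incl_inj:
  assumes "vec V" "vec D" "submodule W K D"
  shows "inj_on (tensor_map K V (sub D W) V D id id) (carrier (V \<otimes>\<^sub>K sub D W))"
proof -
  obtain r where "\<forall>t\<in>carrier (V \<otimes>\<^sub>K sub D W).
      tensor_map K V D V (sub D W) id r (tensor_map K V (sub D W) V D id id t) = t"
    using tensor_incl_retraction[OF assms] by metis
  then show ?thesis
    by (intro inj_on_inverseI[where g = "tensor_map K V D V (sub D W) id r"]) blast
qed

text \<open>Replaces the description by \<open>THE\<close> in \<open>subcomod\<close> by
  \<open>id \<otimes> r\<close> after the ambient coaction, a formula from which linearity can be
  read off.\<close>

lemma subcomodule_retraction: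
  assumes C: "vec (cspace C)" and D: "comodule K C D" and W: "subcomodule K C D W"
  obtains r where "lin_map (dspace D) (sub (dspace D) W) r" "\<And>w. w \<in> W \<Longrightarrow> r w = w"
    "\<And>t. t \<in> carrier (cspace C \<otimes>\<^sub>K sub (dspace D) W) \<Longrightarrow>
      tensor_map K (cspace C) (dspace D) (cspace C) (sub (dspace D) W) id r (tensor_incl K C D W t) = t"
    "\<And>y. y \<in> W \<Longrightarrow> coact (subcomod K C D W) y =
      tensor_map K (cspace C) (dspace D) (cspace C) (sub (dspace D) W) id r (coact D y)"
proof -
  interpret D: comodule K C D by fact
  have sW: "submodule W K (dspace D)" using W by (simp add: subcomodule_def)
  obtain r where r: "lin_map (dspace D) (sub (dspace D) W) r" "\<And>w. w \<in> W \<Longrightarrow> r w = w"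
    and ri: "\<forall>t\<in>carrier (cspace C \<otimes>\<^sub>K sub (dspace D) W).
      tensor_map K (cspace C) (dspace D) (cspace C) (sub (dspace D) W) id r (tensor_incl K C D W t) = t"
    using tensor_incl_retraction[OF C D.space sW] unfolding tensor_incl_def by blast
  have "coact (subcomod K C D W) y =
      tensor_map K (cspace C) (dspace D) (cspace C) (sub (dspace D) W) id r (coact D y)" if y: "y \<in> W" for y
  proof -
    obtain t where t: "t \<in> carrier (cspace C \<otimes>\<^sub>K sub (dspace D) W)" "coact D y = tensor_incl K C D W t"
      using W y by (auto simp: subcomodule_def)
    \<comment> \<open>Lifts are unique because \<open>id \<otimes> r\<close> recovers a lift from
      its image.\<close>
    then have "coact (subcomod K C D W) y = t"
      unfolding subcomod_def using ri by (auto intro!: the_equality) metis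
    then show ?thesis using ri t by simp
  qed
  with r ri show ?thesis using that by blast
qed

lemma dspace_subcomod [simp]: "dspace (subcomod K C D W) = sub (dspace D) W"
  by (simp add: subcomod_def)

lemma subcomodule_submodule: "subcomodule K C D W \<Longrightarrow> submodule W K (dspace D)"
  by (simp add: subcomodule_def)

lemma coact_subcomod:
  assumes C: "vec (cspace C)" and D: "comodule K C D" and W: "subcomodule K C D W" and y: "y \<in> W"
  shows "coact (subcomod K C D W) y \<in> carrier (cspace C \<otimes>\<^sub>K sub (dspace D) W)"
    and "tensor_incl K C D W (coact (subcomod K C D W) y) = coact D y"
proof -
  interpret D: comodule K C D by fact
  obtain t where t: "t \<in> carrier (cspace C \<otimes>\<^sub>K sub (dspace D) W)" "coact D y = tensor_incl K C D W t"
    using W y by (auto simp: subcomodule_def)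
  obtain r where r: "\<And>t. t \<in> carrier (cspace C \<otimes>\<^sub>K sub (dspace D) W) \<Longrightarrow>
      tensor_map K (cspace C) (dspace D) (cspace C) (sub (dspace D) W) id r (tensor_incl K C D W t) = t"
    "\<And>y. y \<in> W \<Longrightarrow> coact (subcomod K C D W) y =
      tensor_map K (cspace C) (dspace D) (cspace C) (sub (dspace D) W) id r (coact D y)"
    using subcomodule_retraction[OF C D W] by metis
  have "coact (subcomod K C D W) y = t" using r(2)[OF y] r(1)[OF t(1)] t(2) by simp
  then show "coact (subcomod K C D W) y \<in> carrier (cspace C \<otimes>\<^sub>K sub (dspace D) W)"
    "tensor_incl K C D W (coact (subcomod K C D W) y) = coact D y"
    using t by simp_all
qed

lemma coact_subcomod_eqI:
  assumes C: "vec (cspace C)" and D: "comodule K C D" and W: "subcomodule K C D W" and y: "y \<in> W"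
    and "t \<in> carrier (cspace C \<otimes>\<^sub>K sub (dspace D) W)" "tensor_incl K C D W t = coact D y"
  shows "coact (subcomod K C D W) y = t"
proof -
  interpret D: comodule K C D by fact
  show ?thesis
    using coact_subcomod[OF C D W y] assms(5,6)
      tensor_incl_inj[OF C D.space subcomodule_submodule[OF W]]
    by (auto simp: tensor_incl_def inj_on_def)
qed

lemma lin_coact_subcomod:
  assumes C: "vec (cspace C)" and D: "comodule K C D" and W: "subcomodule K C D W"
  shows "lin_map (sub (dspace D) W) (cspace C \<otimes>\<^sub>K sub (dspace D) W) (coact (subcomod K C D W))"
proof -
  interpret D: comodule K C D by fact
  note sW = subcomodule_submodule[OF W]
  note [simp] = C D.space vec_sub[OF D.space sW] lin_sub_incl[OF D.space sW]
  obtain r where r: "lin_map (dspace D) (sub (dspace D) W) r"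
    "\<And>y. y \<in> W \<Longrightarrow> coact (subcomod K C D W) y =
      tensor_map K (cspace C) (dspace D) (cspace C) (sub (dspace D) W) id r (coact D y)"
    using subcomodule_retraction[OF C D W] by metis
  \<comment> \<open>The \<open>id\<close> in front of \<open>y\<close> is the inclusion of
    \<open>W\<close> into \<open>D\<close>, with which the chain of linear maps begins.\<close>
  have "lin_map (sub (dspace D) W) (cspace C \<otimes>\<^sub>K sub (dspace D) W)
      (\<lambda>y. tensor_map K (cspace C) (dspace D) (cspace C) (sub (dspace D) W) id r (coact D (id y)))"
    by (intro lin_tensor_map lin_compose[OF D.coact_linear])
      (simp_all add: r lin_sub_incl[OF D.space sW, unfolded id_def])
  then show ?thesis
    by (subst linear_map_cong[OF vec_sub[OF D.space sW]]) (simp_all add: r)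
qed

text \<open>Both sides of coassociativity are sent by \<open>?ii\<close> into
  \<open>C \<otimes> (C \<otimes> D)\<close>, where coassociativity of \<open>D\<close> makes them
  equal. As \<open>?ii\<close> has a left inverse, they are already equal over
  \<open>W\<close>.\<close>

lemma comodule_subcomod:
  assumes C: "coalgebra K C" and D: "comodule K C D" and W: "subcomodule K C D W"
  shows "comodule K C (subcomod K C D W)"
proof -
  interpret C: coalgebra K C by fact
  interpret D: comodule K C D by fact
  note sW = subcomodule_submodule[OF W]
  let ?C = "cspace C" and ?D = "dspace D" and ?W = "sub (dspace D) W" and ?E = "subcomod K C D W"
  let ?i = "tensor_map K ?C ?W ?C ?D id id"
  note linE = lin_coact_subcomod[OF C.space D W]
  note cE = coact_subcomod[OF C.space D W, unfolded tensor_incl_def]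
  note [simp] = C.space D.space vec_sub[OF D.space sW] lin_sub_incl[OF D.space sW]
    C.comult_linear lin_closed[OF C.comult_linear] D.coact_linear lin_closed[OF D.coact_linear] linE
  have WD: "y \<in> carrier ?D" if "y \<in> W" for y using submoduleD(1)[OF D.space sW] that by blast
  show ?thesis
  proof (rule comodule.intro)
    fix y assume "y \<in> carrier (dspace ?E)"
    then have y: "y \<in> W" by simp
    let ?s = "coact ?E y"
    let ?L = "associator K ?C ?C ?W (tensor_map K ?C ?W (?C \<otimes>\<^sub>K ?C) ?W (comult C) id ?s)"
    let ?R = "tensor_map K ?C ?W ?C (?C \<otimes>\<^sub>K ?W) id (coact ?E) ?s"
    let ?ii = "tensor_map K ?C (?C \<otimes>\<^sub>K ?W) ?C (?C \<otimes>\<^sub>K ?D) id ?i"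
    have s: "?s \<in> carrier (?C \<otimes>\<^sub>K ?W)" using cE(1)[OF y] .
    have "\<forall>s\<in>carrier (?C \<otimes>\<^sub>K ?W).
        ?ii (associator K ?C ?C ?W (tensor_map K ?C ?W (?C \<otimes>\<^sub>K ?C) ?W (comult C) id s)) =
        associator K ?C ?C ?D (tensor_map K ?C ?D (?C \<otimes>\<^sub>K ?C) ?D (comult C) id (?i s))"
    proof (rule tensor_ext[where Z = "?C \<otimes>\<^sub>K (?C \<otimes>\<^sub>K ?D)"])
      fix x w assume x: "x \<in> carrier ?C" and w: "w \<in> carrier ?W"
      then have wD: "w \<in> carrier ?D" using WD by simp
      have "\<forall>t\<in>carrier (?C \<otimes>\<^sub>K ?C). ?ii (associator K ?C ?C ?W (pure K (?C \<otimes>\<^sub>K ?C) ?W t w)) =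
          associator K ?C ?C ?D (pure K (?C \<otimes>\<^sub>K ?C) ?D t w)"
        by (rule tensor_ext[where Z = "?C \<otimes>\<^sub>K (?C \<otimes>\<^sub>K ?D)"]) (use w wD in simp_all)
      then show "?ii (associator K ?C ?C ?W (tensor_map K ?C ?W (?C \<otimes>\<^sub>K ?C) ?W (comult C) id (pure K ?C ?W x w))) =
          associator K ?C ?C ?D (tensor_map K ?C ?D (?C \<otimes>\<^sub>K ?C) ?D (comult C) id (?i (pure K ?C ?W x w)))"
        using x w wD by simp
    qed simp_all
    then have "?ii ?L = associator K ?C ?C ?D (tensor_map K ?C ?D (?C \<otimes>\<^sub>K ?C) ?D (comult C) id (coact D y))"
      using s cE(2)[OF y] by simp
    also have "\<dots> = tensor_map K ?C ?D ?C (?C \<otimes>\<^sub>K ?D) id (coact D) (coact D y)"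
      using D.coact_coassoc WD[OF y] by simp
    also have "\<dots> = tensor_map K ?C ?D ?C (?C \<otimes>\<^sub>K ?D) id (coact D) (?i ?s)"
      using cE(2)[OF y] by simp
    also have "\<forall>s\<in>carrier (?C \<otimes>\<^sub>K ?W). tensor_map K ?C ?D ?C (?C \<otimes>\<^sub>K ?D) id (coact D) (?i s) =
        ?ii (tensor_map K ?C ?W ?C (?C \<otimes>\<^sub>K ?W) id (coact ?E) s)"
      by (rule tensor_ext[where Z = "?C \<otimes>\<^sub>K (?C \<otimes>\<^sub>K ?D)"]) (simp_all add: WD cE)
    then have "tensor_map K ?C ?D ?C (?C \<otimes>\<^sub>K ?D) id (coact D) (?i ?s) = ?ii ?R"
      using s by blast
    finally have eq: "?ii ?L = ?ii ?R" .
    obtain r where r: "lin_map ?D ?W r" and ri: "\<forall>t\<in>carrier (?C \<otimes>\<^sub>K ?W). tensor_map K ?C ?D ?C ?W id r (?i t) = t"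
      by (rule tensor_incl_retraction[OF C.space D.space sW])
    \<comment> \<open>Tensoring the retraction of \<open>D\<close> onto \<open>W\<close> twice with
      the identity of \<open>C\<close> inverts \<open>?ii\<close> on the left.\<close>
    have "\<forall>t\<in>carrier (?C \<otimes>\<^sub>K (?C \<otimes>\<^sub>K ?W)).
        tensor_map K ?C (?C \<otimes>\<^sub>K ?D) ?C (?C \<otimes>\<^sub>K ?W) id (tensor_map K ?C ?D ?C ?W id r) (?ii t) = t"
      by (rule tensor_ext[where Z = "?C \<otimes>\<^sub>K (?C \<otimes>\<^sub>K ?W)"]) (simp_all add: r ri)
    moreover have "?L \<in> carrier (?C \<otimes>\<^sub>K (?C \<otimes>\<^sub>K ?W))" "?R \<in> carrier (?C \<otimes>\<^sub>K (?C \<otimes>\<^sub>K ?W))"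
      using s by simp_all
    ultimately have "?L = ?R" using eq by metis
    then show "associator K (cspace C) (cspace C) (dspace ?E)
        (tensor_map K (cspace C) (dspace ?E) (?C \<otimes>\<^sub>K ?C) (dspace ?E) (comult C) id (coact ?E y)) =
        tensor_map K (cspace C) (dspace ?E) (cspace C) (?C \<otimes>\<^sub>K dspace ?E) id (coact ?E) (coact ?E y)"
      by simp
    note b = bilinear_counit[OF vec_sub[OF D.space sW] C.counit_linear]
    \<comment> \<open>The inclusion of \<open>W\<close>, written \<open>id\<close>, is linear and
      passes into the sum, so the sum taken in \<open>?W\<close> can be computed in
      \<open>?D\<close>.\<close>
    have "\<forall>s\<in>carrier (?C \<otimes>\<^sub>K ?W). tensor_sum ?W (\<lambda>x w. counit C x \<odot>\<^bsub>?W\<^esub> w) s =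
        tensor_sum ?D (\<lambda>x w. counit C x \<odot>\<^bsub>?D\<^esub> w) (?i s)"
      using tensor_sum_linear[OF C.space vec_sub[OF D.space sW] vec_sub[OF D.space sW] D.space b
          lin_sub_incl[OF D.space sW]]
        tensor_sum_tensor_map[OF C.space vec_sub[OF D.space sW] C.space D.space D.space
          bilinear_counit[OF D.space C.counit_linear] lin_id' lin_sub_incl[OF D.space sW]]
      by simp
    then show "tensor_sum (dspace ?E) (\<lambda>y\<^sub>0 y\<^sub>1. counit C y\<^sub>0 \<odot>\<^bsub>dspace ?E\<^esub> y\<^sub>1) (coact ?E y) = y"
      using s cE(2)[OF y] D.coact_counit[OF WD[OF y]] by simp
  qed simp_all
qed

text \<open>\<open>V \<otimes> W\<close> and \<open>V \<otimes> W'\<close> have unrelated carriers,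
  so they are compared through their images in \<open>V \<otimes> D\<close>; the smaller inclusion
  factors through the larger one.\<close>

lemma tensor_incl_mono:
  assumes "vec V" "vec D" "submodule W K D" "submodule W' K D" "W \<subseteq> W'"
  shows "tensor_map K V (sub D W) V D id id ` carrier (V \<otimes>\<^sub>K sub D W)
    \<subseteq> tensor_map K V (sub D W') V D id id ` carrier (V \<otimes>\<^sub>K sub D W')"
proof
  have l: "lin_map (sub D W) (sub D W') id"
    using assms(5) by (intro linear_mapI) auto
  note [simp] = vec_sub[OF assms(2,3)] vec_sub[OF assms(2,4)] lin_sub_incl[OF assms(2,3)] lin_sub_incl[OF assms(2,4)] l
  fix x assume "x \<in> tensor_map K V (sub D W) V D id id ` carrier (V \<otimes>\<^sub>K sub D W)"
  then obtain t where t: "t \<in> carrier (V \<otimes>\<^sub>K sub D W)" "x = tensor_map K V (sub D W) V D id id t" by blast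
  have "\<forall>t\<in>carrier (V \<otimes>\<^sub>K sub D W). tensor_map K V (sub D W) V D id id t =
      tensor_map K V (sub D W') V D id id (tensor_map K V (sub D W) V (sub D W') id id t)"
    using assms(5) by (intro tensor_ext[where Z = "V \<otimes>\<^sub>K D"]) (auto simp: assms(1,2))
  then have "x = tensor_map K V (sub D W') V D id id (tensor_map K V (sub D W) V (sub D W') id id t)"
    using t by blast
  then show "x \<in> tensor_map K V (sub D W') V D id id ` carrier (V \<otimes>\<^sub>K sub D W')"
    using t assms(1) by (intro image_eqI[where x = "tensor_map K V (sub D W) V (sub D W') id id t"]) simp_all
qed

text \<open>The image of \<open>C \<otimes> S\<close> in \<open>C \<otimes> D\<close>, for
  \<open>S\<close> the sum, is a subspace containing the image of \<open>C \<otimes> W\<close> for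
  every summand \<open>W\<close>. The coaction of a finite sum of vectors therefore stays in
  it.\<close>

lemma subcomodule_sum:
  assumes C: "vec (cspace C)" and D: "comodule K C D" and W: "\<And>W. W \<in> \<W> \<Longrightarrow> subcomodule K C D W"
  shows "subcomodule K C D (sum_of_subspaces (dspace D) \<W>)" (is "subcomodule K C D ?S")
proof -
  interpret D: comodule K C D by fact
  have sW: "submodule W K (dspace D)" if "W \<in> \<W>" for W using subcomodule_submodule[OF W[OF that]] .
  note S = submodule_sum(1)[OF D.space sW, of \<W>] submodule_sum(2)[OF D.space sW, of \<W>]
  let ?i = "tensor_incl K C D ?S" and ?T = "cspace C \<otimes>\<^sub>K sub (dspace D) ?S"
  have im: "submodule (?i ` carrier ?T) K (cspace C \<otimes>\<^sub>K dspace D)"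
    unfolding tensor_incl_def
    by (intro submodule_image) (simp_all add: C D.space vec_sub S lin_sub_incl)
  have "coact D y \<in> ?i ` carrier ?T" if "y \<in> ?S" for y
    using that
  proof (induction rule: sum_of_subspaces_induct)
    case zero
    show ?case
      using lin_zero[OF D.space _ D.coact_linear] submoduleD(2)[OF _ im] by (simp add: C D.space)
  next
    case (add W x y)
    have "coact D x \<in> tensor_incl K C D W ` carrier (cspace C \<otimes>\<^sub>K sub (dspace D) W)"
      using W[OF add(1)] add(2) by (auto simp: subcomodule_def)
    then have "coact D x \<in> ?i ` carrier ?T"
      using tensor_incl_mono[OF C D.space sW[OF add(1)] S(1) S(2)[OF _ add(1)]]
      unfolding tensor_incl_def by auto
    moreover have "x \<in> carrier (dspace D)" "y \<in> carrier (dspace D)"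
      using add submoduleD(1)[OF D.space] sW S(1) by blast+
    ultimately show ?case
      using add(4) submoduleD(3)[OF _ im] by (simp add: lin_add[OF D.coact_linear] C D.space)
  qed
  then show ?thesis using S(1) by (auto simp: subcomodule_def)
qed

lemma comodule_homD:
  assumes "comodule_hom K C D D' h"
  shows "h \<in> carrier (Vect K (dspace D) (dspace D'))" "lin_map (dspace D) (dspace D') h"
    "y \<in> carrier (dspace D) \<Longrightarrow>
      coact D' (h y) = tensor_map K (cspace C) (dspace D) (cspace C) (dspace D') id h (coact D y)"
  using assms by (simp_all add: comodule_hom_def linear_map_Vect)

text \<open>The coaction at \<open>h y\<close> is \<open>id \<otimes> h\<close> applied to the
  coaction of \<open>y\<close>, and \<open>id \<otimes> h\<close> factors through the tensor product
  with the image of \<open>h\<close>.\<close>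

lemma subcomodule_image:
  assumes C: "vec (cspace C)" and D: "comodule K C D" and R: "comodule K C R" and h: "comodule_hom K C D R h"
  shows "subcomodule K C R (h ` carrier (dspace D))" (is "subcomodule K C R ?W")
proof -
  interpret D: comodule K C D by fact
  interpret R: comodule K C R by fact
  note hD = comodule_homD[OF h]
  have sW: "submodule ?W K (dspace R)" by (rule submodule_image[OF D.space R.space hD(2)])
  have hW: "lin_map (dspace D) (sub (dspace R) ?W) h" by (rule lin_into_sub[OF hD(2)]) simp
  note [simp] = C D.space R.space vec_sub[OF R.space sW] lin_sub_incl[OF R.space sW] hW hD(2) lin_closed[OF hD(2)]
    lin_closed[OF D.coact_linear]
  have "\<forall>t\<in>carrier (cspace C \<otimes>\<^sub>K dspace D).
      tensor_map K (cspace C) (dspace D) (cspace C) (dspace R) id h t =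
      tensor_incl K C R ?W (tensor_map K (cspace C) (dspace D) (cspace C) (sub (dspace R) ?W) id h t)"
    unfolding tensor_incl_def by (rule tensor_ext[where Z = "cspace C \<otimes>\<^sub>K dspace R"]) simp_all
  then have "coact R (h y) = tensor_incl K C R ?W
      (tensor_map K (cspace C) (dspace D) (cspace C) (sub (dspace R) ?W) id h (coact D y))"
    if "y \<in> carrier (dspace D)" for y
    using hD(3)[OF that] that by simp
  then show ?thesis
    using sW by (auto simp: subcomodule_def)
qed

text \<open>\<open>C \<otimes> W\<close> embeds into the tensor product of \<open>C\<close> with the
  ambient comodule, so the morphism condition can be tested there.\<close>

lemma comodule_hom_into_subcomod:
  assumes C: "vec (cspace C)" and D: "comodule K C D" and R: "comodule K C R" and W: "subcomodule K C R W"
  shows "comodule_hom K C D (subcomod K C R W) h \<longleftrightarrow>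
    comodule_hom K C D R h \<and> (\<forall>y\<in>carrier (dspace D). h y \<in> W)"
proof -
  interpret D: comodule K C D by fact
  interpret R: comodule K C R by fact
  note sW = subcomodule_submodule[OF W]
  note [simp] = C D.space R.space vec_sub[OF R.space sW] lin_sub_incl[OF R.space sW] lin_closed[OF D.coact_linear]
  have incl: "\<forall>t\<in>carrier (cspace C \<otimes>\<^sub>K dspace D).
      tensor_incl K C R W (tensor_map K (cspace C) (dspace D) (cspace C) (sub (dspace R) W) id h t) =
      tensor_map K (cspace C) (dspace D) (cspace C) (dspace R) id h t"
    if h: "lin_map (dspace D) (sub (dspace R) W) h"
  proof -
    have hR: "lin_map (dspace D) (dspace R) h" using lin_compose[OF lin_sub_incl[OF R.space sW] h] by simp
    show ?thesis
      unfolding tensor_incl_def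
      by (rule tensor_ext[where Z = "cspace C \<otimes>\<^sub>K dspace R"]) (use h hR lin_closed[OF h] in simp_all)
  qed
  show ?thesis
  proof
    assume h: "comodule_hom K C D (subcomod K C R W) h"
    note hD = comodule_homD[OF h, unfolded dspace_subcomod]
    have hW: "h y \<in> W" if "y \<in> carrier (dspace D)" for y using lin_closed[OF hD(2) that] by simp
    have "lin_map (dspace D) (dspace R) h" using lin_compose[OF lin_sub_incl[OF R.space sW] hD(2)] by simp
    then have "h \<in> carrier (Vect K (dspace D) (dspace R))" using hD(1) by (simp add: Vect_def)
    moreover have "coact R (h y) = tensor_map K (cspace C) (dspace D) (cspace C) (dspace R) id h (coact D y)"
      if y: "y \<in> carrier (dspace D)" for y
      using coact_subcomod(2)[OF C R W hW[OF y]] hD(3)[OF y] incl[OF hD(2)] y by simp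
    ultimately show "comodule_hom K C D R h \<and> (\<forall>y\<in>carrier (dspace D). h y \<in> W)"
      using hW by (simp add: comodule_hom_def)
  next
    assume *: "comodule_hom K C D R h \<and> (\<forall>y\<in>carrier (dspace D). h y \<in> W)"
    then have hD: "comodule_hom K C D R h" and hW: "\<And>y. y \<in> carrier (dspace D) \<Longrightarrow> h y \<in> W" by auto
    note hD = comodule_homD[OF hD]
    have l: "lin_map (dspace D) (sub (dspace R) W) h" by (rule lin_into_sub[OF hD(2) hW])
    then have "h \<in> carrier (Vect K (dspace D) (sub (dspace R) W))" using hD(1) by (simp add: Vect_def)
    moreover have "coact (subcomod K C R W) (h y) =
        tensor_map K (cspace C) (dspace D) (cspace C) (sub (dspace R) W) id h (coact D y)"
      if y: "y \<in> carrier (dspace D)" for y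
      by (rule coact_subcomod_eqI[OF C R W hW[OF y]]) (use hD(3)[OF y] incl[OF l] y l in simp_all)
    ultimately show "comodule_hom K C D (subcomod K C R W) h" by (simp add: comodule_hom_def)
  qed
qed

end

section \<open>The universal measuring comodule\<close>

locale measuring_setup = ground_field K for K :: "'k ring" +
  fixes P P' :: "('k, 'o) operad_data" and C :: "('k, 'a) coalg" and \<Psi> :: "nat \<Rightarrow> ('k, 'a) elt \<Rightarrow> 'o \<Rightarrow> 'o"
    and L L' :: "('k, 'o, 'l) comp_module_data" and R :: "('k, 'a) comod" and \<rho> :: "('k, 'a) elt \<Rightarrow> nat \<Rightarrow> 'l \<Rightarrow> 'l"
  assumes measuring: "operad_measuring K P P' C \<Psi>"
    and module: "cyclic_comp_module K P L" and module': "cyclic_comp_module K P' L'"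
    and cofree: "cofree_comodule K C (product_space (\<lambda>n. Vect K (lspace L n) (lspace L' n))) R \<rho>"
begin

sublocale C: operad_measuring K P P' C \<Psi> by (rule measuring)
sublocale L: cyclic_comp_module K P L by (rule module)
sublocale L': cyclic_comp_module K P' L' by (rule module')
sublocale R: comodule K C R using cofree by (simp add: cofree_comodule_def)

lemma cofree_comodule_ex1:
  assumes "comodule K C D" "lin_map (dspace D) (product_space (\<lambda>n. Vect K (lspace L n) (lspace L' n))) g"
  shows "\<exists>!h. comodule_hom K C D R h \<and> (\<forall>y\<in>carrier (dspace D). \<rho> (h y) = g y)"
  using cofree assms unfolding cofree_comodule_def by blast

lemma rho_linear: "lin_map (dspace R) (product_space (\<lambda>n. Vect K (lspace L n) (lspace L' n))) \<rho>"
  using cofree by (simp add: cofree_comodule_def)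

lemma rho_linear': "lin_map (dspace R) (Vect K (lspace L n) (lspace L' n)) (\<lambda>y. \<rho> y n)"
  using rho_linear by (auto simp: linear_map_def product_space_def Pi_iff fun_eq_iff)

text \<open>Singling out one \<open>y\<close> turns being measuring into an additive condition on
  elements, which passes from members of a family of subcomodules to their sum.\<close>

definition measures_at :: "('k, 'a) comod \<Rightarrow> (nat \<Rightarrow> ('k, 'a) elt \<Rightarrow> 'l \<Rightarrow> 'l) \<Rightarrow> ('k, 'a) elt \<Rightarrow> bool" where
  "measures_at D \<Omega> y \<longleftrightarrow>
    (\<forall>n p i u l. i + p \<le> n + 1 \<longrightarrow> u \<in> carrier (ospace P p) \<longrightarrow> l \<in> carrier (lspace L n) \<longrightarrow>
      \<Omega> (n + 1 - p) y (lact L p n i u l) =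
      tensor_sum (lspace L' (n + 1 - p)) (\<lambda>y\<^sub>0 y\<^sub>1. lact L' p n i (\<Psi> p y\<^sub>0 u) (\<Omega> n y\<^sub>1 l)) (coact D y)) \<and>
    (\<forall>n l. l \<in> carrier (lspace L n) \<longrightarrow> \<Omega> n y (lcyc L n l) = lcyc L' n (\<Omega> n y l))"

lemma comodule_measuring_iff:
  "comodule_measuring K P C \<Psi> L L' D \<Omega> \<longleftrightarrow> comodule K C D \<and>
    (\<forall>n. lin_map (dspace D) (Vect K (lspace L n) (lspace L' n)) (\<Omega> n)) \<and>
    (\<forall>y\<in>carrier (dspace D). measures_at D \<Omega> y)"
  unfolding comodule_measuring_def comodule_measuring_axioms_def measures_at_def by blast

lemma bilinear_lact:
  assumes "i + p \<le> n + 1" "u \<in> carrier (ospace P p)" "l \<in> carrier (lspace L n)"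
    and "lin_map V (Vect K (lspace L n) (lspace L' n)) \<omega>"
  shows "bilinear_map K (cspace C) V (lspace L' (n + 1 - p)) (\<lambda>y\<^sub>0 y\<^sub>1. lact L' p n i (\<Psi> p y\<^sub>0 u) (\<omega> y\<^sub>1 l))"
  by (rule bilinear_compose[OF L'.lact_bilinear[OF assms(1)] lin_Vect_apply[OF C.linear assms(2)]
        lin_Vect_apply[OF assms(4,3)]])

lemma lact_closed:
  "\<lbrakk>i + p \<le> n + 1; u \<in> carrier (ospace P p); l \<in> carrier (lspace L n)\<rbrakk> \<Longrightarrow> lact L p n i u l \<in> carrier (lspace L (n + 1 - p))"
  by (rule bilinear_closed[OF L.lact_bilinear])

lemma lcyc_closed: "l \<in> carrier (lspace L n) \<Longrightarrow> lcyc L n l \<in> carrier (lspace L n)"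
  by (rule lin_closed[OF L.lcyc_linear])

lemma measures_at_zero: "measures_at R (\<lambda>n y. \<rho> y n) \<zero>\<^bsub>dspace R\<^esub>"
  unfolding measures_at_def
proof (intro conjI allI impI)
  have z: "\<rho> \<zero>\<^bsub>dspace R\<^esub> n l = \<zero>\<^bsub>lspace L' n\<^esub>" if "l \<in> carrier (lspace L n)" for n l
    using lin_zero[OF R.space L'.space lin_Vect_apply[OF rho_linear' that]] .
  fix n p i u l
  assume *: "i + p \<le> n + 1" "u \<in> carrier (ospace P p)" "l \<in> carrier (lspace L n)"
  show "\<rho> \<zero>\<^bsub>dspace R\<^esub> (n + 1 - p) (lact L p n i u l) =
      tensor_sum (lspace L' (n + 1 - p)) (\<lambda>y\<^sub>0 y\<^sub>1. lact L' p n i (\<Psi> p y\<^sub>0 u) (\<rho> y\<^sub>1 n l)) (coact R \<zero>\<^bsub>dspace R\<^esub>)"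
    using lin_zero[OF R.space L'.space lin_tensor_sum_compose[OF C.space R.space L'.space
          bilinear_lact[OF * rho_linear'] R.coact_linear]] z[OF lact_closed[OF *]] by simp
next
  have z: "\<rho> \<zero>\<^bsub>dspace R\<^esub> n l = \<zero>\<^bsub>lspace L' n\<^esub>" if "l \<in> carrier (lspace L n)" for n l
    using lin_zero[OF R.space L'.space lin_Vect_apply[OF rho_linear' that]] .
  fix n l assume "l \<in> carrier (lspace L n)"
  then show "\<rho> \<zero>\<^bsub>dspace R\<^esub> n (lcyc L n l) = lcyc L' n (\<rho> \<zero>\<^bsub>dspace R\<^esub> n l)"
    using z lcyc_closed lin_zero[OF L'.space L'.space L'.lcyc_linear] by simp
qed

lemma measures_at_add:
  assumes y: "y \<in> carrier (dspace R)" "y' \<in> carrier (dspace R)"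
    and "measures_at R (\<lambda>n y. \<rho> y n) y" "measures_at R (\<lambda>n y. \<rho> y n) y'"
  shows "measures_at R (\<lambda>n y. \<rho> y n) (y \<oplus>\<^bsub>dspace R\<^esub> y')"
  unfolding measures_at_def
proof (intro conjI allI impI)
  fix n p i u l
  assume *: "i + p \<le> n + 1" "u \<in> carrier (ospace P p)" "l \<in> carrier (lspace L n)"
  show "\<rho> (y \<oplus>\<^bsub>dspace R\<^esub> y') (n + 1 - p) (lact L p n i u l) =
      tensor_sum (lspace L' (n + 1 - p)) (\<lambda>y\<^sub>0 y\<^sub>1. lact L' p n i (\<Psi> p y\<^sub>0 u) (\<rho> y\<^sub>1 n l)) (coact R (y \<oplus>\<^bsub>dspace R\<^esub> y'))"
    using lin_add[OF lin_tensor_sum_compose[OF C.space R.space L'.space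
          bilinear_lact[OF * rho_linear'] R.coact_linear] y]
      lin_add[OF lin_Vect_apply[OF rho_linear' lact_closed[OF *]] y] assms(3,4) *
    unfolding measures_at_def by simp
next
  fix n l assume l: "l \<in> carrier (lspace L n)"
  have c: "\<rho> z n l \<in> carrier (lspace L' n)" if "z \<in> carrier (dspace R)" for z
    using lin_closed[OF lin_Vect_apply[OF rho_linear' l] that] .
  show "\<rho> (y \<oplus>\<^bsub>dspace R\<^esub> y') n (lcyc L n l) = lcyc L' n (\<rho> (y \<oplus>\<^bsub>dspace R\<^esub> y') n l)"
    using lin_add[OF lin_Vect_apply[OF rho_linear' l] y] lin_add[OF lin_Vect_apply[OF rho_linear' lcyc_closed[OF l]] y]
      lin_add[OF L'.lcyc_linear c[OF y(1)] c[OF y(2)]] assms(3,4) l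
    unfolding measures_at_def by simp
qed

text \<open>Sweedler sums over the coaction of \<open>W\<close> and over that of \<open>R\<close>
  agree, because the inclusion carries one coaction to the other.\<close>

lemma subcomodule_measuring_iff:
  assumes W: "subcomodule K C R W"
  shows "comodule_measuring K P C \<Psi> L L' (subcomod K C R W) (\<lambda>n y. \<rho> y n) \<longleftrightarrow>
    (\<forall>y\<in>W. measures_at R (\<lambda>n y. \<rho> y n) y)"
proof -
  note sW = subcomodule_submodule[OF W]
  have lin: "lin_map (sub (dspace R) W) (Vect K (lspace L n) (lspace L' n)) (\<lambda>y. \<rho> y n)" for n
    using lin_compose[OF rho_linear' lin_sub_incl[OF R.space sW]] by simp
  have "tensor_sum (lspace L' (n + 1 - p)) (\<lambda>y\<^sub>0 y\<^sub>1. lact L' p n i (\<Psi> p y\<^sub>0 u) (\<rho> y\<^sub>1 n l)) (coact (subcomod K C R W) y) =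
      tensor_sum (lspace L' (n + 1 - p)) (\<lambda>y\<^sub>0 y\<^sub>1. lact L' p n i (\<Psi> p y\<^sub>0 u) (\<rho> y\<^sub>1 n l)) (coact R y)"
    if y: "y \<in> W" and *: "i + p \<le> n + 1" "u \<in> carrier (ospace P p)" "l \<in> carrier (lspace L n)" for y n p i u l
    using bspec[OF tensor_sum_tensor_map[OF C.space vec_sub[OF R.space sW] C.space R.space L'.space
          bilinear_lact[OF * rho_linear'] lin_id' lin_sub_incl[OF R.space sW]]
        coact_subcomod(1)[OF C.space R.comodule_axioms W y]]
      coact_subcomod(2)[OF C.space R.comodule_axioms W y, unfolded tensor_incl_def]
    by (simp only: id_apply)
  then have "measures_at (subcomod K C R W) (\<lambda>n y. \<rho> y n) y \<longleftrightarrow> measures_at R (\<lambda>n y. \<rho> y n) y" if "y \<in> W" for y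
    unfolding measures_at_def using that by simp
  then show ?thesis
    using lin comodule_subcomod[OF C.coalgebra_axioms R.comodule_axioms W]
    by (simp add: comodule_measuring_iff)
qed

section \<open>The sum of all measuring subcomodules and its universal property\<close>

definition family :: "('k, 'a) elt set set" where
  "family = {W. subcomodule K C R W \<and>
     comodule_measuring K P C \<Psi> L L' (subcomod K C R W) (\<lambda>n y. \<rho> y n)}"

abbreviation univ :: "('k, 'a) comod" where "univ \<equiv> measuring_comod K P C \<Psi> L L' R \<rho>"

abbreviation univ_carrier :: "('k, 'a) elt set" where "univ_carrier \<equiv> sum_of_subspaces (dspace R) family"

lemma univ_eq: "univ = subcomod K C R univ_carrier"
  by (simp add: measuring_comod_def family_def)

lemma subcomodule_univ: "subcomodule K C R univ_carrier"
  by (rule subcomodule_sum[OF C.space R.comodule_axioms]) (simp add: family_def)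

text \<open>An element of the sum is reached from zero by adding elements of measuring subcomodules,
  and \<open>measures_at\<close> holds at zero and is kept by addition.\<close>

lemma univ_measuring: "comodule_measuring K P C \<Psi> L L' univ (\<lambda>n y. \<rho> y n)"
  unfolding univ_eq subcomodule_measuring_iff[OF subcomodule_univ]
proof
  fix y assume "y \<in> univ_carrier"
  then show "measures_at R (\<lambda>n y. \<rho> y n) y"
  proof (induction rule: sum_of_subspaces_induct)
    case (add W x y)
    have W: "subcomodule K C R W" "comodule_measuring K P C \<Psi> L L' (subcomod K C R W) (\<lambda>n y. \<rho> y n)"
      using add(1) by (simp_all add: family_def)
    have "x \<in> carrier (dspace R)" "y \<in> carrier (dspace R)"
      using submoduleD(1)[OF R.space subcomodule_submodule] W(1) subcomodule_univ add(2,3) by blast+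
    then show ?case
      using add W(2) by (intro measures_at_add) (simp_all add: subcomodule_measuring_iff[OF W(1)])
  qed (rule measures_at_zero)
qed

lemma comodule_univ: "comodule K C univ"
  using univ_measuring by (simp add: comodule_measuring_iff)

lemma univ_factor:
  assumes "comodule_measuring K P C \<Psi> L L' D \<Omega>"
  obtains g where "comodule_hom K C D univ g" "\<And>y n. y \<in> carrier (dspace D) \<Longrightarrow> \<rho> (g y) n = \<Omega> n y"
proof -
  interpret D: comodule_measuring K P C \<Psi> L L' D \<Omega> by fact
  \<comment> \<open>All degrees are packed into one linear map to the product space, the form in
    which cofreeness can be applied.\<close>
  have "lin_map (dspace D) (product_space (\<lambda>n. Vect K (lspace L n) (lspace L' n))) (\<lambda>y n. \<Omega> n y)"
    using D.linear by (auto simp: linear_map_def product_space_def Pi_iff fun_eq_iff)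
  from cofree_comodule_ex1[OF D.comodule_axioms this] obtain h where h: "comodule_hom K C D R h"
    and rh: "\<And>y n. y \<in> carrier (dspace D) \<Longrightarrow> \<rho> (h y) n = \<Omega> n y"
    by auto
  note hD = comodule_homD[OF h]
  let ?W = "h ` carrier (dspace D)"
  have sW: "subcomodule K C R ?W"
    by (rule subcomodule_image[OF C.space D.comodule_axioms R.comodule_axioms h])
  have "measures_at R (\<lambda>n y. \<rho> y n) (h z)" if z: "z \<in> carrier (dspace D)" for z
    unfolding measures_at_def
  proof (intro conjI allI impI)
    fix n p i u l
    assume *: "i + p \<le> n + 1" "u \<in> carrier (ospace P p)" "l \<in> carrier (lspace L n)"
    let ?Z = "lspace L' (n + 1 - p)"
    have "tensor_sum ?Z (\<lambda>y\<^sub>0 y\<^sub>1. lact L' p n i (\<Psi> p y\<^sub>0 u) (\<rho> y\<^sub>1 n l)) (coact R (h z)) =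
        tensor_sum ?Z (\<lambda>y\<^sub>0 y\<^sub>1. lact L' p n i (\<Psi> p y\<^sub>0 u) (\<rho> (h y\<^sub>1) n l)) (coact D z)"
      using tensor_sum_tensor_map[OF C.space D.space C.space R.space L'.space
          bilinear_lact[OF * rho_linear'] lin_id' hD(2)] hD(3)[OF z] lin_closed[OF D.coact_linear z] by simp
    \<comment> \<open>\<open>\<rho> (h y\<^sub>1) n\<close> and \<open>\<Omega> n y\<^sub>1\<close>
      agree on the carrier only, so the sums are compared by extensionality and not by rewriting
      under the binder.\<close>
    moreover have "\<forall>t\<in>carrier (cspace C \<otimes>\<^sub>K dspace D).
        tensor_sum ?Z (\<lambda>y\<^sub>0 y\<^sub>1. lact L' p n i (\<Psi> p y\<^sub>0 u) (\<rho> (h y\<^sub>1) n l)) t =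
        tensor_sum ?Z (\<lambda>y\<^sub>0 y\<^sub>1. lact L' p n i (\<Psi> p y\<^sub>0 u) (\<Omega> n y\<^sub>1 l)) t"
      using bilinear_lact[OF * lin_compose[OF rho_linear' hD(2)]] bilinear_lact[OF * D.linear]
      by (intro tensor_ext[where Z = ?Z] lin_tensor_sum)
        (simp_all add: C.space D.space L'.space tensor_sum_pure rh)
    ultimately show "\<rho> (h z) (n + 1 - p) (lact L p n i u l) =
        tensor_sum ?Z (\<lambda>y\<^sub>0 y\<^sub>1. lact L' p n i (\<Psi> p y\<^sub>0 u) (\<rho> y\<^sub>1 n l)) (coact R (h z))"
      using D.lact[OF *(1) z *(2,3)] rh[OF z] lin_closed[OF D.coact_linear z] by simp
  next
    fix n l assume "l \<in> carrier (lspace L n)"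
    then show "\<rho> (h z) n (lcyc L n l) = lcyc L' n (\<rho> (h z) n l)"
      using D.lcyc[OF z] rh[OF z] by simp
  qed
  then have "?W \<in> family"
    using sW subcomodule_measuring_iff[OF sW] by (auto simp: family_def)
  then have "?W \<subseteq> univ_carrier"
    using subcomodule_submodule by (intro submodule_sum(2)[OF R.space]) (auto simp: family_def)
  then have "comodule_hom K C D univ h"
    using h unfolding univ_eq comodule_hom_into_subcomod[OF C.space D.comodule_axioms R.comodule_axioms subcomodule_univ]
    by blast
  then show ?thesis using that rh by blast
qed

text \<open>Morphisms into \<open>univ\<close> are morphisms into the cofree comodule, whose
  uniqueness clause decides.\<close>

lemma univ_unique:
  assumes D: "comodule K C D" and g: "comodule_hom K C D univ g" and g': "comodule_hom K C D univ g'"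
    and eq: "\<And>y n. y \<in> carrier (dspace D) \<Longrightarrow> \<rho> (g y) n = \<rho> (g' y) n"
  shows "g = g'"
proof -
  have "comodule_hom K C D R g" "comodule_hom K C D R g'"
    using g g' comodule_hom_into_subcomod[OF C.space D R.comodule_axioms subcomodule_univ] by (simp_all add: univ_eq)
  moreover have "lin_map (dspace D) (product_space (\<lambda>n. Vect K (lspace L n) (lspace L' n))) (\<lambda>y. \<rho> (g y))"
    using comodule_homD(2)[OF calculation(1)] by (intro lin_compose[OF rho_linear])
  moreover have "\<rho> (g' y) = \<rho> (g y)" if "y \<in> carrier (dspace D)" for y
    using eq[OF that] by auto
  ultimately show ?thesis
    using cofree_comodule_ex1[OF D, of "\<lambda>y. \<rho> (g y)"] by auto
qed

end

section \<open>Composition of measurings\<close>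

context ground_ring
begin

lemma tensor_ext_vec:
  assumes "vec V" "vec W" "vec Z" "lin_map (V \<otimes>\<^sub>K W) Z f" "lin_map (V \<otimes>\<^sub>K W) Z g"
    and "\<And>v w. \<lbrakk>v \<in> carrier V; w \<in> carrier W\<rbrakk> \<Longrightarrow> f (pure K V W v w) = g (pure K V W v w)"
    and "t \<in> carrier (V \<otimes>\<^sub>K W)"
  shows "f t = g t"
  using tensor_ext[OF assms(1-6)] assms(7) by blast

lemma bilinear_compose_Vect:
  assumes "vec A" "vec B" "vec U" "vec V" "vec W"
    and a: "lin_map A (Vect K U V) a" and b: "lin_map B (Vect K V W) b"
  shows "bilinear_map K A B (Vect K U W) (\<lambda>x y. compose (carrier U) (b y) (a x))"
proof (rule bilinear_mapI)
  have V: "compose (carrier U) (b y) (a x) \<in> carrier (Vect K U W)" if "x \<in> carrier A" "y \<in> carrier B" for x y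
    using compose_Vect[OF assms(3) lin_closed[OF a that(1)] lin_closed[OF b that(2)]] .
  have cl: "a x u \<in> carrier V" if "x \<in> carrier A" "u \<in> carrier U" for x u
    using lin_closed[OF lin_Vect_apply[OF a that(2)] that(1)] .
  show "lin_map B (Vect K U W) (\<lambda>y. compose (carrier U) (b y) (a x))" if x: "x \<in> carrier A" for x
    by (rule lin_into_Vect) (use assms V x lin_Vect_apply[OF b] cl in \<open>simp_all add: compose_eq\<close>)
  show "lin_map A (Vect K U W) (\<lambda>x. compose (carrier U) (b y) (a x))" if y: "y \<in> carrier B" for y
  proof (rule lin_into_Vect)
    fix u assume u: "u \<in> carrier U"
    show "lin_map A W (\<lambda>x. compose (carrier U) (b y) (a x) u)"
      using lin_compose[OF linear_map_Vect[OF lin_closed[OF b y]] lin_Vect_apply[OF a u]] u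
      by (simp add: compose_eq)
  qed (use assms V y in simp_all)
qed

definition composite ::
  "('k, 'u) module \<Rightarrow> ('k, 'w) module \<Rightarrow> (('k, 'a) elt \<Rightarrow> 'u \<Rightarrow> 'v) \<Rightarrow>
   (('k, 'a) elt \<Rightarrow> 'v \<Rightarrow> 'w) \<Rightarrow> ('k, 'a) elt \<Rightarrow> 'u \<Rightarrow> 'w" where
  "composite U W a b = tensor_sum (Vect K U W) (\<lambda>x y. compose (carrier U) (b y) (a x))"

lemma
  assumes "vec A" "vec B" "vec U" "vec V" "vec W" "lin_map A (Vect K U V) a" "lin_map B (Vect K V W) b"
  shows lin_composite: "lin_map (A \<otimes>\<^sub>K B) (Vect K U W) (composite U W a b)"
    and composite_pure: "\<lbrakk>x \<in> carrier A; y \<in> carrier B\<rbrakk> \<Longrightarrow>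
      composite U W a b (pure K A B x y) = compose (carrier U) (b y) (a x)"
  unfolding composite_def using assms
  by (simp_all add: lin_tensor_sum bilinear_compose_Vect tensor_sum_pure)

text \<open>The computation shared by both composition theorems. There \<open>s\<close> and
  \<open>s'\<close> are the coactions (or comultiplications) of \<open>y\<close> and
  \<open>y'\<close>, and \<open>e\<close> is the second measuring at \<open>y'\<close>. Its
  measuring identity \<open>e_eq\<close> is used inside the sum over \<open>s\<close>; the resulting
  double sum is one sum over the interchanged tensor, which is the coaction of
  \<open>y \<otimes> y'\<close>.\<close>

lemma interchange_sum:
  assumes "vec C" "vec C'" "vec D" "vec D'" "vec W'" "vec W''"
    and a: "lin_map C U' a" and b: "lin_map D V' b" and e: "lin_map W' W'' e"
    and \<mu>': "bilinear_map K U' V' W' \<mu>'" and \<mu>'': "bilinear_map K U'' V'' W'' \<mu>''"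
    and F: "lin_map (C \<otimes>\<^sub>K C') U'' F" and G: "lin_map (D \<otimes>\<^sub>K D') V'' G"
    and a': "\<And>u. u \<in> carrier U' \<Longrightarrow> lin_map C' U'' (\<lambda>x. a' x u)"
    and b': "\<And>v. v \<in> carrier V' \<Longrightarrow> lin_map D' V'' (\<lambda>y. b' y v)"
    and F_pure: "\<And>x x'. \<lbrakk>x \<in> carrier C; x' \<in> carrier C'\<rbrakk> \<Longrightarrow> F (pure K C C' x x') = a' x' (a x)"
    and G_pure: "\<And>y y'. \<lbrakk>y \<in> carrier D; y' \<in> carrier D'\<rbrakk> \<Longrightarrow> G (pure K D D' y y') = b' y' (b y)"
    and s': "s' \<in> carrier (C' \<otimes>\<^sub>K D')"
    and e_eq: "\<And>u v. \<lbrakk>u \<in> carrier U'; v \<in> carrier V'\<rbrakk> \<Longrightarrow>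
      e (\<mu>' u v) = tensor_sum W'' (\<lambda>x y. \<mu>'' (a' x u) (b' y v)) s'"
    and s: "s \<in> carrier (C \<otimes>\<^sub>K D)"
  shows "e (tensor_sum W' (\<lambda>x y. \<mu>' (a x) (b y)) s) =
    tensor_sum W'' (\<lambda>z w. \<mu>'' (F z) (G w)) (interchange K C D C' D' (pure K (C \<otimes>\<^sub>K D) (C' \<otimes>\<^sub>K D') s s'))"
proof (rule tensor_ext_vec[OF assms(1,3,6) _ _ _ s])
  note b1 = bilinear_compose[OF \<mu>' a b] and b2 = bilinear_compose[OF \<mu>'' F G]
  show "lin_map (C \<otimes>\<^sub>K D) W'' (\<lambda>s. e (tensor_sum W' (\<lambda>x y. \<mu>' (a x) (b y)) s))"
    by (intro lin_compose[OF e] lin_tensor_sum assms b1)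
  show "lin_map (C \<otimes>\<^sub>K D) W'' (\<lambda>s. tensor_sum W'' (\<lambda>z w. \<mu>'' (F z) (G w))
      (interchange K C D C' D' (pure K (C \<otimes>\<^sub>K D) (C' \<otimes>\<^sub>K D') s s')))"
    by (intro lin_tensor_sum_compose[OF _ _ _ b2]) (use assms in simp_all)
  fix x y assume x: "x \<in> carrier C" and y: "y \<in> carrier D"
  note ax = lin_closed[OF a x] and by' = lin_closed[OF b y]
  have b3: "bilinear_map K C' D' W'' (\<lambda>x' y'. \<mu>'' (a' x' (a x)) (b' y' (b y)))"
    by (rule bilinear_compose[OF \<mu>'' a'[OF ax] b'[OF by']])
  \<comment> \<open>\<open>s\<close> is now pure, so the left sum has collapsed to the right side of
    \<open>e_eq\<close>; it remains to vary \<open>s'\<close>.\<close>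
  have "tensor_sum W'' (\<lambda>x' y'. \<mu>'' (a' x' (a x)) (b' y' (b y))) s' =
      tensor_sum W'' (\<lambda>z w. \<mu>'' (F z) (G w)) (interchange K C D C' D' (pure K (C \<otimes>\<^sub>K D) (C' \<otimes>\<^sub>K D') (pure K C D x y) s'))"
  proof (rule tensor_ext_vec[OF assms(2,4,6) _ _ _ s'])
    show "lin_map (C' \<otimes>\<^sub>K D') W'' (tensor_sum W'' (\<lambda>x' y'. \<mu>'' (a' x' (a x)) (b' y' (b y))))"
      by (intro lin_tensor_sum assms b3)
    show "lin_map (C' \<otimes>\<^sub>K D') W'' (\<lambda>s'. tensor_sum W'' (\<lambda>z w. \<mu>'' (F z) (G w))
        (interchange K C D C' D' (pure K (C \<otimes>\<^sub>K D) (C' \<otimes>\<^sub>K D') (pure K C D x y) s')))"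
      by (intro lin_tensor_sum_compose[OF _ _ _ b2]) (use assms x y in simp_all)
  qed (use assms(1-6) x y in \<open>simp add: tensor_sum_pure[OF _ _ _ b2] tensor_sum_pure[OF _ _ _ b3] F_pure G_pure\<close>)
  then show "e (tensor_sum W' (\<lambda>x y. \<mu>' (a x) (b y)) (pure K C D x y)) =
      tensor_sum W'' (\<lambda>z w. \<mu>'' (F z) (G w)) (interchange K C D C' D' (pure K (C \<otimes>\<^sub>K D) (C' \<otimes>\<^sub>K D') (pure K C D x y) s'))"
    using assms(1-6) x y by (simp add: tensor_sum_pure[OF _ _ _ b1] e_eq[OF ax by'])
qed

lemma comult_tensor_coalg:
  "comult (tensor_coalg K C C') = (\<lambda>t. interchange K (cspace C) (cspace C) (cspace C') (cspace C')
     (tensor_map K (cspace C) (cspace C') (cspace C \<otimes>\<^sub>K cspace C) (cspace C' \<otimes>\<^sub>K cspace C') (comult C) (comult C') t))"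
  by (simp add: tensor_coalg_def)

lemma operad_measuring_composite:
  assumes P: "operad_with_multiplication K P" and P': "operad_with_multiplication K P'"
    and P'': "operad_with_multiplication K P''"
    and C: "operad_measuring K P P' C \<Psi>" and C': "operad_measuring K P' P'' C' \<Psi>'"
  shows "operad_measuring K P P'' (tensor_coalg K C C') (\<lambda>n. composite (ospace P n) (ospace P'' n) (\<Psi> n) (\<Psi>' n))"
proof -
  interpret P: operad_with_multiplication K P by fact
  interpret P': operad_with_multiplication K P' by fact
  interpret P'': operad_with_multiplication K P'' by fact
  interpret C: operad_measuring K P P' C \<Psi> by fact
  interpret C': operad_measuring K P' P'' C' \<Psi>' by fact
  let ?T = "tensor_coalg K C C'" and ?X = "cspace C \<otimes>\<^sub>K cspace C'"
  let ?\<Psi> = "\<lambda>n. composite (ospace P n) (ospace P'' n) (\<Psi> n) (\<Psi>' n)"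
  note [simp] = C.space C'.space C.comult_linear C'.comult_linear
    lin_closed[OF C.comult_linear] lin_closed[OF C'.comult_linear] P.space P'.space P''.space
  have T: "cocommutative_coalgebra K ?T"
    by (rule cocommutative_coalgebra_tensor[OF C.cocommutative_coalgebra_axioms C'.cocommutative_coalgebra_axioms])
  then interpret T: cocommutative_coalgebra K ?T .
  have lin: "lin_map ?X (Vect K (ospace P n) (ospace P'' n)) (?\<Psi> n)" for n
    by (rule lin_composite[OF C.space C'.space P.space P'.space P''.space C.linear C'.linear])
  have pure: "?\<Psi> n (pure K (cspace C) (cspace C') x x') u = \<Psi>' n x' (\<Psi> n x u)"
    if "x \<in> carrier (cspace C)" "x' \<in> carrier (cspace C')" "u \<in> carrier (ospace P n)" for n x x' u
    using composite_pure[OF C.space C'.space P.space P'.space P''.space C.linear C'.linear that(1,2)] that(3)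
    by (simp add: compose_eq)
  have \<Psi>_closed: "\<Psi> n x u \<in> carrier (ospace P' n)" if "x \<in> carrier (cspace C)" "u \<in> carrier (ospace P n)" for n x u
    using lin_closed[OF lin_Vect_apply[OF C.linear that(2)] that(1)] .
  show ?thesis
  proof (intro operad_measuring.intro operad_measuring_axioms.intro T)
    show "lin_map (cspace ?T) (Vect K (ospace P n) (ospace P'' n)) (?\<Psi> n)" for n
      using lin by simp
  next
    fix i t u p v q
    assume i: "(1::nat) \<le> i" and t: "t \<in> carrier (cspace ?T)"
      and u: "u \<in> carrier (ospace P p)" and v: "v \<in> carrier (ospace P q)"
    let ?r = "p + q - 1"
    have t': "t \<in> carrier ?X" using t by simp
    note \<mu> = P.ocomp_bilinear[OF i, of p q] and \<mu>' = P'.ocomp_bilinear[OF i, of p q]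
      and \<mu>'' = P''.ocomp_bilinear[OF i, of p q]
    note uv = bilinear_closed[OF \<mu> u v]
    note b = bilinear_compose[OF \<mu>'' lin_Vect_apply[OF lin u] lin_Vect_apply[OF lin v]]
    show "?\<Psi> ?r t (ocomp P p q i u v) =
        tensor_sum (ospace P'' ?r) (\<lambda>x\<^sub>1 x\<^sub>2. ocomp P'' p q i (?\<Psi> p x\<^sub>1 u) (?\<Psi> q x\<^sub>2 v)) (comult ?T t)"
    proof (rule tensor_ext_vec[OF C.space C'.space P''.space _ _ _ t'])
      show "lin_map ?X (ospace P'' ?r) (\<lambda>t. ?\<Psi> ?r t (ocomp P p q i u v))"
        by (rule lin_Vect_apply[OF lin uv])
      show "lin_map ?X (ospace P'' ?r) (\<lambda>t.
          tensor_sum (ospace P'' ?r) (\<lambda>x\<^sub>1 x\<^sub>2. ocomp P'' p q i (?\<Psi> p x\<^sub>1 u) (?\<Psi> q x\<^sub>2 v)) (comult ?T t))"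
        using T.comult_linear by (intro lin_tensor_sum_compose[OF _ _ _ b]) simp_all
      fix x x' assume x: "x \<in> carrier (cspace C)" and x': "x' \<in> carrier (cspace C')"
      have e: "lin_map (ospace P' ?r) (ospace P'' ?r) (\<Psi>' ?r x')"
        by (rule linear_map_Vect[OF lin_closed[OF C'.linear x']])
      \<comment> \<open>By \<open>C.ocomp\<close> the argument of \<open>\<Psi>'\<close> is the
        value of \<open>\<Psi>\<close> on the composition of \<open>u\<close> and \<open>v\<close>;
        \<open>C'.ocomp\<close> is supplied as \<open>e_eq\<close>.\<close>
      have "\<Psi>' ?r x' (tensor_sum (ospace P' ?r) (\<lambda>x\<^sub>1 x\<^sub>2. ocomp P' p q i (\<Psi> p x\<^sub>1 u) (\<Psi> q x\<^sub>2 v)) (comult C x)) =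
          tensor_sum (ospace P'' ?r) (\<lambda>z w. ocomp P'' p q i (?\<Psi> p z u) (?\<Psi> q w v))
            (interchange K (cspace C) (cspace C) (cspace C') (cspace C')
              (pure K (cspace C \<otimes>\<^sub>K cspace C) (cspace C' \<otimes>\<^sub>K cspace C') (comult C x) (comult C' x')))"
        by (rule interchange_sum[OF C.space C'.space C.space C'.space P'.space P''.space
              lin_Vect_apply[OF C.linear u] lin_Vect_apply[OF C.linear v] e \<mu>' \<mu>''
              lin_Vect_apply[OF lin u] lin_Vect_apply[OF lin v]
              lin_Vect_apply[OF C'.linear] lin_Vect_apply[OF C'.linear]])
          (use x x' u v C'.ocomp[OF i x'] in \<open>simp_all add: pure\<close>)
      then show "?\<Psi> ?r (pure K (cspace C) (cspace C') x x') (ocomp P p q i u v) =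
          tensor_sum (ospace P'' ?r) (\<lambda>x\<^sub>1 x\<^sub>2. ocomp P'' p q i (?\<Psi> p x\<^sub>1 u) (?\<Psi> q x\<^sub>2 v))
            (comult ?T (pure K (cspace C) (cspace C') x x'))"
        using x x' uv C.ocomp[OF i x u v] by (simp add: pure comult_tensor_coalg)
    qed
  next
    have counit_pure: "counit ?T (pure K (cspace C) (cspace C') x x') = counit C x \<otimes>\<^bsub>K\<^esub> counit C' x'"
      if "x \<in> carrier (cspace C)" "x' \<in> carrier (cspace C')" for x x'
      by (rule lin_counit_tensor(2)[OF C.space C'.space C.counit_linear C'.counit_linear that])
    have cl: "counit C x \<in> carrier K" if "x \<in> carrier (cspace C)" for x
      using lin_closed[OF C.counit_linear that] by simp
    have cl': "counit C' x \<in> carrier K" if "x \<in> carrier (cspace C')" for x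
      using lin_closed[OF C'.counit_linear that] by simp
    \<comment> \<open>One argument serves \<open>omult\<close> and \<open>ounit\<close>: each
      measuring multiplies the distinguished element by its counit, and on pure tensors the counits
      multiply.\<close>
    have gen: "?\<Psi> n t m = counit ?T t \<odot>\<^bsub>ospace P'' n\<^esub> m''"
      if t: "t \<in> carrier (cspace ?T)" and m: "m \<in> carrier (ospace P n)" "m' \<in> carrier (ospace P' n)" "m'' \<in> carrier (ospace P'' n)"
        and \<Psi>m: "\<And>x. x \<in> carrier (cspace C) \<Longrightarrow> \<Psi> n x m = counit C x \<odot>\<^bsub>ospace P' n\<^esub> m'"
        and \<Psi>'m: "\<And>x. x \<in> carrier (cspace C') \<Longrightarrow> \<Psi>' n x m' = counit C' x \<odot>\<^bsub>ospace P'' n\<^esub> m''"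
      for n t m m' m''
    proof (rule tensor_ext_vec[OF C.space C'.space P''.space lin_Vect_apply[OF lin m(1)] _ _ t[simplified]])
      interpret P''n: module K "ospace P'' n" by (rule P''.space)
      show "lin_map ?X (ospace P'' n) (\<lambda>t. counit ?T t \<odot>\<^bsub>ospace P'' n\<^esub> m'')"
        using T.counit_linear m by (intro lin_smult_scalar) simp_all
      fix x x' assume x: "x \<in> carrier (cspace C)" and x': "x' \<in> carrier (cspace C')"
      show "?\<Psi> n (pure K (cspace C) (cspace C') x x') m =
          counit ?T (pure K (cspace C) (cspace C') x x') \<odot>\<^bsub>ospace P'' n\<^esub> m''"
        using x x' m cl cl' lin_smult[OF linear_map_Vect[OF lin_closed[OF C'.linear x']]]
        by (simp add: pure counit_pure \<Psi>m \<Psi>'m P''n.smult_assoc1)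
    qed
    fix t assume t: "t \<in> carrier (cspace ?T)"
    show "?\<Psi> 2 t (omult P) = counit ?T t \<odot>\<^bsub>ospace P'' 2\<^esub> omult P''"
      by (rule gen[OF t P.omult_closed P'.omult_closed P''.omult_closed C.omult C'.omult])
    show "?\<Psi> 0 t (ounit P) = counit ?T t \<odot>\<^bsub>ospace P'' 0\<^esub> ounit P''"
      by (rule gen[OF t P.ounit_closed P'.ounit_closed P''.ounit_closed C.ounit C'.ounit])
  qed
qed

text \<open>The pattern of \<open>operad_measuring_composite\<close>, with coactions of
  \<open>D\<close> and \<open>D'\<close> in place of comultiplications. The cyclic condition
  involves no Sweedler sum and passes through two successive maps directly.\<close>

lemma comodule_measuring_composite:
  assumes P: "operad_with_multiplication K P" and P': "operad_with_multiplication K P'"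
    and P'': "operad_with_multiplication K P''"
    and C: "operad_measuring K P P' C \<Psi>" and C': "operad_measuring K P' P'' C' \<Psi>'"
    and L: "cyclic_comp_module K P L" and L': "cyclic_comp_module K P' L'" and L'': "cyclic_comp_module K P'' L''"
    and D: "comodule_measuring K P C \<Psi> L L' D \<Omega>" and D': "comodule_measuring K P' C' \<Psi>' L' L'' D' \<Omega>'"
  shows "comodule_measuring K P (tensor_coalg K C C') (\<lambda>n. composite (ospace P n) (ospace P'' n) (\<Psi> n) (\<Psi>' n))
    L L'' (tensor_comod K C D C' D') (\<lambda>n. composite (lspace L n) (lspace L'' n) (\<Omega> n) (\<Omega>' n))"
proof -
  interpret P: operad_with_multiplication K P by fact
  interpret P': operad_with_multiplication K P' by fact
  interpret P'': operad_with_multiplication K P'' by fact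
  interpret C: operad_measuring K P P' C \<Psi> by fact
  interpret C': operad_measuring K P' P'' C' \<Psi>' by fact
  interpret L: cyclic_comp_module K P L by fact
  interpret L': cyclic_comp_module K P' L' by fact
  interpret L'': cyclic_comp_module K P'' L'' by fact
  interpret D: comodule_measuring K P C \<Psi> L L' D \<Omega> by fact
  interpret D': comodule_measuring K P' C' \<Psi>' L' L'' D' \<Omega>' by fact
  let ?T = "tensor_coalg K C C'" and ?X = "cspace C \<otimes>\<^sub>K cspace C'"
  let ?E = "tensor_comod K C D C' D'" and ?Y = "dspace D \<otimes>\<^sub>K dspace D'"
  let ?\<Psi> = "\<lambda>n. composite (ospace P n) (ospace P'' n) (\<Psi> n) (\<Psi>' n)"
  let ?\<Omega> = "\<lambda>n. composite (lspace L n) (lspace L'' n) (\<Omega> n) (\<Omega>' n)"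
  note [simp] = C.space C'.space D.space D'.space D.coact_linear D'.coact_linear
    lin_closed[OF D.coact_linear] lin_closed[OF D'.coact_linear] P.space P'.space P''.space L.space L'.space L''.space
  have E: "comodule K ?T ?E"
    by (rule comodule_tensor[OF C.coalgebra_axioms C'.coalgebra_axioms D.comodule_axioms D'.comodule_axioms])
  then interpret E: comodule K ?T ?E .
  have lin: "lin_map ?X (Vect K (ospace P n) (ospace P'' n)) (?\<Psi> n)" for n
    by (rule lin_composite[OF C.space C'.space P.space P'.space P''.space C.linear C'.linear])
  have linO: "lin_map ?Y (Vect K (lspace L n) (lspace L'' n)) (?\<Omega> n)" for n
    by (rule lin_composite[OF D.space D'.space L.space L'.space L''.space D.linear D'.linear])
  have pure: "?\<Psi> n (pure K (cspace C) (cspace C') x x') u = \<Psi>' n x' (\<Psi> n x u)"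
    if "x \<in> carrier (cspace C)" "x' \<in> carrier (cspace C')" "u \<in> carrier (ospace P n)" for n x x' u
    using composite_pure[OF C.space C'.space P.space P'.space P''.space C.linear C'.linear that(1,2)] that(3)
    by (simp add: compose_eq)
  have pureO: "?\<Omega> n (pure K (dspace D) (dspace D') y y') l = \<Omega>' n y' (\<Omega> n y l)"
    if "y \<in> carrier (dspace D)" "y' \<in> carrier (dspace D')" "l \<in> carrier (lspace L n)" for n y y' l
    using composite_pure[OF D.space D'.space L.space L'.space L''.space D.linear D'.linear that(1,2)] that(3)
    by (simp add: compose_eq)
  have \<Omega>_closed: "\<Omega> n y l \<in> carrier (lspace L' n)" if "y \<in> carrier (dspace D)" "l \<in> carrier (lspace L n)" for n y l
    using lin_closed[OF lin_Vect_apply[OF D.linear that(2)] that(1)] .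
  show ?thesis
  proof (intro comodule_measuring.intro comodule_measuring_axioms.intro E)
    show "lin_map (dspace ?E) (Vect K (lspace L n) (lspace L'' n)) (?\<Omega> n)" for n
      using linO by simp
  next
    fix i p n t u l
    assume i: "i + p \<le> n + (1::nat)" and t: "t \<in> carrier (dspace ?E)"
      and u: "u \<in> carrier (ospace P p)" and l: "l \<in> carrier (lspace L n)"
    let ?r = "n + 1 - p"
    have t': "t \<in> carrier ?Y" using t by simp
    note \<mu> = L.lact_bilinear[OF i] and \<mu>' = L'.lact_bilinear[OF i] and \<mu>'' = L''.lact_bilinear[OF i]
    note ul = bilinear_closed[OF \<mu> u l]
    note b = bilinear_compose[OF \<mu>'' lin_Vect_apply[OF lin u] lin_Vect_apply[OF linO l]]
    show "?\<Omega> ?r t (lact L p n i u l) =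
        tensor_sum (lspace L'' ?r) (\<lambda>y\<^sub>0 y\<^sub>1. lact L'' p n i (?\<Psi> p y\<^sub>0 u) (?\<Omega> n y\<^sub>1 l)) (coact ?E t)"
    proof (rule tensor_ext_vec[OF D.space D'.space L''.space _ _ _ t'])
      show "lin_map ?Y (lspace L'' ?r) (\<lambda>t. ?\<Omega> ?r t (lact L p n i u l))"
        by (rule lin_Vect_apply[OF linO ul])
      show "lin_map ?Y (lspace L'' ?r) (\<lambda>t.
          tensor_sum (lspace L'' ?r) (\<lambda>y\<^sub>0 y\<^sub>1. lact L'' p n i (?\<Psi> p y\<^sub>0 u) (?\<Omega> n y\<^sub>1 l)) (coact ?E t))"
        using E.coact_linear by (intro lin_tensor_sum_compose[OF _ _ _ b]) simp_all
      fix y y' assume y: "y \<in> carrier (dspace D)" and y': "y' \<in> carrier (dspace D')"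
      have e: "lin_map (lspace L' ?r) (lspace L'' ?r) (\<Omega>' ?r y')"
        by (rule linear_map_Vect[OF lin_closed[OF D'.linear y']])
      have "\<Omega>' ?r y' (tensor_sum (lspace L' ?r) (\<lambda>y\<^sub>0 y\<^sub>1. lact L' p n i (\<Psi> p y\<^sub>0 u) (\<Omega> n y\<^sub>1 l)) (coact D y)) =
          tensor_sum (lspace L'' ?r) (\<lambda>z w. lact L'' p n i (?\<Psi> p z u) (?\<Omega> n w l))
            (interchange K (cspace C) (dspace D) (cspace C') (dspace D')
              (pure K (cspace C \<otimes>\<^sub>K dspace D) (cspace C' \<otimes>\<^sub>K dspace D') (coact D y) (coact D' y')))"
        by (rule interchange_sum[OF C.space C'.space D.space D'.space L'.space L''.space
              lin_Vect_apply[OF C.linear u] lin_Vect_apply[OF D.linear l] e \<mu>' \<mu>''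
              lin_Vect_apply[OF lin u] lin_Vect_apply[OF linO l]
              lin_Vect_apply[OF C'.linear] lin_Vect_apply[OF D'.linear]])
          (use y y' u l D'.lact[OF i y'] in \<open>simp_all add: pure pureO\<close>)
      then show "?\<Omega> ?r (pure K (dspace D) (dspace D') y y') (lact L p n i u l) =
          tensor_sum (lspace L'' ?r) (\<lambda>y\<^sub>0 y\<^sub>1. lact L'' p n i (?\<Psi> p y\<^sub>0 u) (?\<Omega> n y\<^sub>1 l))
            (coact ?E (pure K (dspace D) (dspace D') y y'))"
        using y y' D.lact[OF i y u l] ul by (simp add: pureO)
    qed
  next
    fix t n l assume t: "t \<in> carrier (dspace ?E)" and l: "l \<in> carrier (lspace L n)"
    have t': "t \<in> carrier ?Y" using t by simp
    note cl = lin_closed[OF L.lcyc_linear l]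
    show "?\<Omega> n t (lcyc L n l) = lcyc L'' n (?\<Omega> n t l)"
    proof (rule tensor_ext_vec[OF D.space D'.space L''.space _ _ _ t'])
      show "lin_map ?Y (lspace L'' n) (\<lambda>t. ?\<Omega> n t (lcyc L n l))"
        by (rule lin_Vect_apply[OF linO cl])
      show "lin_map ?Y (lspace L'' n) (\<lambda>t. lcyc L'' n (?\<Omega> n t l))"
        by (rule lin_compose[OF L''.lcyc_linear lin_Vect_apply[OF linO l]])
    qed (simp add: pureO l cl D.lcyc D'.lcyc \<Omega>_closed)
  qed
qed

text \<open>Serves uniqueness: the universal property speaks of measurings, so a coalgebra morphism
  into \<open>M\<close> first has to be turned into one.\<close>

lemma operad_measuring_pullback:
  assumes P': "operad_with_multiplication K P'" and M: "operad_measuring K P P' M \<Phi>"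
    and C: "cocommutative_coalgebra K C" and f: "coalgebra_hom K C M f"
  shows "operad_measuring K P P' C (\<lambda>n x. \<Phi> n (f x))"
proof -
  interpret P': operad_with_multiplication K P' by fact
  interpret M: operad_measuring K P P' M \<Phi> by fact
  interpret C: cocommutative_coalgebra K C by fact
  have fl: "lin_map (cspace C) (cspace M) f" and
    fc: "\<And>x. x \<in> carrier (cspace C) \<Longrightarrow> comult M (f x) = tensor_map K (cspace C) (cspace C) (cspace M) (cspace M) f f (comult C x)"
    and fe: "\<And>x. x \<in> carrier (cspace C) \<Longrightarrow> counit M (f x) = counit C x"
    using f by (simp_all add: coalgebra_hom_def linear_map_Vect)
  show ?thesis
  proof (intro operad_measuring.intro operad_measuring_axioms.intro C)
    show "lin_map (cspace C) (Vect K (ospace P n) (ospace P' n)) (\<lambda>x. \<Phi> n (f x))" for n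
      by (rule lin_compose[OF M.linear fl])
  next
    fix i x u p v q
    assume i: "(1::nat) \<le> i" and x: "x \<in> carrier (cspace C)"
      and u: "u \<in> carrier (ospace P p)" and v: "v \<in> carrier (ospace P q)"
    show "\<Phi> (p + q - 1) (f x) (ocomp P p q i u v) =
        tensor_sum (ospace P' (p + q - 1)) (\<lambda>x\<^sub>1 x\<^sub>2. ocomp P' p q i (\<Phi> p (f x\<^sub>1) u) (\<Phi> q (f x\<^sub>2) v)) (comult C x)"
      using M.ocomp[OF i lin_closed[OF fl x] u v] fc[OF x] lin_closed[OF C.comult_linear x]
        tensor_sum_tensor_map[OF C.space C.space M.space M.space P'.space
          bilinear_compose[OF P'.ocomp_bilinear[OF i] lin_Vect_apply[OF M.linear u] lin_Vect_apply[OF M.linear v]] fl fl]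
      by simp
  qed (simp_all add: fe M.omult M.ounit lin_closed[OF fl])
qed

text \<open>Both sides of coassociativity over \<open>M\<close> are images, under
  \<open>f \<otimes> (f \<otimes> id)\<close>, of the corresponding sides over
  \<open>C\<close>.\<close>

lemma comodule_corestriction:
  assumes C: "coalgebra K C" and M: "coalgebra K M" and f: "coalgebra_hom K C M f" and D: "comodule K C D"
  shows "comodule K M (corestriction K C M f D)"
proof -
  interpret C: coalgebra K C by fact
  interpret M: coalgebra K M by fact
  interpret D: comodule K C D by fact
  have fl: "lin_map (cspace C) (cspace M) f" and
    fc: "\<And>x. x \<in> carrier (cspace C) \<Longrightarrow> comult M (f x) = tensor_map K (cspace C) (cspace C) (cspace M) (cspace M) f f (comult C x)"
    and fe: "\<And>x. x \<in> carrier (cspace C) \<Longrightarrow> counit M (f x) = counit C x"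
    using f by (simp_all add: coalgebra_hom_def linear_map_Vect)
  let ?C = "cspace C" and ?M = "cspace M" and ?D = "dspace D"
  let ?f = "tensor_map K ?C ?D ?M ?D f id" and ?E = "corestriction K C M f D"
  let ?ff = "tensor_map K ?C (?C \<otimes>\<^sub>K ?D) ?M (?M \<otimes>\<^sub>K ?D) f ?f"
  have E: "dspace ?E = ?D" "coact ?E = (\<lambda>y. ?f (coact D y))" by (simp_all add: corestriction_def)
  note [simp] = C.space M.space D.space C.comult_linear M.comult_linear D.coact_linear fl lin_closed[OF fl]
    lin_closed[OF C.comult_linear] lin_closed[OF M.comult_linear] lin_closed[OF D.coact_linear]
  have lE: "lin_map ?D (?M \<otimes>\<^sub>K ?D) (coact ?E)"
    unfolding E by (intro lin_tensor_map) simp_all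
  show ?thesis
  proof (rule comodule.intro)
    show "module K (dspace ?E)" "lin_map (dspace ?E) (?M \<otimes>\<^sub>K dspace ?E) (coact ?E)"
      using lE by (simp_all add: E(1))
  next
    fix y assume "y \<in> carrier (dspace ?E)"
    then have y: "y \<in> carrier ?D" by (simp add: E)
    let ?s = "coact D y"
    have s: "?s \<in> carrier (?C \<otimes>\<^sub>K ?D)" using y by simp
    have "\<forall>s\<in>carrier (?C \<otimes>\<^sub>K ?D). associator K ?M ?M ?D (tensor_map K ?M ?D (?M \<otimes>\<^sub>K ?M) ?D (comult M) id (?f s)) =
        ?ff (associator K ?C ?C ?D (tensor_map K ?C ?D (?C \<otimes>\<^sub>K ?C) ?D (comult C) id s))"
    proof (rule tensor_ext[where Z = "?M \<otimes>\<^sub>K (?M \<otimes>\<^sub>K ?D)"])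
      fix x w assume x: "x \<in> carrier ?C" and w: "w \<in> carrier ?D"
      have "\<forall>t\<in>carrier (?C \<otimes>\<^sub>K ?C).
          associator K ?M ?M ?D (pure K (?M \<otimes>\<^sub>K ?M) ?D (tensor_map K ?C ?C ?M ?M f f t) w) =
          ?ff (associator K ?C ?C ?D (pure K (?C \<otimes>\<^sub>K ?C) ?D t w))"
        by (rule tensor_ext[where Z = "?M \<otimes>\<^sub>K (?M \<otimes>\<^sub>K ?D)"]) (simp_all add: w)
      then show "associator K ?M ?M ?D (tensor_map K ?M ?D (?M \<otimes>\<^sub>K ?M) ?D (comult M) id (?f (pure K ?C ?D x w))) =
          ?ff (associator K ?C ?C ?D (tensor_map K ?C ?D (?C \<otimes>\<^sub>K ?C) ?D (comult C) id (pure K ?C ?D x w)))"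
        using x w by (simp add: fc)
    qed simp_all
    then have "associator K ?M ?M ?D (tensor_map K ?M ?D (?M \<otimes>\<^sub>K ?M) ?D (comult M) id (?f ?s)) =
        ?ff (tensor_map K ?C ?D ?C (?C \<otimes>\<^sub>K ?D) id (coact D) ?s)"
      using s D.coact_coassoc[OF y] by simp
    also have "\<forall>s\<in>carrier (?C \<otimes>\<^sub>K ?D). ?ff (tensor_map K ?C ?D ?C (?C \<otimes>\<^sub>K ?D) id (coact D) s) =
        tensor_map K ?M ?D ?M (?M \<otimes>\<^sub>K ?D) id (coact ?E) (?f s)"
      by (rule tensor_ext[where Z = "?M \<otimes>\<^sub>K (?M \<otimes>\<^sub>K ?D)"]) (use lE in \<open>simp_all add: E(2)\<close>)
    then have "?ff (tensor_map K ?C ?D ?C (?C \<otimes>\<^sub>K ?D) id (coact D) ?s) =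
        tensor_map K ?M ?D ?M (?M \<otimes>\<^sub>K ?D) id (coact ?E) (?f ?s)"
      using s by blast
    finally show "associator K (cspace M) (cspace M) (dspace ?E)
        (tensor_map K (cspace M) (dspace ?E) (?M \<otimes>\<^sub>K ?M) (dspace ?E) (comult M) id (coact ?E y)) =
        tensor_map K (cspace M) (dspace ?E) (cspace M) (?M \<otimes>\<^sub>K dspace ?E) id (coact ?E) (coact ?E y)"
      by (simp add: E)
    have "\<forall>s\<in>carrier (?C \<otimes>\<^sub>K ?D). tensor_sum ?D (\<lambda>x w. counit M x \<odot>\<^bsub>?D\<^esub> w) (?f s) =
        tensor_sum ?D (\<lambda>x w. counit C x \<odot>\<^bsub>?D\<^esub> w) s"
      by (rule tensor_ext[where Z = ?D])
        (simp_all add: lin_tensor_sum_compose[OF _ _ _ bilinear_counit[OF D.space M.counit_linear]]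
          lin_tensor_sum[OF _ _ _ bilinear_counit[OF D.space C.counit_linear]]
          tensor_sum_pure[OF _ _ _ bilinear_counit[OF D.space M.counit_linear]]
          tensor_sum_pure[OF _ _ _ bilinear_counit[OF D.space C.counit_linear]] fe)
    then show "tensor_sum (dspace ?E) (\<lambda>y\<^sub>0 y\<^sub>1. counit M y\<^sub>0 \<odot>\<^bsub>dspace ?E\<^esub> y\<^sub>1) (coact ?E y) = y"
      using s D.coact_counit[OF y] by (simp add: E)
  qed
qed

text \<open>Brings a measuring over an arbitrary \<open>C\<close> over the universal coalgebra
  without changing \<Omega>; only there can \<open>univ_factor\<close> be applied.\<close>

lemma comodule_measuring_corestriction:
  assumes M: "operad_measuring K P P' M \<Phi>" and C: "coalgebra K C" and f: "coalgebra_hom K C M f"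
    and \<Psi>: "\<And>n x. x \<in> carrier (cspace C) \<Longrightarrow> \<Psi> n x = \<Phi> n (f x)"
    and L': "cyclic_comp_module K P' L'" and D: "comodule_measuring K P C \<Psi> L L' D \<Omega>"
  shows "comodule_measuring K P M \<Phi> L L' (corestriction K C M f D) \<Omega>"
proof -
  interpret M: operad_measuring K P P' M \<Phi> by fact
  interpret C: coalgebra K C by fact
  interpret L': cyclic_comp_module K P' L' by fact
  interpret D: comodule_measuring K P C \<Psi> L L' D \<Omega> by fact
  have fl: "lin_map (cspace C) (cspace M) f"
    using f by (simp add: coalgebra_hom_def linear_map_Vect)
  let ?E = "corestriction K C M f D"
  have E: "dspace ?E = dspace D" "coact ?E = (\<lambda>y. tensor_map K (cspace C) (dspace D) (cspace M) (dspace D) f id (coact D y))"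
    by (simp_all add: corestriction_def)
  show ?thesis
  proof (intro comodule_measuring.intro comodule_measuring_axioms.intro)
    show "comodule K M ?E"
      by (rule comodule_corestriction[OF C M.coalgebra_axioms f D.comodule_axioms])
    show "lin_map (dspace ?E) (Vect K (lspace L n) (lspace L' n)) (\<Omega> n)" for n
      using D.linear by (simp add: E)
    show "\<Omega> n y (lcyc L n l) = lcyc L' n (\<Omega> n y l)" if "y \<in> carrier (dspace ?E)" "l \<in> carrier (lspace L n)" for n y l
      using D.lcyc that by (simp add: E)
    fix i p n y u l
    assume i: "i + p \<le> n + (1::nat)" and "y \<in> carrier (dspace ?E)"
      and u: "u \<in> carrier (ospace P p)" and l: "l \<in> carrier (lspace L n)"
    then have y: "y \<in> carrier (dspace D)" by (simp add: E)
    let ?Z = "lspace L' (n + 1 - p)"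
    note b = bilinear_compose[OF L'.lact_bilinear[OF i] lin_Vect_apply[OF M.linear u] lin_Vect_apply[OF D.linear l]]
    note b' = bilinear_compose[OF b fl lin_id]
    \<comment> \<open>\<open>\<Psi>\<close> is tied to \<open>\<Phi>\<close> and \<open>f\<close> on
      the carrier of \<open>C\<close> only, so bilinearity is transferred by congruence.\<close>
    have b'': "bilinear_map K (cspace C) (dspace D) ?Z (\<lambda>x w. lact L' p n i (\<Psi> p x u) (\<Omega> n w l))"
    proof (rule bilinear_mapI)
      show "lin_map (dspace D) ?Z (\<lambda>w. lact L' p n i (\<Psi> p x u) (\<Omega> n w l))" if "x \<in> carrier (cspace C)" for x
        using bilinear_right[OF b' that] \<Psi>[OF that] by simp
      show "lin_map (cspace C) ?Z (\<lambda>x. lact L' p n i (\<Psi> p x u) (\<Omega> n w l))" if "w \<in> carrier (dspace D)" for w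
        using bilinear_left[OF b' that] by (subst linear_map_cong[OF C.space]) (simp_all add: \<Psi>)
    qed
    have "tensor_sum ?Z (\<lambda>x w. lact L' p n i (\<Phi> p x u) (\<Omega> n w l)) (coact ?E y) =
        tensor_sum ?Z (\<lambda>x w. lact L' p n i (\<Phi> p (f x) u) (\<Omega> n w l)) (coact D y)"
      using tensor_sum_tensor_map[OF C.space D.space M.space D.space L'.space b fl lin_id']
        lin_closed[OF D.coact_linear y] by (simp add: E)
    also have "\<dots> = tensor_sum ?Z (\<lambda>x w. lact L' p n i (\<Psi> p x u) (\<Omega> n w l)) (coact D y)"
    proof (rule tensor_ext_vec[OF C.space D.space L'.space _ _ _ lin_closed[OF D.coact_linear y]])
      show "lin_map (cspace C \<otimes>\<^sub>K dspace D) ?Z (tensor_sum ?Z (\<lambda>x w. lact L' p n i (\<Phi> p (f x) u) (\<Omega> n w l)))"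
        "lin_map (cspace C \<otimes>\<^sub>K dspace D) ?Z (tensor_sum ?Z (\<lambda>x w. lact L' p n i (\<Psi> p x u) (\<Omega> n w l)))"
        by (intro lin_tensor_sum C.space D.space L'.space b' b'')+
      show "tensor_sum ?Z (\<lambda>x w. lact L' p n i (\<Phi> p (f x) u) (\<Omega> n w l)) (pure K (cspace C) (dspace D) x w) =
          tensor_sum ?Z (\<lambda>x w. lact L' p n i (\<Psi> p x u) (\<Omega> n w l)) (pure K (cspace C) (dspace D) x w)"
        if "x \<in> carrier (cspace C)" "w \<in> carrier (dspace D)" for x w
        using tensor_sum_pure[OF C.space D.space L'.space b' that] tensor_sum_pure[OF C.space D.space L'.space b'' that]
          \<Psi>[OF that(1)] by simp
    qed
    finally show "\<Omega> (n + 1 - p) y (lact L p n i u l) =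
        tensor_sum ?Z (\<lambda>y\<^sub>0 y\<^sub>1. lact L' p n i (\<Phi> p y\<^sub>0 u) (\<Omega> n y\<^sub>1 l)) (coact ?E y)"
      using D.lact[OF i y u l] by simp
  qed
qed

section \<open>Measurings by the ground field through scalar multiples\<close>

definition scaling :: "('k, 'v) module \<Rightarrow> ('k, 'a) elt \<Rightarrow> 'v \<Rightarrow> 'v" where
  "scaling V a = (\<lambda>v\<in>carrier V. scalar a \<odot>\<^bsub>V\<^esub> v)"

lemma lin_scaling: "vec V \<Longrightarrow> lin_map (unit_space K) (Vect K V V) (scaling V)"
  unfolding scaling_def
  by (rule lin_into_Vect) (simp_all add: restrict_Vect lin_smult_const lin_smult_scalar lin_scalar)

lemma scaling_apply: "v \<in> carrier V \<Longrightarrow> scaling V a v = scalar a \<odot>\<^bsub>V\<^esub> v"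
  by (simp add: scaling_def)

text \<open>The comultiplication of \<open>a\<close> is \<open>a \<otimes> 1\<close>, so the
  Sweedler sum has one term in which only \<open>u\<close> is effectively scaled, and linearity in
  \<open>u\<close> takes the scalar out.\<close>

lemma operad_measuring_unit:
  assumes P: "operad_with_multiplication K P"
  shows "operad_measuring K P P (unit_coalg K) (\<lambda>n. scaling (ospace P n))"
proof -
  interpret P: operad_with_multiplication K P by fact
  show ?thesis
  proof (intro operad_measuring.intro operad_measuring_axioms.intro cocommutative_coalgebra_unit)
    fix i a u p v q
    assume i: "(1::nat) \<le> i" and "a \<in> carrier (cspace (unit_coalg K))"
      and u: "u \<in> carrier (ospace P p)" and v: "v \<in> carrier (ospace P q)"
    then have a: "a \<in> carrier (unit_space K)" by simp
    note b = bilinear_compose[OF P.ocomp_bilinear[OF i] lin_Vect_apply[OF lin_scaling[OF P.space] u]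
        lin_Vect_apply[OF lin_scaling[OF P.space] v]]
    show "scaling (ospace P (p + q - 1)) a (ocomp P p q i u v) =
        tensor_sum (ospace P (p + q - 1)) (\<lambda>x\<^sub>1 x\<^sub>2. ocomp P p q i (scaling (ospace P p) x\<^sub>1 u) (scaling (ospace P q) x\<^sub>2 v))
          (comult (unit_coalg K) a)"
      using a u v lin_smult[OF bilinear_left[OF P.ocomp_bilinear[OF i] v]]
        tensor_sum_pure[OF vec_unit_space vec_unit_space P.space b a Scalar_closed[OF one_closed]]
        bilinear_closed[OF P.ocomp_bilinear[OF i] u v]
      by (simp add: P.space scaling_apply)
  qed (simp_all add: lin_scaling P.space scaling_apply P.omult_closed P.ounit_closed)
qed

text \<open>Here the coaction is \<open>1 \<otimes> a\<close>, so the scalar falls on the module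
  element \<open>l\<close> and comes out by linearity on that side.\<close>

lemma comodule_measuring_unit:
  assumes P: "operad_with_multiplication K P" and L: "cyclic_comp_module K P L"
  shows "comodule_measuring K P (unit_coalg K) (\<lambda>n. scaling (ospace P n)) L L (unit_comod K) (\<lambda>n. scaling (lspace L n))"
proof -
  interpret P: operad_with_multiplication K P by fact
  interpret L: cyclic_comp_module K P L by fact
  show ?thesis
  proof (intro comodule_measuring.intro comodule_measuring_axioms.intro comodule_unit(1))
    fix i p n a u l
    assume i: "i + p \<le> n + (1::nat)" and "a \<in> carrier (dspace (unit_comod K))"
      and u: "u \<in> carrier (ospace P p)" and l: "l \<in> carrier (lspace L n)"
    then have a: "a \<in> carrier (unit_space K)" by simp
    note b = bilinear_compose[OF L.lact_bilinear[OF i] lin_Vect_apply[OF lin_scaling[OF P.space] u]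
        lin_Vect_apply[OF lin_scaling[OF L.space] l]]
    show "scaling (lspace L (n + 1 - p)) a (lact L p n i u l) =
        tensor_sum (lspace L (n + 1 - p)) (\<lambda>y\<^sub>0 y\<^sub>1. lact L p n i (scaling (ospace P p) y\<^sub>0 u) (scaling (lspace L n) y\<^sub>1 l))
          (coact (unit_comod K) a)"
      using a u l lin_smult[OF bilinear_right[OF L.lact_bilinear[OF i] u]]
        tensor_sum_pure[OF vec_unit_space vec_unit_space L.space b Scalar_closed[OF one_closed] a]
        bilinear_closed[OF L.lact_bilinear[OF i] u l]
      by (simp add: P.space L.space scaling_apply)
  qed (simp_all add: lin_scaling L.space scaling_apply lin_closed[OF L.lcyc_linear] lin_smult[OF L.lcyc_linear])
qed

end

section \<open>The enriched category\<close>

locale comp_enrichment = ground_field K + comp_setup K M \<Phi> R \<rho>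
  for K :: "'k ring"
    and M :: "('k, 'o) operad_data \<Rightarrow> ('k, 'o) operad_data \<Rightarrow> ('k, 'a) coalg"
    and \<Phi> :: "('k, 'o) operad_data \<Rightarrow> ('k, 'o) operad_data \<Rightarrow> nat \<Rightarrow> ('k, 'a) elt \<Rightarrow> 'o \<Rightarrow> 'o"
    and R :: "('k, 'o, 'l) comp_obj \<Rightarrow> ('k, 'o, 'l) comp_obj \<Rightarrow> ('k, 'a) comod"
    and \<rho> :: "('k, 'o, 'l) comp_obj \<Rightarrow> ('k, 'o, 'l) comp_obj \<Rightarrow> ('k, 'a) elt \<Rightarrow> nat \<Rightarrow> 'l \<Rightarrow> 'l" +
  assumes universal: "\<lbrakk>operad_with_multiplication K P; operad_with_multiplication K P'\<rbrakk> \<Longrightarrow>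
      universal_measuring K P P' (M P P') (\<Phi> P P')"
    and cofree: "\<lbrakk>X \<in> comp_objects K; Y \<in> comp_objects K\<rbrakk> \<Longrightarrow>
      cofree_comodule K (M (fst X) (fst Y)) (hom_product K X Y) (R X Y) (\<rho> X Y)"
begin

section \<open>The hom-objects and their joint universal property\<close>

abbreviation op where "op X n \<equiv> ospace (fst X) n"
abbreviation md where "md X n \<equiv> lspace (snd X) n"
abbreviation Cs where "Cs X Y \<equiv> fst_space (comp_hom X Y)"
abbreviation Ds where "Ds X Y \<equiv> snd_space (comp_hom X Y)"
abbreviation Ph where "Ph X Y \<equiv> \<Phi> (fst X) (fst Y)"

lemma objectD:
  assumes "X \<in> comp_objects K"
  shows "operad_with_multiplication K (fst X)" "cyclic_comp_module K (fst X) (snd X)"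
    "vec (op X n)" "vec (md X n)"
  using assms by (auto simp: comp_objects_def operad_with_multiplication.space cyclic_comp_module.space)

text \<open>Unlike \<open>Hom_Comod\<close> this keeps the corestriction, the form in which
  \<open>univ_factor\<close> and \<open>univ_unique\<close> deal with comodule maps.\<close>

lemma mem_Hom_Comod: "h \<in> Hom (Comod K) A B \<longleftrightarrow> Dom h = A \<and> Cod h = B \<and>
    coalgebra_hom K (fst A) (fst B) (cmap h) \<and>
    comodule_hom K (fst B) (corestriction K (fst A) (fst B) (cmap h) (snd A)) (snd B) (dmap h)"
  by (simp add: Comod_def)

lemma fst_comp_hom [simp]: "fst (comp_hom X Y) = M (fst X) (fst Y)"
  by (simp add: comp_hom_def)

context
  fixes X Y :: "('k, 'o, 'l) comp_obj"
  assumes X: "X \<in> comp_objects K" and Y: "Y \<in> comp_objects K"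
begin

lemma operad_measuring_M: "operad_measuring K (fst X) (fst Y) (M (fst X) (fst Y)) (Ph X Y)"
  using universal[OF objectD(1)[OF X] objectD(1)[OF Y]] by (simp add: universal_measuring_def)

lemma measuring_setup_XY: "measuring_setup K (fst X) (fst Y) (M (fst X) (fst Y)) (Ph X Y) (snd X) (snd Y) (R X Y) (\<rho> X Y)"
  using operad_measuring_M objectD(2)[OF X] objectD(2)[OF Y] cofree[OF X Y]
  by (intro measuring_setup.intro measuring_setup_axioms.intro)
    (simp_all add: hom_product_def ground_field_axioms)

interpretation U: measuring_setup K "fst X" "fst Y" "M (fst X) (fst Y)" "Ph X Y" "snd X" "snd Y" "R X Y" "\<rho> X Y"
  by (rule measuring_setup_XY)

lemma snd_comp_hom: "snd (comp_hom X Y) = U.univ"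
  by (simp add: comp_hom_def)

lemma Obj_comp_hom: "comp_hom X Y \<in> Obj (Comod K)"
  using U.C.cocommutative_coalgebra_axioms U.comodule_univ by (simp add: Obj_Comod snd_comp_hom)

lemma coalgebra_hom_factor:
  assumes "operad_measuring K (fst X) (fst Y) C \<Psi>"
  obtains f where "coalgebra_hom K C (M (fst X) (fst Y)) f"
    "\<And>n x. x \<in> carrier (cspace C) \<Longrightarrow> \<Psi> n x = Ph X Y n (f x)"
proof -
  have "\<exists>!f. coalgebra_hom K C (M (fst X) (fst Y)) f \<and> (\<forall>n. \<forall>x\<in>carrier (cspace C). \<Psi> n x = Ph X Y n (f x))"
    using universal[OF objectD(1)[OF X] objectD(1)[OF Y]] assms unfolding universal_measuring_def by blast
  then show ?thesis using that by blast
qed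

text \<open>Both morphisms factor the same measuring, namely the pullback of the universal one along
  \<open>f\<close>.\<close>

lemma coalgebra_hom_unique:
  assumes C: "cocommutative_coalgebra K C"
    and f: "coalgebra_hom K C (M (fst X) (fst Y)) f" and f': "coalgebra_hom K C (M (fst X) (fst Y)) f'"
    and eq: "\<And>n x. x \<in> carrier (cspace C) \<Longrightarrow> Ph X Y n (f x) = Ph X Y n (f' x)"
  shows "f = f'"
proof -
  have "operad_measuring K (fst X) (fst Y) C (\<lambda>n x. Ph X Y n (f x))"
    by (rule operad_measuring_pullback[OF objectD(1)[OF Y] operad_measuring_M C f])
  then have "\<exists>!g. coalgebra_hom K C (M (fst X) (fst Y)) g \<and>
      (\<forall>n. \<forall>x\<in>carrier (cspace C). Ph X Y n (f x) = Ph X Y n (g x))"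
    using universal[OF objectD(1)[OF X] objectD(1)[OF Y]] unfolding universal_measuring_def by blast
  then show ?thesis using f f' eq by blast
qed

text \<open>The coalgebra part \<open>f\<close> has to be found first: the comodule measuring is
  corestricted along it before it is factored over the universal coalgebra.\<close>

lemma arrow_factor:
  assumes C: "coalgebra K C" and \<Psi>: "operad_measuring K (fst X) (fst Y) C \<Psi>"
    and \<Omega>: "comodule_measuring K (fst X) C \<Psi> (snd X) (snd Y) D \<Omega>"
  obtains h where "h \<in> Hom (Comod K) (C, D) (comp_hom X Y)"
    "\<And>n x. x \<in> carrier (cspace C) \<Longrightarrow> Ph X Y n (cmap h x) = \<Psi> n x"
    "\<And>n y. y \<in> carrier (dspace D) \<Longrightarrow> \<rho> X Y (dmap h y) n = \<Omega> n y"
proof -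
  obtain f where f: "coalgebra_hom K C (M (fst X) (fst Y)) f"
    and fe: "\<And>n x. x \<in> carrier (cspace C) \<Longrightarrow> \<Psi> n x = Ph X Y n (f x)"
    using coalgebra_hom_factor[OF \<Psi>] by blast
  have "comodule_measuring K (fst X) (M (fst X) (fst Y)) (Ph X Y) (snd X) (snd Y) (corestriction K C (M (fst X) (fst Y)) f D) \<Omega>"
    by (rule comodule_measuring_corestriction[OF operad_measuring_M C f fe objectD(2)[OF Y] \<Omega>])
  then obtain g where g: "comodule_hom K (M (fst X) (fst Y)) (corestriction K C (M (fst X) (fst Y)) f D) U.univ g"
    and ge: "\<And>y n. y \<in> carrier (dspace D) \<Longrightarrow> \<rho> X Y (g y) n = \<Omega> n y"
    by (rule U.univ_factor) (simp add: corestriction_def)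
  show ?thesis
    by (rule that[of "\<lparr>Dom = (C, D), Cod = comp_hom X Y, cmap = f, dmap = g\<rparr>"])
      (use f g fe ge in \<open>simp_all add: mem_Hom_Comod snd_comp_hom\<close>)
qed

text \<open>Equality of the coalgebra parts comes first. Until then the comodule parts start from
  corestrictions along different maps and cannot be compared as morphisms.\<close>

lemma arrow_unique:
  assumes A: "A \<in> Obj (Comod K)"
    and h: "h \<in> Hom (Comod K) A (comp_hom X Y)" and h': "h' \<in> Hom (Comod K) A (comp_hom X Y)"
    and c: "\<And>n x. x \<in> carrier (fst_space A) \<Longrightarrow> Ph X Y n (cmap h x) = Ph X Y n (cmap h' x)"
    and d: "\<And>n y. y \<in> carrier (snd_space A) \<Longrightarrow> \<rho> X Y (dmap h y) n = \<rho> X Y (dmap h' y) n"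
  shows "h = h'"
proof -
  have AC: "cocommutative_coalgebra K (fst A)" "comodule K (fst A) (snd A)"
    using A by (simp_all add: Obj_Comod)
  note hD = h[unfolded mem_Hom_Comod] and h'D = h'[unfolded mem_Hom_Comod]
  have cm: "cmap h = cmap h'"
    using coalgebra_hom_unique[OF AC(1), of "cmap h" "cmap h'"] hD h'D c by simp
  have "dmap h = dmap h'"
  proof (rule U.univ_unique)
    show "comodule K (M (fst X) (fst Y)) (corestriction K (fst A) (M (fst X) (fst Y)) (cmap h) (snd A))"
      using hD by (intro comodule_corestriction[OF _ U.C.coalgebra_axioms _ AC(2)])
        (simp_all add: AC(1) cocommutative_coalgebra_coalgebra)
    show "\<rho> X Y (dmap h y) n = \<rho> X Y (dmap h' y) n"
      if "y \<in> carrier (dspace (corestriction K (fst A) (M (fst X) (fst Y)) (cmap h) (snd A)))" for y n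
      using that d by (simp add: corestriction_def)
  qed (use hD h'D cm in \<open>simp_all add: snd_comp_hom\<close>)
  then show ?thesis using cm hD h'D by (intro comod_arr.equality) simp_all
qed

lemma lin_Phi: "lin_map (Cs X Y) (Vect K (op X n) (op Y n)) (Ph X Y n)"
  using U.C.linear by simp

lemma comodule_measuring_comp_hom:
  "comodule_measuring K (fst X) (M (fst X) (fst Y)) (Ph X Y) (snd X) (snd Y) (snd (comp_hom X Y)) (\<lambda>n y. \<rho> X Y y n)"
  using U.univ_measuring by (simp add: snd_comp_hom)

lemma lin_rho: "lin_map (Ds X Y) (Vect K (md X n) (md Y n)) (\<lambda>y. \<rho> X Y y n)"
  by (rule comodule_measuring.linear[OF comodule_measuring_comp_hom])

lemma vec_comp_hom: "vec (Cs X Y)" "vec (Ds X Y)"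
  using Obj_vec[OF Obj_comp_hom] by simp_all

lemma lin_Phi_arrow:
  assumes "A \<in> Obj (Comod K)" "h \<in> Hom (Comod K) A (comp_hom X Y)"
  shows "lin_map (fst_space A) (Vect K (op X n) (op Y n)) (\<lambda>x. Ph X Y n (cmap h x))"
    and "lin_map (snd_space A) (Vect K (md X n) (md Y n)) (\<lambda>y. \<rho> X Y (dmap h y) n)"
  using comod_homD(3,4)[OF HomD(3)[OF assms(1) Obj_comp_hom assms(2)]]
  by (intro lin_compose[OF lin_Phi] lin_compose[OF lin_rho]; simp)+

text \<open>Induced compositions are specified on pure tensors only, and so are the unitors known;
  this uniqueness principle matches such data.\<close>

lemma arrow_unique_tensor:
  assumes A: "A \<in> Obj (Comod K)" and B: "B \<in> Obj (Comod K)"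
    and h: "h \<in> Hom (Comod K) (tensor_obj K A B) (comp_hom X Y)" and h': "h' \<in> Hom (Comod K) (tensor_obj K A B) (comp_hom X Y)"
    and c: "\<And>n x x'. \<lbrakk>x \<in> carrier (fst_space A); x' \<in> carrier (fst_space B)\<rbrakk> \<Longrightarrow>
      Ph X Y n (cmap h (pure K (fst_space A) (fst_space B) x x')) =
      Ph X Y n (cmap h' (pure K (fst_space A) (fst_space B) x x'))"
    and d: "\<And>n y y'. \<lbrakk>y \<in> carrier (snd_space A); y' \<in> carrier (snd_space B)\<rbrakk> \<Longrightarrow>
      \<rho> X Y (dmap h (pure K (snd_space A) (snd_space B) y y')) n =
      \<rho> X Y (dmap h' (pure K (snd_space A) (snd_space B) y y')) n"
  shows "h = h'"
proof (rule arrow_unique[OF Obj_tensor[OF A B] h h'])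
  note T = Obj_tensor[OF A B]
  note l = lin_Phi_arrow[OF T h, simplified] and l' = lin_Phi_arrow[OF T h', simplified]
  show "Ph X Y n (cmap h x) = Ph X Y n (cmap h' x)" if "x \<in> carrier (fst_space (tensor_obj K A B))" for n x
    by (rule tensor_ext_vec[OF Obj_vec(1)[OF A] Obj_vec(1)[OF B] _ l(1) l'(1) c])
      (use that objectD[OF X] objectD[OF Y] in simp_all)
  show "\<rho> X Y (dmap h y) n = \<rho> X Y (dmap h' y) n" if "y \<in> carrier (snd_space (tensor_obj K A B))" for n y
    by (rule tensor_ext_vec[OF Obj_vec(2)[OF A] Obj_vec(2)[OF B] _ l(2) l'(2) d])
      (use that objectD[OF X] objectD[OF Y] in simp_all)
qed

end

section \<open>Induced compositions and identities\<close>

lemma induced_composition_ex1: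
  assumes X: "X \<in> comp_objects K" and Y: "Y \<in> comp_objects K" and Z: "Z \<in> comp_objects K"
  shows "\<exists>!h. induced_composition X Y Z h"
proof -
  let ?A = "comp_hom X Y" and ?B = "comp_hom Y Z"
  note A = Obj_comp_hom[OF X Y] and B = Obj_comp_hom[OF Y Z]
  note vX = objectD(3,4)[OF X] and vY = objectD(3,4)[OF Y] and vZ = objectD(3,4)[OF Z]
  have T: "(tensor_coalg K (fst ?A) (fst ?B), tensor_comod K (fst ?A) (snd ?A) (fst ?B) (snd ?B)) = tensor_obj K ?A ?B"
    by (simp add: tensor_obj_def)
  have m: "operad_measuring K (fst X) (fst Z) (tensor_coalg K (fst ?A) (fst ?B)) (\<lambda>n. composite (op X n) (op Z n) (Ph X Y n) (Ph Y Z n))"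
    using operad_measuring_composite[OF objectD(1)[OF X] objectD(1)[OF Y] objectD(1)[OF Z]
        operad_measuring_M[OF X Y] operad_measuring_M[OF Y Z]] by simp
  have m': "comodule_measuring K (fst X) (tensor_coalg K (fst ?A) (fst ?B)) (\<lambda>n. composite (op X n) (op Z n) (Ph X Y n) (Ph Y Z n))
      (snd X) (snd Z) (tensor_comod K (fst ?A) (snd ?A) (fst ?B) (snd ?B))
      (\<lambda>n. composite (md X n) (md Z n) (\<lambda>y. \<rho> X Y y n) (\<lambda>y. \<rho> Y Z y n))"
    using comodule_measuring_composite[OF objectD(1)[OF X] objectD(1)[OF Y] objectD(1)[OF Z]
        operad_measuring_M[OF X Y] operad_measuring_M[OF Y Z] objectD(2)[OF X] objectD(2)[OF Y] objectD(2)[OF Z]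
        comodule_measuring_comp_hom[OF X Y] comodule_measuring_comp_hom[OF Y Z]] by simp
  have co: "coalgebra K (tensor_coalg K (fst ?A) (fst ?B))"
    using Obj_tensor[OF A B] by (simp add: Obj_Comod cocommutative_coalgebra_coalgebra)
  obtain h where h: "h \<in> Hom (Comod K) (tensor_obj K ?A ?B) (comp_hom X Z)"
    and hc: "\<And>n x. x \<in> carrier (Cs X Y \<otimes>\<^sub>K Cs Y Z) \<Longrightarrow>
      Ph X Z n (cmap h x) = composite (op X n) (op Z n) (Ph X Y n) (Ph Y Z n) x"
    and hd: "\<And>n y. y \<in> carrier (Ds X Y \<otimes>\<^sub>K Ds Y Z) \<Longrightarrow>
      \<rho> X Z (dmap h y) n = composite (md X n) (md Z n) (\<lambda>y. \<rho> X Y y n) (\<lambda>y. \<rho> Y Z y n) y"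
    by (rule arrow_factor[OF X Z co m m', unfolded T tensor_obj_simps]) blast
  note cp = composite_pure[OF vec_comp_hom(1)[OF X Y] vec_comp_hom(1)[OF Y Z] vX(1) vY(1) vZ(1) lin_Phi[OF X Y] lin_Phi[OF Y Z]]
  note dp = composite_pure[OF vec_comp_hom(2)[OF X Y] vec_comp_hom(2)[OF Y Z] vX(2) vY(2) vZ(2) lin_rho[OF X Y] lin_rho[OF Y Z]]
  have "induced_composition X Y Z h"
    unfolding induced_composition_def Comod_simps
    using h hc[OF pure_closed] hd[OF pure_closed] cp dp by simp
  then show ?thesis
  proof (rule ex1I)
    fix h' assume h': "induced_composition X Y Z h'"
    show "h' = h"
    proof (rule arrow_unique_tensor[OF X Z A B _ h])
      show "h' \<in> Hom (Comod K) (tensor_obj K ?A ?B) (comp_hom X Z)"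
        using h' by (simp add: induced_composition_def Comod_simps)
    qed (use h' \<open>induced_composition X Y Z h\<close> in \<open>simp_all add: induced_composition_def\<close>)
  qed
qed

lemma induced_identity_ex1:
  assumes X: "X \<in> comp_objects K"
  shows "\<exists>!h. induced_identity X h"
proof -
  note vX = objectD(3,4)[OF X]
  have U: "(unit_coalg K, unit_comod K) = unit_obj K" by (simp add: unit_obj_def)
  obtain h where h: "h \<in> Hom (Comod K) (unit_obj K) (comp_hom X X)"
    and hc: "\<And>n a. a \<in> carrier (unit_space K) \<Longrightarrow> Ph X X n (cmap h a) = scaling (op X n) a"
    and hd: "\<And>n a. a \<in> carrier (unit_space K) \<Longrightarrow> \<rho> X X (dmap h a) n = scaling (md X n) a"
    by (rule arrow_factor[OF X X cocommutative_coalgebra_coalgebra[OF cocommutative_coalgebra_unit]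
          operad_measuring_unit[OF objectD(1)[OF X]] comodule_measuring_unit[OF objectD(1,2)[OF X]],
          unfolded U unit_obj_simps]) blast
  have "induced_identity X h"
    unfolding induced_identity_def Comod_simps
    using h hc[OF Scalar_closed] hd[OF Scalar_closed] by (simp add: scaling_def)
  then show ?thesis
  proof (rule ex1I)
    fix h' assume h': "induced_identity X h'"
    show "h' = h"
    \<comment> \<open>Every element of the unit space has the form \<open>Scalar a\<close>, so the
      equations defining \<open>induced_identity\<close> cover the whole source.\<close>
    proof (rule arrow_unique[OF X X Obj_unit _ h])
      show "h' \<in> Hom (Comod K) (unit_obj K) (comp_hom X X)"
        using h' by (simp add: induced_identity_def Comod_simps)
    qed (use h' \<open>induced_identity X h\<close> in \<open>auto simp: induced_identity_def unit_space_def\<close>)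
  qed
qed

abbreviation cmp where "cmp X Y Z \<equiv> EComp comp_category X Y Z"
abbreviation idt where "idt X \<equiv> EId comp_category X"

context
  fixes X Y Z :: "('k, 'o, 'l) comp_obj"
  assumes X: "X \<in> comp_objects K" and Y: "Y \<in> comp_objects K" and Z: "Z \<in> comp_objects K"
begin

lemma cmp_induced: "induced_composition X Y Z (cmp X Y Z)"
  using theI'[OF induced_composition_ex1[OF X Y Z]] by (simp add: comp_category_def)

lemma cmp_Hom: "cmp X Y Z \<in> Hom (Comod K) (tensor_obj K (comp_hom X Y) (comp_hom Y Z)) (comp_hom X Z)"
  using cmp_induced by (simp add: induced_composition_def Comod_simps)

lemma cmp_Phi:
  "\<lbrakk>x \<in> carrier (Cs X Y); x' \<in> carrier (Cs Y Z)\<rbrakk> \<Longrightarrow>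
    Ph X Z n (cmap (cmp X Y Z) (pure K (Cs X Y) (Cs Y Z) x x')) = compose (carrier (op X n)) (Ph Y Z n x') (Ph X Y n x)"
  using cmp_induced by (simp add: induced_composition_def)

lemma cmp_rho:
  "\<lbrakk>y \<in> carrier (Ds X Y); y' \<in> carrier (Ds Y Z)\<rbrakk> \<Longrightarrow>
    \<rho> X Z (dmap (cmp X Y Z) (pure K (Ds X Y) (Ds Y Z) y y')) n = compose (carrier (md X n)) (\<rho> Y Z y' n) (\<rho> X Y y n)"
  using cmp_induced by (simp add: induced_composition_def)

lemma cmp_facts:
  "Dom (cmp X Y Z) = tensor_obj K (comp_hom X Y) (comp_hom Y Z)" "Cod (cmp X Y Z) = comp_hom X Z"
  "lin_map (Cs X Y \<otimes>\<^sub>K Cs Y Z) (Cs X Z) (cmap (cmp X Y Z))"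
  "lin_map (Ds X Y \<otimes>\<^sub>K Ds Y Z) (Ds X Z) (dmap (cmp X Y Z))"
proof -
  note T = Obj_tensor[OF Obj_comp_hom[OF X Y] Obj_comp_hom[OF Y Z]] and XZ = Obj_comp_hom[OF X Z]
  note H = HomD[OF T XZ cmp_Hom]
  show "Dom (cmp X Y Z) = tensor_obj K (comp_hom X Y) (comp_hom Y Z)" "Cod (cmp X Y Z) = comp_hom X Z"
    by (fact H)+
  show "lin_map (Cs X Y \<otimes>\<^sub>K Cs Y Z) (Cs X Z) (cmap (cmp X Y Z))"
    "lin_map (Ds X Y \<otimes>\<^sub>K Ds Y Z) (Ds X Z) (dmap (cmp X Y Z))"
    using comod_homD(3,4)[OF H(3)] by simp_all
qed

end

context
  fixes X :: "('k, 'o, 'l) comp_obj"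
  assumes X: "X \<in> comp_objects K"
begin

lemma idt_induced: "induced_identity X (idt X)"
  using theI'[OF induced_identity_ex1[OF X]] by (simp add: comp_category_def)

lemma idt_Hom: "idt X \<in> Hom (Comod K) (unit_obj K) (comp_hom X X)"
  using idt_induced by (simp add: induced_identity_def Comod_simps)

lemma idt_Phi: "a \<in> carrier (unit_space K) \<Longrightarrow> Ph X X n (cmap (idt X) a) = scaling (op X n) a"
  using idt_induced by (auto simp: induced_identity_def unit_space_def scaling_def)

lemma idt_rho: "a \<in> carrier (unit_space K) \<Longrightarrow> \<rho> X X (dmap (idt X) a) n = scaling (md X n) a"
  using idt_induced by (auto simp: induced_identity_def unit_space_def scaling_def)

lemma idt_facts:
  "Dom (idt X) = unit_obj K" "Cod (idt X) = comp_hom X X"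
  "lin_map (unit_space K) (Cs X X) (cmap (idt X))" "lin_map (unit_space K) (Ds X X) (dmap (idt X))"
proof -
  note H = HomD[OF Obj_unit Obj_comp_hom[OF X X] idt_Hom]
  show "Dom (idt X) = unit_obj K" "Cod (idt X) = comp_hom X X" by (fact H)+
  show "lin_map (unit_space K) (Cs X X) (cmap (idt X))" "lin_map (unit_space K) (Ds X X) (dmap (idt X))"
    using comod_homD(3,4)[OF H(3)] by simp_all
qed

end

text \<open>Active as a rewrite rule, it would replace the first component of
  \<open>comp_hom\<close> inside goals, and the facts stated with \<open>Cs X Y\<close> would no
  longer match.\<close>

declare fst_comp_hom [simp del]

text \<open>Both unit laws come down to this: at \<open>a\<close> tensored with \<open>x\<close>,
  composing with the unit measuring scales by \<open>scalar a\<close>, and so does the unitor. With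
  the scaling applied first, linearity of \<open>f\<close> takes the scalar out.\<close>

lemma scaling_compose:
  assumes "vec V" "vec W" "f \<in> carrier (Vect K V W)" "a \<in> carrier (unit_space K)"
  shows "compose (carrier V) f (scaling V a) = scalar a \<odot>\<^bsub>Vect K V W\<^esub> f"
    and "compose (carrier V) (scaling W a) f = scalar a \<odot>\<^bsub>Vect K V W\<^esub> f"
  using lin_smult[OF linear_map_Vect[OF assms(3)]] lin_closed[OF linear_map_Vect[OF assms(3)]] assms(4)
  by (auto simp: Vect_def compose_def scaling_def fun_eq_iff)

lemma enriched: "enriched_category (Comod K) comp_category"
proof -
  interpret V: symmetric_monoidal_category "Comod K :: (('k, 'a) comod_obj, ('k, 'a) comod_arr) monoidal_data"
    by (rule symmetric_monoidal_Comod)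
  have EObj: "EObj comp_category = comp_objects K" and EHom: "EHom comp_category = comp_hom"
    by (simp_all add: comp_category_def)
  show ?thesis
  proof (intro enriched_category.intro enriched_category_axioms.intro symmetric_monoidal_Comod)
    fix X Y assume "X \<in> EObj comp_category" "Y \<in> EObj comp_category"
    then have X: "X \<in> comp_objects K" and Y: "Y \<in> comp_objects K" by (simp_all add: EObj)
    note XY = Obj_comp_hom[OF X Y] and XX = Obj_comp_hom[OF X X] and YY = Obj_comp_hom[OF Y Y]
    note [simp] = vec_comp_hom[OF X Y] vec_comp_hom[OF X X] vec_comp_hom[OF Y Y]
      cmp_facts[OF X X Y] cmp_facts[OF X Y Y] idt_facts[OF X] idt_facts[OF Y]
      lin_closed[OF idt_facts(3)[OF X]] lin_closed[OF idt_facts(4)[OF X]]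
      lin_closed[OF idt_facts(3)[OF Y]] lin_closed[OF idt_facts(4)[OF Y]]
    show "EHom comp_category X Y \<in> Obj (Comod K)"
      using XY by (simp add: EHom)
    show "cmp X X Y \<cdot>\<^bsub>Comod K\<^esub> (idt X \<star>\<^bsub>Comod K\<^esub> Id (Comod K) (EHom comp_category X Y)) =
        LUnit (Comod K) (EHom comp_category X Y)" (is "?l = ?r")
      unfolding EHom
    proof (rule arrow_unique_tensor[OF X Y Obj_unit XY])
      have "idt X \<star>\<^bsub>Comod K\<^esub> Id (Comod K) (comp_hom X Y) \<in> Hom (Comod K) (tensor_obj K (unit_obj K) (comp_hom X Y)) (tensor_obj K (comp_hom X X) (comp_hom X Y))"
        using V.TenArr_hom[OF Obj_unit XX XY XY idt_Hom[OF X] V.Id_hom[OF XY]] by (simp add: Comod_simps(3))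
      then show "cmp X X Y \<cdot>\<^bsub>Comod K\<^esub> (idt X \<star>\<^bsub>Comod K\<^esub> Id (Comod K) (comp_hom X Y)) \<in> Hom (Comod K) (tensor_obj K (unit_obj K) (comp_hom X Y)) (comp_hom X Y)"
        by (rule V.Comp_hom[OF Obj_tensor[OF Obj_unit XY] Obj_tensor[OF XX XY] XY _ cmp_Hom[OF X X Y]])
      show "LUnit (Comod K) (comp_hom X Y) \<in> Hom (Comod K) (tensor_obj K (unit_obj K) (comp_hom X Y)) (comp_hom X Y)"
        using V.LUnit_iso[OF XY] by (simp add: iso_arr_def Comod_simps(3,5))
    next
      fix n x and a :: "('k, 'a) elt" assume "a \<in> carrier (fst_space (unit_obj K))" and x: "x \<in> carrier (Cs X Y)"
      then have a: "a \<in> carrier (unit_space K)" by simp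
      show "Ph X Y n (cmap (cmp X X Y \<cdot>\<^bsub>Comod K\<^esub> (idt X \<star>\<^bsub>Comod K\<^esub> Id (Comod K) (comp_hom X Y)))
          (pure K (fst_space (unit_obj K)) (Cs X Y) a x)) =
        Ph X Y n (cmap (LUnit (Comod K) (comp_hom X Y)) (pure K (fst_space (unit_obj K)) (Cs X Y) a x))"
        using a x lin_closed[OF lin_Phi[OF X Y] x, of n] lin_smult[OF lin_Phi[OF X Y] _ x]
          cmp_Phi[OF X X Y _ x] idt_Phi[OF X a] objectD(3)[OF X] objectD(3)[OF Y]
        by (simp add: Comod_simps compose_eq scaling_compose(1))
    next
      fix n y and a :: "('k, 'a) elt" assume "a \<in> carrier (snd_space (unit_obj K))" and y: "y \<in> carrier (Ds X Y)"
      then have a: "a \<in> carrier (unit_space K)" by simp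
      show "\<rho> X Y (dmap (cmp X X Y \<cdot>\<^bsub>Comod K\<^esub> (idt X \<star>\<^bsub>Comod K\<^esub> Id (Comod K) (comp_hom X Y)))
          (pure K (snd_space (unit_obj K)) (Ds X Y) a y)) n =
        \<rho> X Y (dmap (LUnit (Comod K) (comp_hom X Y)) (pure K (snd_space (unit_obj K)) (Ds X Y) a y)) n"
        using a y lin_closed[OF lin_rho[OF X Y] y, of n] lin_smult[OF lin_rho[OF X Y] _ y]
          cmp_rho[OF X X Y _ y] idt_rho[OF X a] objectD(4)[OF X] objectD(4)[OF Y]
        by (simp add: Comod_simps compose_eq scaling_compose(1))
    qed
    show "cmp X Y Y \<cdot>\<^bsub>Comod K\<^esub> (Id (Comod K) (EHom comp_category X Y) \<star>\<^bsub>Comod K\<^esub> idt Y) =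
        RUnit (Comod K) (EHom comp_category X Y)"
      unfolding EHom
    proof (rule arrow_unique_tensor[OF X Y XY Obj_unit])
      have "Id (Comod K) (comp_hom X Y) \<star>\<^bsub>Comod K\<^esub> idt Y \<in> Hom (Comod K) (tensor_obj K (comp_hom X Y) (unit_obj K)) (tensor_obj K (comp_hom X Y) (comp_hom Y Y))"
        using V.TenArr_hom[OF XY XY Obj_unit YY V.Id_hom[OF XY] idt_Hom[OF Y]] by (simp add: Comod_simps(3))
      then show "cmp X Y Y \<cdot>\<^bsub>Comod K\<^esub> (Id (Comod K) (comp_hom X Y) \<star>\<^bsub>Comod K\<^esub> idt Y) \<in> Hom (Comod K) (tensor_obj K (comp_hom X Y) (unit_obj K)) (comp_hom X Y)"
        by (rule V.Comp_hom[OF Obj_tensor[OF XY Obj_unit] Obj_tensor[OF XY YY] XY _ cmp_Hom[OF X Y Y]])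
      show "RUnit (Comod K) (comp_hom X Y) \<in> Hom (Comod K) (tensor_obj K (comp_hom X Y) (unit_obj K)) (comp_hom X Y)"
        using V.RUnit_iso[OF XY] by (simp add: iso_arr_def Comod_simps(3,5))
    next
      fix n x and a :: "('k, 'a) elt" assume x: "x \<in> carrier (Cs X Y)" and "a \<in> carrier (fst_space (unit_obj K))"
      then have a: "a \<in> carrier (unit_space K)" by simp
      show "Ph X Y n (cmap (cmp X Y Y \<cdot>\<^bsub>Comod K\<^esub> (Id (Comod K) (comp_hom X Y) \<star>\<^bsub>Comod K\<^esub> idt Y))
          (pure K (Cs X Y) (fst_space (unit_obj K)) x a)) =
        Ph X Y n (cmap (RUnit (Comod K) (comp_hom X Y)) (pure K (Cs X Y) (fst_space (unit_obj K)) x a))"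
        using a x lin_closed[OF lin_Phi[OF X Y] x, of n] lin_smult[OF lin_Phi[OF X Y] _ x]
          cmp_Phi[OF X Y Y x] idt_Phi[OF Y a] objectD(3)[OF X] objectD(3)[OF Y]
        by (simp add: Comod_simps compose_eq scaling_compose(2))
    next
      fix n y and a :: "('k, 'a) elt" assume y: "y \<in> carrier (Ds X Y)" and "a \<in> carrier (snd_space (unit_obj K))"
      then have a: "a \<in> carrier (unit_space K)" by simp
      show "\<rho> X Y (dmap (cmp X Y Y \<cdot>\<^bsub>Comod K\<^esub> (Id (Comod K) (comp_hom X Y) \<star>\<^bsub>Comod K\<^esub> idt Y))
          (pure K (Ds X Y) (snd_space (unit_obj K)) y a)) n =
        \<rho> X Y (dmap (RUnit (Comod K) (comp_hom X Y)) (pure K (Ds X Y) (snd_space (unit_obj K)) y a)) n"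
        using a y lin_closed[OF lin_rho[OF X Y] y, of n] lin_smult[OF lin_rho[OF X Y] _ y]
          cmp_rho[OF X Y Y y] idt_rho[OF Y a] objectD(4)[OF X] objectD(4)[OF Y]
        by (simp add: Comod_simps compose_eq scaling_compose(2))
    qed
  next
    fix X Y Z assume "X \<in> EObj comp_category" "Y \<in> EObj comp_category" "Z \<in> EObj comp_category"
    then show "cmp X Y Z \<in> Hom (Comod K) (EHom comp_category X Y \<boxtimes>\<^bsub>Comod K\<^esub> EHom comp_category Y Z) (EHom comp_category X Z)"
      using cmp_Hom by (simp add: EObj EHom Comod_simps)
  next
    fix X assume "X \<in> EObj comp_category"
    then show "idt X \<in> Hom (Comod K) \<I>\<^bsub>Comod K\<^esub> (EHom comp_category X X)"
      using idt_Hom by (simp add: EObj EHom Comod_simps)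
  next
    fix W X Y Z
    assume "W \<in> EObj comp_category" "X \<in> EObj comp_category" "Y \<in> EObj comp_category" "Z \<in> EObj comp_category"
    then have W: "W \<in> comp_objects K" and X: "X \<in> comp_objects K" and Y: "Y \<in> comp_objects K" and Z: "Z \<in> comp_objects K"
      by (simp_all add: EObj)
    note WX = Obj_comp_hom[OF W X] and XY = Obj_comp_hom[OF X Y] and YZ = Obj_comp_hom[OF Y Z]
      and WY = Obj_comp_hom[OF W Y] and XZ = Obj_comp_hom[OF X Z] and WZ = Obj_comp_hom[OF W Z]
    note [simp] = vec_comp_hom[OF W X] vec_comp_hom[OF X Y] vec_comp_hom[OF Y Z] vec_comp_hom[OF W Y]
      vec_comp_hom[OF X Z] vec_comp_hom[OF W Z]
      cmp_facts[OF W X Y] cmp_facts[OF X Y Z] cmp_facts[OF W Y Z] cmp_facts[OF W X Z]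
      lin_closed[OF cmp_facts(3)[OF W X Y]] lin_closed[OF cmp_facts(4)[OF W X Y]]
      lin_closed[OF cmp_facts(3)[OF X Y Z]] lin_closed[OF cmp_facts(4)[OF X Y Z]]
    let ?A = "comp_hom W X" and ?B = "comp_hom X Y" and ?C = "comp_hom Y Z"
    let ?l = "cmp W Y Z \<cdot>\<^bsub>Comod K\<^esub> (cmp W X Y \<star>\<^bsub>Comod K\<^esub> Id (Comod K) ?C)"
    let ?r = "cmp W X Z \<cdot>\<^bsub>Comod K\<^esub> (Id (Comod K) ?A \<star>\<^bsub>Comod K\<^esub> cmp X Y Z) \<cdot>\<^bsub>Comod K\<^esub> Assoc (Comod K) ?A ?B ?C"
    note AB = Obj_tensor[OF WX XY] and BC = Obj_tensor[OF XY YZ]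
    have l: "?l \<in> Hom (Comod K) (tensor_obj K (tensor_obj K ?A ?B) ?C) (comp_hom W Z)"
    proof -
      have "cmp W X Y \<star>\<^bsub>Comod K\<^esub> Id (Comod K) ?C \<in> Hom (Comod K) (tensor_obj K (tensor_obj K ?A ?B) ?C) (tensor_obj K (comp_hom W Y) ?C)"
        using V.TenArr_hom[OF AB WY YZ YZ cmp_Hom[OF W X Y] V.Id_hom[OF YZ]] by (simp add: Comod_simps(3))
      then show ?thesis
        by (rule V.Comp_hom[OF Obj_tensor[OF AB YZ] Obj_tensor[OF WY YZ] WZ _ cmp_Hom[OF W Y Z]])
    qed
    have r: "?r \<in> Hom (Comod K) (tensor_obj K (tensor_obj K ?A ?B) ?C) (comp_hom W Z)"
    proof -
      have "Id (Comod K) ?A \<star>\<^bsub>Comod K\<^esub> cmp X Y Z \<in> Hom (Comod K) (tensor_obj K ?A (tensor_obj K ?B ?C)) (tensor_obj K ?A (comp_hom X Z))"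
        using V.TenArr_hom[OF WX WX BC XZ V.Id_hom[OF WX] cmp_Hom[OF X Y Z]] by (simp add: Comod_simps(3))
      moreover have "Assoc (Comod K) ?A ?B ?C \<in> Hom (Comod K) (tensor_obj K (tensor_obj K ?A ?B) ?C) (tensor_obj K ?A (tensor_obj K ?B ?C))"
        using V.Assoc_iso[OF WX XY YZ] by (simp add: iso_arr_def Comod_simps(3))
      ultimately have "(Id (Comod K) ?A \<star>\<^bsub>Comod K\<^esub> cmp X Y Z) \<cdot>\<^bsub>Comod K\<^esub> Assoc (Comod K) ?A ?B ?C \<in>
          Hom (Comod K) (tensor_obj K (tensor_obj K ?A ?B) ?C) (tensor_obj K ?A (comp_hom X Z))"
        by (intro V.Comp_hom[OF Obj_tensor[OF AB YZ] Obj_tensor[OF WX BC] Obj_tensor[OF WX XZ]])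
      then show ?thesis
        by (rule V.Comp_hom[OF Obj_tensor[OF AB YZ] Obj_tensor[OF WX XZ] WZ _ cmp_Hom[OF W X Z]])
    qed
    note T = Obj_tensor[OF AB YZ]
    note vW = objectD[OF W] and vZ = objectD[OF Z]
    \<comment> \<open>Extensional composition is associative because \<open>a\<close> takes values
      in \<open>V\<close>, where the restriction of the inner composite has no effect. The type
      \<open>'u\<close> is kept general to serve operad elements and module elements.\<close>
    have ass: "compose (carrier U) c (compose (carrier U) b a) = compose (carrier U) (compose (carrier V) c b) a"
      if "a \<in> carrier (Vect K U V)" for U V :: "('k, 'u) module" and a b c :: "'u \<Rightarrow> 'u"
      using lin_closed[OF linear_map_Vect[OF that]] by (auto simp: compose_def)
    have "?l = ?r"
    proof (rule arrow_unique[OF W Z T l r])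
      fix n t assume "t \<in> carrier (fst_space (tensor_obj K (tensor_obj K ?A ?B) ?C))"
      moreover have "\<forall>t\<in>carrier ((Cs W X \<otimes>\<^sub>K Cs X Y) \<otimes>\<^sub>K Cs Y Z). Ph W Z n (cmap ?l t) = Ph W Z n (cmap ?r t)"
      proof (rule tensor_ext3[where Z = "Vect K (op W n) (op Z n)"])
        fix x y z assume xyz: "x \<in> carrier (Cs W X)" "y \<in> carrier (Cs X Y)" "z \<in> carrier (Cs Y Z)"
        then show "Ph W Z n (cmap ?l (pure K (Cs W X \<otimes>\<^sub>K Cs X Y) (Cs Y Z) (pure K (Cs W X) (Cs X Y) x y) z)) =
            Ph W Z n (cmap ?r (pure K (Cs W X \<otimes>\<^sub>K Cs X Y) (Cs Y Z) (pure K (Cs W X) (Cs X Y) x y) z))"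
          using ass[OF lin_closed[OF lin_Phi[OF W X] xyz(1)]]
          by (simp add: Comod_simps compose_eq cmp_Phi[OF W Y Z] cmp_Phi[OF W X Y] cmp_Phi[OF W X Z] cmp_Phi[OF X Y Z])
      qed (use lin_Phi_arrow(1)[OF W Z T l] lin_Phi_arrow(1)[OF W Z T r] vW vZ in simp_all)
      ultimately show "Ph W Z n (cmap ?l t) = Ph W Z n (cmap ?r t)" by simp
    next
      fix n t assume "t \<in> carrier (snd_space (tensor_obj K (tensor_obj K ?A ?B) ?C))"
      moreover have "\<forall>t\<in>carrier ((Ds W X \<otimes>\<^sub>K Ds X Y) \<otimes>\<^sub>K Ds Y Z). \<rho> W Z (dmap ?l t) n = \<rho> W Z (dmap ?r t) n"
      proof (rule tensor_ext3[where Z = "Vect K (md W n) (md Z n)"])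
        fix x y z assume xyz: "x \<in> carrier (Ds W X)" "y \<in> carrier (Ds X Y)" "z \<in> carrier (Ds Y Z)"
        then show "\<rho> W Z (dmap ?l (pure K (Ds W X \<otimes>\<^sub>K Ds X Y) (Ds Y Z) (pure K (Ds W X) (Ds X Y) x y) z)) n =
            \<rho> W Z (dmap ?r (pure K (Ds W X \<otimes>\<^sub>K Ds X Y) (Ds Y Z) (pure K (Ds W X) (Ds X Y) x y) z)) n"
          using ass[OF lin_closed[OF lin_rho[OF W X] xyz(1)]]
          by (simp add: Comod_simps compose_eq cmp_rho[OF W Y Z] cmp_rho[OF W X Y] cmp_rho[OF W X Z] cmp_rho[OF X Y Z])
      qed (use lin_Phi_arrow(2)[OF W Z T l] lin_Phi_arrow(2)[OF W Z T r] vW vZ in simp_all)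
      ultimately show "\<rho> W Z (dmap ?l t) n = \<rho> W Z (dmap ?r t) n" by simp
    qed
    then show "cmp W Y Z \<cdot>\<^bsub>Comod K\<^esub> (cmp W X Y \<star>\<^bsub>Comod K\<^esub> Id (Comod K) (EHom comp_category Y Z)) =
        cmp W X Z \<cdot>\<^bsub>Comod K\<^esub> (Id (Comod K) (EHom comp_category W X) \<star>\<^bsub>Comod K\<^esub> cmp X Y Z) \<cdot>\<^bsub>Comod K\<^esub>
          Assoc (Comod K) (EHom comp_category W X) (EHom comp_category X Y) (EHom comp_category Y Z)"
      by (simp add: EHom)
  qed
qed

end

text \<open>The existence and uniqueness claims accompany the enrichment because
  \<open>comp_category\<close> defines composition and identities by \<open>THE\<close>; they
  guarantee that these descriptions denote the induced arrows.\<close>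

theorem theorem8p7:
  fixes K :: "'k ring"
    and M :: "('k, 'o) operad_data \<Rightarrow> ('k, 'o) operad_data \<Rightarrow> ('k, 'a) coalg"
    and \<Phi> :: "('k, 'o) operad_data \<Rightarrow> ('k, 'o) operad_data \<Rightarrow> nat \<Rightarrow> ('k, 'a) elt \<Rightarrow> 'o \<Rightarrow> 'o"
    and R :: "('k, 'o, 'l) comp_obj \<Rightarrow> ('k, 'o, 'l) comp_obj \<Rightarrow> ('k, 'a) comod"
    and \<rho> :: "('k, 'o, 'l) comp_obj \<Rightarrow> ('k, 'o, 'l) comp_obj \<Rightarrow> ('k, 'a) elt \<Rightarrow> nat \<Rightarrow> 'l \<Rightarrow> 'l"
  assumes "field K"
    and "\<And>P P'. \<lbrakk>operad_with_multiplication K P; operad_with_multiplication K P'\<rbrakk> \<Longrightarrow>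
      universal_measuring K P P' (M P P') (\<Phi> P P')"
    and "\<And>X Y. \<lbrakk>X \<in> comp_objects K; Y \<in> comp_objects K\<rbrakk> \<Longrightarrow>
      cofree_comodule K (M (fst X) (fst Y)) (hom_product K X Y) (R X Y) (\<rho> X Y)"
  shows "(\<forall>X\<in>comp_objects K. \<forall>Y\<in>comp_objects K. \<forall>Z\<in>comp_objects K.
            \<exists>!h. comp_setup.induced_composition K M \<Phi> R \<rho> X Y Z h) \<and>
         (\<forall>X\<in>comp_objects K. \<exists>!h. comp_setup.induced_identity K M \<Phi> R \<rho> X h) \<and>
         enriched_category (Comod K) (comp_setup.comp_category K M \<Phi> R \<rho>)"
proof -
  interpret field K by fact
  interpret comp_enrichment K M \<Phi> R \<rho>
    using assms(2,3) by unfold_locales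
  show ?thesis
    using induced_composition_ex1 induced_identity_ex1 enriched by blast
qed

end
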